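(* Let $\Psi:\mathbb{R}\to\mathbb{R}$ and $J>0$ satisfy the standing assumptions (1)--(5) listed in the context, let $\mathcal{F}$ be the associated free energy functional, and let $\mu^-,\mu^0,\mu^+$ be the three measures defined in the context. Let $\mu\in\mathcal{P}_2(\mathbb{R})$ and let $(S[\mu](t))_{t\in[0,\infty)}$ be the Wasserstein gradient flow for $\mathcal{F}$ with initial value $\mu$. Then there exists $\mu^*\in\{\mu^-,\mu^0,\mu^+\}$ such that $$\lim_{t\to\infty}W_2(S[\mu](t),\mu^* )=0\quad\text{and}\quad\lim_{t\to\infty}\mathcal{F}(S[\mu](t))=\mathcal{F}(\mu^* ).$$
   Context: Standing assumptions on $\Psi:\mathbb{R}\to\mathbb{R}$ and $J>0$: (1) $\Psi=\Psi_c+\Psi_b$ with $\Psi_c,\Psi_b\in C^2(\mathbb{R})$, and there are constants $0<c,c'<\infty$ with $\Psi_c''\ge c$ and $|\Psi_b|+|\Psi_b'|+|\Psi_b''|\le c'$ on $\mathbb{R}$. (2) There exist $\epsilon,c''\in(0,\infty)$ with $\Psi(z)\ge c''(|z|^{2+\epsilon}-1)$ for all $z\in\mathbb{R}$. (3) $\Psi(z)=\Psi(-z)$ for all $z$. (4) $1/J<\int_{\mathbb{R}}z^2e^{-\Psi(z)}dz\big/\int_{\mathbb{R}}e^{-\Psi(z)}dz$. (5) $z\mapsto\Psi'(z)$ is convex on $[0,\infty)$. Wasserstein space: $\mathcal{P}_2(\mathbb{R})$ is the set of Borel probability measures on $\mathbb{R}$ with finite second moment, with the distance $W_2(\mu,\nu)^2=\inf_{\gamma}\int_{\mathbb{R}^2}|y-y'|^2\,d\gamma(y,y')$,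 the infimum over all couplings $\gamma$ of $\mu$ and $\nu$. Functional: $\mathcal{F}:\mathcal{P}_2(\mathbb{R})\to(-\infty,\infty]$ is $\mathcal{F}(\mu)=\int\log(\rho)\,d\mu+\int\Psi\,d\mu-\frac J2\left(\int z\,d\mu(z)\right)^2$ if $\mu$ has Lebesgue density $\rho$, and $\mathcal{F}(\mu)=\infty$ otherwise. $D(\mathcal{F})=\{\mathcal{F}<\infty\}$. Gradient flow: A curve $(\mu_t)_{t\in[0,\infty)}$ in $\mathcal{P}_2(\mathbb{R})$ is absolutely continuous if there is $m\in L^2_{\mathrm{loc}}((0,\infty))$ with $W_2(\mu_s,\mu_t)\le\int_s^tm(r)\,dr$ for all $0<s<t<\infty$; its metric derivative is $|\mu'|(t)=\lim_{s\to t}W_2(\mu_s,\mu_t)/|s-t|$, which exists for a.e. $t$. The metric slope is $|\partial\mathcal{F}|(\mu)=\limsup_{\nu\to\mu}\left(\frac{\mathcal{F}(\mu)-\mathcal{F}(\nu)}{W_2(\mu,\nu)}\right)^+$ for $\mu\in D(\mathcal{F})$ and $+\infty$ otherwise. The gradient flow for $\mathcal{F}$ with initial value $\mu\in\mathcal{P}_2(\mathbb{R})$ is the absolutely continuous curve $(S[\mu](t))_{t\in[0,\infty)}$ such that $\lim_{t\downarrow0}W_2(S[\mu](t),\mu)=0$, $t\mapsto\mathcal{F}(S[\mu](t))$ is locally absolutely continuous on $(0,\infty)$, and $\frac{d}{dt}\mathcal{F}(S[\mu](t))=-|\partial\mathcal{F}|^2(S[\mu](t))=-|(S[\mu])'|^2(t)$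 for a.e. $t>0$. It is known that for every $\mu\in\mathcal{P}_2(\mathbb{R})$ it exists and is unique. The measures $\mu^-,\mu^0,\mu^+$: Let $\varphi^*(\sigma)=\log\int_{\mathbb{R}}e^{\sigma z-\Psi(z)}dz$ for $\sigma\in\mathbb{R}$, let $\varphi(m)=\sup_{\sigma\in\mathbb{R}}(\sigma m-\varphi^*(\sigma))$ be its Legendre transform, let $d\mu^\sigma(z)=e^{-\varphi^*(\sigma)+\sigma z-\Psi(z)}dz$, and let $\bar H(m)=\varphi(m)-\frac J2m^2$. It is known that $\bar H$ has exactly three critical points $-m^\star,0,m^\star$ for some $m^\star>0$. Set $\mu^-=\mu^{\varphi'(-m^\star)}$, $\mu^0=\mu^{\varphi'(0)}$, $\mu^+=\mu^{\varphi'(m^\star)}$. *)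

theory Defs
  imports "HOL-Probability.Probability"
begin

section \<open>The Wasserstein space\<close>

definition P2 :: "real measure set" where
  "P2 = {\<mu>. real_distribution \<mu> \<and> integrable \<mu> (\<lambda>x. x\<^sup>2)}"

definition couplings :: "real measure \<Rightarrow> real measure \<Rightarrow> (real \<times> real) measure set" where
  "couplings \<mu> \<nu> = {\<gamma>. prob_space \<gamma> \<and> sets \<gamma> = sets (borel \<Otimes>\<^sub>M borel) \<and>
     distr \<gamma> borel fst = \<mu> \<and> distr \<gamma> borel snd = \<nu>}"

text \<open>
  For measures in \<^const>\<open>P2\<close> the integrand below is integrable with respect to every coupling, so
  the Bochner integral is the true transport cost, and the product measure is a coupling, so the
  infimum is over a nonempty set that is bounded below. \<open>W2\<close> is only used on \<^const>\<open>P2\<close>.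
\<close>

definition W2 :: "real measure \<Rightarrow> real measure \<Rightarrow> real" where
  "W2 \<mu> \<nu> = sqrt (INF \<gamma>\<in>couplings \<mu> \<nu>. \<integral>(y, y'). \<bar>y - y'\<bar>\<^sup>2 \<partial>\<gamma>)"

section \<open>The free energy\<close>

text \<open>
  The integral with values in the extended reals. It is only used for functions whose negative
  part has finite integral, so that the value of \<open>\<infinity> - \<infinity>\<close> plays no role.
\<close>

definition ext_integral :: "'a measure \<Rightarrow> ('a \<Rightarrow> real) \<Rightarrow> ereal" where
  "ext_integral M f =
     enn2ereal (\<integral>\<^sup>+x. ennreal (f x) \<partial>M) - enn2ereal (\<integral>\<^sup>+x. ennreal (- f x) \<partial>M)"

text \<open>
  For \<open>\<mu>\<close> in \<^const>\<open>P2\<close> with density \<open>\<rho>\<close>, finiteness of the second moment makes the negative part of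
  \<open>ln \<rho>\<close> integrable with respect to \<open>\<mu>\<close>; \<open>\<Psi>\<close> is bounded below. The value \<open>ln 0 = 0\<close> is irrelevant,
  because \<open>{\<rho> = 0}\<close> is a null set of \<open>\<mu>\<close>.
\<close>

definition free_energy :: "(real \<Rightarrow> real) \<Rightarrow> real \<Rightarrow> real measure \<Rightarrow> ereal" where
  "free_energy \<Psi> J \<mu> =
     (if absolutely_continuous lborel \<mu>
      then ext_integral \<mu> (\<lambda>z. ln (enn2real (RN_deriv lborel \<mu> z))) + ext_integral \<mu> \<Psi>
           - ereal (J / 2 * (\<integral>z. z \<partial>\<mu>)\<^sup>2)
      else \<infinity>)"

section \<open>Wasserstein gradient flows\<close>

text \<open>
  Curves are indexed by all reals; only their values at times \<open>t \<ge> 0\<close> are relevant.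
\<close>

definition L2_loc_pos :: "(real \<Rightarrow> real) \<Rightarrow> bool" where
  "L2_loc_pos m \<longleftrightarrow> set_borel_measurable lborel {0<..} m \<and>
     (\<forall>K. compact K \<and> K \<subseteq> {0<..} \<longrightarrow> set_integrable lborel K (\<lambda>r. (m r)\<^sup>2))"

definition ac_curve :: "(real \<Rightarrow> real measure) \<Rightarrow> bool" where
  "ac_curve S \<longleftrightarrow> (\<forall>t\<ge>0. S t \<in> P2) \<and>
     (\<exists>m. L2_loc_pos m \<and>
        (\<forall>s t. 0 < s \<and> s < t \<longrightarrow> W2 (S s) (S t) \<le> (LINT r:{s..t}|lborel. m r)))"

definition metric_derivative :: "(real \<Rightarrow> real measure) \<Rightarrow> real \<Rightarrow> real" where
  "metric_derivative S t = Lim (at t) (\<lambda>s. W2 (S s) (S t) / \<bar>s - t\<bar>)"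

text \<open>The filter of punctured \<^const>\<open>W2\<close>-neighbourhoods of \<open>\<mu>\<close> in \<^const>\<open>P2\<close>.\<close>

definition at_W2 :: "real measure \<Rightarrow> real measure filter" where
  "at_W2 \<mu> = inf (filtercomap (\<lambda>\<nu>. W2 \<mu> \<nu>) (at_right 0)) (principal P2)"

definition metric_slope :: "(real measure \<Rightarrow> ereal) \<Rightarrow> real measure \<Rightarrow> ereal" where
  "metric_slope F \<mu> =
     (if \<mu> \<in> P2 \<and> F \<mu> < \<infinity>
      then Limsup (at_W2 \<mu>) (\<lambda>\<nu>. max 0 ((F \<mu> - F \<nu>) / ereal (W2 \<mu> \<nu>)))
      else \<infinity>)"

definition abs_continuous_on_interval :: "real \<Rightarrow> real \<Rightarrow> (real \<Rightarrow> real) \<Rightarrow> bool" where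
  "abs_continuous_on_interval a b f \<longleftrightarrow>
     (\<forall>\<epsilon>>0. \<exists>\<delta>>0. \<forall>I :: (real \<times> real) set.
        finite I \<and> (\<forall>(x, y)\<in>I. a \<le> x \<and> x \<le> y \<and> y \<le> b) \<and>
        pairwise (\<lambda>p q. disjnt {fst p<..<snd p} {fst q<..<snd q}) I \<and>
        (\<Sum>(x, y)\<in>I. y - x) < \<delta> \<longrightarrow>
        (\<Sum>(x, y)\<in>I. \<bar>f y - f x\<bar>) < \<epsilon>)"

definition locally_abs_continuous_pos :: "(real \<Rightarrow> real) \<Rightarrow> bool" where
  "locally_abs_continuous_pos f \<longleftrightarrow> (\<forall>a b. 0 < a \<and> a < b \<longrightarrow> abs_continuous_on_interval a b f)"

text \<open>
  Local absolute continuity of \<open>t \<mapsto> F (S t)\<close> on \<open>(0, \<infinity>)\<close> includes finiteness for \<open>t > 0\<close>. The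
  initial value is attained as a limit; \<open>S 0\<close> itself is not constrained beyond lying in
  \<^const>\<open>P2\<close>.
\<close>

definition gradient_flow ::
  "(real measure \<Rightarrow> ereal) \<Rightarrow> real measure \<Rightarrow> (real \<Rightarrow> real measure) \<Rightarrow> bool" where
  "gradient_flow F \<mu> S \<longleftrightarrow>
     ac_curve S \<and>
     ((\<lambda>t. W2 (S t) \<mu>) \<longlongrightarrow> 0) (at_right 0) \<and>
     (\<forall>t>0. \<bar>F (S t)\<bar> \<noteq> \<infinity>) \<and>
     locally_abs_continuous_pos (\<lambda>t. real_of_ereal (F (S t))) \<and>
     (AE t in lborel. 0 < t \<longrightarrow>
        (\<exists>D. ((\<lambda>s. real_of_ereal (F (S s))) has_real_derivative D) (at t) \<and>
             ereal D = - (metric_slope F (S t))\<^sup>2 \<and>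
             D = - (metric_derivative S t)\<^sup>2))"

section \<open>The coarse-grained potential and its critical points\<close>

definition C2 :: "(real \<Rightarrow> real) \<Rightarrow> bool" where
  "C2 f \<longleftrightarrow> f differentiable_on UNIV \<and> deriv f differentiable_on UNIV \<and>
     continuous_on UNIV (deriv (deriv f))"

definition phi_star :: "(real \<Rightarrow> real) \<Rightarrow> real \<Rightarrow> real" where
  "phi_star \<Psi> \<sigma> = ln (\<integral>z. exp (\<sigma> * z - \<Psi> z) \<partial>lborel)"

text \<open>
  If \<open>\<Psi>\<close> grows superquadratically, the supremum is finite for every \<open>m\<close>, since
  \<open>phi_star \<Psi> \<sigma> / \<bar>\<sigma>\<bar>\<close> tends to infinity as \<open>\<bar>\<sigma>\<bar>\<close> does.
\<close>

definition phi :: "(real \<Rightarrow> real) \<Rightarrow> real \<Rightarrow> real" where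
  "phi \<Psi> m = (SUP \<sigma>. \<sigma> * m - phi_star \<Psi> \<sigma>)"

definition mu_tilted :: "(real \<Rightarrow> real) \<Rightarrow> real \<Rightarrow> real measure" where
  "mu_tilted \<Psi> \<sigma> = density lborel (\<lambda>z. ennreal (exp (- phi_star \<Psi> \<sigma> + \<sigma> * z - \<Psi> z)))"

definition H_bar :: "(real \<Rightarrow> real) \<Rightarrow> real \<Rightarrow> real \<Rightarrow> real" where
  "H_bar \<Psi> J m = phi \<Psi> m - J / 2 * m\<^sup>2"

definition m_star :: "(real \<Rightarrow> real) \<Rightarrow> real \<Rightarrow> real" where
  "m_star \<Psi> J =
     (THE a. 0 < a \<and> {m. (H_bar \<Psi> J has_real_derivative 0) (at m)} = {- a, 0, a})"

definition mu_minus :: "(real \<Rightarrow> real) \<Rightarrow> real \<Rightarrow> real measure" where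
  "mu_minus \<Psi> J = mu_tilted \<Psi> (deriv (phi \<Psi>) (- m_star \<Psi> J))"

definition mu_zero :: "(real \<Rightarrow> real) \<Rightarrow> real measure" where
  "mu_zero \<Psi> = mu_tilted \<Psi> (deriv (phi \<Psi>) 0)"

definition mu_plus :: "(real \<Rightarrow> real) \<Rightarrow> real \<Rightarrow> real measure" where
  "mu_plus \<Psi> J = mu_tilted \<Psi> (deriv (phi \<Psi>) (m_star \<Psi> J))"

end

theory Submission
  imports Defs
begin

text \<open>
  Along the flow the energy is absolutely continuous and loses the square of the speed per unit of
  time, so \<open>W2 (S s) (S t) \<le> sqrt ((t - s) (F (S s) - F (S t)))\<close>; since the energy is bounded below,
  unit time intervals are eventually traversed with vanishing distance and contain times \<open>t\<^sub>n\<close> at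
  which the slope tends to \<open>0\<close>. Testing the slope with transport along vector fields shows that
  \<open>S t\<^sub>n\<close> is almost stationary for the Gibbs measure \<open>mu_tilted \<Psi> (J m)\<close>, where \<open>m\<close> is its mean. By
  superquadratic moments and a regularity estimate for the density relative to \<open>exp (- \<Psi>)\<close>, a
  sequence of such measures with converging means converges in \<open>W2\<close> to the tilted measure of the
  limit mean \<open>m\<close>, which forces \<open>m\<close> to be the mean of \<open>mu_tilted \<Psi> (J m)\<close>. An HWI inequality, i.e.
  semiconvexity of the energy along the monotone rearrangement, gives convergence of the energies.

  Because \<open>\<Psi>'\<close> is convex on the half line, that equation for \<open>m\<close> has exactly the three solutions
  \<open>- m_star\<close>, \<open>0\<close>, \<open>m_star\<close>. The means at the times \<open>t\<^sub>n\<close> have increments tending to \<open>0\<close> and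
  accumulate only at these three isolated points, hence converge to one of them, and the vanishing
  displacements and the monotonicity of the energy extend the convergence to all times.
\<close>

section \<open>Absolutely continuous functions\<close>

text \<open>Three obstacles shape the argument. \<open>metric_derivative\<close> is a
  \<open>Lim\<close>, hence an unspecified value wherever the limit fails to exist, so the
  dissipation identity says something about distances only after the speed of an absolutely
  continuous curve has been shown to exist almost everywhere; this is the purpose of the covering
  arguments. Second, derivatives are never integrated back: the estimates that use the dissipation
  are phrased as monotonicity of an auxiliary absolutely continuous function, with a free parameter
  in place of a square root. Third, a measure of finite energy comes with a density known only to be
  measurable. Testing with \<open>exp V\<close> times a step function cancels the drift term and
  bounds the oscillation of the density relative to \<open>exp (- V)\<close> on compact intervals by
  a multiple of the stationarity defect. This gives continuity of the relative density, which makes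
  the rearrangement differentiable, and uniform closeness of distribution functions, so that no
  compactness theorem for measures is invoked. The reference tilt is frozen at the limiting mean;
  the varying means only enlarge the defect.\<close>

lemma abs_continuous_on_interval_iff:
  "abs_continuous_on_interval a b f \<longleftrightarrow>
     (\<forall>e>0. \<exists>d>0. \<forall>I :: (real \<times> real) set. finite I \<longrightarrow>
      (\<forall>x y. (x, y) \<in> I \<longrightarrow> a \<le> x \<and> x \<le> y \<and> y \<le> b) \<longrightarrow>
       pairwise (\<lambda>p q. disjnt {fst p<..<snd p} {fst q<..<snd q}) I \<longrightarrow>
       (\<Sum>(x, y)\<in>I. y - x) < d \<longrightarrow> (\<Sum>(x, y)\<in>I. \<bar>f y - f x\<bar>) < e)"
proof -
  have *: "(\<forall>(x, y)\<in>I. a \<le> x \<and> x \<le> y \<and> y \<le> b) \<longleftrightarrow>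
      (\<forall>x y. (x, y) \<in> I \<longrightarrow> a \<le> x \<and> x \<le> y \<and> y \<le> b)" for I :: "(real \<times> real) set"
    by auto
  show ?thesis unfolding abs_continuous_on_interval_def * imp_conjL ..
qed

lemmas abs_continuous_on_intervalD = abs_continuous_on_interval_iff[THEN iffD1, rule_format]
lemmas abs_continuous_on_intervalI = abs_continuous_on_interval_iff[THEN iffD2, OF allI, OF impI]

lemma abs_continuous_on_interval_add:
  assumes "abs_continuous_on_interval a b f" "abs_continuous_on_interval a b g"
  shows "abs_continuous_on_interval a b (\<lambda>x. f x + g x)"
proof (rule abs_continuous_on_intervalI)
  fix e :: real assume "0 < e"
  then have e2: "0 < e / 2" by simp
  obtain d1 where d1: "0 < d1"
    "\<And>I :: (real \<times> real) set. finite I \<Longrightarrow> \<forall>x y. (x, y) \<in> I \<longrightarrow> a \<le> x \<and> x \<le> y \<and> y \<le> b \<Longrightarrow> pairwise (\<lambda>p q. disjnt {fst p<..<snd p} {fst q<..<snd q}) I \<Longrightarrow>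
       (\<Sum>(x, y)\<in>I. y - x) < d1 \<Longrightarrow> (\<Sum>(x, y)\<in>I. \<bar>f y - f x\<bar>) < e / 2"
    using abs_continuous_on_intervalD[OF assms(1) e2] by blast
  obtain d2 where d2: "0 < d2"
    "\<And>I :: (real \<times> real) set. finite I \<Longrightarrow> \<forall>x y. (x, y) \<in> I \<longrightarrow> a \<le> x \<and> x \<le> y \<and> y \<le> b \<Longrightarrow> pairwise (\<lambda>p q. disjnt {fst p<..<snd p} {fst q<..<snd q}) I \<Longrightarrow>
       (\<Sum>(x, y)\<in>I. y - x) < d2 \<Longrightarrow> (\<Sum>(x, y)\<in>I. \<bar>g y - g x\<bar>) < e / 2"
    using abs_continuous_on_intervalD[OF assms(2) e2] by blast
  show "\<exists>d>0. \<forall>I :: (real \<times> real) set. finite I \<longrightarrow> (\<forall>x y. (x, y) \<in> I \<longrightarrow> a \<le> x \<and> x \<le> y \<and> y \<le> b) \<longrightarrow> pairwise (\<lambda>p q. disjnt {fst p<..<snd p} {fst q<..<snd q}) I \<longrightarrow>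
       (\<Sum>(x, y)\<in>I. y - x) < d \<longrightarrow> (\<Sum>(x, y)\<in>I. \<bar>f y + g y - (f x + g x)\<bar>) < e"
  proof (rule exI[of _ "min d1 d2"], intro conjI allI impI)
    fix I :: "(real \<times> real) set"
    assume I: "finite I" "\<forall>x y. (x, y) \<in> I \<longrightarrow> a \<le> x \<and> x \<le> y \<and> y \<le> b" "pairwise (\<lambda>p q. disjnt {fst p<..<snd p} {fst q<..<snd q}) I"
      "(\<Sum>(x, y)\<in>I. y - x) < min d1 d2"
    have "(\<Sum>(x, y)\<in>I. \<bar>f y + g y - (f x + g x)\<bar>)
        \<le> (\<Sum>(x, y)\<in>I. \<bar>f y - f x\<bar>) + (\<Sum>(x, y)\<in>I. \<bar>g y - g x\<bar>)"
      unfolding sum.distrib[symmetric] by (rule sum_mono) (auto simp: split_beta)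
    also have "\<dots> < e / 2 + e / 2"
      using I by (intro add_strict_mono d1(2) d2(2)) auto
    finally show "(\<Sum>(x, y)\<in>I. \<bar>f y + g y - (f x + g x)\<bar>) < e" by simp
  qed (use d1(1) d2(1) in auto)
qed

lemma abs_continuous_on_interval_mult:
  assumes "abs_continuous_on_interval a b f"
  shows "abs_continuous_on_interval a b (\<lambda>x. k * f x)"
proof (rule abs_continuous_on_intervalI)
  fix e :: real assume e: "0 < e"
  have pos: "0 < e / (\<bar>k\<bar> + 1)" using e by (simp add: field_simps)
  obtain d1 where d1: "0 < d1"
    "\<And>I :: (real \<times> real) set. finite I \<Longrightarrow> \<forall>x y. (x, y) \<in> I \<longrightarrow> a \<le> x \<and> x \<le> y \<and> y \<le> b \<Longrightarrow> pairwise (\<lambda>p q. disjnt {fst p<..<snd p} {fst q<..<snd q}) I \<Longrightarrow>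
       (\<Sum>(x, y)\<in>I. y - x) < d1 \<Longrightarrow> (\<Sum>(x, y)\<in>I. \<bar>f y - f x\<bar>) < e / (\<bar>k\<bar> + 1)"
    using abs_continuous_on_intervalD[OF assms pos] by blast
  show "\<exists>d>0. \<forall>I :: (real \<times> real) set. finite I \<longrightarrow> (\<forall>x y. (x, y) \<in> I \<longrightarrow> a \<le> x \<and> x \<le> y \<and> y \<le> b) \<longrightarrow> pairwise (\<lambda>p q. disjnt {fst p<..<snd p} {fst q<..<snd q}) I \<longrightarrow>
       (\<Sum>(x, y)\<in>I. y - x) < d \<longrightarrow> (\<Sum>(x, y)\<in>I. \<bar>k * f y - k * f x\<bar>) < e"
  proof (rule exI[of _ d1], intro conjI allI impI d1(1))
    fix I :: "(real \<times> real) set"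
    assume I: "finite I" "\<forall>x y. (x, y) \<in> I \<longrightarrow> a \<le> x \<and> x \<le> y \<and> y \<le> b" "pairwise (\<lambda>p q. disjnt {fst p<..<snd p} {fst q<..<snd q}) I"
      "(\<Sum>(x, y)\<in>I. y - x) < d1"
    let ?s = "\<Sum>(x, y)\<in>I. \<bar>f y - f x\<bar>"
    have s: "?s < e / (\<bar>k\<bar> + 1)" by (rule d1(2)) (use I in auto)
    have s0: "0 \<le> ?s" by (rule sum_nonneg) auto
    have "(\<Sum>(x, y)\<in>I. \<bar>k * f y - k * f x\<bar>) = \<bar>k\<bar> * ?s"
      by (auto simp: sum_distrib_left right_diff_distrib[symmetric] abs_mult intro!: sum.cong)
    also have "\<dots> \<le> (\<bar>k\<bar> + 1) * ?s" using s0 by (simp add: algebra_simps)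
    also have "\<dots> < (\<bar>k\<bar> + 1) * (e / (\<bar>k\<bar> + 1))" by (rule mult_strict_left_mono[OF s]) auto
    also have "\<dots> = e" by (simp add: field_simps)
    finally show "(\<Sum>(x, y)\<in>I. \<bar>k * f y - k * f x\<bar>) < e" .
  qed
qed

lemma abs_continuous_on_interval_ident: "abs_continuous_on_interval a b (\<lambda>x. x)"
proof (rule abs_continuous_on_intervalI)
  fix e :: real assume "0 < e"
  have eq: "(\<Sum>(x, y)\<in>I. \<bar>y - x\<bar>) = (\<Sum>(x, y)\<in>I. y - x)"
    if "\<forall>x y. (x, y) \<in> I \<longrightarrow> a \<le> x \<and> x \<le> y \<and> y \<le> b" for I :: "(real \<times> real) set"
    using that by (intro sum.cong) auto
  show "\<exists>d>0. \<forall>I :: (real \<times> real) set. finite I \<longrightarrow>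
      (\<forall>x y. (x, y) \<in> I \<longrightarrow> a \<le> x \<and> x \<le> y \<and> y \<le> b) \<longrightarrow>
       pairwise (\<lambda>p q. disjnt {fst p<..<snd p} {fst q<..<snd q}) I \<longrightarrow>
       (\<Sum>(x, y)\<in>I. y - x) < d \<longrightarrow> (\<Sum>(x, y)\<in>I. \<bar>y - x\<bar>) < e"
    by (rule exI[of _ e]) (use \<open>0 < e\<close> eq in auto)
qed

text \<open>Induction on the number of intervals: the one with the largest left end lies to the
  right of all others, and its removal leaves a family inside an initial segment. Degenerate pairs
  are discarded beforehand; their open intervals are empty, so disjointness would not order
  them.\<close>

lemma sum_increments_mono_le:
  fixes k :: "real \<Rightarrow> real" and C :: "(real \<times> real) set"
  assumes "finite C" "c \<le> d" "mono_on {c..d} k"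
    and "\<And>u v. (u, v) \<in> C \<Longrightarrow> c \<le> u \<and> u \<le> v \<and> v \<le> d"
    and "pairwise (\<lambda>p q. disjnt {fst p<..<snd p} {fst q<..<snd q}) C"
  shows "(\<Sum>(u, v)\<in>C. k v - k u) \<le> k d - k c"
proof -
  let ?C = "{(u, v) \<in> C. u < v}"
  have main: "finite D \<Longrightarrow> c \<le> d \<Longrightarrow> mono_on {c..d} k \<Longrightarrow>
      (\<And>u v. (u, v) \<in> D \<Longrightarrow> c \<le> u \<and> u < v \<and> v \<le> d) \<Longrightarrow>
      pairwise (\<lambda>p q. disjnt {fst p<..<snd p} {fst q<..<snd q}) D \<Longrightarrow>
      (\<Sum>(u, v)\<in>D. k v - k u) \<le> k d - k c" for D
  proof (induction "card D" arbitrary: D d)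
    case 0
    then have "D = {}" by auto
    then show ?case using 0 by (auto dest: mono_onD)
  next
    case (Suc n)
    note fin = \<open>finite D\<close>
    have ne: "D \<noteq> {}" using Suc.hyps(2) by auto
    define u where "u = Max (fst ` D)"
    have "u \<in> fst ` D" unfolding u_def using fin ne by (intro Max_in) auto
    then obtain v where uv: "(u, v) \<in> D" by auto
    have umax: "u' \<le> u" if "(u', v') \<in> D" for u' v'
      unfolding u_def using fin that by (intro Max_ge) force+
    have b: "c \<le> u" "u < v" "v \<le> d" using Suc.prems(4)[OF uv] by auto
    let ?D = "D - {(u, v)}"
    have left: "c \<le> u' \<and> u' < v' \<and> v' \<le> u" if D': "(u', v') \<in> ?D" for u' v'
    proof -
      have 1: "c \<le> u'" "u' < v'" "v' \<le> d" "u' \<le> u" using D' Suc.prems(4) umax by auto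
      have "disjnt {u'<..<v'} {u<..<v}"
        using Suc.prems(5) D' uv unfolding pairwise_def by force
      \<comment> \<open>If the other interval reached beyond \<open>u\<close>, this midpoint would
        lie in both open intervals.\<close>
      moreover have "(u + min v v') / 2 \<in> {u'<..<v'} \<inter> {u<..<v}" if "u < v'"
        using 1 that b by (auto simp: min_def)
      ultimately have "v' \<le> u" unfolding disjnt_def by fastforce
      then show ?thesis using 1 by auto
    qed
    have "(\<Sum>(u, v)\<in>?D. k v - k u) \<le> k u - k c"
    proof (rule Suc.hyps(1))
      show "n = card ?D" using Suc.hyps(2) fin uv by simp
      show "mono_on {c..u} k" using Suc.prems(3) by (rule mono_on_subset) (use b in auto)
      show "pairwise (\<lambda>p q. disjnt {fst p<..<snd p} {fst q<..<snd q}) ?D"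
        using Suc.prems(5) by (rule pairwise_subset) auto
    qed (use fin b left in auto)
    moreover have "(\<Sum>(u, v)\<in>D. k v - k u) = (k v - k u) + (\<Sum>(u, v)\<in>?D. k v - k u)"
      using fin uv by (subst sum.remove[OF _ uv]) auto
    moreover have "k v \<le> k d" using Suc.prems(3) b by (auto intro: mono_onD)
    ultimately show ?case by simp
  qed
  have "(\<Sum>(u, v)\<in>C. k v - k u) = (\<Sum>(u, v)\<in>?C. k v - k u)"
  proof (rule sum.mono_neutral_right)
    show "\<forall>i\<in>C - ?C. (case i of (u, v) \<Rightarrow> k v - k u) = 0"
    proof
      fix i assume i: "i \<in> C - ?C"
      obtain u v where [simp]: "i = (u, v)" by (cases i)
      have "u \<le> v" "\<not> u < v" using i assms(4)[of u v] by auto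
      then show "(case i of (u, v) \<Rightarrow> k v - k u) = 0" by auto
    qed
  qed (use assms(1) in auto)
  also have "\<dots> \<le> k d - k c"
  proof (rule main)
    show "finite ?C" using assms(1) by (rule rev_finite_subset) auto
    show "pairwise (\<lambda>p q. disjnt {fst p<..<snd p} {fst q<..<snd q}) ?C"
      using assms(5) by (rule pairwise_subset) auto
  qed (use assms in auto)
  finally show ?thesis .
qed

text \<open>Passage from tagged divisions to the pairs in the definition of absolute continuity.
  Sums can be transferred because equal intervals with disjoint interiors are degenerate, and a
  degenerate interval determines its tag.\<close>

lemma tagged_partial_division_interval_pairs:
  fixes p :: "(real \<times> real set) set"
  assumes p: "p tagged_partial_division_of {a..b}"
  defines "I \<equiv> (\<lambda>(x, K). (Inf K, Sup K)) ` p"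
  shows "inj_on (\<lambda>(x, K). (Inf K, Sup K)) p" and "finite I"
    and "\<And>u v. (u, v) \<in> I \<Longrightarrow> a \<le> u \<and> u \<le> v \<and> v \<le> b"
    and "pairwise (\<lambda>p q. disjnt {fst p<..<snd p} {fst q<..<snd q}) I"
    and "\<And>x K. (x, K) \<in> p \<Longrightarrow> K = {Inf K..Sup K} \<and> Inf K \<le> x \<and> x \<le> Sup K"
proof -
  note D = tagged_partial_division_ofD[OF p]
  show K: "K = {Inf K..Sup K} \<and> Inf K \<le> x \<and> x \<le> Sup K" if xK: "(x, K) \<in> p" for x K
  proof -
    obtain u v where uv: "K = cbox u v" using D(4)[OF xK] by auto
    have x: "x \<in> K" using D(2)[OF xK] .
    then have "u \<le> v" using uv by auto
    then show ?thesis using uv x by (auto simp: cbox_interval)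
  qed
  have Kab: "K \<subseteq> {a..b}" if "(x, K) \<in> p" for x K using D(3)[OF that] .
  have int: "disjnt {Inf K<..<Sup K} {Inf K'<..<Sup K'}"
    if "(x, K) \<in> p" "(x', K') \<in> p" "(x, K) \<noteq> (x', K')" for x K x' K'
  proof -
    have "interior K \<inter> interior K' = {}" by (rule D(5)[OF that])
    moreover have "interior K = {Inf K<..<Sup K}"
      using K[OF that(1)] interior_atLeastAtMost_real by metis
    moreover have "interior K' = {Inf K'<..<Sup K'}"
      using K[OF that(2)] interior_atLeastAtMost_real by metis
    ultimately show ?thesis by (simp add: disjnt_def)
  qed
  show "inj_on (\<lambda>(x, K). (Inf K, Sup K)) p"
  proof (rule inj_onI)
    fix i j assume ij: "i \<in> p" "j \<in> p" "(\<lambda>(x, K). (Inf K, Sup K)) i = (\<lambda>(x, K). (Inf K, Sup K)) j"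
    obtain x K where i: "i = (x, K)" by (cases i)
    obtain x' K' where j: "j = (x', K')" by (cases j)
    have eq: "Inf K = Inf K'" "Sup K = Sup K'" using ij i j by auto
    have "K = K'" using K[of x K] K[of x' K'] ij i j eq by auto
    show "i = j"
    proof (rule ccontr)
      assume "i \<noteq> j"
      then have "disjnt {Inf K<..<Sup K} {Inf K'<..<Sup K'}" using int[of x K x' K'] ij i j by auto
      then have "{Inf K<..<Sup K} = {}" using eq by (simp add: disjnt_def)
      then have "Inf K \<ge> Sup K" by auto
      then have "x = x'" using K[of x K] K[of x' K'] ij i j eq by auto
      then show False using \<open>K = K'\<close> \<open>i \<noteq> j\<close> i j by auto
    qed
  qed
  show "finite I" unfolding I_def using D(1) by auto
  show "a \<le> u \<and> u \<le> v \<and> v \<le> b" if uv: "(u, v) \<in> I" for u v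
  proof -
    obtain x K where xK: "(x, K) \<in> p" "u = Inf K" "v = Sup K" using uv unfolding I_def by auto
    have le: "Inf K \<le> Sup K" and eq: "K = {Inf K..Sup K}" using K[OF xK(1)] by auto
    have "Inf K \<in> K" "Sup K \<in> K"
      by (subst (2) eq, use le in simp)+
    then show ?thesis using Kab[OF xK(1)] xK le by auto
  qed
  show "pairwise (\<lambda>p q. disjnt {fst p<..<snd p} {fst q<..<snd q}) I"
    unfolding pairwise_def I_def using int by (force split: prod.splits)
qed

text \<open>
  A gauge which is an open set of small measure around the exceptional points makes their
  contribution negligible by absolute continuity, so that Cousin's lemma replaces the
  differentiation theorem for absolutely continuous functions.
\<close>

lemma abs_continuous_antimonotone:
  fixes f :: "real \<Rightarrow> real"
  assumes ab: "a \<le> b" and ac: "abs_continuous_on_interval a b f" and N: "N \<in> null_sets lborel"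
    and incr: "\<And>x e. x \<in> {a..b} - N \<Longrightarrow> 0 < e \<Longrightarrow> \<exists>d>0. \<forall>u v. a \<le> u \<longrightarrow> u \<le> x \<longrightarrow> x \<le> v \<longrightarrow> v \<le> b
        \<longrightarrow> x - u < d \<longrightarrow> v - x < d \<longrightarrow> f v - f u \<le> e * (v - u)"
  shows "f b \<le> f a"
proof (rule field_le_epsilon)
  fix e :: real assume e: "0 < e"
  \<comment> \<open>Half of \<open>e\<close> pays for the exceptional set, the other half for the
    slopes elsewhere; adding \<open>1\<close> to the length covers \<open>a = b\<close>.\<close>
  define e1 where "e1 = e / (2 * (b - a + 1))"
  have e1: "0 < e1" "e1 * (b - a) \<le> e / 2" using e ab by (auto simp: e1_def field_simps)
  have e2: "0 < e / 2" using e by simp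
  obtain \<delta> where \<delta>: "0 < \<delta>"
    "\<And>I :: (real \<times> real) set. finite I \<Longrightarrow> \<forall>x y. (x, y) \<in> I \<longrightarrow> a \<le> x \<and> x \<le> y \<and> y \<le> b \<Longrightarrow> pairwise (\<lambda>p q. disjnt {fst p<..<snd p} {fst q<..<snd q}) I \<Longrightarrow>
       (\<Sum>(x, y)\<in>I. y - x) < \<delta> \<Longrightarrow> (\<Sum>(x, y)\<in>I. \<bar>f y - f x\<bar>) < e / 2"
    using abs_continuous_on_intervalD[OF ac e2] by blast
  have Nl: "N \<in> null_sets lebesgue" using N by (rule null_sets_completionI)
  obtain U where U: "open U" "N \<subseteq> U" "U - N \<in> lmeasurable" "emeasure lebesgue (U - N) < ennreal \<delta>"
    using sets_lebesgue_outer_open[of N \<delta>] \<delta>(1) Nl by auto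
  have Um: "emeasure lborel U < ennreal \<delta>"
  proof -
    have "emeasure lebesgue U = emeasure lebesgue (U - N)"
      using Nl U(1) by (subst emeasure_Diff_null_set) auto
    then show ?thesis using U(4) U(1) by (simp add: emeasure_completion)
  qed
  have "\<exists>d>0. \<forall>u v. a \<le> u \<longrightarrow> u \<le> x \<longrightarrow> x \<le> v \<longrightarrow> v \<le> b
        \<longrightarrow> x - u < d \<longrightarrow> v - x < d \<longrightarrow> f v - f u \<le> e1 * (v - u)" if "x \<in> {a..b} - N" for x
    using incr[OF that e1(1)] .
  then obtain d where d: "\<And>x. x \<in> {a..b} - N \<Longrightarrow> d x > 0 \<and> (\<forall>u v. a \<le> u \<longrightarrow> u \<le> x \<longrightarrow> x \<le> v \<longrightarrow> v \<le> b
        \<longrightarrow> x - u < d x \<longrightarrow> v - x < d x \<longrightarrow> f v - f u \<le> e1 * (v - u))" by metis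
  define g where "g x = (if x \<in> N then U else if x \<in> {a..b} then ball x (d x) else UNIV)" for x
  have "gauge g" unfolding gauge_def g_def using U d by auto
  then obtain p where p: "p tagged_division_of {a..b}" "g fine p"
    using fine_division_exists_real by blast
  have pp: "p tagged_partial_division_of {a..b}" using p(1) by (simp add: tagged_division_of_def)
  have finp: "finite p" using p(1) by (rule tagged_division_of_finite)
  define pN where "pN = {(x, K) \<in> p. x \<in> N}"
  have pNsub: "pN \<subseteq> p" unfolding pN_def by auto
  have pN: "pN tagged_partial_division_of {a..b}"
    by (rule tagged_partial_division_subset[OF pp pNsub])
  define I where "I = (\<lambda>(x, K). (Inf K, Sup K)) ` pN"
  note IN = tagged_partial_division_interval_pairs[OF pN, folded I_def]
  note Ip = tagged_partial_division_interval_pairs[OF pp]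
  have KU: "{u..v} \<subseteq> U" if uv: "(u, v) \<in> I" for u v
  proof -
    obtain x K where xK: "(x, K) \<in> pN" "u = Inf K" "v = Sup K" using uv unfolding I_def by auto
    have "K \<subseteq> g x" using p(2) xK(1) pNsub unfolding fine_def by auto
    then have "K \<subseteq> U" using xK(1) unfolding g_def pN_def by auto
    then show ?thesis using IN(5)[OF xK(1)] xK by auto
  qed
  have "(\<Sum>(x, y)\<in>I. y - x) < \<delta>"
  proof -
    have disj: "disjoint_family_on (\<lambda>(u, v). {u<..<v}) I"
      using IN(4) unfolding disjoint_family_on_def pairwise_def disjnt_def by (auto simp: split_beta)
    have "ennreal (\<Sum>(x, y)\<in>I. y - x) = (\<Sum>(x, y)\<in>I. ennreal (y - x))"
      using IN(3) by (subst sum_ennreal[symmetric]) (auto intro!: sum.cong)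
    also have "\<dots> = (\<Sum>i\<in>I. emeasure lborel (case i of (u, v) \<Rightarrow> {u<..<v}))"
      using IN(3) by (auto intro!: sum.cong)
    also have "\<dots> = emeasure lborel (\<Union>i\<in>I. case i of (u, v) \<Rightarrow> {u<..<v})"
      by (rule sum_emeasure[OF _ disj IN(2)]) auto
    also have "\<dots> \<le> emeasure lborel U"
    proof (rule emeasure_mono)
      show "(\<Union>i\<in>I. case i of (u, v) \<Rightarrow> {u<..<v}) \<subseteq> U" using KU by fastforce
    qed (use U in auto)
    also have "\<dots> < ennreal \<delta>" by (rule Um)
    finally have "ennreal (\<Sum>(x, y)\<in>I. y - x) < ennreal \<delta>" .
    moreover have "0 \<le> (\<Sum>(x, y)\<in>I. y - x)" using IN(3) by (intro sum_nonneg) auto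
    ultimately show ?thesis by (simp add: ennreal_less_iff)
  qed
  then have sN: "(\<Sum>(x, y)\<in>I. \<bar>f y - f x\<bar>) < e / 2"
    using IN(2,3,4) by (intro \<delta>(2)) auto
  have "f b - f a = (\<Sum>(x, K)\<in>p. f (Sup K) - f (Inf K))"
    using additive_tagged_division_1[OF ab p(1), of f] by simp
  also have "\<dots> = (\<Sum>(x, K)\<in>pN. f (Sup K) - f (Inf K)) + (\<Sum>(x, K)\<in>p - pN. f (Sup K) - f (Inf K))"
    by (subst add.commute, rule sum.subset_diff[OF pNsub finp])
  also have "(\<Sum>(x, K)\<in>pN. f (Sup K) - f (Inf K)) \<le> (\<Sum>(x, K)\<in>pN. \<bar>f (Sup K) - f (Inf K)\<bar>)"
    by (rule sum_mono) auto
  also have "\<dots> = (\<Sum>(x, y)\<in>I. \<bar>f y - f x\<bar>)"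
    unfolding I_def by (subst sum.reindex[OF IN(1)]) (auto intro!: sum.cong)
  also have "(\<Sum>(x, K)\<in>p - pN. f (Sup K) - f (Inf K)) \<le> (\<Sum>(x, K)\<in>p - pN. e1 * (Sup K - Inf K))"
  proof (rule sum_mono, clarify)
    fix x K assume xK: "(x, K) \<in> p" "(x, K) \<notin> pN"
    have x: "x \<in> {a..b}" "x \<notin> N" using xK tagged_division_ofD(2,3)[OF p(1) xK(1)] by (auto simp: pN_def)
    have "K \<subseteq> ball x (d x)" using p(2) xK x unfolding fine_def g_def by force
    moreover have K: "K = {Inf K..Sup K} \<and> Inf K \<le> x \<and> x \<le> Sup K" using Ip(5)[OF xK(1)] .
    moreover have "Inf K \<in> K" "Sup K \<in> K"
      using K by (smt (verit) atLeastAtMost_iff)+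
    moreover have "K \<subseteq> {a..b}" using tagged_division_ofD(3)[OF p(1) xK(1)] .
    ultimately show "f (Sup K) - f (Inf K) \<le> e1 * (Sup K - Inf K)"
      using d[of x] x by (auto simp: dist_real_def subset_iff abs_less_iff)
  qed
  also have "\<dots> \<le> (\<Sum>(x, K)\<in>p. e1 * (Sup K - Inf K))"
  proof (rule sum_mono2[OF finp])
    fix i assume "i \<in> p - (p - pN)"
    then show "0 \<le> (case i of (x, K) \<Rightarrow> e1 * (Sup K - Inf K))"
      using Ip(5)[of "fst i" "snd i"] e1 by (auto simp: split_beta)
  qed auto
  also have "\<dots> = e1 * (b - a)"
    using additive_tagged_division_1[OF ab p(1), of "\<lambda>x. x"]
    by (simp add: sum_distrib_left[symmetric] split_beta)
  finally show "f b \<le> f a + e" using sN e1 by simp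
qed

section \<open>Existence of the metric derivative\<close>

text \<open>A closed interval is a ball about its midpoint, so this is the Vitali covering theorem
  for intervals that contain \<open>t\<close> without being centred there. The freedom matters:
  difference quotients have \<open>t\<close> at an endpoint.\<close>

lemma vitali_intervals:
  fixes S U :: "real set" and P :: "real \<Rightarrow> real \<Rightarrow> bool"
  assumes U: "open U" "S \<subseteq> U"
    and cov: "\<And>t d. t \<in> S \<Longrightarrow> 0 < d \<Longrightarrow> \<exists>u v. u < v \<and> u \<le> t \<and> t \<le> v \<and> v - u < d \<and> P u v"
  obtains C :: "(real \<times> real) set" where "countable C"
    "\<And>u v. (u, v) \<in> C \<Longrightarrow> u < v \<and> {u..v} \<subseteq> U \<and> P u v"
    "pairwise (\<lambda>i j. disjnt {fst i..snd i} {fst j..snd j}) C"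
    "negligible (S - (\<Union>i\<in>C. {fst i..snd i}))"
proof -
  define K where "K = {(u, v). u < v \<and> {u..v} \<subseteq> U \<and> P u v}"
  define a :: "real \<times> real \<Rightarrow> real" where "a i = (fst i + snd i) / 2" for i
  define r :: "real \<times> real \<Rightarrow> real" where "r i = (snd i - fst i) / 2" for i
  have cb: "cball (a i) (r i) = {fst i..snd i}" for i
  proof -
    have "a i - r i = fst i" "a i + r i = snd i" unfolding a_def r_def by (auto simp: field_simps)
    then show ?thesis by (simp add: cball_eq_atLeastAtMost)
  qed
  have pos: "0 < r i" if "i \<in> K" for i using that unfolding K_def r_def by auto
  have c: "\<exists>i. i \<in> K \<and> x \<in> cball (a i) (r i) \<and> r i < d" if x: "x \<in> S" and d: "0 < d" for x d
  proof -
    obtain e where e: "0 < e" "ball x e \<subseteq> U" using U x open_contains_ball by blast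
    obtain u v where uv: "u < v" "u \<le> x" "x \<le> v" "v - u < min d e" "P u v"
      using cov[OF x, of "min d e"] d e by auto
    have "{u..v} \<subseteq> ball x e" using uv by (auto simp: dist_real_def)
    then have "(u, v) \<in> K" using uv e unfolding K_def by auto
    moreover have "x \<in> cball (a (u, v)) (r (u, v))" unfolding cb using uv by auto
    moreover have "r (u, v) < d" unfolding r_def using uv by auto
    ultimately show ?thesis by blast
  qed
  obtain C where C: "countable C" "C \<subseteq> K"
     "pairwise (\<lambda>i j. disjnt (cball (a i) (r i)) (cball (a j) (r j))) C"
     "negligible (S - (\<Union>i \<in> C. cball (a i) (r i)))"
    using Vitali_covering_theorem_cballs[OF pos c] by blast
  show thesis
  proof (rule that[of C])
    show "u < v \<and> {u..v} \<subseteq> U \<and> P u v" if "(u, v) \<in> C" for u v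
      using subsetD[OF C(2) that] unfolding K_def by simp
    show "pairwise (\<lambda>i j. disjnt {fst i..snd i} {fst j..snd j}) C" using C(3) unfolding cb .
    show "negligible (S - (\<Union>i\<in>C. {fst i..snd i}))" using C(4) unfolding cb .
  qed (rule C(1))
qed

text \<open>Exhausts the countable family by finite subfamilies, so that bounds for finite sums over
  disjoint Vitali intervals pass to the union.\<close>

lemma emeasure_countable_UN_le:
  assumes "countable C" "\<And>i. i \<in> C \<Longrightarrow> A i \<in> sets M" "disjoint_family_on A C"
    and "\<And>F. finite F \<Longrightarrow> F \<subseteq> C \<Longrightarrow> (\<Sum>i\<in>F. emeasure M (A i)) \<le> X"
  shows "emeasure M (\<Union>i\<in>C. A i) \<le> X"
proof -
  define F where "F n = {i \<in> C. to_nat_on C i \<le> n}" for n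
  have fin: "finite (F n)" for n
    unfolding F_def using inj_on_to_nat_on[OF assms(1)]
    by (intro inj_on_finite[of "to_nat_on C" _ "{..n}"]) (auto simp: inj_on_def)
  have sub: "F n \<subseteq> C" for n unfolding F_def by auto
  have "(\<Union>i\<in>C. A i) = (\<Union>n. \<Union>i\<in>F n. A i)" unfolding F_def by auto
  also have "emeasure M \<dots> = (SUP n. emeasure M (\<Union>i\<in>F n. A i))"
  proof (rule SUP_emeasure_incseq[symmetric])
    show "range (\<lambda>n. \<Union>i\<in>F n. A i) \<subseteq> sets M" using fin sub assms(2) by (auto intro!: sets.finite_UN)
    show "incseq (\<lambda>n. \<Union>i\<in>F n. A i)" unfolding F_def incseq_def by auto
  qed
  also have "\<dots> \<le> X"
  proof (rule SUP_least)
    fix n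
    have "(\<Sum>i\<in>F n. emeasure M (A i)) = emeasure M (\<Union>i\<in>F n. A i)"
    proof (rule sum_emeasure)
      show "disjoint_family_on A (F n)" using assms(3) sub by (rule disjoint_family_on_mono[rotated])
    qed (use sub assms(2) fin in auto)
    then show "emeasure M (\<Union>i\<in>F n. A i) \<le> X" using assms(4)[OF fin[of n] sub[of n]] by simp
  qed
  finally show ?thesis .
qed

lemma negligible_borel_null: "N \<in> sets borel \<Longrightarrow> negligible N \<Longrightarrow> N \<in> null_sets lborel"
  by (simp add: negligible_iff_null_sets null_sets_completion_iff)

text \<open>Disjoint Vitali intervals inside \<open>U\<close> exhaust \<open>N\<close> up to a null
  set, and their total length is at most the \<open>\<gamma>\<close>-mass of \<open>U\<close>
  divided by \<open>\<kappa>\<close>.\<close>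

lemma vitali_measure_le:
  fixes N U :: "real set"
  assumes "finite_measure \<gamma>" and [measurable_cong]: "sets \<gamma> = sets borel"
    and N: "N \<in> sets borel" "open U" "N \<subseteq> U" and \<kappa>: "0 < \<kappa>"
    and cov: "\<And>t d. t \<in> N \<Longrightarrow> 0 < d \<Longrightarrow> \<exists>u v. u < v \<and> u \<le> t \<and> t \<le> v \<and> v - u < d \<and> P u v"
    and le: "\<And>u v. u < v \<Longrightarrow> {u..v} \<subseteq> U \<Longrightarrow> P u v \<Longrightarrow> \<kappa> * (v - u) \<le> measure \<gamma> {u..v}"
  shows "emeasure lborel N \<le> ennreal (measure \<gamma> U / \<kappa>)"
proof -
  interpret finite_measure \<gamma> by fact
  obtain C where C: "countable C"
    "\<And>u v. (u, v) \<in> C \<Longrightarrow> u < v \<and> {u..v} \<subseteq> U \<and> P u v"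
    "pairwise (\<lambda>i j. disjnt {fst i..snd i} {fst j..snd j}) C"
    "negligible (N - (\<Union>i\<in>C. {fst i..snd i}))"
    using vitali_intervals[OF N(2,3) cov] by blast
  have disj: "disjoint_family_on (\<lambda>i. {fst i..snd i}) C"
    using C(3) unfolding disjoint_family_on_def pairwise_def disjnt_def by auto
  have UC: "(\<Union>i\<in>C. {fst i..snd i}) \<in> sets borel" using C(1) by (intro sets.countable_UN') auto
  have "emeasure lborel (\<Union>i\<in>C. {fst i..snd i}) \<le> ennreal (measure \<gamma> U / \<kappa>)"
  proof (rule emeasure_countable_UN_le[OF C(1) _ disj])
    fix F assume F: "finite F" "F \<subseteq> C"
    have "(\<Sum>i\<in>F. snd i - fst i) * \<kappa> = (\<Sum>i\<in>F. \<kappa> * (snd i - fst i))"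
      by (simp add: sum_distrib_left mult.commute)
    also have "\<dots> \<le> (\<Sum>i\<in>F. measure \<gamma> {fst i..snd i})"
    proof (rule sum_mono)
      fix i assume "i \<in> F"
      then have "(fst i, snd i) \<in> C" using F by auto
      from C(2)[OF this] show "\<kappa> * (snd i - fst i) \<le> measure \<gamma> {fst i..snd i}" by (intro le) auto
    qed
    also have "\<dots> = measure \<gamma> (\<Union>i\<in>F. {fst i..snd i})"
      using F disjoint_family_on_mono[OF F(2) disj]
      by (intro finite_measure_finite_Union[symmetric]) auto
    also have "\<dots> \<le> measure \<gamma> U"
    proof (rule finite_measure_mono)
      show "(\<Union>i\<in>F. {fst i..snd i}) \<subseteq> U"
      proof (rule UN_least)
        fix i assume "i \<in> F"
        then show "{fst i..snd i} \<subseteq> U" using F C(2)[of "fst i" "snd i"] by auto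
      qed
    qed (use N in auto)
    finally have "(\<Sum>i\<in>F. snd i - fst i) \<le> measure \<gamma> U / \<kappa>" using \<kappa> by (simp add: field_simps)
    moreover have "(\<Sum>i\<in>F. emeasure lborel {fst i..snd i}) = ennreal (\<Sum>i\<in>F. snd i - fst i)"
    proof -
      have "fst i \<le> snd i" if "i \<in> F" for i using C(2)[of "fst i" "snd i"] that F by auto
      then show ?thesis by (subst sum_ennreal[symmetric]) (auto intro!: sum.cong)
    qed
    ultimately show "(\<Sum>i\<in>F. emeasure lborel {fst i..snd i}) \<le> ennreal (measure \<gamma> U / \<kappa>)"
      by (simp add: ennreal_leI)
  qed simp
  moreover have "emeasure lborel N \<le> emeasure lborel (\<Union>i\<in>C. {fst i..snd i})"
  proof (rule emeasure_mono_AE)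
    have "N - (\<Union>i\<in>C. {fst i..snd i}) \<in> null_sets lborel"
      using C(4) N UC by (intro negligible_borel_null) auto
    then show "AE x in lborel. x \<in> N \<longrightarrow> x \<in> (\<Union>i\<in>C. {fst i..snd i})"
      by (rule AE_I') auto
  qed (use UC in simp)
  ultimately show ?thesis by (rule order.trans[rotated])
qed

lemma open_Collect_less_on:
  fixes f g :: "real \<Rightarrow> real"
  assumes "open A" "continuous_on A f" "continuous_on A g"
  shows "open {x \<in> A. f x < g x}"
proof -
  have "open (A \<inter> (\<lambda>x. g x - f x) -` {0<..})"
    using assms by (intro continuous_open_preimage continuous_intros) auto
  moreover have "A \<inter> (\<lambda>x. g x - f x) -` {0<..} = {x \<in> A. f x < g x}" by auto
  ultimately show ?thesis by simp
qed

text \<open>What the theory of the speed uses of a curve: a pseudometric between times, bounded by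
  the mass which an absolutely continuous finite measure gives to the time interval. In the
  application \<open>\<omega>\<close> is the Wasserstein distance along the curve and
  \<open>\<beta>\<close> has density \<open>\<bar>m\<bar>\<close>.\<close>

locale dominated_pseudometric =
  fixes \<omega> :: "real \<Rightarrow> real \<Rightarrow> real" and a b :: real and \<beta> :: "real measure"
  assumes nonneg: "\<And>s t. s \<in> {a<..<b} \<Longrightarrow> t \<in> {a<..<b} \<Longrightarrow> 0 \<le> \<omega> s t"
    and sym: "\<And>s t. s \<in> {a<..<b} \<Longrightarrow> t \<in> {a<..<b} \<Longrightarrow> \<omega> s t = \<omega> t s"
    and triangle: "\<And>r s t. r \<in> {a<..<b} \<Longrightarrow> s \<in> {a<..<b} \<Longrightarrow> t \<in> {a<..<b} \<Longrightarrow> \<omega> r t \<le> \<omega> r s + \<omega> s t"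
    and finite_\<beta>: "finite_measure \<beta>" and sets_\<beta>: "sets \<beta> = sets borel"
    and ac_\<beta>: "absolutely_continuous lborel \<beta>"
    and bound: "\<And>s t. a < s \<Longrightarrow> s \<le> t \<Longrightarrow> t < b \<Longrightarrow> \<omega> s t \<le> measure \<beta> {s..t}"
begin

sublocale finite_borel_measure \<beta>
  using finite_\<beta> sets_\<beta> by (simp add: finite_borel_measure_def finite_borel_measure_axioms_def)

lemma singleton_null [simp]: "measure \<beta> {x} = 0"
proof -
  have "{x} \<in> null_sets lborel" by (simp add: null_sets_def)
  then have "{x} \<in> null_sets \<beta>" using ac_\<beta> unfolding absolutely_continuous_def by blast
  then show ?thesis by (simp add: null_sets_def measure_def)
qed

lemma measure_split: "s \<le> t \<Longrightarrow> t \<le> r \<Longrightarrow> measure \<beta> {s..r} = measure \<beta> {s..t} + measure \<beta> {t..r}"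
proof -
  assume "s \<le> t" "t \<le> r"
  then have "measure \<beta> ({s..t} \<union> {t..r}) = measure \<beta> {s..t} + measure \<beta> {t..r} - measure \<beta> ({s..t} \<inter> {t..r})"
    using sets_\<beta> by (intro measure_Un3) (auto simp: fmeasurable_eq_sets)
  moreover have "{s..t} \<union> {t..r} = {s..r}" "{s..t} \<inter> {t..r} = {t}"
    using \<open>s \<le> t\<close> \<open>t \<le> r\<close> by auto
  ultimately show ?thesis by simp
qed

lemma refl: "s \<in> {a<..<b} \<Longrightarrow> \<omega> s s = 0"
  using bound[of s s] nonneg[of s s] by auto

text \<open>The defect \<open>k t\<close>, the \<open>\<beta>\<close>-mass of \<open>{c..t}\<close>
  minus the distance from \<open>c\<close>, is nondecreasing by the triangle inequality. On each
  slow interval it grows by at least the \<open>\<beta>\<close>-mass minus \<open>p\<close> times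
  the length. Adding this over a Vitali family bounds the \<open>\<beta>\<close>-mass of
  \<open>N\<close> in terms of the total defect, which rearranges to the claim.\<close>

lemma le_of_low_speed:
  assumes N: "N \<in> sets borel" and p: "0 \<le> p" and cd: "a < c" "c \<le> d" "d < b"
    and cov: "\<And>t e. t \<in> N \<Longrightarrow> t \<in> {a<..<b} \<Longrightarrow> 0 < e \<Longrightarrow>
        \<exists>u v. u < v \<and> u \<le> t \<and> t \<le> v \<and> v - u < e \<and> \<omega> u v \<le> p * (v - u)"
  shows "\<omega> c d \<le> p * (d - c) + measure \<beta> ({c..d} - N)"
proof -
  have [measurable]: "A \<in> sets \<beta> \<longleftrightarrow> A \<in> sets borel" for A using sets_\<beta> by simp
  obtain C where C: "countable C"
    "\<And>u v. (u, v) \<in> C \<Longrightarrow> u < v \<and> {u..v} \<subseteq> {c<..<d} \<and> \<omega> u v \<le> p * (v - u)"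
    "pairwise (\<lambda>i j. disjnt {fst i..snd i} {fst j..snd j}) C"
    "negligible (N \<inter> {c<..<d} - (\<Union>i\<in>C. {fst i..snd i}))"
  proof (rule vitali_intervals[of "{c<..<d}" "N \<inter> {c<..<d}" "\<lambda>u v. \<omega> u v \<le> p * (v - u)"])
    fix t e :: real assume "t \<in> N \<inter> {c<..<d}" "0 < e"
    then show "\<exists>u v. u < v \<and> u \<le> t \<and> t \<le> v \<and> v - u < e \<and> \<omega> u v \<le> p * (v - u)"
      using cov[of t e] cd by auto
  qed auto
  have inC: "c < u \<and> u < v \<and> v < d" if "(u, v) \<in> C" for u v
  proof -
    have uv: "u < v" and sub: "{u..v} \<subseteq> {c<..<d}" using C(2)[OF that] by auto
    show ?thesis using uv subsetD[OF sub, of u] subsetD[OF sub, of v] by auto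
  qed
  have disj: "disjoint_family_on (\<lambda>i. {fst i..snd i}) C"
    using C(3) unfolding disjoint_family_on_def pairwise_def disjnt_def by auto
  have UC: "(\<Union>i\<in>C. {fst i..snd i}) \<in> sets borel" using C(1) by (intro sets.countable_UN') auto
  let ?X = "p * (d - c) + measure \<beta> {c..d} - \<omega> c d"
  define k where "k t = measure \<beta> {c..t} - \<omega> c t" for t
  have kmono: "mono_on {c..d} k"
  proof (rule mono_onI)
    fix s t assume st: "s \<in> {c..d}" "t \<in> {c..d}" "s \<le> t"
    have "\<omega> c t \<le> \<omega> c s + \<omega> s t" using st cd by (intro triangle) auto
    moreover have "\<omega> s t \<le> measure \<beta> {s..t}" using st cd by (intro bound) auto
    moreover have "measure \<beta> {c..t} = measure \<beta> {c..s} + measure \<beta> {s..t}"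
      using st by (intro measure_split) auto
    ultimately show "k s \<le> k t" unfolding k_def by simp
  qed
  have "emeasure \<beta> (\<Union>i\<in>C. {fst i..snd i}) \<le> ennreal ?X"
  proof (rule emeasure_countable_UN_le[OF C(1) _ disj])
    fix F assume F: "finite F" "F \<subseteq> C"
    have pwF: "pairwise (\<lambda>p q. disjnt {fst p<..<snd p} {fst q<..<snd q}) F"
    proof (rule pairwise_mono[OF C(3) _ F(2)])
      fix i j :: "real \<times> real" assume "disjnt {fst i..snd i} {fst j..snd j}"
      then show "disjnt {fst i<..<snd i} {fst j<..<snd j}"
        by (rule disjnt_subset1[OF disjnt_subset2]) auto
    qed
    have inF: "c \<le> u \<and> u \<le> v \<and> v \<le> d" if "(u, v) \<in> F" for u v
      using inC[of u v] that F by auto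
    have "(\<Sum>(u, v)\<in>F. k v - k u) \<le> k d - k c"
      by (rule sum_increments_mono_le[OF F(1) cd(2) kmono inF pwF])
    also have "\<dots> = measure \<beta> {c..d} - \<omega> c d"
      unfolding k_def using refl cd by simp
    finally have 1: "(\<Sum>(u, v)\<in>F. k v - k u) \<le> measure \<beta> {c..d} - \<omega> c d" .
    have 2: "(\<Sum>(u, v)\<in>F. v - u) \<le> d - c"
      using sum_increments_mono_le[OF F(1) cd(2) _ inF pwF, of "\<lambda>x. x"] by (auto simp: mono_on_def)
    have "(\<Sum>(u, v)\<in>F. measure \<beta> {u..v} - p * (v - u)) \<le> (\<Sum>(u, v)\<in>F. k v - k u)"
    proof (rule sum_mono, clarify)
      fix u v assume uv: "(u, v) \<in> F"
      have i: "c < u \<and> u < v \<and> v < d" "\<omega> u v \<le> p * (v - u)" using inC[of u v] C(2)[of u v] uv F by auto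
      have "\<omega> c v \<le> \<omega> c u + \<omega> u v" using i cd by (intro triangle) auto
      moreover have "measure \<beta> {c..v} = measure \<beta> {c..u} + measure \<beta> {u..v}"
        using i by (intro measure_split) auto
      ultimately show "measure \<beta> {u..v} - p * (v - u) \<le> k v - k u" unfolding k_def using i by simp
    qed
    then have "(\<Sum>(u, v)\<in>F. measure \<beta> {u..v}) \<le> (\<Sum>(u, v)\<in>F. k v - k u) + p * (\<Sum>(u, v)\<in>F. v - u)"
      unfolding sum_distrib_left by (simp add: split_beta sum_subtractf)
    also have "\<dots> \<le> (measure \<beta> {c..d} - \<omega> c d) + p * (d - c)"
      using 1 2 p by (intro add_mono mult_left_mono) auto
    finally have 3: "(\<Sum>(u, v)\<in>F. measure \<beta> {u..v}) \<le> ?X" by simp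
    have "(\<Sum>i\<in>F. emeasure \<beta> {fst i..snd i}) = ennreal (\<Sum>(u, v)\<in>F. measure \<beta> {u..v})"
      by (subst sum_ennreal[symmetric]) (auto simp: emeasure_eq_measure split_beta)
    then show "(\<Sum>i\<in>F. emeasure \<beta> {fst i..snd i}) \<le> ennreal ?X"
      using 3 by (simp add: ennreal_leI)
  qed (simp add: sets_\<beta>)
  moreover have X0: "0 \<le> ?X" using bound[of c d] cd p by (smt (verit) mult_nonneg_nonneg)
  ultimately have 4: "measure \<beta> (\<Union>i\<in>C. {fst i..snd i}) \<le> ?X"
    by (simp add: emeasure_eq_measure)
  have "N \<inter> {c<..<d} - (\<Union>i\<in>C. {fst i..snd i}) \<in> null_sets lborel"
    using C(4) N UC by (intro negligible_borel_null) auto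
  then have n1: "N \<inter> {c<..<d} - (\<Union>i\<in>C. {fst i..snd i}) \<in> null_sets \<beta>"
    using ac_\<beta> unfolding absolutely_continuous_def by blast
  have n2: "{c} \<in> null_sets \<beta>" "{d} \<in> null_sets \<beta>" by (auto simp: null_sets_def emeasure_eq_measure)
  have n3: "(N \<inter> {c<..<d} - (\<Union>i\<in>C. {fst i..snd i})) \<union> {c} \<union> {d} \<in> null_sets \<beta>"
    using n1 n2 by (intro null_sets.Un)
  have "emeasure \<beta> (N \<inter> {c..d}) \<le> emeasure \<beta> (\<Union>i\<in>C. {fst i..snd i})"
  proof (rule emeasure_mono_AE)
    show "AE x in \<beta>. x \<in> N \<inter> {c..d} \<longrightarrow> x \<in> (\<Union>i\<in>C. {fst i..snd i})"
      by (rule AE_I'[OF n3]) auto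
  qed (use UC sets_\<beta> in simp)
  then have 5: "measure \<beta> (N \<inter> {c..d}) \<le> ?X" using 4 by (simp add: emeasure_eq_measure)
  have "measure \<beta> ({c..d} - N) = measure \<beta> {c..d} - measure \<beta> (N \<inter> {c..d})"
    using N by (subst finite_measure_Diff'[of "{c..d}" N]) (auto simp: Int_commute)
  then show ?thesis using 5 by simp
qed

text \<open>
  If the curve has difference quotients below \<open>p\<close> and above \<open>q > p\<close> near every point of a set,
  Vitali coverings by intervals of both kinds bound its length there by \<open>p\<close> times the measure from
  above and by \<open>q\<close> times the measure from below.
\<close>

lemma two_speeds_null:
  assumes N: "N \<in> sets borel" "N \<subseteq> {a<..<b}" and pq: "0 \<le> p" "p < q"
    and lo: "\<And>t e. t \<in> N \<Longrightarrow> 0 < e \<Longrightarrow>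
        \<exists>u v. u < v \<and> u \<le> t \<and> t \<le> v \<and> v - u < e \<and> \<omega> u v \<le> p * (v - u)"
    and up: "\<And>t e. t \<in> N \<Longrightarrow> 0 < e \<Longrightarrow>
        \<exists>u v. u < v \<and> u \<le> t \<and> t \<le> v \<and> v - u < e \<and> q * (v - u) \<le> \<omega> u v"
  shows "N \<in> null_sets lborel"
proof -
  have [measurable]: "A \<in> sets \<beta> \<longleftrightarrow> A \<in> sets borel" for A using sets_\<beta> by simp
  \<comment> \<open>\<open>\<beta>\<close> restricted to the complement of \<open>N\<close>. Outer
    regularity makes its mass on a neighbourhood of \<open>N\<close> arbitrarily small, while
    \<open>le_of_low_speed\<close> shows that a fast interval carries at least
    \<open>(q - p) * (v - u)\<close> of it.\<close>
  define \<gamma> where "\<gamma> = density \<beta> (indicator (- N))"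
  have em\<gamma>: "emeasure \<gamma> A = emeasure \<beta> (A - N)" if A: "A \<in> sets borel" for A
  proof -
    have "emeasure \<gamma> A = (\<integral>\<^sup>+x. indicator (- N) x * indicator A x \<partial>\<beta>)"
      unfolding \<gamma>_def
    proof (rule emeasure_density)
      show "indicator (- N) \<in> borel_measurable \<beta>"
        by (rule borel_measurable_indicator) (use N(1) in \<open>auto simp: sets_\<beta>\<close>)
    qed (use A in \<open>simp add: sets_\<beta>\<close>)
    also have "\<dots> = (\<integral>\<^sup>+x. indicator (A - N) x \<partial>\<beta>)"
      by (intro nn_integral_cong) (auto split: split_indicator)
    finally show ?thesis using A N(1) by (simp add: sets_\<beta>)
  qed
  have me\<gamma>: "measure \<gamma> A = measure \<beta> (A - N)" if "A \<in> sets borel" for A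
    using em\<gamma>[OF that] by (simp add: measure_def)
  have fin: "finite_measure \<gamma>"
  proof (rule finite_measureI)
    have "space \<gamma> = UNIV" using sets_eq_imp_space_eq[OF sets_\<beta>] by (simp add: \<gamma>_def)
    then show "emeasure \<gamma> (space \<gamma>) \<noteq> \<infinity>" using em\<gamma>[of UNIV] by (simp add: emeasure_eq_measure)
  qed
  have sets\<gamma>: "sets \<gamma> = sets borel" unfolding \<gamma>_def using sets_\<beta> by simp
  have small: "emeasure lborel N \<le> ennreal (e / (q - p))" if e: "0 < e" for e
  proof -
    have "emeasure \<beta> N = (INF U\<in>{U. N \<subseteq> U \<and> open U}. emeasure \<beta> U)"
      by (rule outer_regular) (auto simp: sets_\<beta> N emeasure_eq_measure)
    moreover have "emeasure \<beta> N < emeasure \<beta> N + ennreal e"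
      using e by (simp add: emeasure_eq_measure ennreal_plus[symmetric] ennreal_less_iff del: ennreal_plus)
    ultimately have "(INF U\<in>{U. N \<subseteq> U \<and> open U}. emeasure \<beta> U) < emeasure \<beta> N + ennreal e" by simp
    then obtain U where U: "N \<subseteq> U" "open U" "emeasure \<beta> U < emeasure \<beta> N + ennreal e"
      by (auto simp: INF_less_iff)
    define V where "V = U \<inter> {a<..<b}"
    have V: "open V" "N \<subseteq> V" "V \<in> sets borel" unfolding V_def using U N by auto
    have "measure \<beta> V \<le> measure \<beta> U" unfolding V_def using U by (intro finite_measure_mono) auto
    also have "\<dots> \<le> measure \<beta> N + e"
      using U(3) e by (simp add: emeasure_eq_measure ennreal_plus[symmetric] ennreal_less_iff del: ennreal_plus)
    finally have "measure \<gamma> V \<le> e"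
      using V N finite_measure_Diff[of V N] by (simp add: me\<gamma> sets_\<beta>)
    moreover have "emeasure lborel N \<le> ennreal (measure \<gamma> V / (q - p))"
    proof (rule vitali_measure_le[OF fin sets\<gamma> N(1) V(1,2) _ up])
      show "0 < q - p" using pq by simp
      fix u v assume uv: "u < v" "{u..v} \<subseteq> V" "q * (v - u) \<le> \<omega> u v"
      have ab: "a < u" "v < b"
        using subsetD[OF uv(2), of u] subsetD[OF uv(2), of v] uv(1) unfolding V_def by auto
      have "\<omega> u v \<le> p * (v - u) + measure \<beta> ({u..v} - N)"
        using uv ab lo by (intro le_of_low_speed[OF N(1) pq(1)]) auto
      then show "(q - p) * (v - u) \<le> measure \<gamma> {u..v}"
        using uv by (simp add: me\<gamma> algebra_simps)
    qed
    ultimately show ?thesis using pq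
      by (elim order.trans) (intro ennreal_leI divide_right_mono, auto)
  qed
  have "emeasure lborel N \<le> 0"
  proof (rule ennreal_le_epsilon)
    fix e :: real assume "0 < e"
    then show "emeasure lborel N \<le> 0 + ennreal e" using small[of "e * (q - p)"] pq by simp
  qed
  then show ?thesis using N by (auto simp: null_sets_def)
qed

text \<open>Covering by intervals of quotient at least \<open>q\<close> bounds the measure of
  \<open>N\<close> by the total \<open>\<beta>\<close>-mass divided by \<open>q\<close>, for every
  \<open>q\<close>.\<close>

lemma infinite_speed_null:
  assumes N: "N \<in> sets borel" "N \<subseteq> {a<..<b}"
    and up: "\<And>t e q. t \<in> N \<Longrightarrow> 0 < e \<Longrightarrow> 0 < q \<Longrightarrow>
        \<exists>u v. u < v \<and> u \<le> t \<and> t \<le> v \<and> v - u < e \<and> q * (v - u) \<le> \<omega> u v"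
  shows "N \<in> null_sets lborel"
proof -
  have small: "emeasure lborel N \<le> ennreal (measure \<beta> {a<..<b} / q)" if q: "0 < q" for q
  proof (rule vitali_measure_le[OF finite_\<beta> sets_\<beta> N(1) open_greaterThanLessThan N(2) q up[OF _ _ q]])
    fix u v assume uv: "u < v" "{u..v} \<subseteq> {a<..<b}" "q * (v - u) \<le> \<omega> u v"
    show "q * (v - u) \<le> measure \<beta> {u..v}"
      using bound[of u v] uv subsetD[OF uv(2), of u] subsetD[OF uv(2), of v] by auto
  qed
  have "emeasure lborel N \<le> 0"
  proof (rule ennreal_le_epsilon)
    fix e :: real assume e: "0 < e"
    define B where "B = measure \<beta> {a<..<b}"
    have B: "0 \<le> B" unfolding B_def by simp
    have "B / ((B + 1) / e) = e * (B / (B + 1))" using e B by (simp add: field_simps)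
    also have "\<dots> \<le> e * 1" using e B by (intro mult_left_mono) (auto simp: divide_le_eq_1)
    finally have "B / ((B + 1) / e) \<le> e" by simp
    moreover have "0 < (B + 1) / e" using e B by (intro divide_pos_pos) auto
    ultimately show "emeasure lborel N \<le> 0 + ennreal e"
      using small[of "(B + 1) / e"] by (simp add: B_def[symmetric] order.trans[OF _ ennreal_leI])
  qed
  then show ?thesis using N by (auto simp: null_sets_def)
qed

text \<open>Strict inequalities make the condition on \<open>t\<close> open for fixed
  \<open>s\<close>, so that \<open>slower\<close> and \<open>faster\<close> yield countable
  intersections of open sets.\<close>

definition slower :: "real \<Rightarrow> real set" where
  "slower p = {t\<in>{a<..<b}. \<forall>e>0. \<exists>s\<in>{a<..<b}. s \<noteq> t \<and> \<bar>s - t\<bar> < e \<and> \<omega> s t < p * \<bar>s - t\<bar>}"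

definition faster :: "real \<Rightarrow> real set" where
  "faster q = {t\<in>{a<..<b}. \<forall>e>0. \<exists>s\<in>{a<..<b}. s \<noteq> t \<and> \<bar>s - t\<bar> < e \<and> q * \<bar>s - t\<bar> < \<omega> s t}"

text \<open>\<open>\<omega> s\<close> moves by at most the \<open>\<beta>\<close>-mass between two
  times, and the distribution function of \<open>\<beta>\<close> is continuous because absolute
  continuity excludes atoms.\<close>

lemma continuous_on_right: "s \<in> {a<..<b} \<Longrightarrow> continuous_on {a<..<b} (\<omega> s)"
proof -
  assume s: "s \<in> {a<..<b}"
  have cdf_cont: "isCont (cdf \<beta>) x" for x by (simp add: isCont_cdf)
  have diff: "\<bar>\<omega> s t - \<omega> s t'\<bar> \<le> \<bar>cdf \<beta> t - cdf \<beta> t'\<bar>" if t: "t \<in> {a<..<b}" "t' \<in> {a<..<b}" for t t'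
  proof -
    have key: "\<bar>\<omega> s t - \<omega> s t'\<bar> \<le> \<bar>cdf \<beta> t - cdf \<beta> t'\<bar>"
      if t: "t \<in> {a<..<b}" "t' \<in> {a<..<b}" and le: "t \<le> t'" for t t'
    proof -
      have "\<omega> s t \<le> \<omega> s t' + \<omega> t' t" "\<omega> s t' \<le> \<omega> s t + \<omega> t t'" "\<omega> t' t = \<omega> t t'"
        using triangle[OF s t(2,1)] triangle[OF s t(1,2)] sym[OF t] by auto
      moreover have "\<omega> t t' \<le> measure \<beta> {t..t'}" using t le by (intro bound) auto
      moreover have "measure \<beta> {t..t'} = cdf \<beta> t' - cdf \<beta> t"
      proof (cases "t = t'")
        case False
        have "{t..t'} = {t} \<union> {t<..t'}" using le by auto
        then have "measure \<beta> {t..t'} = measure \<beta> {t} + measure \<beta> {t<..t'}"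
          using finite_measure_Union[of "{t}" "{t<..t'}"] by (simp add: sets_\<beta>)
        then show ?thesis using cdf_diff_eq[of t t'] le False by simp
      qed auto
      ultimately show ?thesis by linarith
    qed
    show ?thesis using key[of t t'] key[of t' t] t by (cases "t \<le> t'") auto
  qed
  show ?thesis
    unfolding continuous_on_iff
  proof (intro ballI allI impI)
    fix t e :: real assume t: "t \<in> {a<..<b}" and e: "0 < e"
    obtain d where d: "d > 0" "\<And>t'. dist t' t < d \<Longrightarrow> dist (cdf \<beta> t') (cdf \<beta> t) < e"
      using cdf_cont[of t] e unfolding continuous_at_eps_delta by (auto simp: dist_real_def)
    show "\<exists>d>0. \<forall>x'\<in>{a<..<b}. dist x' t < d \<longrightarrow> dist (\<omega> s x') (\<omega> s t) < e"
    proof (intro exI[of _ d] conjI ballI impI)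
      fix x' assume x': "x' \<in> {a<..<b}" "dist x' t < d"
      show "dist (\<omega> s x') (\<omega> s t) < e"
        using diff[OF x'(1) t] d(2)[OF x'(2)] by (simp add: dist_real_def)
    qed (use d in auto)
  qed
qed

lemma borel_slower: "slower p \<in> sets borel"
proof -
  have "slower p = (\<Inter>n::nat. \<Union>s\<in>{a<..<b}. {t\<in>{a<..<b}. s \<noteq> t \<and> \<bar>s - t\<bar> < 1 / Suc n \<and> \<omega> s t < p * \<bar>s - t\<bar>})"
  proof (intro set_eqI iffI)
    fix t assume t: "t \<in> (\<Inter>n::nat. \<Union>s\<in>{a<..<b}. {t\<in>{a<..<b}. s \<noteq> t \<and> \<bar>s - t\<bar> < 1 / Suc n \<and> \<omega> s t < p * \<bar>s - t\<bar>})"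
    show "t \<in> slower p"
      unfolding slower_def
    proof (intro CollectI conjI allI impI)
      show "t \<in> {a<..<b}" using t by auto
      fix e :: real assume "0 < e"
      then obtain n where n: "1 / Suc n < e" using nat_approx_posE by auto
      have "t \<in> (\<Union>s\<in>{a<..<b}. {t\<in>{a<..<b}. s \<noteq> t \<and> \<bar>s - t\<bar> < 1 / Suc n \<and> \<omega> s t < p * \<bar>s - t\<bar>})"
        using t by blast
      then obtain s where "s \<in> {a<..<b}" "s \<noteq> t" "\<bar>s - t\<bar> < 1 / Suc n" "\<omega> s t < p * \<bar>s - t\<bar>" by blast
      then show "\<exists>s\<in>{a<..<b}. s \<noteq> t \<and> \<bar>s - t\<bar> < e \<and> \<omega> s t < p * \<bar>s - t\<bar>"
        using n by (intro bexI[of _ s]) auto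
    qed
  qed (auto simp: slower_def)
  also have "\<dots> \<in> sets borel"
  proof (intro sets.countable_INT'' borel_open open_UN ballI)
    fix n :: nat and s assume s: "s \<in> {a<..<b}"
    have "open {t \<in> {a<..<b}. \<omega> s t < p * \<bar>s - t\<bar>}"
      using continuous_on_right[OF s] by (intro open_Collect_less_on continuous_intros) auto
    moreover have "open {t. \<bar>s - t\<bar> < 1 / Suc n}" by (intro open_Collect_less continuous_intros)
    moreover have "open {t. s \<noteq> t}" by (intro open_Collect_neq continuous_intros)
    ultimately have "open ({t \<in> {a<..<b}. \<omega> s t < p * \<bar>s - t\<bar>} \<inter> {t. \<bar>s - t\<bar> < 1 / Suc n} \<inter> {t. s \<noteq> t})"
      by (intro open_Int)
    then show "open {t\<in>{a<..<b}. s \<noteq> t \<and> \<bar>s - t\<bar> < 1 / Suc n \<and> \<omega> s t < p * \<bar>s - t\<bar>}"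
      by (rule back_subst[of "open"]) (intro set_eqI iffI; elim CollectE IntE conjE; intro CollectI IntI conjI; assumption)
  qed auto
  finally show ?thesis .
qed

lemma borel_faster: "faster p \<in> sets borel"
proof -
  have "faster p = (\<Inter>n::nat. \<Union>s\<in>{a<..<b}. {t\<in>{a<..<b}. s \<noteq> t \<and> \<bar>s - t\<bar> < 1 / Suc n \<and> p * \<bar>s - t\<bar> < \<omega> s t})"
  proof (intro set_eqI iffI)
    fix t assume t: "t \<in> (\<Inter>n::nat. \<Union>s\<in>{a<..<b}. {t\<in>{a<..<b}. s \<noteq> t \<and> \<bar>s - t\<bar> < 1 / Suc n \<and> p * \<bar>s - t\<bar> < \<omega> s t})"
    show "t \<in> faster p"
      unfolding faster_def
    proof (intro CollectI conjI allI impI)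
      show "t \<in> {a<..<b}" using t by auto
      fix e :: real assume "0 < e"
      then obtain n where n: "1 / Suc n < e" using nat_approx_posE by auto
      have "t \<in> (\<Union>s\<in>{a<..<b}. {t\<in>{a<..<b}. s \<noteq> t \<and> \<bar>s - t\<bar> < 1 / Suc n \<and> p * \<bar>s - t\<bar> < \<omega> s t})"
        using t by blast
      then obtain s where "s \<in> {a<..<b}" "s \<noteq> t" "\<bar>s - t\<bar> < 1 / Suc n" "p * \<bar>s - t\<bar> < \<omega> s t" by blast
      then show "\<exists>s\<in>{a<..<b}. s \<noteq> t \<and> \<bar>s - t\<bar> < e \<and> p * \<bar>s - t\<bar> < \<omega> s t"
        using n by (intro bexI[of _ s]) auto
    qed
  qed (auto simp: faster_def)
  also have "\<dots> \<in> sets borel"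
  proof (intro sets.countable_INT'' borel_open open_UN ballI)
    fix n :: nat and s assume s: "s \<in> {a<..<b}"
    have "open {t \<in> {a<..<b}. p * \<bar>s - t\<bar> < \<omega> s t}"
      using continuous_on_right[OF s] by (intro open_Collect_less_on continuous_intros) auto
    moreover have "open {t. \<bar>s - t\<bar> < 1 / Suc n}" by (intro open_Collect_less continuous_intros)
    moreover have "open {t. s \<noteq> t}" by (intro open_Collect_neq continuous_intros)
    ultimately have "open ({t \<in> {a<..<b}. p * \<bar>s - t\<bar> < \<omega> s t} \<inter> {t. \<bar>s - t\<bar> < 1 / Suc n} \<inter> {t. s \<noteq> t})"
      by (intro open_Int)
    then show "open {t\<in>{a<..<b}. s \<noteq> t \<and> \<bar>s - t\<bar> < 1 / Suc n \<and> p * \<bar>s - t\<bar> < \<omega> s t}"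
      by (rule back_subst[of "open"]) (intro set_eqI iffI; elim CollectE IntE conjE; intro CollectI IntI conjI; assumption)
  qed auto
  finally show ?thesis .
qed

lemma slowerD:
  assumes "t \<in> slower p" "0 < e"
  shows "\<exists>u v. u < v \<and> u \<le> t \<and> t \<le> v \<and> v - u < e \<and> \<omega> u v \<le> p * (v - u)"
proof -
  obtain s where s: "s \<in> {a<..<b}" "t \<in> {a<..<b}" "s \<noteq> t" "\<bar>s - t\<bar> < e" "\<omega> s t < p * \<bar>s - t\<bar>"
    using assms unfolding slower_def by blast
  show ?thesis
  proof (cases "s < t")
    case True
    then show ?thesis using s by (intro exI[of _ s] exI[of _ t]) auto
  next
    case False
    then show ?thesis using s sym[OF s(1,2)] by (intro exI[of _ t] exI[of _ s]) auto
  qed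
qed

lemma fasterD:
  assumes "t \<in> faster q" "0 < e"
  shows "\<exists>u v. u < v \<and> u \<le> t \<and> t \<le> v \<and> v - u < e \<and> q * (v - u) \<le> \<omega> u v"
proof -
  obtain s where s: "s \<in> {a<..<b}" "t \<in> {a<..<b}" "s \<noteq> t" "\<bar>s - t\<bar> < e" "q * \<bar>s - t\<bar> < \<omega> s t"
    using assms unfolding faster_def by blast
  show ?thesis
  proof (cases "s < t")
    case True
    then show ?thesis using s by (intro exI[of _ s] exI[of _ t]) auto
  next
    case False
    then show ?thesis using s sym[OF s(1,2)] by (intro exI[of _ t] exI[of _ s]) auto
  qed
qed

text \<open>The limit is the infimum \<open>w\<close> of all eventual upper bounds, of which
  \<open>q0\<close> is one. Below it, rationals \<open>p < q\<close> separate a given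
  \<open>y\<close> from \<open>w\<close>: \<open>q\<close> is no eventual upper bound, so
  \<open>t\<close> is in \<open>faster q\<close>, hence not in \<open>slower p\<close>, and the
  quotients eventually stay above \<open>p\<close>.\<close>

lemma limit_exists_pointwise:
  assumes t: "t \<in> {a<..<b}" and q0: "t \<notin> faster q0"
    and pq: "\<And>p q. p \<in> \<rat> \<Longrightarrow> q \<in> \<rat> \<Longrightarrow> 0 \<le> p \<Longrightarrow> p < q \<Longrightarrow> t \<notin> slower p \<inter> faster q"
  shows "\<exists>w. ((\<lambda>s. \<omega> s t / \<bar>s - t\<bar>) \<longlongrightarrow> w) (at t)"
proof -
  define h where "h s = \<omega> s t / \<bar>s - t\<bar>" for s
  have nbhd: "\<forall>\<^sub>F s in at t. s \<in> {a<..<b} \<and> s \<noteq> t"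
    using t eventually_at_in_open'[of "{a<..<b}" t] by (auto simp: eventually_at_filter)
  have ev_le: "\<forall>\<^sub>F s in at t. h s \<le> q" if nq: "t \<notin> faster q" for q
  proof -
    obtain e where e: "e > 0" and ns: "\<not> (\<exists>s\<in>{a<..<b}. s \<noteq> t \<and> \<bar>s - t\<bar> < e \<and> q * \<bar>s - t\<bar> < \<omega> s t)"
      using nq t unfolding faster_def by blast
    have e2: "\<omega> s t \<le> q * \<bar>s - t\<bar>" if "s \<in> {a<..<b}" "s \<noteq> t" "\<bar>s - t\<bar> < e" for s
      using ns that by (meson linorder_not_le)
    have "\<forall>\<^sub>F s in at t. dist s t < e" using e by (auto simp: eventually_at)
    then show ?thesis using nbhd
      by eventually_elim (use e2 in \<open>auto simp: h_def dist_real_def divide_le_eq\<close>)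
  qed
  have ev_ge: "\<forall>\<^sub>F s in at t. p \<le> h s" if np: "t \<notin> slower p" for p
  proof -
    obtain e where e: "e > 0" and ns: "\<not> (\<exists>s\<in>{a<..<b}. s \<noteq> t \<and> \<bar>s - t\<bar> < e \<and> \<omega> s t < p * \<bar>s - t\<bar>)"
      using np t unfolding slower_def by blast
    have e2: "p * \<bar>s - t\<bar> \<le> \<omega> s t" if "s \<in> {a<..<b}" "s \<noteq> t" "\<bar>s - t\<bar> < e" for s
      using ns that by (meson linorder_not_le)
    have "\<forall>\<^sub>F s in at t. dist s t < e" using e by (auto simp: eventually_at)
    then show ?thesis using nbhd
      by eventually_elim (use e2 in \<open>auto simp: h_def dist_real_def le_divide_eq\<close>)
  qed
  have h0: "\<forall>\<^sub>F s in at t. 0 \<le> h s"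
    using nbhd by eventually_elim (use nonneg t in \<open>auto simp: h_def\<close>)
  define Q where "Q = {q. \<forall>\<^sub>F s in at t. h s \<le> q}"
  have Qne: "Q \<noteq> {}" using ev_le[OF q0] unfolding Q_def by auto
  have Q0: "0 \<le> q" if "q \<in> Q" for q
  proof -
    have "\<forall>\<^sub>F s in at t. h s \<le> q" using that unfolding Q_def by simp
    with h0 have "\<forall>\<^sub>F s in at t. 0 \<le> q" by eventually_elim auto
    then show ?thesis by (simp add: eventually_const_iff)
  qed
  have bdd: "bdd_below Q" by (rule bdd_belowI[of _ 0]) (rule Q0)
  define w where "w = Inf Q"
  have w0: "0 \<le> w" unfolding w_def using Qne Q0 by (intro cInf_greatest)
  have "(h \<longlongrightarrow> w) (at t)"
  proof (rule order_tendstoI)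
    fix y assume y: "w < y"
    then obtain q where "q \<in> Q" "q < y" unfolding w_def using cInf_lessD[OF Qne] by auto
    then have "\<forall>\<^sub>F s in at t. h s \<le> q" "q < y" unfolding Q_def by auto
    then show "\<forall>\<^sub>F s in at t. h s < y" by (auto elim: eventually_mono)
  next
    fix y assume y: "y < w"
    show "\<forall>\<^sub>F s in at t. y < h s"
    proof (cases "y < 0")
      case True
      show ?thesis using h0 by eventually_elim (use True in auto)
    next
      case False
      obtain p where p: "p \<in> \<rat>" "y < p" "p < w" using Rats_dense_in_real[OF y] by auto
      obtain q where q: "q \<in> \<rat>" "p < q" "q < w" using Rats_dense_in_real[OF p(3)] by auto
      have "q \<notin> Q" using q(3) cInf_lower[OF _ bdd] unfolding w_def by fastforce
      then have "t \<in> faster q" using ev_le[of q] unfolding Q_def by auto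
      then have "t \<notin> slower p" using pq[OF p(1) q(1)] False p q by auto
      then show ?thesis using ev_ge[of p] p(2) by (auto elim: eventually_mono)
    qed
  qed
  then show ?thesis unfolding h_def by blast
qed

text \<open>Countably many exceptional sets suffice: one for each pair of rationals with
  \<open>0 \<le> p < q\<close>, and one for infinite speed.\<close>

theorem AE_metric_derivative_exists:
  "AE t in lborel. t \<in> {a<..<b} \<longrightarrow> (\<exists>w. ((\<lambda>s. \<omega> s t / \<bar>s - t\<bar>) \<longlongrightarrow> w) (at t))"
proof -
  define Z where "Z = (\<Inter>n::nat. faster (real n))"
  have Z: "Z \<in> null_sets lborel"
  proof (rule infinite_speed_null)
    show "Z \<in> sets borel" unfolding Z_def using borel_faster by auto
    show "Z \<subseteq> {a<..<b}" unfolding Z_def faster_def by auto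
    fix t e q :: real assume t: "t \<in> Z" "0 < e" "0 < q"
    obtain n :: nat where n: "q < real n" using reals_Archimedean2 by blast
    have "t \<in> faster (real n)" using t unfolding Z_def by auto
    from fasterD[OF this t(2)] obtain u v where
      uv: "u < v" "u \<le> t" "t \<le> v" "v - u < e" "real n * (v - u) \<le> \<omega> u v" by blast
    have "q * (v - u) \<le> real n * (v - u)" using n uv by (intro mult_right_mono) auto
    then have "q * (v - u) \<le> \<omega> u v" using uv by linarith
    then show "\<exists>u v. u < v \<and> u \<le> t \<and> t \<le> v \<and> v - u < e \<and> q * (v - u) \<le> \<omega> u v"
      using uv by blast
  qed
  define I :: "(real \<times> real) set" where "I = {(p, q). p \<in> \<rat> \<and> q \<in> \<rat> \<and> 0 \<le> p \<and> p < q}"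
  have cI: "countable I"
    by (rule countable_subset[of _ "\<rat> \<times> \<rat>"]) (auto simp: I_def countable_rat)
  have "(\<Union>i\<in>I. slower (fst i) \<inter> faster (snd i)) \<in> null_sets lborel"
  proof (rule null_sets_UN'[OF cI])
    fix i assume i: "i \<in> I"
    show "slower (fst i) \<inter> faster (snd i) \<in> null_sets lborel"
    proof (rule two_speeds_null)
      show "slower (fst i) \<inter> faster (snd i) \<in> sets borel"
        using borel_slower borel_faster by auto
      show "slower (fst i) \<inter> faster (snd i) \<subseteq> {a<..<b}" unfolding slower_def by auto
      show "0 \<le> fst i" "fst i < snd i" using i unfolding I_def by auto
    qed (use slowerD fasterD in auto)
  qed
  with Z have "Z \<union> (\<Union>i\<in>I. slower (fst i) \<inter> faster (snd i)) \<in> null_sets lborel" by auto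
  then show ?thesis
  proof (rule AE_I')
    show "{x \<in> space lborel. \<not> (x \<in> {a<..<b} \<longrightarrow> (\<exists>w. ((\<lambda>s. \<omega> s x / \<bar>s - x\<bar>) \<longlongrightarrow> w) (at x)))}
        \<subseteq> Z \<union> (\<Union>i\<in>I. slower (fst i) \<inter> faster (snd i))"
    proof clarsimp
      fix x assume x: "a < x" "x < b" "\<forall>w. \<not> ((\<lambda>s. \<omega> s x / \<bar>s - x\<bar>) \<longlongrightarrow> w) (at x)" 
        "\<forall>i\<in>I. x \<in> slower (fst i) \<longrightarrow> x \<notin> faster (snd i)"
      show "x \<in> Z"
      proof (rule ccontr)
        assume "x \<notin> Z"
        then obtain n :: nat where "x \<notin> faster (real n)" unfolding Z_def by auto
        then have "\<exists>w. ((\<lambda>s. \<omega> s x / \<bar>s - x\<bar>) \<longlongrightarrow> w) (at x)"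
          by (rule limit_exists_pointwise[rotated]) (use x in \<open>auto simp: I_def\<close>)
        then show False using x by blast
      qed
    qed
  qed
qed

end

section \<open>Square-integrable functions\<close>

lemma integrable_mult_L2:
  fixes f g :: "'a \<Rightarrow> real"
  assumes [measurable]: "f \<in> borel_measurable M" "g \<in> borel_measurable M"
    and "integrable M (\<lambda>x. (f x)\<^sup>2)" "integrable M (\<lambda>x. (g x)\<^sup>2)"
  shows "integrable M (\<lambda>x. f x * g x)"
proof (rule Bochner_Integration.integrable_bound)
  show "integrable M (\<lambda>x. (f x)\<^sup>2 + (g x)\<^sup>2)" using assms by simp
  have "norm (f x * g x) \<le> norm ((f x)\<^sup>2 + (g x)\<^sup>2)" for x
  proof -
    have "2 * (\<bar>f x\<bar> * \<bar>g x\<bar>) \<le> \<bar>f x\<bar>\<^sup>2 + \<bar>g x\<bar>\<^sup>2"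
      using zero_le_power2[of "\<bar>f x\<bar> - \<bar>g x\<bar>"] unfolding power2_diff by linarith
    moreover have "0 \<le> \<bar>f x\<bar> * \<bar>g x\<bar>" by simp
    ultimately have "\<bar>f x\<bar> * \<bar>g x\<bar> \<le> \<bar>f x\<bar>\<^sup>2 + \<bar>g x\<bar>\<^sup>2" by linarith
    then show ?thesis by (simp add: abs_mult)
  qed
  then show "AE x in M. norm (f x * g x) \<le> norm ((f x)\<^sup>2 + (g x)\<^sup>2)" by simp
qed simp

lemma integrable_add_L2:
  fixes f g :: "'a \<Rightarrow> real"
  assumes "f \<in> borel_measurable M" "g \<in> borel_measurable M"
    and "integrable M (\<lambda>x. (f x)\<^sup>2)" "integrable M (\<lambda>x. (g x)\<^sup>2)"
  shows "integrable M (\<lambda>x. (f x + g x)\<^sup>2)" "integrable M (\<lambda>x. (f x - g x)\<^sup>2)"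
  using assms integrable_mult_L2[OF assms] by (simp_all add: power2_sum power2_diff mult.assoc)

lemma integral_cauchy_schwarz:
  fixes f g :: "'a \<Rightarrow> real"
  assumes [measurable]: "f \<in> borel_measurable M" "g \<in> borel_measurable M"
    and int: "integrable M (\<lambda>x. (f x)\<^sup>2)" "integrable M (\<lambda>x. (g x)\<^sup>2)"
  shows "\<bar>\<integral>x. f x * g x \<partial>M\<bar> \<le> sqrt (\<integral>x. (f x)\<^sup>2 \<partial>M) * sqrt (\<integral>x. (g x)\<^sup>2 \<partial>M)"
proof -
  define A where "A = (\<integral>x. (f x)\<^sup>2 \<partial>M)"
  define B where "B = (\<integral>x. f x * g x \<partial>M)"
  define C where "C = (\<integral>x. (g x)\<^sup>2 \<partial>M)"
  have fg: "integrable M (\<lambda>x. f x * g x)" by (rule integrable_mult_L2) (use assms in auto)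
  have q: "0 \<le> A + 2 * t * B + t\<^sup>2 * C" for t
  proof -
    have "0 \<le> (\<integral>x. (f x + t * g x)\<^sup>2 \<partial>M)" by simp
    also have "\<dots> = (\<integral>x. (f x)\<^sup>2 + (2 * t) * (f x * g x) + t\<^sup>2 * (g x)\<^sup>2 \<partial>M)"
      by (intro Bochner_Integration.integral_cong) (auto simp: power2_eq_square algebra_simps)
    also have "\<dots> = A + 2 * t * B + t\<^sup>2 * C"
      unfolding A_def B_def C_def using int fg by simp
    finally show ?thesis .
  qed
  have A0: "0 \<le> A" and C0: "0 \<le> C" unfolding A_def C_def by simp_all
  have "B\<^sup>2 \<le> A * C"
  proof (cases "C = 0")
    case True
    have "B = 0"
    proof (rule ccontr)
      assume "B \<noteq> 0"
      \<comment> \<open>At this point the quadratic, which is affine for \<open>C = 0\<close>, takes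
        the value \<open>- 1\<close>.\<close>
      then show False using q[of "- (A + 1) / (2 * B)"] True by (simp add: field_simps)
    qed
    then show ?thesis using A0 C0 by simp
  next
    case False
    then have "0 < C" using C0 by simp
    then show ?thesis using q[of "- B / C"] by (simp add: field_simps power2_eq_square)
  qed
  then have "\<bar>B\<bar> \<le> sqrt (A * C)" by (simp add: real_le_rsqrt)
  then show ?thesis unfolding A_def B_def C_def by (simp add: real_sqrt_mult)
qed

lemma integral_minkowski:
  fixes f g :: "'a \<Rightarrow> real"
  assumes [measurable]: "f \<in> borel_measurable M" "g \<in> borel_measurable M"
    and int: "integrable M (\<lambda>x. (f x)\<^sup>2)" "integrable M (\<lambda>x. (g x)\<^sup>2)"
  shows "sqrt (\<integral>x. (f x + g x)\<^sup>2 \<partial>M) \<le> sqrt (\<integral>x. (f x)\<^sup>2 \<partial>M) + sqrt (\<integral>x. (g x)\<^sup>2 \<partial>M)"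
proof -
  have fg: "integrable M (\<lambda>x. f x * g x)" by (rule integrable_mult_L2) (use assms in auto)
  let ?A = "\<integral>x. (f x)\<^sup>2 \<partial>M" and ?C = "\<integral>x. (g x)\<^sup>2 \<partial>M"
  have "(\<integral>x. (f x + g x)\<^sup>2 \<partial>M) = ?A + ?C + 2 * (\<integral>x. f x * g x \<partial>M)"
    using int fg by (simp add: power2_sum mult.assoc)
  also have "\<dots> \<le> ?A + ?C + 2 * (sqrt ?A * sqrt ?C)"
    using integral_cauchy_schwarz[OF assms] by linarith
  also have "\<dots> = (sqrt ?A + sqrt ?C)\<^sup>2" by (simp add: power2_sum)
  finally show ?thesis by (intro real_le_lsqrt) auto
qed

lemma (in prob_space) expectation_le_L2:
  assumes [measurable]: "f \<in> borel_measurable M" and int: "integrable M (\<lambda>x. (f x)\<^sup>2 :: real)"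
  shows "integrable M f" "\<bar>\<integral>x. f x \<partial>M\<bar> \<le> sqrt (\<integral>x. (f x)\<^sup>2 \<partial>M)"
proof -
  show "integrable M f" using integrable_mult_L2[of f M "\<lambda>_. 1"] int by simp
  show "\<bar>\<integral>x. f x \<partial>M\<bar> \<le> sqrt (\<integral>x. (f x)\<^sup>2 \<partial>M)"
    using integral_cauchy_schwarz[of f M "\<lambda>_. 1"] int by (simp add: prob_space)
qed

section \<open>The Wasserstein distance on the line\<close>

definition unit_interval :: "real measure" where
  "unit_interval = restrict_space lborel {0<..<1}"

text \<open>The left-continuous generalized inverse of the distribution function. It is used for
  levels in \<open>{0<..<1}\<close>, where the set is nonempty and bounded below.\<close>

definition quantile :: "real measure \<Rightarrow> real \<Rightarrow> real" where
  "quantile \<mu> u = Inf {x. u \<le> cdf \<mu> x}"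

lemma prob_space_unit_interval: "prob_space unit_interval"
  unfolding unit_interval_def
  by (auto simp add: emeasure_restrict_space space_restrict_space intro!: prob_spaceI)

lemma space_unit_interval [simp]: "space unit_interval = {0<..<1}"
  by (simp add: unit_interval_def space_restrict_space)

context
  fixes \<mu> :: "real measure" assumes \<mu>: "real_distribution \<mu>"
begin

interpretation cdf_distribution \<mu> unfolding cdf_distribution_def by (rule \<mu>)

lemma quantile_le_iff: "0 < u \<Longrightarrow> u < 1 \<Longrightarrow> quantile \<mu> u \<le> x \<longleftrightarrow> u \<le> cdf \<mu> x"
  unfolding quantile_def using pseudoinverse[of u x] by simp

lemma measurable_quantile: "quantile \<mu> \<in> borel_measurable unit_interval"
proof -
  have eq: "quantile \<mu> = I" unfolding quantile_def by auto
  have "I \<in> borel_measurable (restrict_space borel {0<..<1})" by (rule measurable_CI)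
  then show ?thesis
    unfolding eq unit_interval_def
    by (subst measurable_cong_sets[OF sets_restrict_space_cong[OF sets_lborel] refl])
qed

lemma distr_quantile: "distr unit_interval borel (quantile \<mu>) = \<mu>"
proof -
  have eq: "quantile \<mu> = I" unfolding quantile_def by auto
  show ?thesis unfolding eq unit_interval_def by (rule distr_I_eq_M)
qed

end

text \<open>
  The square of a difference is twice the area of the triangle \<open>y \<le> s < t < x\<close> or its mirror image.
  This reduces the transport cost to the probabilities of \<open>Y \<le> s, t < X\<close>, which the quantile
  coupling minimizes simultaneously for all \<open>s < t\<close>.
\<close>

lemma layer_cake_square:
  fixes x y :: real
  defines "h \<equiv> \<lambda>x y. \<integral>\<^sup>+s. \<integral>\<^sup>+t. (if y \<le> s \<and> s < t \<and> t < x then 1 else 0) \<partial>lborel \<partial>lborel"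
  shows "ennreal ((x - y)\<^sup>2) = 2 * (h x y + h y x)"
proof -
  have inner: "(\<integral>\<^sup>+t. (if y \<le> s \<and> s < t \<and> t < x then 1 else 0) \<partial>lborel) = ennreal (x - s) * indicator {y..x} s"
    for x y s :: real
  proof (cases "y \<le> s \<and> s \<le> x")
    case True
    have "(\<integral>\<^sup>+t. (if y \<le> s \<and> s < t \<and> t < x then 1 else 0) \<partial>lborel) = (\<integral>\<^sup>+t. indicator {s<..<x} t \<partial>lborel)"
      using True by (intro nn_integral_cong) (auto split: split_indicator)
    also have "\<dots> = ennreal (x - s)" using True by simp
    finally show ?thesis using True by simp
  next
    case False
    have "(\<integral>\<^sup>+t. (if y \<le> s \<and> s < t \<and> t < x then 1 else 0) \<partial>lborel) = (\<integral>\<^sup>+t. 0 \<partial>(lborel :: real measure))"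
      using False by (intro nn_integral_cong) auto
    then show ?thesis using False by auto
  qed
  have hle: "h x y = ennreal ((x - y)\<^sup>2 / 2)" if "y \<le> x" for x y :: real
  proof -
    have "h x y = (\<integral>\<^sup>+s. ennreal (x - s) * indicator {y..x} s \<partial>lborel)" unfolding h_def inner ..
    also have "\<dots> = ennreal ((- (x - x)\<^sup>2 / 2) - (- (x - y)\<^sup>2 / 2))"
      by (rule nn_integral_FTC_Icc) (use that in \<open>auto intro!: derivative_eq_intros simp: field_simps\<close>)
    finally show ?thesis by simp
  qed
  have h0: "h x y = 0" if "x \<le> y" for x y :: real
    unfolding h_def by (subst nn_integral_0_iff_AE) (use that in \<open>auto simp: inner split: split_indicator\<close>)
  have 2: "2 * ennreal r = ennreal (2 * r)" if "0 \<le> r" for r :: real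
    using that by (simp add: ennreal_mult)
  show ?thesis
  proof (cases "y \<le> x")
    case True
    then show ?thesis using hle[of y x] h0[of y x] 2[of "(x - y)\<^sup>2 / 2"] by simp
  next
    case False
    then show ?thesis using hle[of x y] h0[of x y] 2[of "(y - x)\<^sup>2 / 2"]
      by (simp add: power2_commute)
  qed
qed

lemma (in prob_space) nn_integral_layer_cake:
  fixes X Y :: "'a \<Rightarrow> real"
  assumes [measurable]: "X \<in> borel_measurable M" "Y \<in> borel_measurable M"
  shows "(\<integral>\<^sup>+\<omega>. (\<integral>\<^sup>+s. \<integral>\<^sup>+t. (if Y \<omega> \<le> s \<and> s < t \<and> t < X \<omega> then 1 else 0) \<partial>lborel \<partial>lborel) \<partial>M)
    = (\<integral>\<^sup>+s. \<integral>\<^sup>+t. (if s < t then emeasure M {\<omega>\<in>space M. Y \<omega> \<le> s \<and> t < X \<omega>} else 0) \<partial>lborel \<partial>lborel)"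
proof -
  interpret P: pair_sigma_finite M "lborel :: real measure" ..
  let ?f = "\<lambda>\<omega> s t :: real. (if Y \<omega> \<le> s \<and> s < t \<and> t < X \<omega> then 1 else 0) :: ennreal"
  have "(\<integral>\<^sup>+\<omega>. (\<integral>\<^sup>+s. \<integral>\<^sup>+t. ?f \<omega> s t \<partial>lborel \<partial>lborel) \<partial>M)
      = (\<integral>\<^sup>+s. (\<integral>\<^sup>+\<omega>. \<integral>\<^sup>+t. ?f \<omega> s t \<partial>lborel \<partial>M) \<partial>lborel)"
    by (rule P.Fubini'[symmetric]) measurable
  also have "\<dots> = (\<integral>\<^sup>+s. (\<integral>\<^sup>+t. \<integral>\<^sup>+\<omega>. ?f \<omega> s t \<partial>M \<partial>lborel) \<partial>lborel)"
    by (intro nn_integral_cong P.Fubini'[symmetric]) measurable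
  also have "\<dots> = (\<integral>\<^sup>+s. \<integral>\<^sup>+t. (if s < t then emeasure M {\<omega>\<in>space M. Y \<omega> \<le> s \<and> t < X \<omega>} else 0) \<partial>lborel \<partial>lborel)"
  proof (intro nn_integral_cong)
    fix s t :: real
    have "(\<integral>\<^sup>+\<omega>. ?f \<omega> s t \<partial>M) = (\<integral>\<^sup>+\<omega>. indicator {\<omega>\<in>space M. Y \<omega> \<le> s \<and> s < t \<and> t < X \<omega>} \<omega> \<partial>M)"
      by (intro nn_integral_cong) auto
    also have "\<dots> = emeasure M {\<omega>\<in>space M. Y \<omega> \<le> s \<and> s < t \<and> t < X \<omega>}" by simp
    also have "\<dots> = (if s < t then emeasure M {\<omega>\<in>space M. Y \<omega> \<le> s \<and> t < X \<omega>} else 0)"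
      by auto
    finally show "(\<integral>\<^sup>+\<omega>. ?f \<omega> s t \<partial>M) = \<dots>" .
  qed
  finally show ?thesis .
qed

lemma (in prob_space) emeasure_gap_ge:
  fixes X Y :: "'a \<Rightarrow> real"
  assumes [measurable]: "X \<in> borel_measurable M" "Y \<in> borel_measurable M"
  shows "ennreal (cdf (distr M borel Y) s - cdf (distr M borel X) t)
    \<le> emeasure M {\<omega>\<in>space M. Y \<omega> \<le> s \<and> t < X \<omega>}"
proof -
  have Y: "cdf (distr M borel Y) s = measure M {\<omega>\<in>space M. Y \<omega> \<le> s}"
    unfolding cdf_def by (subst measure_distr) (auto intro!: arg_cong[of _ _ "measure M"])
  have X: "cdf (distr M borel X) t = measure M {\<omega>\<in>space M. X \<omega> \<le> t}"
    unfolding cdf_def by (subst measure_distr) (auto intro!: arg_cong[of _ _ "measure M"])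
  have "measure M {\<omega>\<in>space M. Y \<omega> \<le> s} \<le>
      measure M ({\<omega>\<in>space M. X \<omega> \<le> t} \<union> {\<omega>\<in>space M. Y \<omega> \<le> s \<and> t < X \<omega>})"
    by (intro finite_measure_mono) auto
  also have "\<dots> \<le> measure M {\<omega>\<in>space M. X \<omega> \<le> t} + measure M {\<omega>\<in>space M. Y \<omega> \<le> s \<and> t < X \<omega>}"
    by (intro measure_Un_le) measurable
  finally show ?thesis unfolding X Y by (simp add: emeasure_eq_measure ennreal_leI)
qed

text \<open>For quantiles the event is a half-open interval of levels, so the lower bound of
  \<open>emeasure_gap_ge\<close> is attained for all \<open>s\<close> and \<open>t\<close> at once.
  A negative difference of distribution functions is truncated to \<open>0\<close> by
  \<open>ennreal\<close>, in agreement with the empty interval.\<close>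

lemma emeasure_gap_quantile:
  assumes "real_distribution \<mu>" "real_distribution \<nu>"
  shows "emeasure unit_interval {u\<in>space unit_interval. quantile \<nu> u \<le> s \<and> t < quantile \<mu> u}
    = ennreal (cdf \<nu> s - cdf \<mu> t)"
proof -
  interpret m: real_distribution \<mu> by fact
  interpret n: real_distribution \<nu> by fact
  have "{u\<in>space unit_interval. quantile \<nu> u \<le> s \<and> t < quantile \<mu> u}
     = {0<..<1} \<inter> {cdf \<mu> t<..cdf \<nu> s}" 
    using quantile_le_iff[OF assms(1)] quantile_le_iff[OF assms(2)] by (auto simp: not_le[symmetric])
  then have "emeasure unit_interval {u\<in>space unit_interval. quantile \<nu> u \<le> s \<and> t < quantile \<mu> u}
    = emeasure lborel ({0<..<1} \<inter> {cdf \<mu> t<..cdf \<nu> s})"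
    unfolding unit_interval_def by (simp add: emeasure_restrict_space)
  \<comment> \<open>Only the level \<open>1\<close> can be lost in \<open>{0<..<1}\<close>, namely
    when \<open>cdf \<nu> s = 1\<close>.\<close>
  also have "\<dots> = emeasure lborel {cdf \<mu> t<..cdf \<nu> s}"
  proof (rule emeasure_eq_AE)
    show "AE x in lborel. (x \<in> {0<..<1} \<inter> {cdf \<mu> t<..cdf \<nu> s}) = (x \<in> {cdf \<mu> t<..cdf \<nu> s})"
      using AE_lborel_singleton[of "1 :: real"]
    proof eventually_elim
      case (elim x)
      then show ?case
        using m.cdf_nonneg[of t] n.cdf_bounded_prob[of s] by auto
    qed
  qed auto
  also have "\<dots> = ennreal (cdf \<nu> s - cdf \<mu> t)"
    by (cases "cdf \<mu> t \<le> cdf \<nu> s") (auto simp: ennreal_neg)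
  finally show ?thesis .
qed

lemma P2D:
  assumes "\<mu> \<in> P2"
  shows "real_distribution \<mu>" "prob_space \<mu>" "sets \<mu> = sets borel" "space \<mu> = UNIV"
    "integrable \<mu> (\<lambda>x. x\<^sup>2)" "integrable \<mu> (\<lambda>x. x)"
proof -
  show rd: "real_distribution \<mu>" and sq: "integrable \<mu> (\<lambda>x. x\<^sup>2)" using assms unfolding P2_def by auto
  interpret real_distribution \<mu> by fact
  show "prob_space \<mu>" by (rule prob_space_axioms)
  show "sets \<mu> = sets borel" "space \<mu> = UNIV" by (rule events_eq_borel, rule space_eq_univ)
  show "integrable \<mu> (\<lambda>x. x)" using sq by (rule expectation_le_L2(1)[rotated]) simp
qed

lemma P2I:
  assumes "prob_space \<mu>" "sets \<mu> = sets borel" "integrable \<mu> (\<lambda>x. x\<^sup>2)"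
  shows "\<mu> \<in> P2"
  using assms sets_eq_imp_space_eq[OF assms(2)]
  by (auto simp: P2_def real_distribution_def real_distribution_axioms_def)

lemma L2_coupling:
  assumes "\<mu> \<in> P2" and [measurable]: "X \<in> borel_measurable M" and "distr M borel X = \<mu>"
  shows "integrable M (\<lambda>\<omega>. (X \<omega>)\<^sup>2)"
  using P2D(5)[OF assms(1)] unfolding assms(3)[symmetric] by (simp add: integrable_distr_eq)

text \<open>Stated for random variables on an arbitrary probability space, so that it serves both
  the projections of a coupling and the pair of a point and its image under a transport map.\<close>

lemma transport_cost_ge_quantile:
  assumes \<mu>: "\<mu> \<in> P2" and \<nu>: "\<nu> \<in> P2" and "prob_space M"
    and [measurable]: "X \<in> borel_measurable M" "Y \<in> borel_measurable M"
    and X: "distr M borel X = \<mu>" and Y: "distr M borel Y = \<nu>"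
  shows "(\<integral>u. (quantile \<mu> u - quantile \<nu> u)\<^sup>2 \<partial>unit_interval) \<le> (\<integral>\<omega>. (X \<omega> - Y \<omega>)\<^sup>2 \<partial>M)"
proof -
  interpret prob_space M by fact
  interpret U: prob_space unit_interval by (rule prob_space_unit_interval)
  note rd = P2D(1)[OF \<mu>] P2D(1)[OF \<nu>]
  note [measurable] = measurable_quantile[OF rd(1)] measurable_quantile[OF rd(2)]
  let ?h = "\<lambda>x y. \<integral>\<^sup>+s. \<integral>\<^sup>+t. (if y \<le> s \<and> s < t \<and> t < x then 1 else 0) \<partial>(lborel::real measure) \<partial>(lborel::real measure) :: ennreal"
  have meas[measurable]: "(\<lambda>\<omega>. ?h (A \<omega>) (B \<omega>)) \<in> borel_measurable N"
    if [measurable]: "A \<in> borel_measurable N" "B \<in> borel_measurable N" for A B :: "'x \<Rightarrow> real" and N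
    by measurable
  have split: "(\<integral>\<^sup>+\<omega>. ennreal ((A \<omega> - B \<omega>)\<^sup>2) \<partial>N) = 2 * ((\<integral>\<^sup>+\<omega>. ?h (A \<omega>) (B \<omega>) \<partial>N) + (\<integral>\<^sup>+\<omega>. ?h (B \<omega>) (A \<omega>) \<partial>N))"
    if [measurable]: "A \<in> borel_measurable N" "B \<in> borel_measurable N" for A B :: "'x \<Rightarrow> real" and N
    unfolding layer_cake_square
    by (subst nn_integral_cmult, measurable, subst nn_integral_add, measurable)
  have le: "(\<integral>\<^sup>+u. ?h (quantile \<mu> u) (quantile \<nu> u) \<partial>unit_interval) \<le> (\<integral>\<^sup>+\<omega>. ?h (X \<omega>) (Y \<omega>) \<partial>M)"
    if "distr M borel X = \<mu>" "distr M borel Y = \<nu>" "real_distribution \<mu>" "real_distribution \<nu>"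
      and [measurable]: "X \<in> borel_measurable M" "Y \<in> borel_measurable M" for X Y \<mu> \<nu>
  proof -
    note [measurable] = measurable_quantile[OF that(3)] measurable_quantile[OF that(4)]
    have gap: "(if s < t then emeasure unit_interval {u\<in>space unit_interval. quantile \<nu> u \<le> s \<and> t < quantile \<mu> u} else 0)
        \<le> (if s < t then emeasure M {\<omega>\<in>space M. Y \<omega> \<le> s \<and> t < X \<omega>} else 0)" for s t
      using emeasure_gap_ge[OF that(5,6), of s t] emeasure_gap_quantile[OF that(3,4), of s t]
      by (simp add: that(1,2) del: space_unit_interval)
    show ?thesis
      unfolding nn_integral_layer_cake[OF that(5,6)]
        U.nn_integral_layer_cake[OF measurable_quantile[OF that(3)] measurable_quantile[OF that(4)]]
      by (intro nn_integral_mono gap)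
  qed
  have "(\<integral>\<^sup>+u. ennreal ((quantile \<mu> u - quantile \<nu> u)\<^sup>2) \<partial>unit_interval) \<le> (\<integral>\<^sup>+\<omega>. ennreal ((X \<omega> - Y \<omega>)\<^sup>2) \<partial>M)"
    by (subst split, measurable, subst split, measurable)
       (intro mult_left_mono add_mono le X Y rd, auto)
  moreover have "integrable unit_interval (\<lambda>u. (quantile \<mu> u - quantile \<nu> u)\<^sup>2)"
    using L2_coupling[OF \<mu> _ distr_quantile[OF rd(1)]] L2_coupling[OF \<nu> _ distr_quantile[OF rd(2)]]
    by (intro integrable_add_L2) auto
  moreover have "integrable M (\<lambda>\<omega>. (X \<omega> - Y \<omega>)\<^sup>2)"
    using L2_coupling[OF \<mu> _ X] L2_coupling[OF \<nu> _ Y] by (intro integrable_add_L2) auto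
  ultimately show ?thesis by (simp add: nn_integral_eq_integral)
qed

text \<open>Turns \<open>W2\<close> into an \<open>L2\<close> distance of quantile functions; the
  triangle inequality and definiteness are read off from there, without gluing couplings.\<close>

lemma W2_eq_quantile:
  assumes \<mu>: "\<mu> \<in> P2" and \<nu>: "\<nu> \<in> P2"
  shows "W2 \<mu> \<nu> = sqrt (\<integral>u. (quantile \<mu> u - quantile \<nu> u)\<^sup>2 \<partial>unit_interval)"
proof -
  interpret U: prob_space unit_interval by (rule prob_space_unit_interval)
  note rd = P2D(1)[OF \<mu>] P2D(1)[OF \<nu>]
  note [measurable] = measurable_quantile[OF rd(1)] measurable_quantile[OF rd(2)]
  let ?c = "\<lambda>\<gamma>. \<integral>(y, y'). \<bar>y - y'\<bar>\<^sup>2 \<partial>\<gamma>" and ?q = "\<integral>u. (quantile \<mu> u - quantile \<nu> u)\<^sup>2 \<partial>unit_interval"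
  let ?\<gamma> = "distr unit_interval (borel \<Otimes>\<^sub>M borel) (\<lambda>u. (quantile \<mu> u, quantile \<nu> u))"
  have lower: "?q \<le> ?c \<gamma>" if "\<gamma> \<in> couplings \<mu> \<nu>" for \<gamma>
  proof -
    have \<gamma>: "prob_space \<gamma>" "sets \<gamma> = sets (borel \<Otimes>\<^sub>M borel)"
      "distr \<gamma> borel fst = \<mu>" "distr \<gamma> borel snd = \<nu>" using that unfolding couplings_def by auto
    have "?q \<le> (\<integral>\<omega>. (fst \<omega> - snd \<omega>)\<^sup>2 \<partial>\<gamma>)"
      by (rule transport_cost_ge_quantile[OF \<mu> \<nu> \<gamma>(1) _ _ \<gamma>(3,4)])
         (simp_all add: measurable_cong_sets[OF \<gamma>(2) refl])
    then show ?thesis by (simp add: case_prod_unfold)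
  qed
  have in\<gamma>: "?\<gamma> \<in> couplings \<mu> \<nu>"
    unfolding couplings_def
    by (auto simp: U.prob_space_distr distr_distr comp_def distr_quantile[OF rd(1), simplified comp_def]
        distr_quantile[OF rd(1)] distr_quantile[OF rd(2)])
  have eq: "?c ?\<gamma> = ?q" by (subst integral_distr) auto
  have "(INF \<gamma>\<in>couplings \<mu> \<nu>. ?c \<gamma>) = ?q"
  proof (rule antisym)
    show "(INF \<gamma>\<in>couplings \<mu> \<nu>. ?c \<gamma>) \<le> ?q"
    proof -
      have "bdd_below (?c ` couplings \<mu> \<nu>)" by (rule bdd_belowI2[of _ ?q]) (rule lower)
      from cINF_lower[OF this in\<gamma>] show ?thesis unfolding eq .
    qed
    show "?q \<le> (INF \<gamma>\<in>couplings \<mu> \<nu>. ?c \<gamma>)"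
      using in\<gamma> lower by (intro cINF_greatest) auto
  qed
  then show ?thesis unfolding W2_def by simp
qed

lemma W2_le_coupling:
  assumes "\<mu> \<in> P2" "\<nu> \<in> P2" "prob_space M"
    and "X \<in> borel_measurable M" "Y \<in> borel_measurable M" "distr M borel X = \<mu>" "distr M borel Y = \<nu>"
  shows "W2 \<mu> \<nu> \<le> sqrt (\<integral>\<omega>. (X \<omega> - Y \<omega>)\<^sup>2 \<partial>M)"
  using transport_cost_ge_quantile[OF assms] by (simp add: W2_eq_quantile[OF assms(1,2)])

lemma integrable_quantile:
  assumes "\<mu> \<in> P2"
  shows "quantile \<mu> \<in> borel_measurable unit_interval" "integrable unit_interval (\<lambda>u. (quantile \<mu> u)\<^sup>2)"
  using measurable_quantile[OF P2D(1)[OF assms]]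
    L2_coupling[OF assms measurable_quantile[OF P2D(1)[OF assms]] distr_quantile[OF P2D(1)[OF assms]]] by auto

section \<open>Metric properties inherited from the quantile representation\<close>

lemma W2_nonneg: "\<mu> \<in> P2 \<Longrightarrow> \<nu> \<in> P2 \<Longrightarrow> 0 \<le> W2 \<mu> \<nu>"
  by (simp add: W2_eq_quantile)

lemma W2_sym: "\<mu> \<in> P2 \<Longrightarrow> \<nu> \<in> P2 \<Longrightarrow> W2 \<mu> \<nu> = W2 \<nu> \<mu>"
  by (simp add: W2_eq_quantile power2_commute)

lemma W2_triangle:
  assumes "\<mu> \<in> P2" "\<nu> \<in> P2" "\<kappa> \<in> P2"
  shows "W2 \<mu> \<kappa> \<le> W2 \<mu> \<nu> + W2 \<nu> \<kappa>"
proof -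
  note q = integrable_quantile[OF assms(1)] integrable_quantile[OF assms(2)] integrable_quantile[OF assms(3)]
  show ?thesis
    using integral_minkowski[of "\<lambda>u. quantile \<mu> u - quantile \<nu> u" unit_interval "\<lambda>u. quantile \<nu> u - quantile \<kappa> u"]
      integrable_add_L2(2)[OF q(1,3,2,4)] integrable_add_L2(2)[OF q(3,5,4,6)] q
    by (simp add: W2_eq_quantile assms)
qed

lemma W2_eq_0D:
  assumes "\<mu> \<in> P2" "\<nu> \<in> P2" "W2 \<mu> \<nu> = 0"
  shows "\<mu> = \<nu>"
proof -
  note q = integrable_quantile[OF assms(1)] integrable_quantile[OF assms(2)]
  have "(\<integral>u. (quantile \<mu> u - quantile \<nu> u)\<^sup>2 \<partial>unit_interval) = 0"
    using assms by (simp add: W2_eq_quantile)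
  then have "AE u in unit_interval. (quantile \<mu> u - quantile \<nu> u)\<^sup>2 = 0"
    using integral_nonneg_eq_0_iff_AE[OF integrable_add_L2(2)[OF q(1,3,2,4)]] by simp
  then have "distr unit_interval borel (quantile \<mu>) = distr unit_interval borel (quantile \<nu>)"
    using q by (intro distr_cong_AE) auto
  then show ?thesis using distr_quantile P2D(1) assms by simp
qed

lemma mean_diff_le_W2:
  assumes "\<mu> \<in> P2" "\<nu> \<in> P2"
  shows "\<bar>(\<integral>x. x \<partial>\<mu>) - (\<integral>x. x \<partial>\<nu>)\<bar> \<le> W2 \<mu> \<nu>"
proof -
  interpret U: prob_space unit_interval by (rule prob_space_unit_interval)
  note q = integrable_quantile[OF assms(1)] integrable_quantile[OF assms(2)]
  have m: "(\<integral>x. x \<partial>\<mu>) = (\<integral>u. quantile \<mu> u \<partial>unit_interval)" if "\<mu> \<in> P2" for \<mu>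
    using integrable_quantile[OF that]
    by (subst distr_quantile[OF P2D(1)[OF that], symmetric]) (simp add: integral_distr)
  have "(\<integral>x. x \<partial>\<mu>) - (\<integral>x. x \<partial>\<nu>) = (\<integral>u. quantile \<mu> u - quantile \<nu> u \<partial>unit_interval)"
    unfolding m[OF assms(1)] m[OF assms(2)]
    using U.expectation_le_L2(1)[OF q(1,2)] U.expectation_le_L2(1)[OF q(3,4)] by simp
  also have "\<bar>\<dots>\<bar> \<le> W2 \<mu> \<nu>"
    unfolding W2_eq_quantile[OF assms]
    by (rule U.expectation_le_L2(2)) (use q integrable_add_L2(2)[OF q(1,3,2,4)] in auto)
  finally show ?thesis .
qed

section \<open>The free energy of measures with a density\<close>

lemma ext_integral_eq_integral:
  assumes "integrable M f"
  shows "ext_integral M f = ereal (\<integral>x. f x \<partial>M)"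
proof -
  obtain r q where rq: "0 \<le> r" "0 \<le> q" "(\<integral>\<^sup>+x. ennreal (f x) \<partial>M) = ennreal r"
    "(\<integral>\<^sup>+x. ennreal (- f x) \<partial>M) = ennreal q" "integral\<^sup>L M f = r - q"
    using integrableE[OF assms] by metis
  then show ?thesis unfolding ext_integral_def by simp
qed

lemma ext_integral_cong_AE: "(AE x in M. f x = g x) \<Longrightarrow> ext_integral M f = ext_integral M g"
  unfolding ext_integral_def by (auto intro!: arg_cong2[of _ _ _ _ minus] arg_cong[of _ _ enn2ereal] nn_integral_cong_AE)

text \<open>With finite negative parts no cancellation \<open>\<infinity> - \<infinity>\<close> can
  hide an infinite positive part, so finiteness of the sum passes to both summands.\<close>

lemma ext_integral_finiteD:
  assumes [measurable]: "f \<in> borel_measurable M" "g \<in> borel_measurable M"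
    and neg: "(\<integral>\<^sup>+x. ennreal (- f x) \<partial>M) < \<infinity>" "(\<integral>\<^sup>+x. ennreal (- g x) \<partial>M) < \<infinity>"
    and fin: "ext_integral M f + ext_integral M g - ereal r \<noteq> \<infinity>"
  shows "integrable M f" "integrable M g"
proof -
  obtain n1 where n1: "0 \<le> n1" "(\<integral>\<^sup>+x. ennreal (- f x) \<partial>M) = ennreal n1"
    using neg(1) by (cases "\<integral>\<^sup>+x. ennreal (- f x) \<partial>M") auto
  obtain n2 where n2: "0 \<le> n2" "(\<integral>\<^sup>+x. ennreal (- g x) \<partial>M) = ennreal n2"
    using neg(2) by (cases "\<integral>\<^sup>+x. ennreal (- g x) \<partial>M") auto
  have "(\<integral>\<^sup>+x. ennreal (f x) \<partial>M) \<noteq> \<infinity> \<and> (\<integral>\<^sup>+x. ennreal (g x) \<partial>M) \<noteq> \<infinity>"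
    using fin n1 n2 unfolding ext_integral_def
    by (cases "\<integral>\<^sup>+x. ennreal (f x) \<partial>M"; cases "\<integral>\<^sup>+x. ennreal (g x) \<partial>M") auto
  then show "integrable M f" "integrable M g" unfolding real_integrable_def using neg by auto
qed

lemma free_energy_density:
  assumes [measurable]: "\<rho> \<in> borel_measurable borel" and "\<And>x. 0 \<le> \<rho> x"
    and \<nu>: "\<nu> = density lborel (\<lambda>x. ennreal (\<rho> x))" and "prob_space \<nu>"
  shows "free_energy \<Psi> J \<nu> = ext_integral \<nu> (\<lambda>z. ln (\<rho> z)) + ext_integral \<nu> \<Psi> - ereal (J / 2 * (\<integral>z. z \<partial>\<nu>)\<^sup>2)"
proof -
  interpret prob_space \<nu> by fact
  have ac: "absolutely_continuous lborel \<nu>"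
    unfolding \<nu> by (rule absolutely_continuousI_density) simp
  have "AE x in lborel. ennreal (\<rho> x) = RN_deriv lborel \<nu> x"
    by (rule RN_deriv_unique_sigma_finite) (auto simp: \<nu>[symmetric] sigma_finite_measure_axioms)
  then have "AE x in \<nu>. ennreal (\<rho> x) = RN_deriv lborel \<nu> x"
    by (rule absolutely_continuous_AE[rotated 2, OF _]) (use ac in \<open>auto simp: \<nu>\<close>)
  then have "AE x in \<nu>. ln (enn2real (RN_deriv lborel \<nu> x)) = ln (\<rho> x)"
    by eventually_elim (metis assms(2) enn2real_ennreal)
  from ext_integral_cong_AE[OF this] show ?thesis unfolding free_energy_def using ac by simp
qed

lemma free_energy_density_integrable:
  assumes "\<rho> \<in> borel_measurable borel" "\<And>x. 0 \<le> \<rho> x"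
    and "\<nu> = density lborel (\<lambda>x. ennreal (\<rho> x))" "prob_space \<nu>"
    and "integrable \<nu> (\<lambda>z. ln (\<rho> z))" "integrable \<nu> \<Psi>"
  shows "free_energy \<Psi> J \<nu> = ereal ((\<integral>z. ln (\<rho> z) \<partial>\<nu>) + (\<integral>z. \<Psi> z \<partial>\<nu>) - J / 2 * (\<integral>z. z \<partial>\<nu>)\<^sup>2)"
  using free_energy_density[OF assms(1-4), of \<Psi> J] ext_integral_eq_integral[OF assms(5)]
    ext_integral_eq_integral[OF assms(6)] by simp

lemma integrable_gauss: "integrable lborel (\<lambda>z::real. exp (- z\<^sup>2 / 2 - 1))"
proof -
  have "integrable lborel (\<lambda>z::real. (sqrt (2 * pi) * exp (- 1)) * (std_normal_density z * z ^ 0))"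
    by (intro integrable_mult_right integrable_std_normal_moment)
  moreover have "(sqrt (2 * pi) * exp (- 1)) * (std_normal_density z * z ^ 0) = exp (- z\<^sup>2 / 2 - 1)" for z :: real
    by (simp add: std_normal_density_def mult_exp_exp algebra_simps)
  ultimately show ?thesis by (simp only:)
qed

text \<open>The function \<open>r * ln r + r * b\<close> of \<open>r\<close> has the minimum
  \<open>- exp (- b - 1)\<close>, attained at \<open>r = exp (- b - 1)\<close>. With
  \<open>b = x\<^sup>2 / 2\<close> the error term becomes a Gaussian, so that a second moment
  controls the negative part of the entropy.\<close>

lemma neg_x_ln_x_le:
  fixes r b :: real assumes "0 \<le> r"
  shows "r * (- ln r) \<le> r * b + exp (- b - 1)"
proof (cases "r = 0")
  case False
  then have r: "0 < r" using assms by simp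
  have "ln (exp (- b - 1) / r) \<le> exp (- b - 1) / r - 1" using r by (intro ln_le_minus_one) auto
  then have "- b - 1 - ln r \<le> exp (- b - 1) / r - 1" using r by (simp add: ln_div)
  then have "r * (- b - ln r) \<le> r * (exp (- b - 1) / r)" using r by (intro mult_left_mono) auto
  then show ?thesis using r by (simp add: algebra_simps)
qed simp

lemma entropy_neg_part:
  assumes [measurable]: "\<rho> \<in> borel_measurable borel" and \<rho>: "\<And>x. 0 \<le> \<rho> x"
    and \<nu>: "\<nu> = density lborel (\<lambda>x. ennreal (\<rho> x))" and P: "\<nu> \<in> P2"
  shows "(\<integral>\<^sup>+x. ennreal (- ln (\<rho> x)) \<partial>\<nu>)
    \<le> ennreal ((\<integral>z. z\<^sup>2 / 2 \<partial>\<nu>) + (\<integral>z. exp (- z\<^sup>2 / 2 - 1) \<partial>lborel))"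
proof -
  have sq: "integrable \<nu> (\<lambda>z. z\<^sup>2 / 2)" using P2D(5)[OF P] by simp
  then have sq': "integrable lborel (\<lambda>z. \<rho> z * (z\<^sup>2 / 2))"
    unfolding \<nu> using \<rho> by (subst (asm) integrable_density) auto
  have "(\<integral>\<^sup>+x. ennreal (- ln (\<rho> x)) \<partial>\<nu>) = (\<integral>\<^sup>+x. ennreal (\<rho> x) * ennreal (- ln (\<rho> x)) \<partial>lborel)"
    unfolding \<nu> by (subst nn_integral_density) auto
  also have "\<dots> \<le> (\<integral>\<^sup>+x. ennreal (\<rho> x * (x\<^sup>2 / 2) + exp (- x\<^sup>2 / 2 - 1)) \<partial>lborel)"
  proof (rule nn_integral_mono)
    fix x
    have "\<rho> x * (- ln (\<rho> x)) \<le> \<rho> x * (x\<^sup>2 / 2) + exp (- (x\<^sup>2 / 2) - 1)"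
      by (rule neg_x_ln_x_le) (rule \<rho>)
    then show "ennreal (\<rho> x) * ennreal (- ln (\<rho> x)) \<le> ennreal (\<rho> x * (x\<^sup>2 / 2) + exp (- x\<^sup>2 / 2 - 1))"
      using \<rho>[of x] by (simp add: ennreal_mult'[symmetric] ennreal_leI del: ennreal_plus)
  qed
  also have "\<dots> = ennreal (\<integral>x. \<rho> x * (x\<^sup>2 / 2) + exp (- x\<^sup>2 / 2 - 1) \<partial>lborel)"
    using sq' integrable_gauss \<rho> by (intro nn_integral_eq_integral) auto
  also have "(\<integral>x. \<rho> x * (x\<^sup>2 / 2) + exp (- x\<^sup>2 / 2 - 1) \<partial>lborel)
      = (\<integral>x. \<rho> x * (x\<^sup>2 / 2) \<partial>lborel) + (\<integral>z. exp (- z\<^sup>2 / 2 - 1) \<partial>lborel)"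
    using sq' integrable_gauss by (rule Bochner_Integration.integral_add)
  also have "(\<integral>x. \<rho> x * (x\<^sup>2 / 2) \<partial>lborel) = (\<integral>z. z\<^sup>2 / 2 \<partial>\<nu>)"
    unfolding \<nu> using \<rho> by (subst integral_density) auto
  finally show ?thesis .
qed

section \<open>Transport by diffeomorphisms of the line\<close>

text \<open>Intervals determine Lebesgue measure: the preimage of \<open>{l<..<u}\<close> under
  \<open>S\<close> is \<open>{T l<..<T u}\<close>, over which the fundamental theorem integrates the
  derivative \<open>1 / T' (S y)\<close> of \<open>S\<close> to \<open>u - l\<close>.\<close>

lemma lborel_eq_distr_inverse:
  fixes T T' S :: "real \<Rightarrow> real"
  assumes dT: "\<And>x. (T has_real_derivative T' x) (at x)" and pos: "\<And>x. 0 < T' x"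
    and cont: "continuous_on UNIV T'" and inv: "\<And>x. S (T x) = x" "\<And>y. T (S y) = y"
  shows "S \<in> borel_measurable borel"
    and "lborel = distr (density lborel (\<lambda>y. ennreal (1 / T' (S y)))) borel S"
proof -
  have cT: "continuous_on A T" for A using dT by (auto intro!: continuous_at_imp_continuous_on DERIV_isCont)
  have dS: "(S has_real_derivative 1 / T' (S y)) (at y)" for y
  proof -
    have "isCont S (T (S y))"
      by (rule isCont_inverse_function[of 1]) (use inv dT in \<open>auto intro: DERIV_isCont\<close>)
    then have "DERIV S y :> inverse (T' (S y))"
      using dT[of "S y"] pos[of "S y"] inv
      by (intro DERIV_inverse_function[where f = T and a = "y - 1" and b = "y + 1"]) auto
    then show ?thesis by (simp add: inverse_eq_divide)
  qed
  have cS: "continuous_on UNIV S" using dS by (auto intro!: continuous_at_imp_continuous_on DERIV_isCont)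
  then show [measurable]: "S \<in> borel_measurable borel" by (rule borel_measurable_continuous_onI)
  have [measurable]: "T' \<in> borel_measurable borel" using cont by (rule borel_measurable_continuous_onI)
  have mono: "strict_mono T"
  proof (rule strict_monoI)
    fix x y :: real assume "x < y"
    then show "T x < T y" by (rule DERIV_pos_imp_increasing) (use dT pos in blast)
  qed
  show "lborel = distr (density lborel (\<lambda>y. ennreal (1 / T' (S y)))) borel S"
  proof (rule lborel_eqI)
    fix l u :: real assume "\<And>b. b \<in> Basis \<Longrightarrow> l \<bullet> b \<le> u \<bullet> b"
    then have lu: "l \<le> u" by simp
    have "S -` {l<..<u} = {T l<..<T u}"
      using strict_mono_less[OF mono] inv(2) by (auto) (metis inv(2) strict_mono_less[OF mono])+
    then have "emeasure (distr (density lborel (\<lambda>y. ennreal (1 / T' (S y)))) borel S) (box l u)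
      = (\<integral>\<^sup>+y. ennreal (1 / T' (S y)) * indicator {T l<..<T u} y \<partial>lborel)"
      by (simp add: emeasure_distr emeasure_density box_real)
    also have "\<dots> = (\<integral>\<^sup>+y. ennreal (1 / T' (S y)) * indicator {T l..T u} y \<partial>lborel)"
    proof (rule nn_integral_cong_AE)
      show "AE y in lborel. ennreal (1 / T' (S y)) * indicator {T l<..<T u} y
          = ennreal (1 / T' (S y)) * indicator {T l..T u} y"
        using AE_lborel_singleton[of "T l"] AE_lborel_singleton[of "T u"]
        by eventually_elim (auto split: split_indicator)
    qed
    also have "\<dots> = ennreal (S (T u) - S (T l))"
    proof (rule nn_integral_FTC_Icc)
      show "T l \<le> T u" using lu strict_mono_less_eq[OF mono] by simp
    qed (use dS pos in \<open>auto intro: less_imp_le\<close>)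
    finally show "emeasure (distr (density lborel (\<lambda>y. ennreal (1 / T' (S y)))) borel S) (box l u)
      = (\<Prod>b\<in>Basis. (u - l) \<bullet> b)" using inv by simp
  qed simp
qed

lemma distr_density_diffeo:
  fixes T T' S :: "real \<Rightarrow> real"
  assumes dT: "\<And>x. (T has_real_derivative T' x) (at x)" and pos: "\<And>x. 0 < T' x"
    and cont: "continuous_on UNIV T'" and inv: "\<And>x. S (T x) = x" "\<And>y. T (S y) = y"
    and [measurable]: "\<rho> \<in> borel_measurable borel" and \<rho>: "\<And>x. 0 \<le> \<rho> x"
  shows "distr (density lborel (\<lambda>x. ennreal (\<rho> x))) borel T = density lborel (\<lambda>y. ennreal (\<rho> (S y) / T' (S y)))"
proof (rule measure_eqI)
  note L = lborel_eq_distr_inverse[OF assms(1-5)]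
  note [measurable] = L(1)
  have [measurable]: "T' \<in> borel_measurable borel" using cont by (rule borel_measurable_continuous_onI)
  have "continuous_on UNIV T" using dT by (auto intro!: continuous_at_imp_continuous_on DERIV_isCont)
  then have [measurable]: "T \<in> borel_measurable borel" by (rule borel_measurable_continuous_onI)
  fix A assume "A \<in> sets (distr (density lborel (\<lambda>x. ennreal (\<rho> x))) borel T)"
  then have [measurable]: "A \<in> sets borel" by simp
  have "emeasure (distr (density lborel (\<lambda>x. ennreal (\<rho> x))) borel T) A
      = (\<integral>\<^sup>+x. ennreal (\<rho> x) * indicator A (T x) \<partial>lborel)"
  proof -
    have "indicator (T -` A) x = (indicator A (T x) :: ennreal)" for x by (simp add: indicator_def)
    moreover have "T -` A \<in> sets borel" by (rule measurable_sets_borel[of T borel]) auto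
    ultimately show ?thesis by (simp add: emeasure_distr emeasure_density)
  qed
  also have "\<dots> = (\<integral>\<^sup>+x. ennreal (\<rho> x) * indicator A (T x) \<partial>distr (density lborel (\<lambda>y. ennreal (1 / T' (S y)))) borel S)"
    using L(2) by simp
  also have "\<dots> = (\<integral>\<^sup>+y. ennreal (1 / T' (S y)) * (ennreal (\<rho> (S y)) * indicator A y) \<partial>lborel)"
    by (simp add: nn_integral_distr nn_integral_density inv)
  also have "\<dots> = (\<integral>\<^sup>+y. ennreal (\<rho> (S y) / T' (S y)) * indicator A y \<partial>lborel)"
    using \<rho> pos by (intro nn_integral_cong) (auto simp: ennreal_mult'[symmetric] less_imp_le split: split_indicator)
  also have "\<dots> = emeasure (density lborel (\<lambda>y. ennreal (\<rho> (S y) / T' (S y)))) A"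
    by (simp add: emeasure_density)
  finally show "emeasure (distr (density lborel (\<lambda>x. ennreal (\<rho> x))) borel T) A
    = emeasure (density lborel (\<lambda>y. ennreal (\<rho> (S y) / T' (S y)))) A" .
qed simp

text \<open>Two applications of the mean value theorem, which give the constant \<open>L\<close>
  instead of \<open>L / 2\<close>. The bound on \<open>f''\<close> is asked for only between the two
  points, because for perturbations of compact support it is at hand only on a bounded set.\<close>

lemma taylor_lower:
  fixes f f' f'' :: "real \<Rightarrow> real"
  assumes d1: "\<And>z. (f has_real_derivative f' z) (at z)" and d2: "\<And>z. (f' has_real_derivative f'' z) (at z)"
    and L: "0 \<le> L" "\<And>z. min x y \<le> z \<Longrightarrow> z \<le> max x y \<Longrightarrow> - L \<le> f'' z"
  shows "f x + f' x * (y - x) - L * (y - x)\<^sup>2 \<le> f y"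
proof (cases x y rule: linorder_cases)
  case less
  obtain z where z: "x < z" "z < y" "f y - f x = (y - x) * f' z" using MVT2[OF less d1] by blast
  obtain w where w: "x < w" "w < z" "f' z - f' x = (z - x) * f'' w" using MVT2[OF z(1) d2] by blast
  have "(z - x) * (- L) \<le> (z - x) * f'' w" using L(2)[of w] z w by (intro mult_left_mono) auto
  moreover have "L * (z - x) \<le> L * (y - x)" using L(1) z by (intro mult_left_mono) auto
  ultimately have "f' x - L * (y - x) \<le> f' z" using w by (simp add: algebra_simps)
  then have "(y - x) * (f' x - L * (y - x)) \<le> (y - x) * f' z" using less by (intro mult_left_mono) auto
  then show ?thesis using z by (simp add: algebra_simps power2_eq_square)
next
  case greater
  obtain z where z: "y < z" "z < x" "f x - f y = (x - y) * f' z" using MVT2[OF greater d1] by blast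
  obtain w where w: "z < w" "w < x" "f' x - f' z = (x - z) * f'' w" using MVT2[OF z(2) d2] by blast
  have "(x - z) * (- L) \<le> (x - z) * f'' w" using L(2)[of w] z w by (intro mult_left_mono) auto
  moreover have "L * (x - z) \<le> L * (x - y)" using L(1) z by (intro mult_left_mono) auto
  ultimately have "f' z \<le> f' x + L * (x - y)" using w by (simp add: algebra_simps)
  then have "(x - y) * f' z \<le> (x - y) * (f' x + L * (x - y))" using greater by (intro mult_left_mono) auto
  then show ?thesis using z by (simp add: algebra_simps power2_eq_square)
qed simp

text \<open>Once continuously differentiable is the right class: one of the fields tested later is a
  cutoff of \<open>T x - x\<close> for a rearrangement \<open>T\<close> of which only a continuous
  first derivative is available. The derivative is carried as a second argument.\<close>

definition test_function :: "(real \<Rightarrow> real) \<Rightarrow> (real \<Rightarrow> real) \<Rightarrow> bool" where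
  "test_function \<xi> \<xi>' \<longleftrightarrow> (\<forall>x. (\<xi> has_real_derivative \<xi>' x) (at x)) \<and> continuous_on UNIV \<xi>' \<and>
     (\<exists>R. \<forall>x. R < \<bar>x\<bar> \<longrightarrow> \<xi> x = 0)"

lemma test_functionD:
  assumes "test_function \<xi> \<xi>'"
  obtains R B where "0 < R" "0 < B" "\<And>x. (\<xi> has_real_derivative \<xi>' x) (at x)"
    "continuous_on UNIV \<xi>" "continuous_on UNIV \<xi>'" "\<And>x. R < \<bar>x\<bar> \<Longrightarrow> \<xi> x = 0" "\<And>x. R < \<bar>x\<bar> \<Longrightarrow> \<xi>' x = 0"
    "\<And>x. \<bar>\<xi> x\<bar> \<le> B" "\<And>x. \<bar>\<xi>' x\<bar> \<le> B"
proof -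
  obtain R0 where d: "\<And>x. (\<xi> has_real_derivative \<xi>' x) (at x)" and c': "continuous_on UNIV \<xi>'"
    and R0: "\<And>x. R0 < \<bar>x\<bar> \<Longrightarrow> \<xi> x = 0" using assms unfolding test_function_def by auto
  define R where "R = max R0 1"
  have R: "0 < R" and z: "\<And>x. R < \<bar>x\<bar> \<Longrightarrow> \<xi> x = 0" using R0 unfolding R_def by auto
  have c: "continuous_on UNIV \<xi>" using d by (auto intro!: continuous_at_imp_continuous_on DERIV_isCont)
  have z': "\<xi>' x = 0" if x: "R < \<bar>x\<bar>" for x
  proof -
    have "open {x. R < \<bar>x\<bar>}" by (intro open_Collect_less continuous_intros)
    then have "((\<lambda>x. 0) has_real_derivative \<xi>' x) (at x)"
      by (rule has_field_derivative_transform_within_open[OF d]) (use x z in auto)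
    then show ?thesis using DERIV_unique DERIV_const by blast
  qed
  have "bounded (\<xi> ` {-R..R})" "bounded (\<xi>' ` {-R..R})"
    by (intro compact_imp_bounded compact_continuous_image continuous_on_subset[OF c] continuous_on_subset[OF c'], auto)+
  then obtain B1 B2 where "\<forall>x\<in>{-R..R}. \<bar>\<xi> x\<bar> \<le> B1" "\<forall>x\<in>{-R..R}. \<bar>\<xi>' x\<bar> \<le> B2"
    unfolding bounded_iff by auto
  then have B: "\<And>x. x \<in> {-R..R} \<Longrightarrow> \<bar>\<xi> x\<bar> \<le> B1" "\<And>x. x \<in> {-R..R} \<Longrightarrow> \<bar>\<xi>' x\<bar> \<le> B2"
    by blast+
  define B where "B = max 1 (max B1 B2)"
  have "\<bar>\<xi> x\<bar> \<le> B" "\<bar>\<xi>' x\<bar> \<le> B" for x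
  proof -
    have "\<bar>\<xi> x\<bar> \<le> B \<and> \<bar>\<xi>' x\<bar> \<le> B"
    proof (cases "R < \<bar>x\<bar>")
      case True
      then show ?thesis using z[of x] z'[of x] by (simp add: B_def)
    next
      case False
      then have "x \<in> {-R..R}" by auto
      then have "\<bar>\<xi> x\<bar> \<le> B1" "\<bar>\<xi>' x\<bar> \<le> B2" by (rule B)+
      then show ?thesis unfolding B_def by linarith
    qed
    then show "\<bar>\<xi> x\<bar> \<le> B" "\<bar>\<xi>' x\<bar> \<le> B" by auto
  qed
  moreover have "0 < B" unfolding B_def by simp
  ultimately show thesis using R d c c' z z' by (intro that[of R B])
qed

section \<open>Measures of finite energy for a semiconvex potential of superquadratic growth\<close>

locale confined_potential =
  fixes \<Psi> \<Psi>' \<Psi>'' :: "real \<Rightarrow> real" and J L K \<epsilon> :: real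
  assumes J_pos: "0 < J"
    and deriv1: "\<And>z. (\<Psi> has_real_derivative \<Psi>' z) (at z)"
    and deriv2: "\<And>z. (\<Psi>' has_real_derivative \<Psi>'' z) (at z)"
    and cont2: "continuous_on UNIV \<Psi>''"
    and L_nonneg: "0 \<le> L" and semiconvex: "\<And>z. - L \<le> \<Psi>'' z"
    and K_pos: "0 < K" and \<epsilon>_pos: "0 < \<epsilon>"
    and growth: "\<And>z. K * (\<bar>z\<bar> powr (2 + \<epsilon>) - 1) \<le> \<Psi> z"
begin

lemma continuous_potential: "continuous_on A \<Psi>" "continuous_on A \<Psi>'"
  using deriv1 deriv2 by (auto intro!: continuous_at_imp_continuous_on DERIV_isCont)

lemma measurable_potential [measurable]: "\<Psi> \<in> borel_measurable borel" "\<Psi>' \<in> borel_measurable borel"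
  using continuous_potential by (auto intro!: borel_measurable_continuous_onI)

lemma potential_lower: "- K \<le> \<Psi> z"
proof -
  have "K * (0 - 1) \<le> K * (\<bar>z\<bar> powr (2 + \<epsilon>) - 1)" using K_pos by (intro mult_left_mono) auto
  then show ?thesis using growth[of z] by simp
qed

text \<open>\<open>R\<close> is the crossover point beyond which the power dominates
  \<open>B * z\<^sup>2\<close>; inside, the constant \<open>B * R\<^sup>2\<close> suffices.\<close>

lemma square_le_powr:
  assumes "0 < \<delta>"
  shows "\<exists>C\<ge>0. \<forall>z::real. A * z\<^sup>2 \<le> \<delta> * \<bar>z\<bar> powr (2 + \<epsilon>) + C"
proof -
  define B where "B = max A 0"
  define R where "R = (B / \<delta>) powr (1 / \<epsilon>)"
  have B: "0 \<le> B" "A \<le> B" unfolding B_def by auto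
  have R: "0 \<le> R" unfolding R_def by simp
  have "A * z\<^sup>2 \<le> \<delta> * \<bar>z\<bar> powr (2 + \<epsilon>) + B * R\<^sup>2" for z :: real
  proof (cases "\<bar>z\<bar> \<le> R")
    case True
    have "A * z\<^sup>2 \<le> B * z\<^sup>2" using B by (intro mult_right_mono) auto
    also have "\<dots> \<le> B * R\<^sup>2"
      using True B R by (intro mult_left_mono) (metis abs_ge_zero power2_abs power_mono, simp)
    also have "\<dots> \<le> \<delta> * \<bar>z\<bar> powr (2 + \<epsilon>) + B * R\<^sup>2" using assms by simp
    finally show ?thesis .
  next
    case False
    then have z: "0 < \<bar>z\<bar>" using R by linarith
    have "B / \<delta> = R powr \<epsilon>"
      unfolding R_def using \<epsilon>_pos B assms by (simp add: powr_powr)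
    also have "\<dots> \<le> \<bar>z\<bar> powr \<epsilon>" using False R \<epsilon>_pos by (intro powr_mono2) auto
    finally have "B \<le> \<delta> * \<bar>z\<bar> powr \<epsilon>" using assms by (simp add: field_simps)
    then have "B * z\<^sup>2 \<le> (\<delta> * \<bar>z\<bar> powr \<epsilon>) * z\<^sup>2" by (intro mult_right_mono) auto
    also have "\<dots> = \<delta> * \<bar>z\<bar> powr (2 + \<epsilon>)"
    proof -
      have "z\<^sup>2 = \<bar>z\<bar> powr 2" using z by (simp add: powr_numeral)
      then show ?thesis by (simp add: powr_add)
    qed
    finally have "B * z\<^sup>2 \<le> \<delta> * \<bar>z\<bar> powr (2 + \<epsilon>)" .
    moreover have "A * z\<^sup>2 \<le> B * z\<^sup>2" using B by (intro mult_right_mono) auto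
    moreover have "0 \<le> B * R\<^sup>2" using B by simp
    ultimately show ?thesis by linarith
  qed
  moreover have "0 \<le> B * R\<^sup>2" using B by simp
  ultimately show ?thesis by blast
qed

abbreviation "FE \<equiv> free_energy \<Psi> J"

definition "gauss_const = (\<integral>z. exp (- (z::real)\<^sup>2 / 2 - 1) \<partial>lborel)"

text \<open>A measure of finite energy together with a chosen density. Entropy and potential energy
  are separately integrable, so the extended-real functional becomes an expression in real
  integrals.\<close>

definition energy_density :: "real measure \<Rightarrow> (real \<Rightarrow> real) \<Rightarrow> bool" where
  "energy_density \<nu> \<rho> \<longleftrightarrow> \<nu> \<in> P2 \<and> \<rho> \<in> borel_measurable borel \<and> (\<forall>x. 0 \<le> \<rho> x) \<and>
     \<nu> = density lborel (\<lambda>x. ennreal (\<rho> x)) \<and> integrable \<nu> (\<lambda>z. ln (\<rho> z)) \<and> integrable \<nu> \<Psi>"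

lemma energy_densityD:
  assumes "energy_density \<nu> \<rho>"
  shows "\<nu> \<in> P2" "\<rho> \<in> borel_measurable borel" "\<And>x. 0 \<le> \<rho> x"
    "\<nu> = density lborel (\<lambda>x. ennreal (\<rho> x))" "integrable \<nu> (\<lambda>z. ln (\<rho> z))" "integrable \<nu> \<Psi>"
  using assms unfolding energy_density_def by auto

lemma free_energy_eq:
  assumes "energy_density \<nu> \<rho>"
  shows "FE \<nu> = ereal ((\<integral>z. ln (\<rho> z) \<partial>\<nu>) + (\<integral>z. \<Psi> z \<partial>\<nu>) - J / 2 * (\<integral>z. z \<partial>\<nu>)\<^sup>2)"
  using energy_densityD[OF assms] P2D(2) by (intro free_energy_density_integrable) auto

lemma free_energy_finiteD:
  assumes \<nu>: "\<nu> \<in> P2" and fin: "FE \<nu> \<noteq> \<infinity>"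
  obtains \<rho> where "energy_density \<nu> \<rho>"
proof -
  interpret prob_space \<nu> using P2D(2)[OF \<nu>] .
  have ac: "absolutely_continuous lborel \<nu>" using fin unfolding free_energy_def by (auto split: if_splits)
  have sets: "sets \<nu> = sets lborel" using P2D(3)[OF \<nu>] by simp
  define \<rho> where "\<rho> x = enn2real (RN_deriv lborel \<nu> x)" for x
  have [measurable]: "\<rho> \<in> borel_measurable borel"
    unfolding \<rho>_def using borel_measurable_RN_deriv[of lborel \<nu>] by simp
  have \<rho>0: "0 \<le> \<rho> x" for x unfolding \<rho>_def by simp
  have "AE x in lborel. RN_deriv lborel \<nu> x \<noteq> \<infinity>"
    by (rule sigma_finite_measure.RN_deriv_finite[OF sigma_finite_lborel sigma_finite_measure_axioms ac sets])
  then have "AE x in lborel. ennreal (\<rho> x) = RN_deriv lborel \<nu> x"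
    by eventually_elim (auto simp: \<rho>_def less_top)
  then have "density lborel (\<lambda>x. ennreal (\<rho> x)) = density lborel (RN_deriv lborel \<nu>)"
    by (intro density_cong) auto
  also have "\<dots> = \<nu>" by (rule sigma_finite_measure.density_RN_deriv[OF sigma_finite_lborel ac sets])
  finally have dens: "\<nu> = density lborel (\<lambda>x. ennreal (\<rho> x))" by simp
  have [measurable]: "\<rho> \<in> borel_measurable \<nu>" "\<Psi> \<in> borel_measurable \<nu>"
    by (simp_all add: measurable_cong_sets[OF P2D(3)[OF \<nu>] refl])
  have F: "FE \<nu> = ext_integral \<nu> (\<lambda>z. ln (\<rho> z)) + ext_integral \<nu> \<Psi> - ereal (J / 2 * (\<integral>z. z \<partial>\<nu>)\<^sup>2)"
    by (rule free_energy_density[OF _ \<rho>0 dens prob_space_axioms]) measurable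
  have n1: "(\<integral>\<^sup>+x. ennreal (- ln (\<rho> x)) \<partial>\<nu>) < \<infinity>"
    unfolding infinity_ennreal_def
    by (rule le_less_trans[OF entropy_neg_part[OF _ \<rho>0 dens \<nu>] ennreal_less_top]) measurable
  have "(\<integral>\<^sup>+x. ennreal (- \<Psi> x) \<partial>\<nu>) \<le> (\<integral>\<^sup>+x. ennreal K \<partial>\<nu>)"
    using potential_lower by (intro nn_integral_mono ennreal_leI) (simp add: minus_le_iff)
  also have "\<dots> = ennreal K" by (simp add: emeasure_space_1)
  finally have n2: "(\<integral>\<^sup>+x. ennreal (- \<Psi> x) \<partial>\<nu>) < \<infinity>"
    unfolding infinity_ennreal_def by (rule le_less_trans[OF _ ennreal_less_top])
  have ml: "(\<lambda>z. ln (\<rho> z)) \<in> borel_measurable \<nu>" and mp: "\<Psi> \<in> borel_measurable \<nu>" by measurable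
  note fin' = fin[unfolded F]
  have "integrable \<nu> (\<lambda>z. ln (\<rho> z))" "integrable \<nu> \<Psi>"
    by (rule ext_integral_finiteD(1)[OF ml mp n1 n2 fin'], rule ext_integral_finiteD(2)[OF ml mp n1 n2 fin'])
  then show thesis using \<nu> \<rho>0 dens by (intro that[of \<rho>]) (auto simp: energy_density_def)
qed

text \<open>The entropy can be negative by at most half the second moment plus a constant, and the
  interaction costs at most \<open>J / 2\<close> times the second moment. Superquadratic growth lets
  one half of the potential energy absorb both, and the other half bounds the higher moment.\<close>

lemma moment_bound:
  obtains c1 c2 where "0 < c1"
    "\<And>\<nu> \<rho>. energy_density \<nu> \<rho> \<Longrightarrow> integrable \<nu> (\<lambda>z. \<bar>z\<bar> powr (2 + \<epsilon>)) \<and>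
       c1 * (\<integral>z. \<bar>z\<bar> powr (2 + \<epsilon>) \<partial>\<nu>) - c2 \<le> real_of_ereal (FE \<nu>)"
proof -
  obtain C where C: "C \<ge> 0" "\<And>z::real. (1 / 2 + J / 2) * z\<^sup>2 \<le> K / 2 * \<bar>z\<bar> powr (2 + \<epsilon>) + C"
    using square_le_powr[of "K / 2" "1 / 2 + J / 2"] K_pos by auto
  show thesis
  proof (rule that[of "K / 2" "gauss_const + C + K"])
    show "0 < K / 2" using K_pos by simp
    fix \<nu> \<rho> assume e: "energy_density \<nu> \<rho>"
    note D = energy_densityD[OF e]
    interpret prob_space \<nu> using P2D(2)[OF D(1)] .
    have [measurable_cong]: "sets \<nu> = sets borel" using P2D(3)[OF D(1)] .
    have "integrable \<nu> (\<lambda>z. (\<Psi> z + K) / K)" using D(6) by simp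
    then have ip: "integrable \<nu> (\<lambda>z. \<bar>z\<bar> powr (2 + \<epsilon>))"
    proof (rule Bochner_Integration.integrable_bound)
      show "AE z in \<nu>. norm (\<bar>z\<bar> powr (2 + \<epsilon>)) \<le> norm ((\<Psi> z + K) / K)"
      proof (rule AE_I2)
        fix z
        have "\<bar>z\<bar> powr (2 + \<epsilon>) \<le> (\<Psi> z + K) / K" using growth[of z] K_pos by (simp add: field_simps)
        also have "\<dots> \<le> \<bar>(\<Psi> z + K) / K\<bar>" by (rule abs_ge_self)
        finally show "norm (\<bar>z\<bar> powr (2 + \<epsilon>)) \<le> norm ((\<Psi> z + K) / K)" by simp
      qed
    qed simp
    have sq: "integrable \<nu> (\<lambda>z. z\<^sup>2)" using P2D(5)[OF D(1)] .
    have ent: "- (\<integral>z. z\<^sup>2 / 2 \<partial>\<nu>) - gauss_const \<le> (\<integral>z. ln (\<rho> z) \<partial>\<nu>)"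
    proof -
      obtain r q where rq: "0 \<le> r" "0 \<le> q" "(\<integral>\<^sup>+x. ennreal (- ln (\<rho> x)) \<partial>\<nu>) = ennreal q"
        "(\<integral>x. ln (\<rho> x) \<partial>\<nu>) = r - q"
        using integrableE[OF D(5)] by metis
      have "0 \<le> (\<integral>z. z\<^sup>2 / 2 \<partial>\<nu>) + gauss_const"
        unfolding gauss_const_def by (intro add_nonneg_nonneg integral_nonneg_AE) auto
      then have "q \<le> (\<integral>z. z\<^sup>2 / 2 \<partial>\<nu>) + gauss_const"
        using entropy_neg_part[OF D(2,3,4,1)] unfolding rq(3) gauss_const_def[symmetric] by (rule ennreal_le_iff[THEN iffD1])
      then show ?thesis using rq by simp
    qed
    have m: "(\<integral>z. z \<partial>\<nu>)\<^sup>2 \<le> (\<integral>z. z\<^sup>2 \<partial>\<nu>)"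
    proof -
      have "\<bar>\<integral>z. z \<partial>\<nu>\<bar> \<le> sqrt (\<integral>z. z\<^sup>2 \<partial>\<nu>)" using expectation_le_L2(2)[of "\<lambda>z. z"] sq by simp
      then have "\<bar>\<integral>z. z \<partial>\<nu>\<bar>\<^sup>2 \<le> (sqrt (\<integral>z. z\<^sup>2 \<partial>\<nu>))\<^sup>2" by (intro power_mono) auto
      then show ?thesis by simp
    qed
    have "K * (\<integral>z. \<bar>z\<bar> powr (2 + \<epsilon>) \<partial>\<nu>) - K = (\<integral>z. K * (\<bar>z\<bar> powr (2 + \<epsilon>) - 1) \<partial>\<nu>)"
      using ip by (simp add: prob_space right_diff_distrib)
    also have "\<dots> \<le> (\<integral>z. \<Psi> z \<partial>\<nu>)" using growth ip D(6) by (intro integral_mono) auto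
    finally have p: "K * (\<integral>z. \<bar>z\<bar> powr (2 + \<epsilon>) \<partial>\<nu>) - K \<le> (\<integral>z. \<Psi> z \<partial>\<nu>)" .
    have "(1 / 2 + J / 2) * (\<integral>z. z\<^sup>2 \<partial>\<nu>) = (\<integral>z. (1 / 2 + J / 2) * z\<^sup>2 \<partial>\<nu>)" by simp
    also have "\<dots> \<le> (\<integral>z. K / 2 * \<bar>z\<bar> powr (2 + \<epsilon>) + C \<partial>\<nu>)"
      using C(2) ip sq by (intro integral_mono) auto
    also have "\<dots> = K / 2 * (\<integral>z. \<bar>z\<bar> powr (2 + \<epsilon>) \<partial>\<nu>) + C" using ip by (simp add: prob_space)
    finally have q: "(\<integral>z. z\<^sup>2 \<partial>\<nu>) / 2 + J / 2 * (\<integral>z. z\<^sup>2 \<partial>\<nu>) \<le> K / 2 * (\<integral>z. \<bar>z\<bar> powr (2 + \<epsilon>) \<partial>\<nu>) + C"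
      by (simp add: algebra_simps)
    have "J / 2 * (\<integral>z. z \<partial>\<nu>)\<^sup>2 \<le> J / 2 * (\<integral>z. z\<^sup>2 \<partial>\<nu>)" using m J_pos by (intro mult_left_mono) auto
    with ent p q have "K / 2 * (\<integral>z. \<bar>z\<bar> powr (2 + \<epsilon>) \<partial>\<nu>) - (gauss_const + C + K)
        \<le> (\<integral>z. ln (\<rho> z) \<partial>\<nu>) + (\<integral>z. \<Psi> z \<partial>\<nu>) - J / 2 * (\<integral>z. z \<partial>\<nu>)\<^sup>2"
      by simp
    then show "integrable \<nu> (\<lambda>z. \<bar>z\<bar> powr (2 + \<epsilon>)) \<and>
       K / 2 * (\<integral>z. \<bar>z\<bar> powr (2 + \<epsilon>) \<partial>\<nu>) - (gauss_const + C + K) \<le> real_of_ereal (FE \<nu>)"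
      using ip free_energy_eq[OF e] by simp
  qed
qed

section \<open>The slope bounds the first variation\<close>

text \<open>The pushed density at \<open>T x\<close> is \<open>\<rho> x / T' x\<close>, which splits
  its logarithm; the two-sided bounds on \<open>T'\<close> keep \<open>ln (T' x)\<close> bounded and
  hence integrable.\<close>

lemma free_energy_diffeo:
  fixes T T' S :: "real \<Rightarrow> real"
  assumes e: "energy_density \<nu> \<rho>"
    and dT: "\<And>x. (T has_real_derivative T' x) (at x)"
    and cont: "continuous_on UNIV T'" and inv: "\<And>x. S (T x) = x" "\<And>y. T (S y) = y"
    and T': "\<And>x. 1 / 2 \<le> T' x" "\<And>x. T' x \<le> 2"
    and sq: "integrable \<nu> (\<lambda>x. (T x)\<^sup>2)" and pot: "integrable \<nu> (\<lambda>x. \<Psi> (T x))"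
  shows "distr \<nu> borel T \<in> P2"
    and "FE (distr \<nu> borel T) = ereal ((\<integral>x. ln (\<rho> x) \<partial>\<nu>) - (\<integral>x. ln (T' x) \<partial>\<nu>)
      + (\<integral>x. \<Psi> (T x) \<partial>\<nu>) - J / 2 * (\<integral>x. T x \<partial>\<nu>)\<^sup>2)"
    and "integrable \<nu> (\<lambda>x. ln (T' x))"
proof -
  note D = energy_densityD[OF e]
  interpret prob_space \<nu> using P2D(2)[OF D(1)] .
  have [measurable_cong]: "sets \<nu> = sets borel" using P2D(3)[OF D(1)] .
  have pos: "0 < T' x" for x using T'(1)[of x] by linarith
  have [measurable]: "T' \<in> borel_measurable borel" using cont by (rule borel_measurable_continuous_onI)
  have "continuous_on UNIV T" using dT by (auto intro!: continuous_at_imp_continuous_on DERIV_isCont)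
  then have [measurable]: "T \<in> borel_measurable borel" by (rule borel_measurable_continuous_onI)
  note [measurable] = lborel_eq_distr_inverse(1)[OF dT pos cont inv] D(2)
  let ?\<nu> = "distr \<nu> borel T" and ?\<rho> = "\<lambda>y. \<rho> (S y) / T' (S y)"
  show P: "?\<nu> \<in> P2"
    by (rule P2I) (use sq in \<open>auto intro!: prob_space_distr simp: integrable_distr_eq\<close>)
  have dens: "?\<nu> = density lborel (\<lambda>y. ennreal (?\<rho> y))"
    by (subst D(4), rule distr_density_diffeo[OF dT pos cont inv D(2,3)])
  have lnT': "\<bar>ln (T' x)\<bar> \<le> ln 2" for x
  proof -
    have "ln (1 / 2) \<le> ln (T' x)" "ln (T' x) \<le> ln 2" using T'[of x] pos[of x] by (auto intro: ln_mono)
    then show ?thesis by (simp add: ln_div abs_le_iff)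
  qed
  show iT': "integrable \<nu> (\<lambda>x. ln (T' x))"
    by (rule integrable_const_bound[of _ "ln 2"]) (use lnT' in auto)
  have "AE x in lborel. 0 < ennreal (\<rho> x) \<longrightarrow> 0 < \<rho> x" by simp
  then have \<rho>pos: "AE x in \<nu>. 0 < \<rho> x"
    by (subst D(4), subst AE_density) auto
  have ae: "AE x in \<nu>. ln (\<rho> x) - ln (T' x) = ln (?\<rho> (T x))"
    using \<rho>pos by eventually_elim (simp add: inv ln_div pos less_imp_neq[OF pos, symmetric])
  have "integrable \<nu> (\<lambda>x. ln (\<rho> x) - ln (T' x))" using D(5) iT' by simp
  then have i: "integrable \<nu> (\<lambda>x. ln (?\<rho> (T x)))"
    by (rule integrable_cong_AE_imp) (use ae in auto)
  have "integrable ?\<nu> (\<lambda>y. ln (?\<rho> y))" "integrable ?\<nu> \<Psi>"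
    using i pot by (simp_all add: integrable_distr_eq)
  then have "energy_density ?\<nu> ?\<rho>"
    unfolding energy_density_def using P dens D(3) pos by (simp add: less_imp_le)
  from free_energy_eq[OF this]
  have F: "FE ?\<nu> = ereal ((\<integral>x. ln (?\<rho> (T x)) \<partial>\<nu>) + (\<integral>x. \<Psi> (T x) \<partial>\<nu>) - J / 2 * (\<integral>x. T x \<partial>\<nu>)\<^sup>2)"
    by (simp add: integral_distr)
  have "(\<integral>x. ln (?\<rho> (T x)) \<partial>\<nu>) = (\<integral>x. ln (\<rho> x) - ln (T' x) \<partial>\<nu>)"
    by (rule integral_cong_AE) (use ae in auto)
  also have "\<dots> = (\<integral>x. ln (\<rho> x) \<partial>\<nu>) - (\<integral>x. ln (T' x) \<partial>\<nu>)" using D(5) iT' by simp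
  finally show "FE ?\<nu> = ereal ((\<integral>x. ln (\<rho> x) \<partial>\<nu>) - (\<integral>x. ln (T' x) \<partial>\<nu>)
      + (\<integral>x. \<Psi> (T x) \<partial>\<nu>) - J / 2 * (\<integral>x. T x \<partial>\<nu>)\<^sup>2)" using F by simp
qed

text \<open>The sign is that of a decrease: this is the initial rate at which the energy falls when
  mass is moved along \<open>\<xi>\<close>.\<close>

definition first_variation :: "real measure \<Rightarrow> (real \<Rightarrow> real) \<Rightarrow> (real \<Rightarrow> real) \<Rightarrow> real" where
  "first_variation \<nu> \<xi> \<xi>' = (\<integral>x. \<xi>' x - (\<Psi>' x - J * (\<integral>y. y \<partial>\<nu>)) * \<xi> x \<partial>\<nu>)"

text \<open>First order expansion of the energy with a quadratic error. A one-sided estimate is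
  enough to bound the slope from below, and the square produced by the interaction term has the
  favourable sign.\<close>

lemma perturbation:
  assumes e: "energy_density \<nu> \<rho>" and \<xi>: "test_function \<xi> \<xi>'"
  shows "\<exists>\<tau>0 C. 0 < \<tau>0 \<and> 0 \<le> C \<and> (\<forall>\<tau>. 0 < \<tau> \<and> \<tau> < \<tau>0 \<longrightarrow>
     distr \<nu> borel (\<lambda>x. x + \<tau> * \<xi> x) \<in> P2 \<and> \<bar>FE (distr \<nu> borel (\<lambda>x. x + \<tau> * \<xi> x))\<bar> \<noteq> \<infinity> \<and>
     W2 \<nu> (distr \<nu> borel (\<lambda>x. x + \<tau> * \<xi> x)) \<le> \<tau> * sqrt (\<integral>x. (\<xi> x)\<^sup>2 \<partial>\<nu>) \<and>
     \<tau> * first_variation \<nu> \<xi> \<xi>' - C * \<tau>\<^sup>2 \<le>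
       real_of_ereal (FE \<nu>) - real_of_ereal (FE (distr \<nu> borel (\<lambda>x. x + \<tau> * \<xi> x))))"
proof -
  note D = energy_densityD[OF e]
  interpret prob_space \<nu> using P2D(2)[OF D(1)] .
  have [measurable_cong]: "sets \<nu> = sets borel" using P2D(3)[OF D(1)] .
  obtain R B where RB: "0 < R" "0 < B" "\<And>x. (\<xi> has_real_derivative \<xi>' x) (at x)"
    "continuous_on UNIV \<xi>" "continuous_on UNIV \<xi>'" "\<And>x. R < \<bar>x\<bar> \<Longrightarrow> \<xi> x = 0" "\<And>x. R < \<bar>x\<bar> \<Longrightarrow> \<xi>' x = 0"
    "\<And>x. \<bar>\<xi> x\<bar> \<le> B" "\<And>x. \<bar>\<xi>' x\<bar> \<le> B" by (rule test_functionD[OF \<xi>]) blast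
  have [measurable]: "\<xi> \<in> borel_measurable borel" "\<xi>' \<in> borel_measurable borel"
    using RB(4,5) by (auto intro: borel_measurable_continuous_onI)
  have "bounded (\<Psi>'' ` {- R - 1..R + 1})" "bounded (\<Psi>' ` {- R..R})"
    using cont2 continuous_potential(2)[of UNIV]
    by (intro compact_imp_bounded compact_continuous_image; auto intro: continuous_on_subset)+
  then obtain G G' where "\<forall>x\<in>{- R - 1..R + 1}. \<bar>\<Psi>'' x\<bar> \<le> G" and "\<forall>x\<in>{- R..R}. \<bar>\<Psi>' x\<bar> \<le> G'"
    unfolding bounded_iff by auto
  then have G0: "\<And>x. x \<in> {- R - 1..R + 1} \<Longrightarrow> \<bar>\<Psi>'' x\<bar> \<le> G" and G': "\<And>x. x \<in> {- R..R} \<Longrightarrow> \<bar>\<Psi>' x\<bar> \<le> G'"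
    by blast+
  have Gp: "0 \<le> G" using G0[of 0] RB(1) by auto
  \<comment> \<open>Ensures \<open>\<tau> * B \<le> 1 / 2\<close>: the map is then increasing with
    derivative in \<open>{1 / 2..2}\<close> and moves points by at most \<open>1 / 2\<close>, so
    \<open>G\<close> bounds \<open>\<Psi>''\<close> along every displacement that starts in
    \<open>{- R..R}\<close>.\<close>
  define \<tau>0 where "\<tau>0 = 1 / (2 * B + 1)"
  have \<tau>0: "0 < \<tau>0" unfolding \<tau>0_def using RB by simp
  \<comment> \<open>\<open>2 * B\<^sup>2\<close> comes from the expansion of
    \<open>ln (1 + \<tau> * \<xi>' x)\<close>, \<open>G * B\<^sup>2\<close> from that of the
    potential.\<close>
  define C where "C = 2 * B\<^sup>2 + G * B\<^sup>2"
  let ?m = "\<integral>y. y \<partial>\<nu>"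
  have i\<xi>: "integrable \<nu> \<xi>" "integrable \<nu> \<xi>'" "integrable \<nu> (\<lambda>x. (\<xi> x)\<^sup>2)"
  proof -
    show "integrable \<nu> \<xi>" by (rule integrable_const_bound[of _ B]) (use RB in auto)
    show "integrable \<nu> \<xi>'" by (rule integrable_const_bound[of _ B]) (use RB in auto)
    show "integrable \<nu> (\<lambda>x. (\<xi> x)\<^sup>2)"
    proof (rule integrable_const_bound[of _ "B\<^sup>2"])
      show "AE x in \<nu>. norm ((\<xi> x)\<^sup>2) \<le> B\<^sup>2"
        using power_mono[OF RB(8), of _ 2] by (auto simp: power2_abs)
    qed simp
  qed
  have i\<Psi>: "integrable \<nu> (\<lambda>x. \<Psi>' x * \<xi> x)"
  proof (rule integrable_const_bound[of _ "\<bar>G'\<bar> * B"])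
    show "AE x in \<nu>. norm (\<Psi>' x * \<xi> x) \<le> \<bar>G'\<bar> * B"
    proof (rule AE_I2)
      fix x
      show "norm (\<Psi>' x * \<xi> x) \<le> \<bar>G'\<bar> * B"
      proof (cases "R < \<bar>x\<bar>")
        case True then show ?thesis using RB by simp
      next
        case False
        then have "\<bar>\<Psi>' x\<bar> \<le> G'" by (intro G') auto
        then have "\<bar>\<Psi>' x\<bar> \<le> \<bar>G'\<bar>" by linarith
        then show ?thesis using RB(8)[of x] RB(2) by (auto simp: abs_mult intro: mult_mono)
      qed
    qed
  qed simp
  have fv: "first_variation \<nu> \<xi> \<xi>' = (\<integral>x. \<xi>' x \<partial>\<nu>) - (\<integral>x. \<Psi>' x * \<xi> x \<partial>\<nu>) + J * ?m * (\<integral>x. \<xi> x \<partial>\<nu>)"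
    unfolding first_variation_def using i\<xi> i\<Psi> by (simp add: left_diff_distrib)
  show ?thesis
  proof (rule exI[of _ \<tau>0], rule exI[of _ C], intro conjI allI impI \<tau>0)
    show "0 \<le> C" unfolding C_def using Gp by simp
    fix \<tau> assume "0 < \<tau> \<and> \<tau> < \<tau>0"
    then have \<tau>: "0 < \<tau>" "\<tau> < \<tau>0" by auto
    have \<tau>B: "\<tau> * B \<le> 1 / 2" "\<tau> * B \<le> 1"
    proof -
      have "\<tau> * B \<le> \<tau>0 * B" using \<tau> RB(2) by (intro mult_right_mono) auto
      also have "\<dots> \<le> 1 / 2" unfolding \<tau>0_def using RB(2) by (simp add: field_simps)
      finally show "\<tau> * B \<le> 1 / 2" "\<tau> * B \<le> 1" by auto
    qed
    have small: "\<bar>\<tau> * \<xi> x\<bar> \<le> 1 / 2" "\<bar>\<tau> * \<xi>' x\<bar> \<le> 1 / 2" "\<bar>\<tau> * \<xi> x\<bar> \<le> \<tau> * B" "\<bar>\<tau> * \<xi>' x\<bar> \<le> \<tau> * B" for x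
    proof -
      show 1: "\<bar>\<tau> * \<xi> x\<bar> \<le> \<tau> * B" "\<bar>\<tau> * \<xi>' x\<bar> \<le> \<tau> * B"
        using \<tau> RB(8,9)[of x] by (auto simp: abs_mult)
      show "\<bar>\<tau> * \<xi> x\<bar> \<le> 1 / 2" "\<bar>\<tau> * \<xi>' x\<bar> \<le> 1 / 2" using 1 \<tau>B by linarith+
    qed
    define T where "T x = x + \<tau> * \<xi> x" for x
    define T' where "T' x = 1 + \<tau> * \<xi>' x" for x
    have dT: "(T has_real_derivative T' x) (at x)" for x
      unfolding T_def T'_def by (auto intro!: derivative_eq_intros RB(3))
    have cT': "continuous_on UNIV T'" unfolding T'_def by (intro continuous_intros RB(5))
    have T': "1 / 2 \<le> T' x" "T' x \<le> 2" for x using small(2)[of x] unfolding T'_def by (auto simp: abs_le_iff)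
    have Tmono: "T x < T y" if "x < y" for x y
      using that by (rule DERIV_pos_imp_increasing) (metis dT T'(1) less_le_trans half_gt_zero zero_less_one)
    have cT: "continuous_on A T" for A using dT by (auto intro!: continuous_at_imp_continuous_on DERIV_isCont)
    have surj: "\<exists>x. T x = y" for y
    proof -
      have "T (y - 1) \<le> y" "y \<le> T (y + 1)" using small(1)[of "y - 1"] small(1)[of "y + 1"] unfolding T_def by auto
      then show ?thesis using IVT'[of T "y - 1" y "y + 1"] cT by auto
    qed
    define S where "S y = (THE x. T x = y)" for y
    have inv: "S (T x) = x" "T (S y) = y" for x y
    proof -
      have uniq: "x = x'" if "T x = T x'" for x x' using Tmono[of x x'] Tmono[of x' x] that by (cases x x' rule: linorder_cases) auto
      show "S (T x) = x" unfolding S_def using uniq by blast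
      obtain x where "T x = y" using surj by blast
      then show "T (S y) = y" unfolding S_def using uniq by (metis (mono_tags, lifting) the_equality)
    qed
    have [measurable]: "T \<in> borel_measurable borel" using cT by (rule borel_measurable_continuous_onI)
    have sq: "integrable \<nu> (\<lambda>x. (T x)\<^sup>2)"
      unfolding T_def using P2D(5)[OF D(1)] i\<xi>(3)
      by (intro integrable_add_L2) (auto simp: power_mult_distrib)
    have up: "\<Psi> (T x) \<le> \<Psi> x + \<tau> * (\<Psi>' x * \<xi> x) + G * B\<^sup>2 * \<tau>\<^sup>2" for x
    proof (cases "R < \<bar>x\<bar>")
      case True
      then show ?thesis using RB(6) Gp by (simp add: T_def)
    next
      case False
      \<comment> \<open>An upper Taylor bound for \<open>\<Psi>\<close> is a lower one for
        \<open>- \<Psi>\<close>.\<close>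
      have "- \<Psi> x + - \<Psi>' x * (T x - x) - G * (T x - x)\<^sup>2 \<le> - \<Psi> (T x)"
      proof (rule taylor_lower[of "\<lambda>x. - \<Psi> x" "\<lambda>x. - \<Psi>' x" "\<lambda>x. - \<Psi>'' x"])
        fix z assume "min x (T x) \<le> z" "z \<le> max x (T x)"
        then have "z \<in> {- R - 1..R + 1}" using small(1)[of x] False by (auto simp: T_def)
        then show "- G \<le> - \<Psi>'' z" using G0[of z] by auto
      qed (auto intro!: derivative_eq_intros deriv1 deriv2 Gp)
      moreover have "G * (T x - x)\<^sup>2 \<le> G * (\<tau> * B)\<^sup>2"
        using power_mono[OF small(3)[of x], of 2] Gp by (intro mult_left_mono) (auto simp: T_def)
      ultimately show ?thesis by (simp add: T_def power_mult_distrib algebra_simps)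
    qed
    have lowT: "- (K) \<le> \<Psi> (T x)" for x by (rule potential_lower)
    have pot: "integrable \<nu> (\<lambda>x. \<Psi> (T x))"
    proof (rule Bochner_Integration.integrable_bound)
      show "integrable \<nu> (\<lambda>x. \<bar>\<Psi> x\<bar> + \<tau> * \<bar>\<Psi>' x * \<xi> x\<bar> + G * B\<^sup>2 * \<tau>\<^sup>2 + K)" using D(6) i\<Psi> by simp
      show "AE x in \<nu>. norm (\<Psi> (T x)) \<le> norm (\<bar>\<Psi> x\<bar> + \<tau> * \<bar>\<Psi>' x * \<xi> x\<bar> + G * B\<^sup>2 * \<tau>\<^sup>2 + K)"
      proof (rule AE_I2)
        fix x
        have n: "0 \<le> G * B\<^sup>2 * \<tau>\<^sup>2" "0 \<le> \<tau> * \<bar>\<Psi>' x * \<xi> x\<bar>" using Gp \<tau> by auto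
        have "\<tau> * (\<Psi>' x * \<xi> x) \<le> \<tau> * \<bar>\<Psi>' x * \<xi> x\<bar>" using \<tau> by (intro mult_left_mono) auto
        then show "norm (\<Psi> (T x)) \<le> norm (\<bar>\<Psi> x\<bar> + \<tau> * \<bar>\<Psi>' x * \<xi> x\<bar> + G * B\<^sup>2 * \<tau>\<^sup>2 + K)"
          using up[of x] lowT[of x] n K_pos unfolding real_norm_def by linarith
      qed
    qed simp
    note FT = free_energy_diffeo[OF e dT cT' inv T' sq pot]
    have Teq: "(\<lambda>x. x + \<tau> * \<xi> x) = T" unfolding T_def by auto
    show "distr \<nu> borel (\<lambda>x. x + \<tau> * \<xi> x) \<in> P2" "\<bar>FE (distr \<nu> borel (\<lambda>x. x + \<tau> * \<xi> x))\<bar> \<noteq> \<infinity>"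
      unfolding Teq using FT by auto
    have "W2 \<nu> (distr \<nu> borel T) \<le> sqrt (\<integral>x. (x - T x)\<^sup>2 \<partial>\<nu>)"
      by (rule W2_le_coupling[OF D(1) FT(1) prob_space_axioms]) (auto simp: distr_id2[OF P2D(3)[OF D(1), symmetric]])
    also have "(\<integral>x. (x - T x)\<^sup>2 \<partial>\<nu>) = \<tau>\<^sup>2 * (\<integral>x. (\<xi> x)\<^sup>2 \<partial>\<nu>)"
      unfolding T_def by (simp add: power_mult_distrib)
    finally show "W2 \<nu> (distr \<nu> borel (\<lambda>x. x + \<tau> * \<xi> x)) \<le> \<tau> * sqrt (\<integral>x. (\<xi> x)\<^sup>2 \<partial>\<nu>)"
      unfolding Teq using \<tau> by (simp add: real_sqrt_mult)
    have 1: "\<tau> * (\<integral>x. \<xi>' x \<partial>\<nu>) - 2 * B\<^sup>2 * \<tau>\<^sup>2 \<le> (\<integral>x. ln (T' x) \<partial>\<nu>)"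
    proof -
      have "\<tau> * (\<integral>x. \<xi>' x \<partial>\<nu>) - 2 * B\<^sup>2 * \<tau>\<^sup>2 = (\<integral>x. \<tau> * \<xi>' x - 2 * B\<^sup>2 * \<tau>\<^sup>2 \<partial>\<nu>)"
        using i\<xi> by (simp add: prob_space)
      also have "\<dots> \<le> (\<integral>x. ln (T' x) \<partial>\<nu>)"
      proof (rule integral_mono)
        fix x
        have "\<bar>ln (1 + \<tau> * \<xi>' x) - \<tau> * \<xi>' x\<bar> \<le> 2 * (\<tau> * \<xi>' x)\<^sup>2"
          by (rule abs_ln_one_plus_x_minus_x_bound) (rule small)
        moreover have "(\<tau> * \<xi>' x)\<^sup>2 \<le> (\<tau> * B)\<^sup>2" using power_mono[OF small(4)[of x], of 2] by simp
        ultimately show "\<tau> * \<xi>' x - 2 * B\<^sup>2 * \<tau>\<^sup>2 \<le> ln (T' x)"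
          unfolding T'_def by (simp add: power_mult_distrib abs_le_iff algebra_simps)
      qed (use i\<xi> FT(3) in auto)
      finally show ?thesis .
    qed
    have 2: "(\<integral>x. \<Psi> (T x) \<partial>\<nu>) \<le> (\<integral>x. \<Psi> x \<partial>\<nu>) + \<tau> * (\<integral>x. \<Psi>' x * \<xi> x \<partial>\<nu>) + G * B\<^sup>2 * \<tau>\<^sup>2"
    proof -
      have "(\<integral>x. \<Psi> (T x) \<partial>\<nu>) \<le> (\<integral>x. \<Psi> x + \<tau> * (\<Psi>' x * \<xi> x) + G * B\<^sup>2 * \<tau>\<^sup>2 \<partial>\<nu>)"
        by (rule integral_mono) (use up pot D(6) i\<Psi> in auto)
      also have "\<dots> = (\<integral>x. \<Psi> x \<partial>\<nu>) + \<tau> * (\<integral>x. \<Psi>' x * \<xi> x \<partial>\<nu>) + G * B\<^sup>2 * \<tau>\<^sup>2"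
        using D(6) i\<Psi> by (simp add: prob_space)
      finally show ?thesis .
    qed
    have mT: "(\<integral>x. T x \<partial>\<nu>) = ?m + \<tau> * (\<integral>x. \<xi> x \<partial>\<nu>)"
      unfolding T_def using P2D(6)[OF D(1)] i\<xi> by simp
    have 3: "J / 2 * ?m\<^sup>2 + \<tau> * (J * ?m * (\<integral>x. \<xi> x \<partial>\<nu>)) \<le> J / 2 * (\<integral>x. T x \<partial>\<nu>)\<^sup>2"
    proof -
      have "J / 2 * (\<integral>x. T x \<partial>\<nu>)\<^sup>2 = J / 2 * ?m\<^sup>2 + \<tau> * (J * ?m * (\<integral>x. \<xi> x \<partial>\<nu>)) + J / 2 * (\<tau> * (\<integral>x. \<xi> x \<partial>\<nu>))\<^sup>2"
        unfolding mT by (simp add: power2_eq_square algebra_simps)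
      moreover have "0 \<le> J / 2 * (\<tau> * (\<integral>x. \<xi> x \<partial>\<nu>))\<^sup>2" using J_pos by simp
      ultimately show ?thesis by linarith
    qed
    have "real_of_ereal (FE \<nu>) - real_of_ereal (FE (distr \<nu> borel T))
        = (\<integral>x. ln (T' x) \<partial>\<nu>) + (\<integral>x. \<Psi> x \<partial>\<nu>) - (\<integral>x. \<Psi> (T x) \<partial>\<nu>) + J / 2 * (\<integral>x. T x \<partial>\<nu>)\<^sup>2 - J / 2 * ?m\<^sup>2"
      unfolding free_energy_eq[OF e] FT(2) by simp
    also have "\<dots> \<ge> \<tau> * first_variation \<nu> \<xi> \<xi>' - C * \<tau>\<^sup>2"
      using 1 2 3 unfolding fv C_def by (simp add: algebra_simps)
    finally show "\<tau> * first_variation \<nu> \<xi> \<xi>' - C * \<tau>\<^sup>2 \<le>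
       real_of_ereal (FE \<nu>) - real_of_ereal (FE (distr \<nu> borel (\<lambda>x. x + \<tau> * \<xi> x)))"
      unfolding Teq .
  qed
qed

text \<open>Along the perturbations the difference quotients are at least
  \<open>(D - C * \<tau>) / N\<close>. The slope is a limsup over punctured neighbourhoods, so the
  perturbed measures have to differ from \<open>\<nu>\<close>; this follows from the strict drop of
  the energy.\<close>

theorem first_variation_le_slope:
  assumes e: "energy_density \<nu> \<rho>" and \<xi>: "test_function \<xi> \<xi>'"
    and slope: "metric_slope FE \<nu> \<le> ereal \<kappa>" and \<kappa>: "0 \<le> \<kappa>"
  shows "first_variation \<nu> \<xi> \<xi>' \<le> \<kappa> * sqrt (\<integral>x. (\<xi> x)\<^sup>2 \<partial>\<nu>)"
proof (cases "first_variation \<nu> \<xi> \<xi>' \<le> 0")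
  case True
  moreover have "0 \<le> \<kappa> * sqrt (\<integral>x. (\<xi> x)\<^sup>2 \<partial>\<nu>)" using \<kappa> by simp
  ultimately show ?thesis by linarith
next
  case False
  note D = energy_densityD[OF e]
  define D where "D = first_variation \<nu> \<xi> \<xi>'"
  define N where "N = sqrt (\<integral>x. (\<xi> x)\<^sup>2 \<partial>\<nu>)"
  define V where "V \<tau> = distr \<nu> borel (\<lambda>x. x + \<tau> * \<xi> x)" for \<tau>
  have Dpos: "0 < D" using False unfolding D_def by simp
  obtain \<tau>0 C where \<tau>0: "0 < \<tau>0" and C: "0 \<le> C"
    and V': "\<forall>\<tau>. 0 < \<tau> \<and> \<tau> < \<tau>0 \<longrightarrow> V \<tau> \<in> P2 \<and> \<bar>FE (V \<tau>)\<bar> \<noteq> \<infinity> \<and> W2 \<nu> (V \<tau>) \<le> \<tau> * N \<and>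
       \<tau> * D - C * \<tau>\<^sup>2 \<le> real_of_ereal (FE \<nu>) - real_of_ereal (FE (V \<tau>))"
    using perturbation[OF e \<xi>, folded D_def N_def V_def] by (elim exE conjE) rule
  have V: "\<And>\<tau>. 0 < \<tau> \<Longrightarrow> \<tau> < \<tau>0 \<Longrightarrow> V \<tau> \<in> P2 \<and> \<bar>FE (V \<tau>)\<bar> \<noteq> \<infinity> \<and> W2 \<nu> (V \<tau>) \<le> \<tau> * N \<and>
       \<tau> * D - C * \<tau>\<^sup>2 \<le> real_of_ereal (FE \<nu>) - real_of_ereal (FE (V \<tau>))"
    using V' by simp
  \<comment> \<open>Below \<open>\<tau>1\<close> the linear gain exceeds the quadratic
    error.\<close>
  define \<tau>1 where "\<tau>1 = min \<tau>0 (D / (C + 1))"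
  have \<tau>1: "0 < \<tau>1" "\<tau>1 \<le> \<tau>0" "\<tau>1 \<le> D / (C + 1)" unfolding \<tau>1_def using \<tau>0 C Dpos by auto
  have gain: "0 < D - C * \<tau>" if \<tau>: "0 < \<tau>" "\<tau> < \<tau>1" for \<tau>
  proof -
    have "\<tau> * (C + 1) < D" using \<tau> \<tau>1 C by (simp add: pos_less_divide_eq[symmetric])
    then show ?thesis using \<tau> by (simp add: algebra_simps)
  qed
  have Wpos: "0 < W2 \<nu> (V \<tau>)" if \<tau>: "0 < \<tau>" "\<tau> < \<tau>1" for \<tau>
  proof -
    have v: "V \<tau> \<in> P2" "\<tau> * D - C * \<tau>\<^sup>2 \<le> real_of_ereal (FE \<nu>) - real_of_ereal (FE (V \<tau>))"
      using V[of \<tau>] \<tau> \<tau>1 by auto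
    have "0 < \<tau> * (D - C * \<tau>)" using gain[OF \<tau>] \<tau> by simp
    then have "FE \<nu> \<noteq> FE (V \<tau>)" using v(2) by (auto simp: power2_eq_square algebra_simps)
    then have "W2 \<nu> (V \<tau>) \<noteq> 0" using W2_eq_0D[OF D(1) v(1)] by auto
    then show ?thesis using W2_nonneg[OF D(1) v(1)] by simp
  qed
  \<comment> \<open>A positive distance that is at most a multiple of \<open>N\<close> rules out
    \<open>N = 0\<close>.\<close>
  have Npos: "0 < N"
  proof -
    have "0 < W2 \<nu> (V (\<tau>1 / 2))" using \<tau>1 by (intro Wpos) auto
    also have "\<dots> \<le> \<tau>1 / 2 * N" using V[of "\<tau>1 / 2"] \<tau>1 by auto
    finally show ?thesis using \<tau>1 by (simp add: zero_less_mult_iff)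
  qed
  let ?g = "\<lambda>\<nu>'. max 0 ((FE \<nu> - FE \<nu>') / ereal (W2 \<nu> \<nu>'))"
  have quot: "ereal ((D - C * \<tau>) / N) \<le> ?g (V \<tau>)" if \<tau>: "0 < \<tau>" "\<tau> < \<tau>1" for \<tau>
  proof -
    obtain r where r: "FE \<nu> = ereal r" using free_energy_eq[OF e] by auto
    obtain r' where r': "FE (V \<tau>) = ereal r'" using V[of \<tau>] \<tau> \<tau>1 by (cases "FE (V \<tau>)") auto
    have v: "W2 \<nu> (V \<tau>) \<le> \<tau> * N" "\<tau> * (D - C * \<tau>) \<le> r - r'"
      using V[of \<tau>] \<tau> \<tau>1 r r' by (auto simp: power2_eq_square algebra_simps)
    have g: "0 < \<tau> * (D - C * \<tau>)" using gain[OF \<tau>] \<tau> by simp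
    have "(D - C * \<tau>) / N = (\<tau> * (D - C * \<tau>)) / (\<tau> * N)" using \<tau> by simp
    also have "\<dots> \<le> (r - r') / W2 \<nu> (V \<tau>)"
      using v g Wpos[OF \<tau>] by (intro frac_le) linarith+
    finally show ?thesis using r r' Wpos[OF \<tau>] by (simp add: max_def)
  qed
  have lim: "filterlim V (at_W2 \<nu>) (at_right 0)"
    unfolding filterlim_iff at_W2_def
  proof (intro allI impI)
    fix P assume "eventually P (inf (filtercomap (W2 \<nu>) (at_right 0)) (principal P2))"
    then obtain b where b: "0 < b" "\<And>\<nu>'. \<nu>' \<in> P2 \<Longrightarrow> 0 < W2 \<nu> \<nu>' \<Longrightarrow> W2 \<nu> \<nu>' < b \<Longrightarrow> P \<nu>'"
      unfolding eventually_inf_principal eventually_filtercomap eventually_at_right_field by blast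
    show "\<forall>\<^sub>F \<tau> in at_right 0. P (V \<tau>)"
      unfolding eventually_at_right_field
    proof (intro exI[of _ "min \<tau>1 (b / N)"] conjI allI impI)
      show "0 < min \<tau>1 (b / N)" using \<tau>1 b Npos by simp
      fix \<tau> assume \<tau>: "0 < \<tau>" "\<tau> < min \<tau>1 (b / N)"
      then have "\<tau> * N < b" using Npos by (simp add: pos_less_divide_eq)
      moreover have "V \<tau> \<in> P2" "W2 \<nu> (V \<tau>) \<le> \<tau> * N" using V[of \<tau>] \<tau> \<tau>1 by auto
      ultimately show "P (V \<tau>)" using \<tau> Wpos[of \<tau>] by (intro b(2)) auto
    qed
  qed
  have "metric_slope FE \<nu> = Limsup (at_W2 \<nu>) ?g"
    unfolding metric_slope_def using D(1) free_energy_eq[OF e] by simp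
  then have sl: "Limsup (at_W2 \<nu>) ?g \<le> ereal \<kappa>" using slope by simp
  have "ereal (D / N) \<le> Limsup (at_W2 \<nu>) ?g"
    unfolding Limsup_def
  proof (rule INF_greatest, clarify)
    fix P assume P: "eventually P (at_W2 \<nu>)"
    have ev: "\<forall>\<^sub>F \<tau> in at_right 0. P (V \<tau>)" using lim P by (simp add: filterlim_iff)
    have ev2: "\<forall>\<^sub>F \<tau> in at_right 0. 0 < \<tau> \<and> \<tau> < \<tau>1"
      unfolding eventually_at_right_field using \<tau>1 by auto
    have "((\<lambda>\<tau>. ereal ((D - C * \<tau>) / N)) \<longlongrightarrow> ereal ((D - C * 0) / N)) (at_right 0)"
      using Npos by (intro tendsto_intros lim_ereal[THEN iffD2]) auto
    then have "((\<lambda>\<tau>. ereal ((D - C * \<tau>) / N)) \<longlongrightarrow> ereal (D / N)) (at_right 0)" by simp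
    then show "ereal (D / N) \<le> (SUP \<nu>'\<in>Collect P. ?g \<nu>')"
    proof (rule tendsto_upperbound)
      show "\<forall>\<^sub>F \<tau> in at_right 0. ereal ((D - C * \<tau>) / N) \<le> (SUP \<nu>'\<in>Collect P. ?g \<nu>')"
        using ev ev2
      proof eventually_elim
        case (elim \<tau>)
        then have "?g (V \<tau>) \<le> (SUP \<nu>'\<in>Collect P. ?g \<nu>')" by (intro SUP_upper) auto
        then show ?case using quot[of \<tau>] elim by (auto intro: order.trans)
      qed
    qed simp
  qed
  then have "ereal (D / N) \<le> ereal \<kappa>" using sl by (rule order.trans)
  then show ?thesis using Npos unfolding D_def N_def by (simp add: field_simps)
qed

end

section \<open>Regularity of almost stationary measures\<close>

text \<open>Piecewise quadratic: \<open>2 * z\<^sup>2\<close> on \<open>{0..1 / 2}\<close> and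
  \<open>1 - 2 * (1 - z)\<^sup>2\<close> on \<open>{1 / 2..1}\<close>. The derivative
  \<open>smooth_step'\<close> is the tent of height \<open>2\<close> over the unit interval, a
  continuous averaging kernel of total mass \<open>1\<close>; the step itself also provides the
  cutoffs.\<close>

definition smooth_step :: "real \<Rightarrow> real" where
  "smooth_step z = 2 * (max 0 z)\<^sup>2 - 4 * (max 0 (z - 1 / 2))\<^sup>2 + 2 * (max 0 (z - 1))\<^sup>2"

definition smooth_step' :: "real \<Rightarrow> real" where
  "smooth_step' z = 4 * max 0 z - 8 * max 0 (z - 1 / 2) + 4 * max 0 (z - 1)"

lemma has_derivative_max_0_square: "((\<lambda>z. (max 0 z)\<^sup>2) has_real_derivative 2 * max 0 z) (at z)"
proof (cases z "0::real" rule: linorder_cases)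
  case less
  have "((\<lambda>_. 0) has_real_derivative 2 * max 0 z) (at z)" using less by simp
  then show ?thesis
    by (rule has_field_derivative_transform_within_open[where S = "{..<0}"]) (use less in auto)
next
  case greater
  have "((\<lambda>z. z\<^sup>2) has_real_derivative 2 * max 0 z) (at z)"
    using greater by (auto intro!: derivative_eq_intros)
  then show ?thesis
    by (rule has_field_derivative_transform_within_open[where S = "{0<..}"]) (use greater in auto)
next
  case equal
  have "((\<lambda>h. (max 0 h)\<^sup>2 / h) \<longlongrightarrow> 0) (at (0::real))"
  proof (rule Lim_null_comparison)
    have "norm ((max 0 h)\<^sup>2 / h) \<le> \<bar>h\<bar>" for h :: real
      by (cases "h > 0") (auto simp: power2_eq_square)
    then show "\<forall>\<^sub>F h in at 0. norm ((max 0 h)\<^sup>2 / h) \<le> \<bar>h::real\<bar>" by simp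
    show "((\<lambda>h. \<bar>h\<bar>) \<longlongrightarrow> 0) (at (0::real))" by (rule tendsto_eq_intros refl | simp)+
  qed
  then show ?thesis using equal by (simp add: DERIV_def)
qed

lemma smooth_step_deriv: "(smooth_step has_real_derivative smooth_step' z) (at z)"
proof -
  have 1: "((\<lambda>z. (max 0 (z - c))\<^sup>2) has_real_derivative 2 * max 0 (z - c)) (at z)" for c :: real
  proof -
    have "((\<lambda>z. z - c) has_real_derivative 1) (at z)" by (auto intro!: derivative_eq_intros)
    from DERIV_chain2[of "\<lambda>z. (max 0 z)\<^sup>2" _ "\<lambda>z. z - c", OF has_derivative_max_0_square this]
    show ?thesis by simp
  qed
  show ?thesis unfolding smooth_step_def[abs_def] smooth_step'_def
    by (rule derivative_eq_intros has_derivative_max_0_square 1 | simp)+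
qed

lemma smooth_step_simps: "z \<le> 0 \<Longrightarrow> smooth_step z = 0" "1 \<le> z \<Longrightarrow> smooth_step z = 1"
  by (auto simp: smooth_step_def max_def power2_eq_square algebra_simps)

lemma smooth_step'_bounds: "0 \<le> smooth_step' z" "smooth_step' z \<le> 2"
  by (auto simp: smooth_step'_def max_def)

lemma smooth_step_bounds: "0 \<le> smooth_step z" "smooth_step z \<le> 1"
proof -
  have mono: "smooth_step x \<le> smooth_step y" if "x \<le> y" for x y
    by (rule DERIV_nonneg_imp_nondecreasing[OF that]) (use smooth_step_deriv smooth_step'_bounds in blast)
  show "0 \<le> smooth_step z" using mono[of "min z 0" z] by (simp add: smooth_step_simps)
  show "smooth_step z \<le> 1" using mono[of z "max z 1"] by (simp add: smooth_step_simps)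
qed

lemma continuous_smooth_step [continuous_intros]:
  assumes "continuous_on A f"
  shows "continuous_on A (\<lambda>x. smooth_step (f x))" "continuous_on A (\<lambda>x. smooth_step' (f x))"
  unfolding smooth_step_def smooth_step'_def by (intro continuous_intros assms)+

lemma measurable_smooth_step [measurable]:
  "smooth_step \<in> borel_measurable borel" "smooth_step' \<in> borel_measurable borel"
  by (auto intro!: borel_measurable_continuous_onI continuous_intros)

lemma measure_eqI_atLeastAtMost:
  fixes M N :: "real measure"
  assumes sets: "sets M = sets borel" "sets N = sets borel"
    and eq: "\<And>a b. a \<le> b \<Longrightarrow> emeasure M {a..b} = emeasure N {a..b}"
    and fin: "\<And>a b. emeasure M {a..b} \<noteq> \<infinity>"
  shows "M = N"
proof (rule measure_eqI_generator_eq)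
  let ?E = "range (\<lambda>(a, b). {a..b :: real})"
  show "Int_stable ?E" by (auto simp: Int_stable_def)
  show "?E \<subseteq> Pow UNIV" by simp
  show "emeasure M X = emeasure N X" if "X \<in> ?E" for X
  proof -
    from \<open>X \<in> ?E\<close> obtain a b where X: "X = {a..b}" by auto
    show ?thesis unfolding X by (cases "a \<le> b") (use eq in auto)
  qed
  show "sets M = sigma_sets UNIV ?E" "sets N = sigma_sets UNIV ?E"
    unfolding sets borel_eq_atLeastAtMost by (auto simp: case_prod_unfold)
  show "range (\<lambda>n. {- real n..real n}) \<subseteq> ?E" by auto
  show "(\<Union>n. {- real n..real n}) = UNIV"
  proof (intro set_eqI iffI UNIV_I)
    fix x :: real
    obtain n :: nat where "\<bar>x\<bar> < real n" using reals_Archimedean2 by blast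
    then show "x \<in> (\<Union>n. {- real n..real n})" by (auto intro!: exI[of _ n])
  qed
  show "emeasure M {- real n..real n} \<noteq> \<infinity>" for n using fin .
qed

text \<open>
  The density relative to \<open>exp (- V)\<close> is the limit of the averages of \<open>exp V\<close> against kernels
  shrinking to a point: the difference of two averages is the value of the test inequality at a
  function supported near the interval between their base points.
\<close>

locale almost_stationary =
  fixes V V' :: "real \<Rightarrow> real" and \<nu> :: "real measure" and K :: real
  assumes dV: "\<And>x. (V has_real_derivative V' x) (at x)" and contV': "continuous_on UNIV V'"
    and rd: "real_distribution \<nu>" and ac: "absolutely_continuous lborel \<nu>"
    and K_nonneg: "0 \<le> K"
    and test: "\<And>\<xi> \<xi>'. test_function \<xi> \<xi>' \<Longrightarrow>
        (\<integral>x. \<xi>' x - V' x * \<xi> x \<partial>\<nu>) \<le> K * sqrt (\<integral>x. (\<xi> x)\<^sup>2 \<partial>\<nu>)"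
begin

sublocale real_distribution \<nu> by (rule rd)

lemma contV: "continuous_on A V"
  using dV by (auto intro!: continuous_at_imp_continuous_on DERIV_isCont)

lemma measurable_V [measurable]: "V \<in> borel_measurable borel" "V' \<in> borel_measurable borel"
  using contV contV' by (auto intro!: borel_measurable_continuous_onI)

lemma singleton_zero: "measure \<nu> {x} = 0"
proof -
  have "{x} \<in> null_sets lborel" by (simp add: null_sets_def)
  then have "{x} \<in> null_sets \<nu>" using ac unfolding absolutely_continuous_def by blast
  then show ?thesis by (simp add: null_sets_def measure_def)
qed

lemma cdf_continuous: "isCont (cdf \<nu>) x"
  by (simp add: isCont_cdf singleton_zero)

lemma measure_Icc: "a \<le> b \<Longrightarrow> measure \<nu> {a..b} = cdf \<nu> b - cdf \<nu> a"
proof (cases "a = b")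
  case False
  assume "a \<le> b"
  then have "{a..b} = {a} \<union> {a<..b}" by auto
  then have "measure \<nu> {a..b} = measure \<nu> {a} + measure \<nu> {a<..b}"
    using finite_measure_Union[of "{a}" "{a<..b}"] by simp
  then show ?thesis using cdf_diff_eq[of a b] \<open>a \<le> b\<close> False by (simp add: singleton_zero)
qed (simp add: singleton_zero)

definition "bump \<delta> x z = smooth_step' ((z - x) / \<delta>) / \<delta> * exp (V z)"

definition "avg \<delta> x = (\<integral>z. bump \<delta> x z \<partial>\<nu>)"

lemma bump_nonneg: "0 < \<delta> \<Longrightarrow> 0 \<le> bump \<delta> x z"
  unfolding bump_def using smooth_step'_bounds by simp

lemma bump_support: "0 < \<delta> \<Longrightarrow> z \<notin> {x..x + \<delta>} \<Longrightarrow> bump \<delta> x z = 0"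
  unfolding bump_def smooth_step'_def by (auto simp: max_def field_simps)

lemma measurable_bump [measurable]: "bump \<delta> x \<in> borel_measurable borel"
  "case_prod (bump \<delta>) \<in> borel_measurable (borel \<Otimes>\<^sub>M borel)"
  unfolding bump_def case_prod_unfold by measurable

lemma exp_V_bounded: "\<exists>M\<ge>0. \<forall>z\<in>{a..b}. exp (V z) \<le> M"
proof -
  have "bounded ((\<lambda>z. exp (V z)) ` {a..b})"
    by (intro compact_imp_bounded compact_continuous_image continuous_intros contV) auto
  then obtain M where "\<forall>z\<in>{a..b}. exp (V z) \<le> M" unfolding bounded_iff by auto
  then show ?thesis by (intro exI[of _ "max M 0"]) auto
qed

lemma bump_bounded: "0 < \<delta> \<Longrightarrow> \<exists>B. \<forall>z. \<bar>bump \<delta> x z\<bar> \<le> B"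
proof -
  assume \<delta>: "0 < \<delta>"
  obtain M where M: "0 \<le> M" "\<forall>z\<in>{x..x + \<delta>}. exp (V z) \<le> M" using exp_V_bounded by blast
  have "\<bar>bump \<delta> x z\<bar> \<le> 2 / \<delta> * M" for z
  proof (cases "z \<in> {x..x + \<delta>}")
    case True
    have "bump \<delta> x z \<le> 2 / \<delta> * M"
      unfolding bump_def using smooth_step'_bounds[of "(z - x) / \<delta>"] \<delta> M True
      by (intro mult_mono divide_right_mono) auto
    then show ?thesis using bump_nonneg[OF \<delta>] by simp
  qed (use bump_support[OF \<delta>] M \<delta> in auto)
  then show ?thesis by blast
qed

lemma integrable_bump: "0 < \<delta> \<Longrightarrow> integrable \<nu> (bump \<delta> x)"
proof -
  assume \<delta>: "0 < \<delta>"
  obtain B where "\<forall>z. \<bar>bump \<delta> x z\<bar> \<le> B" using bump_bounded[OF \<delta>] by blast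
  then show ?thesis by (intro integrable_const_bound[of _ B]) auto
qed

lemma avg_diff:
  assumes \<delta>: "0 < \<delta>" "0 < \<delta>'" and M: "0 \<le> M"
    and ab: "a \<le> x" "a \<le> y" "x + \<delta> \<le> b" "y + \<delta>' \<le> b"
    and MV: "\<And>z. z \<in> {a..b} \<Longrightarrow> exp (2 * V z) \<le> M"
  shows "\<bar>avg \<delta> x - avg \<delta>' y\<bar> \<le> K * sqrt (M * (cdf \<nu> b - cdf \<nu> a))"
proof -
  have le: "avg \<delta> x - avg \<delta>' y \<le> K * sqrt (M * (cdf \<nu> b - cdf \<nu> a))"
    if \<delta>: "0 < \<delta>" "0 < \<delta>'" and ab: "a \<le> x" "a \<le> y" "x + \<delta> \<le> b" "y + \<delta>' \<le> b" for \<delta> \<delta>' x y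
  proof -
    define \<eta> where "\<eta> z = smooth_step ((z - x) / \<delta>) - smooth_step ((z - y) / \<delta>')" for z
    define \<eta>' where "\<eta>' z = smooth_step' ((z - x) / \<delta>) / \<delta> - smooth_step' ((z - y) / \<delta>') / \<delta>'" for z
    \<comment> \<open>\<open>exp (V z)\<close> is an integrating factor: in
      \<open>\<xi>' z - V' z * \<xi> z\<close> the terms with \<open>V'\<close> cancel and the
      difference of the two kernels remains.\<close>
    define \<xi> where "\<xi> z = exp (V z) * \<eta> z" for z
    define \<xi>' where "\<xi>' z = exp (V z) * V' z * \<eta> z + exp (V z) * \<eta>' z" for z
    have s1: "((\<lambda>z. smooth_step ((z - x) / \<delta>)) has_real_derivative smooth_step' ((z - x) / \<delta>) / \<delta>) (at z)"
      if "0 < \<delta>" for z x \<delta>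
    proof -
      have "((\<lambda>z. (z - x) / \<delta>) has_real_derivative 1 / \<delta>) (at z)"
        using that by (auto intro!: derivative_eq_intros)
      from DERIV_chain2[OF smooth_step_deriv this] show ?thesis by simp
    qed
    have "(\<eta> has_real_derivative \<eta>' z) (at z)" for z
      unfolding \<eta>_def \<eta>'_def by (intro DERIV_diff s1 \<delta>)
    then have d: "(\<xi> has_real_derivative \<xi>' z) (at z)" for z
      unfolding \<xi>_def \<xi>'_def by (auto intro!: derivative_eq_intros dV)
    have \<eta>0: "\<eta> z = 0" if "z \<notin> {a..b}" for z
    proof (cases "z < a")
      case True
      then have "(z - x) / \<delta> \<le> 0" "(z - y) / \<delta>' \<le> 0" using ab \<delta> by (auto simp: divide_le_0_iff)
      then show ?thesis unfolding \<eta>_def by (simp add: smooth_step_simps)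
    next
      case False
      then have "1 \<le> (z - x) / \<delta>" "1 \<le> (z - y) / \<delta>'" using ab \<delta> that by (auto simp: le_divide_eq)
      then show ?thesis unfolding \<eta>_def by (simp add: smooth_step_simps)
    qed
    have \<eta>1: "\<bar>\<eta> z\<bar> \<le> 1" for z
      using smooth_step_bounds[of "(z - x) / \<delta>"] smooth_step_bounds[of "(z - y) / \<delta>'"]
      unfolding \<eta>_def by linarith
    have "continuous_on UNIV \<xi>'"
      unfolding \<xi>'_def \<eta>_def \<eta>'_def by (intro continuous_intros contV contV') (use \<delta> in auto)
    moreover have "\<forall>z. max \<bar>a\<bar> \<bar>b\<bar> < \<bar>z\<bar> \<longrightarrow> \<xi> z = 0"
    proof (intro allI impI)
      fix z assume "max \<bar>a\<bar> \<bar>b\<bar> < \<bar>z\<bar>"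
      then have "z \<notin> {a..b}" unfolding atLeastAtMost_iff by linarith
      then show "\<xi> z = 0" unfolding \<xi>_def using \<eta>0 by simp
    qed
    ultimately have tf: "test_function \<xi> \<xi>'" unfolding test_function_def using d by blast
    have "(\<integral>z. \<xi>' z - V' z * \<xi> z \<partial>\<nu>) = (\<integral>z. bump \<delta> x z - bump \<delta>' y z \<partial>\<nu>)"
      by (intro Bochner_Integration.integral_cong)
         (auto simp: \<xi>_def \<xi>'_def \<eta>'_def bump_def algebra_simps)
    also have "\<dots> = avg \<delta> x - avg \<delta>' y"
      unfolding avg_def using integrable_bump \<delta> by simp
    finally have 1: "avg \<delta> x - avg \<delta>' y \<le> K * sqrt (\<integral>z. (\<xi> z)\<^sup>2 \<partial>\<nu>)" using test[OF tf] by simp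
    have "(\<integral>z. (\<xi> z)\<^sup>2 \<partial>\<nu>) \<le> (\<integral>z. M * indicator {a..b} z \<partial>\<nu>)"
    proof (rule integral_mono_AE')
      show "AE z in \<nu>. (\<xi> z)\<^sup>2 \<le> M * indicator {a..b} z"
      proof (rule AE_I2)
        fix z
        show "(\<xi> z)\<^sup>2 \<le> M * indicator {a..b} z"
        proof (cases "z \<in> {a..b}")
          case True
          have "(\<xi> z)\<^sup>2 = exp (2 * V z) * (\<eta> z)\<^sup>2"
            unfolding \<xi>_def by (simp add: power_mult_distrib power2_eq_square exp_add[symmetric])
          also have "\<dots> \<le> M * 1"
            using MV[OF True] power_mono[OF \<eta>1[of z], of 2] M by (intro mult_mono) auto
          finally show ?thesis using True by simp
        qed (use \<eta>0[of z] in \<open>simp add: \<xi>_def\<close>)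
      qed
    qed (use M in \<open>auto intro!: integrable_mult_right integrable_real_indicator simp: less_top[symmetric]\<close>)
    also have "\<dots> = M * (cdf \<nu> b - cdf \<nu> a)" using measure_Icc[of a b] ab \<delta> by simp
    finally have "K * sqrt (\<integral>z. (\<xi> z)\<^sup>2 \<partial>\<nu>) \<le> K * sqrt (M * (cdf \<nu> b - cdf \<nu> a))"
      using K_nonneg by (intro mult_left_mono) auto
    then show ?thesis using 1 by linarith
  qed
  show ?thesis using le[OF \<delta> ab] le[OF \<delta>(2,1) ab(2,1,4,3)] by linarith
qed

text \<open>The averages reach from \<open>x\<close> to the right by \<open>1 / Suc n\<close>, which
  is at most \<open>1\<close>; this is why bounds on \<open>V\<close> are requested up to one unit
  beyond the right end of an interval.\<close>

definition "h x = lim (\<lambda>n. avg (1 / Suc n) x)"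

lemma cdf_seq: "(\<lambda>n. K * sqrt (M * (cdf \<nu> (y + 1 / Suc n) - cdf \<nu> x))) \<longlonglongrightarrow> K * sqrt (M * (cdf \<nu> y - cdf \<nu> x))"
proof -
  have "(\<lambda>n. y + 1 / Suc n) \<longlonglongrightarrow> y + 0" by (intro tendsto_intros LIMSEQ_Suc[OF lim_1_over_n])
  then have "(\<lambda>n. cdf \<nu> (y + 1 / Suc n)) \<longlonglongrightarrow> cdf \<nu> y"
    using isCont_tendsto_compose[OF cdf_continuous[of y], of "\<lambda>n. y + 1 / Suc n" sequentially] by simp
  then show ?thesis by (intro tendsto_intros)
qed

lemma exp_2V_bounded: "\<exists>M\<ge>0. \<forall>z\<in>{a..b}. exp (2 * V z) \<le> M"
proof -
  obtain M where M: "0 \<le> M" "\<forall>z\<in>{a..b}. exp (V z) \<le> M" using exp_V_bounded by blast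
  have "exp (2 * V z) \<le> M * M" if "z \<in> {a..b}" for z
  proof -
    have "exp (2 * V z) = exp (V z) * exp (V z)" by (simp add: exp_add[symmetric])
    also have "\<dots> \<le> M * M" using M that by (intro mult_mono) auto
    finally show ?thesis .
  qed
  then show ?thesis using M by (intro exI[of _ "M * M"]) auto
qed

lemma avg_tendsto: "(\<lambda>n. avg (1 / Suc n) x) \<longlonglongrightarrow> h x"
proof -
  obtain M where M: "0 \<le> M" "\<forall>z\<in>{x..x + 1}. exp (2 * V z) \<le> M" using exp_2V_bounded by blast
  have "Cauchy (\<lambda>n. avg (1 / Suc n) x)"
  proof (rule metric_CauchyI)
    fix e :: real assume e: "0 < e"
    have "(\<lambda>n. K * sqrt (M * (cdf \<nu> (x + 1 / Suc n) - cdf \<nu> x))) \<longlonglongrightarrow> K * sqrt (M * (cdf \<nu> x - cdf \<nu> x))"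
      by (rule cdf_seq)
    then have "\<forall>\<^sub>F n in sequentially. K * sqrt (M * (cdf \<nu> (x + 1 / Suc n) - cdf \<nu> x)) < e"
      using e by (intro order_tendstoD(2)) auto
    then obtain N where N: "K * sqrt (M * (cdf \<nu> (x + 1 / Suc N) - cdf \<nu> x)) < e"
      by (auto simp: eventually_sequentially)
    show "\<exists>N. \<forall>m\<ge>N. \<forall>n\<ge>N. dist (avg (1 / Suc m) x) (avg (1 / Suc n) x) < e"
    proof (intro exI[of _ N] allI impI)
      fix m n assume mn: "N \<le> m" "N \<le> n"
      have d: "1 / real (Suc m) \<le> 1 / Suc N" "1 / real (Suc n) \<le> 1 / Suc N" "1 / real (Suc N) \<le> 1"
        using mn by (auto simp: field_simps)
      have "\<bar>avg (1 / Suc m) x - avg (1 / Suc n) x\<bar> \<le> K * sqrt (M * (cdf \<nu> (x + 1 / Suc N) - cdf \<nu> x))"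
      proof (rule avg_diff[OF _ _ M(1)])
        fix z assume "z \<in> {x..x + 1 / real (Suc N)}"
        then have "z \<in> {x..x + 1}" using d unfolding atLeastAtMost_iff by linarith
        then show "exp (2 * V z) \<le> M" using M by blast
      qed (use d in auto)
      then show "dist (avg (1 / Suc m) x) (avg (1 / Suc n) x) < e" using N by (simp add: dist_real_def)
    qed
  qed
  then show ?thesis unfolding h_def by (simp add: Cauchy_convergent_iff convergent_LIMSEQ_iff)
qed

lemma h_nonneg: "0 \<le> h x"
  by (rule tendsto_lowerbound[OF avg_tendsto])
     (auto simp: avg_def intro!: always_eventually integral_nonneg_AE AE_I2 bump_nonneg)

lemma h_diff:
  assumes xy: "x \<le> y" and M: "0 \<le> M" and MV: "\<And>z. z \<in> {x..y + 1} \<Longrightarrow> exp (2 * V z) \<le> M"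
  shows "\<bar>h x - h y\<bar> \<le> K * sqrt (M * (cdf \<nu> y - cdf \<nu> x))"
proof (rule tendsto_le[OF _ cdf_seq])
  show "(\<lambda>n. \<bar>avg (1 / Suc n) x - avg (1 / Suc n) y\<bar>) \<longlonglongrightarrow> \<bar>h x - h y\<bar>"
    by (intro tendsto_intros avg_tendsto)
  show "\<forall>\<^sub>F n in sequentially. \<bar>avg (1 / real (Suc n)) x - avg (1 / real (Suc n)) y\<bar>
         \<le> K * sqrt (M * (cdf \<nu> (y + 1 / real (Suc n)) - cdf \<nu> x))"
  proof (intro always_eventually allI)
    fix n
    have n: "1 / real (Suc n) \<le> 1" "0 < 1 / real (Suc n)" by simp_all
    show "\<bar>avg (1 / real (Suc n)) x - avg (1 / real (Suc n)) y\<bar>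
         \<le> K * sqrt (M * (cdf \<nu> (y + 1 / real (Suc n)) - cdf \<nu> x))"
    proof (rule avg_diff[OF n(2,2) M])
      fix z assume "z \<in> {x..y + 1 / real (Suc n)}"
      then have "z \<in> {x..y + 1}" using n unfolding atLeastAtMost_iff by linarith
      then show "exp (2 * V z) \<le> M" by (rule MV)
    qed (use xy n in linarith)+
  qed
qed simp

lemma avg_h_diff:
  assumes M: "0 \<le> M" and MV: "\<And>z. z \<in> {x..x + 1} \<Longrightarrow> exp (2 * V z) \<le> M"
  shows "\<bar>avg (1 / Suc n) x - h x\<bar> \<le> K * sqrt M"
proof (rule tendsto_upperbound)
  show "(\<lambda>m. \<bar>avg (1 / Suc n) x - avg (1 / Suc m) x\<bar>) \<longlonglongrightarrow> \<bar>avg (1 / Suc n) x - h x\<bar>"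
    by (intro tendsto_intros avg_tendsto)
  show "\<forall>\<^sub>F m in sequentially. \<bar>avg (1 / Suc n) x - avg (1 / Suc m) x\<bar> \<le> K * sqrt M"
  proof (intro always_eventually allI)
    fix m
    have "1 / real (Suc n) \<le> 1" "1 / real (Suc m) \<le> 1" by simp_all
    then have "\<bar>avg (1 / Suc n) x - avg (1 / Suc m) x\<bar> \<le> K * sqrt (M * (cdf \<nu> (x + 1) - cdf \<nu> x))"
      using M MV by (intro avg_diff) auto
    also have "\<dots> \<le> K * sqrt (M * 1)"
      using cdf_bounded_prob[of "x + 1"] cdf_nonneg[of x] M K_nonneg
      by (intro mult_left_mono real_sqrt_le_mono) auto
    finally show "\<bar>avg (1 / Suc n) x - avg (1 / Suc m) x\<bar> \<le> K * sqrt M" by simp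
  qed
qed simp

text \<open>The increment of the distribution function in \<open>h_diff\<close> is at most
  \<open>1\<close>. On a bounded interval the relative density thus varies by at most a constant
  times \<open>K\<close>: a small defect makes \<open>\<nu>\<close> locally resemble a multiple of
  the reference measure.\<close>

lemma h_oscillation:
  assumes "x \<in> {a..b}" "y \<in> {a..b}" "0 \<le> M" "\<And>z. z \<in> {a..b + 1} \<Longrightarrow> exp (2 * V z) \<le> M"
  shows "\<bar>h x - h y\<bar> \<le> K * sqrt M"
proof -
  have "\<bar>h x - h y\<bar> \<le> K * sqrt M" if "x \<le> y" "x \<in> {a..b}" "y \<in> {a..b}" for x y
  proof -
    have "\<bar>h x - h y\<bar> \<le> K * sqrt (M * (cdf \<nu> y - cdf \<nu> x))"
      using that assms by (intro h_diff) auto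
    also have "\<dots> \<le> K * sqrt (M * 1)"
      using cdf_bounded_prob[of y] cdf_nonneg[of x] assms K_nonneg
      by (intro mult_left_mono real_sqrt_le_mono) auto
    finally show ?thesis by simp
  qed
  from this[of x y] this[of y x] show ?thesis using assms by (cases "x \<le> y") auto
qed

lemma continuous_h: "continuous_on UNIV h"
proof (rule continuous_at_imp_continuous_on, rule ballI)
  fix x :: real
  obtain M where M: "0 \<le> M" "\<forall>z\<in>{x - 1..x + 2}. exp (2 * V z) \<le> M" using exp_2V_bounded by blast
  have bound: "\<bar>h y - h x\<bar> \<le> K * sqrt (M * \<bar>cdf \<nu> y - cdf \<nu> x\<bar>)" if "dist y x < 1" for y
  proof (cases "x \<le> y")
    case True
    then show ?thesis using h_diff[OF True M(1)] M that cdf_nondecreasing[OF True]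
      by (auto simp: dist_real_def abs_minus_commute)
  next
    case False
    then have yx: "y \<le> x" by simp
    have "exp (2 * V z) \<le> M" if z: "z \<in> {y..x + 1}" for z
    proof -
      have "z \<in> {x - 1..x + 2}" using z \<open>dist y x < 1\<close> by (auto simp: dist_real_def)
      then show ?thesis using M by blast
    qed
    from h_diff[OF yx M(1) this] show ?thesis using cdf_nondecreasing[OF yx]
      by (simp add: abs_minus_commute)
  qed
  have lim: "((\<lambda>y. K * sqrt (M * \<bar>cdf \<nu> y - cdf \<nu> x\<bar>)) \<longlongrightarrow> K * sqrt (M * \<bar>cdf \<nu> x - cdf \<nu> x\<bar>)) (at x)"
    using cdf_continuous[of x] unfolding isCont_def by (intro tendsto_intros)
  have "((\<lambda>y. h y - h x) \<longlongrightarrow> 0) (at x)"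
  proof (rule Lim_null_comparison)
    show "\<forall>\<^sub>F y in at x. norm (h y - h x) \<le> K * sqrt (M * \<bar>cdf \<nu> y - cdf \<nu> x\<bar>)"
      unfolding eventually_at using bound by (intro exI[of _ 1]) auto
    show "((\<lambda>y. K * sqrt (M * \<bar>cdf \<nu> y - cdf \<nu> x\<bar>)) \<longlongrightarrow> 0) (at x)" using lim by simp
  qed
  then show "isCont h x" unfolding isCont_def by (simp add: LIM_zero_iff)
qed

lemma measurable_h [measurable]: "h \<in> borel_measurable borel"
  using continuous_h by (rule borel_measurable_continuous_onI)

lemma measurable_avg [measurable]: "0 < \<delta> \<Longrightarrow> avg \<delta> \<in> borel_measurable borel"
  unfolding avg_def
  by (rule borel_measurable_lebesgue_integral) (simp add: measurable_cong_sets[OF sets_pair_measure_cong[OF refl events_eq_borel] refl])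

text \<open>Tonelli's theorem: as a function of its base point the kernel is, up to sign and a
  constant factor, an exact derivative of the step.\<close>

lemma nn_integral_avg:
  assumes \<delta>: "0 < \<delta>" and ab: "a \<le> b"
  shows "(\<integral>\<^sup>+x. ennreal (avg \<delta> x) * indicator {a..b} x \<partial>lborel)
    = (\<integral>\<^sup>+z. ennreal (exp (V z) * (smooth_step ((z - a) / \<delta>) - smooth_step ((z - b) / \<delta>))) \<partial>\<nu>)"
proof -
  interpret P: pair_sigma_finite lborel \<nu> ..
  have [measurable_cong]: "sets \<nu> = sets borel" by (rule events_eq_borel)
  have "(\<integral>\<^sup>+x. ennreal (avg \<delta> x) * indicator {a..b} x \<partial>lborel)
      = (\<integral>\<^sup>+x. (\<integral>\<^sup>+z. ennreal (bump \<delta> x z) * indicator {a..b} x \<partial>\<nu>) \<partial>lborel)"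
  proof (intro nn_integral_cong)
    fix x
    have "ennreal (avg \<delta> x) = (\<integral>\<^sup>+z. ennreal (bump \<delta> x z) \<partial>\<nu>)"
      unfolding avg_def by (rule nn_integral_eq_integral[symmetric]) (use integrable_bump bump_nonneg \<delta> in auto)
    then show "ennreal (avg \<delta> x) * indicator {a..b} x = (\<integral>\<^sup>+z. ennreal (bump \<delta> x z) * indicator {a..b} x \<partial>\<nu>)"
      by (simp add: nn_integral_multc)
  qed
  also have "\<dots> = (\<integral>\<^sup>+z. (\<integral>\<^sup>+x. ennreal (bump \<delta> x z) * indicator {a..b} x \<partial>lborel) \<partial>\<nu>)"
    by (rule P.Fubini'[symmetric]) (unfold bump_def, measurable)
  also have "\<dots> = (\<integral>\<^sup>+z. ennreal (exp (V z) * (smooth_step ((z - a) / \<delta>) - smooth_step ((z - b) / \<delta>))) \<partial>\<nu>)"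
  proof (intro nn_integral_cong)
    fix z
    have d: "((\<lambda>x. - exp (V z) * smooth_step ((z - x) / \<delta>)) has_real_derivative bump \<delta> x z) (at x)" for x
    proof -
      have "((\<lambda>x. (z - x) / \<delta>) has_real_derivative - 1 / \<delta>) (at x)"
        using \<delta> by (auto intro!: derivative_eq_intros)
      from DERIV_cmult[OF DERIV_chain2[OF smooth_step_deriv this], of "- exp (V z)"]
      show ?thesis unfolding bump_def by (simp add: mult.commute)
    qed
    have "(\<integral>\<^sup>+x. ennreal (bump \<delta> x z) * indicator {a..b} x \<partial>lborel)
       = ennreal (- exp (V z) * smooth_step ((z - b) / \<delta>) - - exp (V z) * smooth_step ((z - a) / \<delta>))"
      by (rule nn_integral_FTC_Icc) (use d bump_nonneg \<delta> ab in \<open>auto simp: bump_def\<close>)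
    then show "(\<integral>\<^sup>+x. ennreal (bump \<delta> x z) * indicator {a..b} x \<partial>lborel)
       = ennreal (exp (V z) * (smooth_step ((z - a) / \<delta>) - smooth_step ((z - b) / \<delta>)))"
      by (simp add: algebra_simps)
  qed
  finally show ?thesis .
qed

text \<open>Both sides are limits of \<open>nn_integral_avg\<close> as the kernels shrink. On the
  side of \<open>\<nu>\<close> the difference of steps tends to the indicator of
  \<open>{a<..b}\<close>, and the missing endpoint carries no mass.\<close>

lemma integral_h:
  assumes ab: "a \<le> b"
  shows "(\<integral>\<^sup>+x. ennreal (h x) * indicator {a..b} x \<partial>lborel) = (\<integral>\<^sup>+z. ennreal (exp (V z)) * indicator {a..b} z \<partial>\<nu>)"
proof (rule LIMSEQ_unique)
  obtain M2 where M2: "0 \<le> M2" "\<forall>z\<in>{a..b + 1}. exp (2 * V z) \<le> M2" using exp_2V_bounded by blast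
  obtain M1 where M1: "0 \<le> M1" "\<forall>z\<in>{a..b + 1}. exp (V z) \<le> M1" using exp_V_bounded by blast
  have hb: "h x \<le> h a + K * sqrt M2" if "x \<in> {a..b}" for x
    using h_oscillation[of x a b a M2] that M2 ab by auto
  have ah: "avg (1 / Suc n) x \<le> h a + 2 * (K * sqrt M2)" if "x \<in> {a..b}" for x n
    using avg_h_diff[of M2 x n] M2 that hb[OF that] by auto
  show "(\<lambda>n. \<integral>\<^sup>+x. ennreal (avg (1 / Suc n) x) * indicator {a..b} x \<partial>lborel)
      \<longlonglongrightarrow> (\<integral>\<^sup>+x. ennreal (h x) * indicator {a..b} x \<partial>lborel)"
  proof (rule nn_integral_dominated_convergence[where w = "\<lambda>x. ennreal (h a + 2 * (K * sqrt M2)) * indicator {a..b} x"])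
    show "(\<integral>\<^sup>+x. ennreal (h a + 2 * (K * sqrt M2)) * indicator {a..b} x \<partial>lborel) < \<infinity>"
      using ab by (simp add: nn_integral_cmult ennreal_mult_less_top)
    show "AE x in lborel. ennreal (avg (1 / Suc n) x) * indicator {a..b} x
        \<le> ennreal (h a + 2 * (K * sqrt M2)) * indicator {a..b} x" for n
      using ah by (intro AE_I2) (auto intro!: ennreal_leI split: split_indicator)
    show "AE x in lborel. (\<lambda>n. ennreal (avg (1 / Suc n) x) * indicator {a..b} x) \<longlonglongrightarrow> ennreal (h x) * indicator {a..b} x"
    proof (rule AE_I2)
      fix x
      show "(\<lambda>n. ennreal (avg (1 / Suc n) x) * indicator {a..b} x) \<longlonglongrightarrow> ennreal (h x) * indicator {a..b} x"
        using tendsto_ennrealI[OF avg_tendsto[of x]] by (auto split: split_indicator)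
    qed
  qed measurable
  have "(\<lambda>n. \<integral>\<^sup>+z. ennreal (exp (V z) * (smooth_step ((z - a) / (1 / Suc n)) - smooth_step ((z - b) / (1 / Suc n)))) \<partial>\<nu>)
      \<longlonglongrightarrow> (\<integral>\<^sup>+z. ennreal (exp (V z)) * indicator {a<..b} z \<partial>\<nu>)"
  proof (rule nn_integral_dominated_convergence[where w = "\<lambda>x. ennreal M1"])
    have [measurable_cong]: "sets \<nu> = sets borel" by (rule events_eq_borel)
    show "(\<lambda>z. ennreal (exp (V z) * (smooth_step ((z - a) / (1 / Suc n)) - smooth_step ((z - b) / (1 / Suc n)))))
       \<in> borel_measurable \<nu>" for n by measurable
    show "(\<integral>\<^sup>+x. ennreal M1 \<partial>\<nu>) < \<infinity>" using emeasure_space_1 by simp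
    show "AE z in \<nu>. ennreal (exp (V z) * (smooth_step ((z - a) / (1 / Suc n)) - smooth_step ((z - b) / (1 / Suc n))))
        \<le> ennreal M1" for n
    proof (intro AE_I2 ennreal_leI)
      fix z
      let ?d = "smooth_step ((z - a) / (1 / Suc n)) - smooth_step ((z - b) / (1 / Suc n))"
      have d1: "?d \<le> 1" using smooth_step_bounds[of "(z - a) / (1 / Suc n)"] smooth_step_bounds[of "(z - b) / (1 / Suc n)"] by linarith
      show "exp (V z) * ?d \<le> M1"
      proof (cases "z \<in> {a..b + 1}")
        case True
        have "exp (V z) * ?d \<le> exp (V z) * 1" using d1 by (intro mult_left_mono) auto
        also have "\<dots> \<le> M1" using M1 True by simp
        finally show ?thesis .
      next
        case False
        have "?d = 0"
        proof (cases "z < a")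
          case True
          then have "(z - a) / (1 / Suc n) \<le> 0" "(z - b) / (1 / Suc n) \<le> 0" using ab by (auto simp: mult_nonpos_nonneg)
          then show ?thesis by (simp add: smooth_step_simps del: of_nat_Suc)
        next
          case False
          then have "b + 1 < z" using \<open>z \<notin> {a..b + 1}\<close> by auto
          then have "1 * 1 \<le> (z - a) * real (Suc n)" "1 * 1 \<le> (z - b) * real (Suc n)" using ab by (intro mult_mono; simp)+
          then show ?thesis by (simp add: smooth_step_simps del: of_nat_Suc)
        qed
        then show ?thesis using M1 by simp
      qed
    qed
    show "AE z in \<nu>. (\<lambda>n. ennreal (exp (V z) * (smooth_step ((z - a) / (1 / Suc n)) - smooth_step ((z - b) / (1 / Suc n)))))
        \<longlonglongrightarrow> ennreal (exp (V z)) * indicator {a<..b} z"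
    proof (rule AE_I2)
      fix z
      have lim: "(\<lambda>n. smooth_step ((z - c) / (1 / Suc n))) \<longlonglongrightarrow> (if c < z then 1 else 0)" for c
      proof (cases "c < z")
        case True
        then obtain N :: nat where N: "1 / (z - c) < real N" using reals_Archimedean2 by blast
        have "\<forall>\<^sub>F n in sequentially. smooth_step ((z - c) / (1 / Suc n)) = 1"
          unfolding eventually_sequentially
        proof (intro exI[of _ N] allI impI)
          fix n assume "N \<le> n"
          then have "1 / (z - c) \<le> real (Suc n)" using N by simp
          then have "1 \<le> (z - c) * real (Suc n)" using True by (simp add: field_simps)
          then show "smooth_step ((z - c) / (1 / Suc n)) = 1" by (simp add: smooth_step_simps del: of_nat_Suc)
        qed
        then show ?thesis using True by (simp add: tendsto_eventually)
      next
        case False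
        then have "(z - c) / (1 / Suc n) \<le> 0" for n by (simp add: mult_nonpos_nonneg)
        then show ?thesis using False by (simp add: smooth_step_simps del: of_nat_Suc)
      qed
      have "(\<lambda>n. ennreal (exp (V z) * (smooth_step ((z - a) / (1 / Suc n)) - smooth_step ((z - b) / (1 / Suc n)))))
        \<longlonglongrightarrow> ennreal (exp (V z) * ((if a < z then 1 else 0) - (if b < z then 1 else 0)))"
        by (intro tendsto_ennrealI tendsto_intros lim)
      also have "ennreal (exp (V z) * ((if a < z then 1 else 0) - (if b < z then 1 else 0))) = ennreal (exp (V z)) * indicator {a<..b} z"
        using ab by (auto split: split_indicator)
      finally show "(\<lambda>n. ennreal (exp (V z) * (smooth_step ((z - a) / (1 / Suc n)) - smooth_step ((z - b) / (1 / Suc n)))))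
        \<longlonglongrightarrow> ennreal (exp (V z)) * indicator {a<..b} z" .
    qed
  qed (auto simp: measurable_cong_sets[OF events_eq_borel refl])
  moreover have "(\<integral>\<^sup>+z. ennreal (exp (V z)) * indicator {a<..b} z \<partial>\<nu>) = (\<integral>\<^sup>+z. ennreal (exp (V z)) * indicator {a..b} z \<partial>\<nu>)"
  proof (rule nn_integral_cong_AE)
    have "AE z in \<nu>. z \<noteq> a"
      by (rule AE_I[of _ _ "{a}"]) (auto simp: emeasure_eq_measure singleton_zero)
    then show "AE z in \<nu>. ennreal (exp (V z)) * indicator {a<..b} z = ennreal (exp (V z)) * indicator {a..b} z"
      by eventually_elim (auto split: split_indicator)
  qed
  ultimately show "(\<lambda>n. \<integral>\<^sup>+x. ennreal (avg (1 / Suc n) x) * indicator {a..b} x \<partial>lborel)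
      \<longlonglongrightarrow> (\<integral>\<^sup>+z. ennreal (exp (V z)) * indicator {a..b} z \<partial>\<nu>)"
    using ab by (subst nn_integral_avg) auto
qed

text \<open>\<open>integral_h\<close> identifies the measures on closed intervals after weighting
  \<open>\<nu>\<close> by \<open>exp V\<close>; weighting once more by \<open>exp (- V)\<close>
  recovers \<open>\<nu>\<close>.\<close>

theorem density_h: "\<nu> = density lborel (\<lambda>x. ennreal (h x * exp (- V x)))"
proof -
  have [measurable_cong]: "sets \<nu> = sets borel" by (rule events_eq_borel)
  have "density \<nu> (\<lambda>z. ennreal (exp (V z))) = density lborel (\<lambda>x. ennreal (h x))"
  proof (rule measure_eqI_atLeastAtMost)
    show "emeasure (density \<nu> (\<lambda>z. ennreal (exp (V z)))) {a..b} = emeasure (density lborel (\<lambda>x. ennreal (h x))) {a..b}"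
      if "a \<le> b" for a b using integral_h[OF that] by (simp add: emeasure_density)
    show "emeasure (density \<nu> (\<lambda>z. ennreal (exp (V z)))) {a..b} \<noteq> \<infinity>" for a b
    proof -
      obtain M where M: "0 \<le> M" "\<forall>z\<in>{a..b}. exp (V z) \<le> M" using exp_V_bounded by blast
      have "(\<integral>\<^sup>+z. ennreal (exp (V z)) * indicator {a..b} z \<partial>\<nu>) \<le> (\<integral>\<^sup>+z. ennreal M \<partial>\<nu>)"
        using M by (intro nn_integral_mono) (auto intro!: ennreal_leI split: split_indicator)
      also have "\<dots> = ennreal M" using emeasure_space_1 by simp
      finally show ?thesis by (auto simp: emeasure_density top_unique)
    qed
  qed simp_all
  then have "density (density \<nu> (\<lambda>z. ennreal (exp (V z)))) (\<lambda>x. ennreal (exp (- V x)))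
      = density (density lborel (\<lambda>x. ennreal (h x))) (\<lambda>x. ennreal (exp (- V x)))" by simp
  then have "density \<nu> (\<lambda>x. ennreal (exp (V x)) * ennreal (exp (- V x)))
      = density lborel (\<lambda>x. ennreal (h x) * ennreal (exp (- V x)))"
    by (simp add: density_density_eq)
  moreover have "ennreal (exp (V x)) * ennreal (exp (- V x)) = 1" for x
    by (simp add: ennreal_mult'[symmetric] exp_add[symmetric] flip: ennreal_1)
  ultimately show ?thesis by (simp add: density_1 ennreal_mult' h_nonneg)
qed

end

section \<open>Distribution functions of positive continuous densities\<close>

lemma cdf_density_has_derivative:
  fixes \<rho> :: "real \<Rightarrow> real"
  assumes "continuous_on UNIV \<rho>" and \<rho>: "\<And>x. 0 \<le> \<rho> x"
    and M: "M = density lborel (\<lambda>x. ennreal (\<rho> x))" and "prob_space M"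
  shows "(cdf M has_real_derivative \<rho> x) (at x)"
proof -
  interpret prob_space M by fact
  interpret finite_borel_measure M by unfold_locales (simp add: M)
  have [measurable]: "\<rho> \<in> borel_measurable borel" using assms(1) by (rule borel_measurable_continuous_onI)
  define G where "G y = integral {x - 2..y} \<rho>" for y
  have dG: "(G has_real_derivative \<rho> y) (at y)" if y: "y \<in> {x - 1..x + 1}" for y
  proof -
    have "(G has_real_derivative \<rho> y) (at y within {x - 2..x + 2})"
      unfolding G_def using y
      by (intro integral_has_real_derivative continuous_on_subset[OF assms(1)]) auto
    moreover have "at y within {x - 2..x + 2} = at y" using y by (intro at_within_interior) auto
    ultimately show ?thesis by simp
  qed
  have eq: "cdf M y = cdf M (x - 1) + (G y - G (x - 1))" if y: "y \<in> {x - 1<..<x + 1}" for y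
  proof -
    have "emeasure M {x - 1<..y} = (\<integral>\<^sup>+z. ennreal (\<rho> z) * indicator {x - 1<..y} z \<partial>lborel)"
      unfolding M by (simp add: emeasure_density)
    also have "\<dots> = (\<integral>\<^sup>+z. ennreal (\<rho> z) * indicator {x - 1..y} z \<partial>lborel)"
    proof (rule nn_integral_cong_AE)
      show "AE z in lborel. ennreal (\<rho> z) * indicator {x - 1<..y} z = ennreal (\<rho> z) * indicator {x - 1..y} z"
        using AE_lborel_singleton[of "x - 1"] by eventually_elim (auto split: split_indicator)
    qed
    also have "\<dots> = ennreal (G y - G (x - 1))"
      by (rule nn_integral_FTC_Icc) (use y dG \<rho> in auto)
    finally have em: "emeasure M {x - 1<..y} = ennreal (G y - G (x - 1))" .
    have "G (x - 1) \<le> G y"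
    proof (rule DERIV_nonneg_imp_nondecreasing[of "x - 1" y])
      fix z assume "x - 1 \<le> z" "z \<le> y"
      then have "z \<in> {x - 1..x + 1}" using y by auto
      then show "\<exists>D. (G has_real_derivative D) (at z) \<and> 0 \<le> D" using dG \<rho> by blast
    qed (use y in auto)
    then have "measure M {x - 1<..y} = G y - G (x - 1)" using em by (simp add: emeasure_eq_measure)
    then show ?thesis using cdf_diff_eq[of "x - 1" y] y by auto
  qed
  have "((\<lambda>y. cdf M (x - 1) + (G y - G (x - 1))) has_real_derivative \<rho> x) (at x)"
    using dG[of x] by (auto intro!: derivative_eq_intros)
  then show ?thesis
    by (rule has_field_derivative_transform_within_open[of _ _ _ "{x - 1<..<x + 1}"]) (use eq in auto)
qed

lemma cdf_quantile:
  assumes "real_distribution M" "\<And>x. isCont (cdf M) x" "0 < u" "u < 1"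
  shows "cdf M (quantile M u) = u"
proof (rule antisym)
  interpret real_distribution M by fact
  note q = quantile_le_iff[OF assms(1,3,4)]
  show "u \<le> cdf M (quantile M u)" using q[of "quantile M u"] by simp
  show "cdf M (quantile M u) \<le> u"
  proof (rule ccontr)
    assume "\<not> cdf M (quantile M u) \<le> u"
    then have "\<forall>\<^sub>F x in at (quantile M u). u < cdf M x"
      using assms(2)[of "quantile M u"] unfolding isCont_def by (intro order_tendstoD(1)) auto
    then obtain d where d: "0 < d" "\<And>x. x \<noteq> quantile M u \<Longrightarrow> dist x (quantile M u) < d \<Longrightarrow> u < cdf M x"
      unfolding eventually_at by auto
    have "u < cdf M (quantile M u - d / 2)" by (rule d(2)) (use d(1) in \<open>auto simp: dist_real_def\<close>)
    then have "quantile M u \<le> quantile M u - d / 2" using q[of "quantile M u - d / 2"] by simp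
    then show False using d(1) by simp
  qed
qed

lemma cdf_strict_mono_of_deriv:
  assumes "\<And>x. (cdf M has_real_derivative \<rho> x) (at x)" "\<And>x. 0 < \<rho> x" "x < y"
  shows "cdf M x < cdf M y"
  by (rule DERIV_pos_imp_increasing[OF assms(3)]) (use assms in blast)

lemma cdf_range_of_deriv:
  assumes "real_distribution M" "\<And>x. (cdf M has_real_derivative \<rho> x) (at x)" "\<And>x. 0 < \<rho> x"
  shows "0 < cdf M x" "cdf M x < 1"
proof -
  interpret real_distribution M by fact
  show "0 < cdf M x" using cdf_strict_mono_of_deriv[OF assms(2,3), of "x - 1" x] cdf_nonneg[of "x - 1"] by simp
  show "cdf M x < 1" using cdf_strict_mono_of_deriv[OF assms(2,3), of x "x + 1"] cdf_bounded_prob[of "x + 1"] by simp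
qed

lemma quantile_cdf:
  assumes "real_distribution M" "\<And>x. (cdf M has_real_derivative \<rho> x) (at x)" "\<And>x. 0 < \<rho> x"
  shows "quantile M (cdf M x) = x"
proof -
  note r = cdf_range_of_deriv[OF assms, of x]
  note q = quantile_le_iff[OF assms(1) r]
  have 1: "quantile M (cdf M x) \<le> x" using q by simp
  have "cdf M x \<le> cdf M (quantile M (cdf M x))" using q[of "quantile M (cdf M x)"] by simp
  then have "x \<le> quantile M (cdf M x)"
    using cdf_strict_mono_of_deriv[OF assms(2,3), of "quantile M (cdf M x)" x] by force
  then show ?thesis using 1 by simp
qed

lemma quantile_has_derivative:
  assumes "real_distribution M" "\<And>x. (cdf M has_real_derivative \<rho> x) (at x)" "\<And>x. 0 < \<rho> x" "0 < u" "u < 1"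
  shows "(quantile M has_real_derivative inverse (\<rho> (quantile M u))) (at u)"
proof -
  have cont: "isCont (cdf M) x" for x using assms(2) by (rule DERIV_isCont)
  note cq = cdf_quantile[OF assms(1) cont]
  have "isCont (quantile M) (cdf M (quantile M u))"
    by (rule isCont_inverse_function[of 1]) (use quantile_cdf[OF assms(1-3)] cont in auto)
  then have iso: "isCont (quantile M) u" using cq assms(4,5) by simp
  show ?thesis
    by (rule DERIV_inverse_function[where f = "cdf M" and a = 0 and b = 1])
       (use assms iso cq less_imp_neq[OF assms(3), symmetric] in auto)
qed

section \<open>An energy estimate along the monotone rearrangement\<close>

lemma density_real:
  fixes f g :: "real \<Rightarrow> real"
  assumes [measurable]: "g \<in> borel_measurable borel" "f \<in> borel_measurable borel" and "\<And>x. 0 \<le> g x"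
  shows "integrable (density lborel (\<lambda>x. ennreal (g x))) f \<longleftrightarrow> integrable lborel (\<lambda>x. g x * f x)"
    and "(\<integral>x. f x \<partial>density lborel (\<lambda>x. ennreal (g x))) = (\<integral>x. g x * f x \<partial>lborel)"
  using assms(3) integrable_density[of f lborel g] integral_density[of f lborel g] by simp_all

text \<open>
  The measure is averaged with the stationary one before it is rearranged. This makes the
  density positive everywhere, so that the rearrangement is a diffeomorphism of the whole line,
  and by concavity of the logarithm costs only a factor \<open>2\<close> in the relative entropy.
\<close>

locale normalized_stationary = almost_stationary +
  fixes L :: real
  assumes normalized: "(\<integral>\<^sup>+x. ennreal (exp (- V x)) \<partial>lborel) = 1"
    and L_nonneg: "0 \<le> L" and lower: "\<And>x y. V x + V' x * (y - x) - L * (y - x)\<^sup>2 \<le> V y"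
    and \<nu>_P2: "\<nu> \<in> P2" and \<mu>_P2: "density lborel (\<lambda>x. ennreal (exp (- V x))) \<in> P2"
begin

definition "\<mu> = density lborel (\<lambda>x. ennreal (exp (- V x)))"

definition "mix = density lborel (\<lambda>x. ennreal ((h x + 1) / 2 * exp (- V x)))"

lemma emeasure_mix: "A \<in> sets borel \<Longrightarrow> 2 * emeasure mix A = emeasure \<nu> A + emeasure \<mu> A"
proof -
  assume [measurable]: "A \<in> sets borel"
  have e: "2 * ennreal ((h x + 1) / 2 * exp (- V x)) = ennreal (h x * exp (- V x)) + ennreal (exp (- V x))" for x
  proof -
    have "2 * ennreal ((h x + 1) / 2 * exp (- V x)) = ennreal (2 * ((h x + 1) / 2 * exp (- V x)))"
      using h_nonneg[of x] ennreal_mult[of 2 "(h x + 1) / 2 * exp (- V x)"] by simp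
    also have "2 * ((h x + 1) / 2 * exp (- V x)) = h x * exp (- V x) + exp (- V x)" by (simp add: algebra_simps)
    also have "ennreal \<dots> = ennreal (h x * exp (- V x)) + ennreal (exp (- V x))"
      using h_nonneg[of x] by (intro ennreal_plus) auto
    finally show ?thesis .
  qed
  have "2 * emeasure mix A = (\<integral>\<^sup>+x. 2 * ennreal ((h x + 1) / 2 * exp (- V x)) * indicator A x \<partial>lborel)"
    unfolding mix_def by (simp add: emeasure_density nn_integral_cmult[symmetric] mult.assoc)
  also have "\<dots> = (\<integral>\<^sup>+x. ennreal (h x * exp (- V x)) * indicator A x + ennreal (exp (- V x)) * indicator A x \<partial>lborel)"
    unfolding e by (simp add: distrib_right)
  also have "\<dots> = emeasure \<nu> A + emeasure \<mu> A"
    by (subst density_h) (simp add: \<mu>_def emeasure_density nn_integral_add)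
  finally show ?thesis .
qed

lemma real_distribution_\<mu>: "real_distribution \<mu>" using P2D(1)[OF \<mu>_P2] unfolding \<mu>_def .

lemma prob_space_mix: "prob_space mix"
proof
  have "space \<mu> = UNIV" by (simp add: \<mu>_def)
  then have "emeasure \<mu> UNIV = 1" using prob_space.emeasure_space_1[OF P2D(2)[OF \<mu>_P2, folded \<mu>_def]] by simp
  moreover have "emeasure \<nu> UNIV = 1" using emeasure_space_1 by simp
  ultimately have "2 * emeasure mix UNIV = 2" using emeasure_mix[of UNIV] by simp
  then have "2 * emeasure mix UNIV = 2 * 1" by simp
  then show "emeasure mix (space mix) = 1"
    by (subst (asm) ennreal_mult_cancel_left) (simp add: mix_def)
qed

lemma measure_mix: "A \<in> sets borel \<Longrightarrow> measure mix A = (measure \<nu> A + measure \<mu> A) / 2"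
proof -
  assume A: "A \<in> sets borel"
  interpret m: prob_space mix by (rule prob_space_mix)
  interpret s: real_distribution \<mu> by (rule real_distribution_\<mu>)
  have "ennreal (2 * measure mix A) = ennreal (measure \<nu> A + measure \<mu> A)"
    using emeasure_mix[OF A] by (simp add: emeasure_eq_measure m.emeasure_eq_measure s.emeasure_eq_measure ennreal_mult)
  then show ?thesis by (subst (asm) ennreal_inj) auto
qed

lemma real_distribution_mix: "real_distribution mix"
  using prob_space_mix by (simp add: real_distribution_def real_distribution_axioms_def mix_def)

lemma cdf_mix: "cdf mix x = (cdf \<nu> x + cdf \<mu> x) / 2"
  unfolding cdf_def by (rule measure_mix) simp

lemma cdf_\<mu>_deriv: "(cdf \<mu> has_real_derivative exp (- V x)) (at x)"
  by (rule cdf_density_has_derivative[OF _ _ \<mu>_def])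
     (auto intro!: continuous_intros contV prob_space_mix P2D(2)[OF \<mu>_P2, folded \<mu>_def])

lemma mix_density_pos: "0 < (h x + 1) / 2 * exp (- V x)"
  using h_nonneg[of x] by simp

lemma cdf_mix_deriv: "(cdf mix has_real_derivative (h x + 1) / 2 * exp (- V x)) (at x)"
  by (rule cdf_density_has_derivative[OF _ _ mix_def prob_space_mix])
     (intro continuous_intros contV continuous_h, simp, rule less_imp_le[OF mix_density_pos])

lemma measurable_densities [measurable]:
  "(\<lambda>x. h x * exp (- V x)) \<in> borel_measurable borel" "(\<lambda>x. exp (- V x)) \<in> borel_measurable borel"
  "(\<lambda>x. (h x + 1) / 2 * exp (- V x)) \<in> borel_measurable borel"
  by measurable

context
  fixes f :: "real \<Rightarrow> real" assumes f_meas: "f \<in> borel_measurable borel"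
begin

lemma integral_\<nu>_density:
  "integrable \<nu> f \<longleftrightarrow> integrable lborel (\<lambda>x. h x * exp (- V x) * f x)"
  "(\<integral>x. f x \<partial>\<nu>) = (\<integral>x. h x * exp (- V x) * f x \<partial>lborel)"
proof -
  have "0 \<le> h x * exp (- V x)" for x using h_nonneg by simp
  note * = density_real[OF measurable_densities(1) f_meas this]
  show "integrable \<nu> f \<longleftrightarrow> integrable lborel (\<lambda>x. h x * exp (- V x) * f x)"
    by (subst density_h) (rule *(1))
  show "(\<integral>x. f x \<partial>\<nu>) = (\<integral>x. h x * exp (- V x) * f x \<partial>lborel)"
    by (subst density_h) (rule *(2))
qed

lemma integral_\<mu>_density: "integrable \<mu> f \<longleftrightarrow> integrable lborel (\<lambda>x. exp (- V x) * f x)"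
  unfolding \<mu>_def by (rule density_real(1)[OF measurable_densities(2) f_meas]) simp

lemma integral_mix_density:
  "integrable mix f \<longleftrightarrow> integrable lborel (\<lambda>x. (h x + 1) / 2 * exp (- V x) * f x)"
  "(\<integral>x. f x \<partial>mix) = (\<integral>x. (h x + 1) / 2 * exp (- V x) * f x \<partial>lborel)"
  unfolding mix_def
  by (rule density_real(1)[OF measurable_densities(3) f_meas less_imp_le[OF mix_density_pos]],
      rule density_real(2)[OF measurable_densities(3) f_meas less_imp_le[OF mix_density_pos]])

lemma integrable_mix:
  assumes "integrable \<nu> f" "integrable \<mu> f"
  shows "integrable mix f"
proof -
  have "integrable lborel (\<lambda>x. (1 / 2) * (h x * exp (- V x) * f x) + (1 / 2) * (exp (- V x) * f x))"
    using assms unfolding integral_\<nu>_density(1) integral_\<mu>_density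
    by (intro Bochner_Integration.integrable_add integrable_mult_right)
  moreover have "(\<lambda>x. (1 / 2) * (h x * exp (- V x) * f x) + (1 / 2) * (exp (- V x) * f x))
      = (\<lambda>x. (h x + 1) / 2 * exp (- V x) * f x)"
    by (rule ext) (simp add: algebra_simps add_divide_distrib)
  ultimately show ?thesis unfolding integral_mix_density(1) by simp
qed

text \<open>The density of \<open>\<nu>\<close> is at most twice that of \<open>mix\<close>, so
  squared displacements controlled under the mixture are controlled under
  \<open>\<nu>\<close>.\<close>

lemma integral_le_mix:
  assumes f: "\<And>x. 0 \<le> f x" and int: "integrable mix f"
  shows "integrable \<nu> f" "(\<integral>x. f x \<partial>\<nu>) \<le> 2 * (\<integral>x. f x \<partial>mix)"
proof -
  note [measurable] = f_meas
  have 1: "integrable lborel (\<lambda>x. 2 * ((h x + 1) / 2 * exp (- V x) * f x))"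
    using int unfolding integral_mix_density(1) by (rule integrable_mult_right)
  have le: "h x * exp (- V x) * f x \<le> 2 * ((h x + 1) / 2 * exp (- V x) * f x)" for x
  proof -
    have "2 * ((h x + 1) / 2 * exp (- V x) * f x) = h x * exp (- V x) * f x + exp (- V x) * f x" by algebra
    moreover have "0 \<le> exp (- V x) * f x" using f by simp
    ultimately show ?thesis by linarith
  qed
  have 2: "integrable lborel (\<lambda>x. h x * exp (- V x) * f x)"
  proof (rule Bochner_Integration.integrable_bound[OF 1])
    show "AE x in lborel. norm (h x * exp (- V x) * f x) \<le> norm (2 * ((h x + 1) / 2 * exp (- V x) * f x))"
    proof (rule AE_I2)
      fix x
      have "0 \<le> h x * exp (- V x) * f x" using h_nonneg f by simp
      then show "norm (h x * exp (- V x) * f x) \<le> norm (2 * ((h x + 1) / 2 * exp (- V x) * f x))"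
        using le[of x] unfolding real_norm_def by linarith
    qed
  qed measurable
  then show "integrable \<nu> f" unfolding integral_\<nu>_density(1) .
  have "(\<integral>x. f x \<partial>\<nu>) = (\<integral>x. h x * exp (- V x) * f x \<partial>lborel)" by (rule integral_\<nu>_density(2))
  also have "\<dots> \<le> (\<integral>x. 2 * ((h x + 1) / 2 * exp (- V x) * f x) \<partial>lborel)"
    by (rule integral_mono[OF 2 1 le])
  also have "\<dots> = 2 * (\<integral>x. f x \<partial>mix)"
    unfolding integral_mix_density(2) by (rule integral_mult_right_zero)
  finally show "(\<integral>x. f x \<partial>\<nu>) \<le> 2 * (\<integral>x. f x \<partial>mix)" .
qed

end

lemma mix_P2: "mix \<in> P2"
proof (rule P2I[OF prob_space_mix])
  show "sets mix = sets borel" by (simp add: mix_def)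
  show "integrable mix (\<lambda>x. x\<^sup>2)"
    using P2D(5)[OF \<nu>_P2] P2D(5)[OF \<mu>_P2, folded \<mu>_def] by (intro integrable_mix) simp_all
qed

definition "T x = quantile \<mu> (cdf mix x)"

text \<open>The solution of \<open>T' x * exp (- V (T x)) = (h x + 1) / 2 * exp (- V x)\<close>, the
  Monge-Ampere equation on the line.\<close>

definition "T' x = (h x + 1) / 2 * exp (- V x) * exp (V (T x))"

lemma T_deriv: "(T has_real_derivative T' x) (at x)"
proof -
  note r = cdf_range_of_deriv[OF real_distribution_mix cdf_mix_deriv mix_density_pos, of x]
  have "(quantile \<mu> has_real_derivative inverse (exp (- V (quantile \<mu> (cdf mix x))))) (at (cdf mix x))"
    by (rule quantile_has_derivative[OF real_distribution_\<mu> cdf_\<mu>_deriv _ r]) simp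
  from DERIV_chain2[OF this cdf_mix_deriv] show ?thesis
    unfolding T_def[abs_def] T'_def by (simp add: exp_minus mult.commute)
qed

lemma continuous_T: "continuous_on A T"
  using T_deriv by (auto intro!: continuous_at_imp_continuous_on DERIV_isCont)

lemma continuous_T': "continuous_on UNIV T'"
  unfolding T'_def
  by (intro continuous_intros contV continuous_h continuous_on_compose2[OF contV continuous_T]) auto

lemma T_quantile: "u \<in> {0<..<1} \<Longrightarrow> T (quantile mix u) = quantile \<mu> u"
  unfolding T_def by (subst cdf_quantile) (auto intro: real_distribution_mix DERIV_isCont[OF cdf_mix_deriv])

lemma measurable_T [measurable]: "T \<in> borel_measurable borel" "T' \<in> borel_measurable borel"
  using continuous_T continuous_T' by (auto intro!: borel_measurable_continuous_onI)

lemma displacement_mix: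
  "integrable mix (\<lambda>x. (T x - x)\<^sup>2)" "(\<integral>x. (T x - x)\<^sup>2 \<partial>mix) = (W2 mix \<mu>)\<^sup>2"
proof -
  note \<mu> = \<mu>_P2[folded \<mu>_def]
  note q = integrable_quantile[OF mix_P2] integrable_quantile[OF \<mu>]
  note [measurable] = q(1,3)
  have sq: "integrable unit_interval (\<lambda>u. (quantile mix u - quantile \<mu> u)\<^sup>2)"
    by (rule integrable_add_L2) (use q in auto)
  have eq: "(T (quantile mix u) - quantile mix u)\<^sup>2 = (quantile mix u - quantile \<mu> u)\<^sup>2"
    if "u \<in> space unit_interval" for u
    using T_quantile that by (simp add: power2_commute)
  have "integrable (distr unit_interval borel (quantile mix)) (\<lambda>x. (T x - x)\<^sup>2)"
    by (subst integrable_distr_eq, simp, simp, subst Bochner_Integration.integrable_cong[OF refl eq], assumption, rule sq)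
  then show "integrable mix (\<lambda>x. (T x - x)\<^sup>2)" by (simp add: distr_quantile real_distribution_mix)
  have "(\<integral>x. (T x - x)\<^sup>2 \<partial>mix) = (\<integral>x. (T x - x)\<^sup>2 \<partial>distr unit_interval borel (quantile mix))"
    by (simp add: distr_quantile real_distribution_mix)
  also have "\<dots> = (\<integral>u. (quantile mix u - quantile \<mu> u)\<^sup>2 \<partial>unit_interval)"
    by (subst integral_distr, simp, simp, rule Bochner_Integration.integral_cong[OF refl eq])
  also have "\<dots> = (W2 mix \<mu>)\<^sup>2"
    unfolding W2_eq_quantile[OF mix_P2 \<mu>] by simp
  finally show "(\<integral>x. (T x - x)\<^sup>2 \<partial>mix) = (W2 mix \<mu>)\<^sup>2" .
qed

text \<open>Three inequalities are combined: \<open>sqrt (h x) \<le> (h x + 1) / 2\<close>, the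
  bound \<open>ln (T' x) \<le> T' x - 1\<close> in the Monge-Ampere equation, and the semiconvexity
  estimate \<open>lower\<close>. Up to the quadratic term the right-hand side is the integrand of
  \<open>test\<close> for the field \<open>T x - x\<close>.\<close>

lemma log_density_le:
  assumes "0 < h x"
  shows "ln (h x) / 2 \<le> (T' x - 1) - V' x * (T x - x) + L * (T x - x)\<^sup>2"
proof -
  have T'0: "0 < T' x" unfolding T'_def using h_nonneg[of x] by simp
  have "2 * sqrt (h x) \<le> h x + 1" using zero_le_power2[of "sqrt (h x) - 1"] assms by (simp add: power2_diff)
  then have "ln (sqrt (h x)) \<le> ln ((h x + 1) / 2)" using assms by simp
  then have 1: "ln (h x) / 2 \<le> ln ((h x + 1) / 2)" using assms by (simp add: ln_sqrt)
  have "ln (T' x) = ln ((h x + 1) / 2) - V x + V (T x)"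
  proof -
    define r where "r = (h x + 1) / 2"
    have "0 < r" unfolding r_def using assms by simp
    then have "T' x = exp (ln r - V x + V (T x))"
      unfolding T'_def r_def[symmetric] by (simp add: exp_add exp_diff exp_minus field_simps)
    then show ?thesis unfolding r_def[symmetric] by simp
  qed
  moreover have "ln (T' x) \<le> T' x - 1" using T'0 by (rule ln_le_minus_one)
  moreover have "V x + V' x * (T x - x) - L * (T x - x)\<^sup>2 \<le> V (T x)" by (rule lower)
  ultimately show ?thesis using 1 by linarith
qed

definition "cutoff R x = smooth_step (2 + x / R) * smooth_step (2 - x / R)"

definition "cutoff' R x = (smooth_step' (2 + x / R) * smooth_step (2 - x / R)
   - smooth_step (2 + x / R) * smooth_step' (2 - x / R)) / R"

lemma cutoff_deriv: "0 < R \<Longrightarrow> (cutoff R has_real_derivative cutoff' R x) (at x)"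
proof -
  assume R: "0 < R"
  have "((\<lambda>x. 2 + x / R) has_real_derivative 1 / R) (at x)" "((\<lambda>x. 2 - x / R) has_real_derivative - 1 / R) (at x)"
    using R by (auto intro!: derivative_eq_intros)
  from DERIV_mult[OF DERIV_chain2[OF smooth_step_deriv this(1)] DERIV_chain2[OF smooth_step_deriv this(2)]]
  show ?thesis unfolding cutoff_def[abs_def] cutoff'_def by (simp add: algebra_simps diff_divide_distrib)
qed

lemma cutoff_bounds: "0 \<le> cutoff R x" "cutoff R x \<le> 1"
  unfolding cutoff_def using smooth_step_bounds by (auto intro: mult_le_one)

lemma cutoff_0: "0 < R \<Longrightarrow> 2 * R < \<bar>x\<bar> \<Longrightarrow> cutoff R x = 0"
proof -
  assume R: "0 < R" and x: "2 * R < \<bar>x\<bar>"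
  show ?thesis
  proof (cases "0 \<le> x")
    case True
    then have "2 - x / R \<le> 0" using R x by (simp add: field_simps)
    then show ?thesis unfolding cutoff_def by (simp add: smooth_step_simps)
  next
    case False
    then have "2 + x / R \<le> 0" using R x by (simp add: field_simps)
    then show ?thesis unfolding cutoff_def by (simp add: smooth_step_simps)
  qed
qed

lemma cutoff_1: "0 < R \<Longrightarrow> \<bar>x\<bar> \<le> R \<Longrightarrow> cutoff R x = 1"
proof -
  assume R: "0 < R" and x: "\<bar>x\<bar> \<le> R"
  then have "1 \<le> 2 - x / R" "1 \<le> 2 + x / R" by (auto simp: field_simps abs_le_iff)
  then show ?thesis unfolding cutoff_def by (simp add: smooth_step_simps)
qed

lemma cutoff'_bound: "0 < R \<Longrightarrow> \<bar>cutoff' R x\<bar> \<le> 4 / R"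
proof -
  assume R: "0 < R"
  have "\<bar>smooth_step' a * smooth_step b\<bar> \<le> 2 * 1" for a b
    unfolding abs_mult using smooth_step_bounds[of b] smooth_step'_bounds[of a] by (intro mult_mono) auto
  from this[of "2 + x / R" "2 - x / R"] this[of "2 - x / R" "2 + x / R"]
  have "\<bar>smooth_step' (2 + x / R) * smooth_step (2 - x / R)
   - smooth_step (2 + x / R) * smooth_step' (2 - x / R)\<bar> \<le> 4"
    by (simp add: mult.commute)
  then show ?thesis unfolding cutoff'_def using R by (simp add: divide_right_mono)
qed

lemma continuous_cutoff: "0 < R \<Longrightarrow> continuous_on A (cutoff R)" "0 < R \<Longrightarrow> continuous_on A (cutoff' R)"
  unfolding cutoff_def[abs_def] cutoff'_def[abs_def] by (intro continuous_intros; simp)+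

text \<open>\<open>log_density_le\<close> is integrated against \<open>\<nu>\<close> with the field
  \<open>T x - x\<close> cut off at radius \<open>R\<close>, which then tends to infinity. The
  leading factor \<open>2\<close> undoes the halved logarithm; the factors \<open>sqrt 2\<close> and
  \<open>2\<close> on the distance terms come from \<open>integral_le_mix\<close>.\<close>

theorem relative_entropy_le:
  assumes int: "integrable \<nu> (\<lambda>x. ln (h x))"
  shows "(\<integral>x. ln (h x) \<partial>\<nu>) \<le> 2 * (K * (sqrt 2 * W2 mix \<mu>) + 2 * L * (W2 mix \<mu>)\<^sup>2)"
proof -
  have [measurable_cong]: "sets \<nu> = sets borel" by (rule events_eq_borel)
  define \<xi> where "\<xi> x = T x - x" for x
  have [measurable]: "\<xi> \<in> borel_measurable borel" unfolding \<xi>_def by measurable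
  define N where "N = sqrt (\<integral>x. (\<xi> x)\<^sup>2 \<partial>\<nu>)"
  have sq\<xi>: "integrable \<nu> (\<lambda>x. (\<xi> x)\<^sup>2)" and le\<xi>: "(\<integral>x. (\<xi> x)\<^sup>2 \<partial>\<nu>) \<le> 2 * (W2 mix \<mu>)\<^sup>2"
    using integral_le_mix[of "\<lambda>x. (\<xi> x)\<^sup>2"] displacement_mix unfolding \<xi>_def by auto
  have W0: "0 \<le> W2 mix \<mu>" using mix_P2 \<mu>_P2[folded \<mu>_def] by (rule W2_nonneg)
  have N0: "0 \<le> N" unfolding N_def by simp
  have N2: "N\<^sup>2 = (\<integral>x. (\<xi> x)\<^sup>2 \<partial>\<nu>)" unfolding N_def by simp
  have NW: "N \<le> sqrt 2 * W2 mix \<mu>"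
    using real_sqrt_le_mono[OF le\<xi>] W0 unfolding N_def by (simp add: real_sqrt_mult)
  have i\<xi>: "integrable \<nu> (\<lambda>x. \<bar>\<xi> x\<bar>)" and m\<xi>: "(\<integral>x. \<bar>\<xi> x\<bar> \<partial>\<nu>) \<le> N"
    using expectation_le_L2[of "\<lambda>x. \<bar>\<xi> x\<bar>"] sq\<xi> unfolding N_def by auto
  have "AE x in lborel. 0 < ennreal (h x * exp (- V x)) \<longrightarrow> 0 < h x"
    using h_nonneg by (simp add: zero_less_mult_iff)
  then have hpos: "AE x in \<nu>. 0 < h x" by (subst density_h, subst AE_density) auto
  have bound: "(\<integral>x. cutoff R x * (ln (h x) / 2) \<partial>\<nu>) \<le> K * N + 4 / R * N + L * N\<^sup>2" if R: "0 < R" for R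
  proof -
    define \<zeta> where "\<zeta> x = cutoff R x * \<xi> x" for x
    define \<zeta>' where "\<zeta>' x = cutoff' R x * \<xi> x + cutoff R x * (T' x - 1)" for x
    have [measurable]: "cutoff R \<in> borel_measurable borel" "cutoff' R \<in> borel_measurable borel"
      using continuous_cutoff R by (auto intro!: borel_measurable_continuous_onI)
    have "(\<zeta> has_real_derivative \<zeta>' x) (at x)" for x
      unfolding \<zeta>_def[abs_def] \<zeta>'_def \<xi>_def
      by (auto intro!: derivative_eq_intros cutoff_deriv[OF R] T_deriv)
    moreover have c\<zeta>': "continuous_on UNIV \<zeta>'"
      unfolding \<zeta>'_def \<xi>_def using R by (intro continuous_intros continuous_cutoff continuous_T continuous_T')
    moreover have "\<forall>x. 2 * R < \<bar>x\<bar> \<longrightarrow> \<zeta> x = 0" unfolding \<zeta>_def using cutoff_0[OF R] by simp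
    ultimately have tf: "test_function \<zeta> \<zeta>'" unfolding test_function_def by blast
    obtain R' B where RB: "\<And>x. R' < \<bar>x\<bar> \<Longrightarrow> \<zeta> x = 0" "\<And>x. R' < \<bar>x\<bar> \<Longrightarrow> \<zeta>' x = 0" "continuous_on UNIV \<zeta>"
      by (rule test_functionD[OF tf]) blast
    \<comment> \<open>No integrability of \<open>T'\<close> is available; \<open>g\<close> is
      integrable because the cutoff makes it continuous with compact support, hence bounded.\<close>
    define g where "g x = \<zeta>' x - V' x * \<zeta> x" for x
    have cg: "continuous_on UNIV g" unfolding g_def by (intro continuous_intros c\<zeta>' contV' RB)
    then have [measurable]: "g \<in> borel_measurable borel" by (rule borel_measurable_continuous_onI)
    have "bounded (g ` {- R'..R'})"
      by (intro compact_imp_bounded compact_continuous_image continuous_on_subset[OF cg]) auto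
    then obtain G where G: "\<forall>x\<in>{- R'..R'}. \<bar>g x\<bar> \<le> G" unfolding bounded_iff by auto
    have "\<bar>g x\<bar> \<le> max G 0" for x
    proof (cases "R' < \<bar>x\<bar>")
      case True then show ?thesis using RB by (simp add: g_def)
    next
      case False
      then have "x \<in> {- R'..R'}" by auto
      then show ?thesis using G by fastforce
    qed
    then have ig: "integrable \<nu> g" by (intro integrable_const_bound[of _ "max G 0"]) auto
    have il: "integrable \<nu> (\<lambda>x. cutoff R x * (ln (h x) / 2))"
    proof (rule Bochner_Integration.integrable_bound[OF int])
      show "AE x in \<nu>. norm (cutoff R x * (ln (h x) / 2)) \<le> norm (ln (h x))"
      proof (rule AE_I2)
        fix x
        have "\<bar>cutoff R x\<bar> * \<bar>ln (h x) / 2\<bar> \<le> 1 * \<bar>ln (h x)\<bar>"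
          using cutoff_bounds[of R x] by (intro mult_mono) auto
        then show "norm (cutoff R x * (ln (h x) / 2)) \<le> norm (ln (h x))" by (simp add: abs_mult)
      qed
    qed measurable
    have "(\<integral>x. cutoff R x * (ln (h x) / 2) \<partial>\<nu>) \<le> (\<integral>x. g x + 4 / R * \<bar>\<xi> x\<bar> + L * (\<xi> x)\<^sup>2 \<partial>\<nu>)"
    proof (rule integral_mono_AE)
      show "AE x in \<nu>. cutoff R x * (ln (h x) / 2) \<le> g x + 4 / R * \<bar>\<xi> x\<bar> + L * (\<xi> x)\<^sup>2"
        using hpos
      proof eventually_elim
        case (elim x)
        have "cutoff R x * (ln (h x) / 2) \<le> cutoff R x * ((T' x - 1) - V' x * \<xi> x + L * (\<xi> x)\<^sup>2)"
          unfolding \<xi>_def by (rule mult_left_mono[OF log_density_le[OF elim] cutoff_bounds(1)])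
        \<comment> \<open>Differentiating the cutoff as well leaves an error supported in its
          transition zone, of size at most \<open>4 / R * \<bar>\<xi> x\<bar>\<close>.\<close>
        also have "\<dots> = g x - cutoff' R x * \<xi> x + cutoff R x * (L * (\<xi> x)\<^sup>2)"
          unfolding g_def \<zeta>_def \<zeta>'_def by (simp add: algebra_simps)
        also have "\<dots> \<le> g x + 4 / R * \<bar>\<xi> x\<bar> + L * (\<xi> x)\<^sup>2"
        proof -
          have "\<bar>cutoff' R x\<bar> * \<bar>\<xi> x\<bar> \<le> 4 / R * \<bar>\<xi> x\<bar>" by (intro mult_right_mono cutoff'_bound R) auto
          then have "- (cutoff' R x * \<xi> x) \<le> 4 / R * \<bar>\<xi> x\<bar>" using abs_ge_minus_self[of "cutoff' R x * \<xi> x"] by (simp add: abs_mult)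
          moreover have "cutoff R x * (L * (\<xi> x)\<^sup>2) \<le> 1 * (L * (\<xi> x)\<^sup>2)"
            using cutoff_bounds[of R x] L_nonneg by (intro mult_right_mono) auto
          ultimately show ?thesis by simp
        qed
        finally show ?case .
      qed
    qed (use il ig i\<xi> sq\<xi> in auto)
    also have "\<dots> = (\<integral>x. g x \<partial>\<nu>) + 4 / R * (\<integral>x. \<bar>\<xi> x\<bar> \<partial>\<nu>) + L * N\<^sup>2"
      unfolding N2 using ig i\<xi> sq\<xi> by simp
    also have "\<dots> \<le> K * N + 4 / R * N + L * N\<^sup>2"
    proof -
      have "(\<integral>x. (\<zeta> x)\<^sup>2 \<partial>\<nu>) \<le> (\<integral>x. (\<xi> x)\<^sup>2 \<partial>\<nu>)"
      proof (rule integral_mono_AE')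
        show "AE x in \<nu>. (\<zeta> x)\<^sup>2 \<le> (\<xi> x)\<^sup>2"
        proof (rule AE_I2)
          fix x
          have "(\<zeta> x)\<^sup>2 = (cutoff R x)\<^sup>2 * (\<xi> x)\<^sup>2" unfolding \<zeta>_def by (simp add: power_mult_distrib)
          also have "\<dots> \<le> 1 * (\<xi> x)\<^sup>2"
            using cutoff_bounds[of R x] by (intro mult_right_mono power_le_one) auto
          finally show "(\<zeta> x)\<^sup>2 \<le> (\<xi> x)\<^sup>2" by simp
        qed
      qed (use sq\<xi> in auto)
      then have "sqrt (\<integral>x. (\<zeta> x)\<^sup>2 \<partial>\<nu>) \<le> N" unfolding N_def by simp
      then have "K * sqrt (\<integral>x. (\<zeta> x)\<^sup>2 \<partial>\<nu>) \<le> K * N" by (rule mult_left_mono[OF _ K_nonneg])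
      then have "(\<integral>x. g x \<partial>\<nu>) \<le> K * N" using test[OF tf] unfolding g_def by linarith
      moreover have "4 / R * (\<integral>x. \<bar>\<xi> x\<bar> \<partial>\<nu>) \<le> 4 / R * N" using m\<xi> R by (intro mult_left_mono) auto
      ultimately show ?thesis by simp
    qed
    finally show ?thesis .
  qed
  have lim: "(\<lambda>n. \<integral>x. cutoff (real (Suc n)) x * (ln (h x) / 2) \<partial>\<nu>) \<longlonglongrightarrow> (\<integral>x. ln (h x) / 2 \<partial>\<nu>)"
  proof (rule integral_dominated_convergence[where w = "\<lambda>x. \<bar>ln (h x)\<bar>"])
    show "AE x in \<nu>. (\<lambda>n. cutoff (real (Suc n)) x * (ln (h x) / 2)) \<longlonglongrightarrow> ln (h x) / 2"
    proof (intro AE_I2 tendsto_eventually)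
      fix x
      obtain N :: nat where N: "\<bar>x\<bar> < real N" using reals_Archimedean2 by blast
      show "\<forall>\<^sub>F n in sequentially. cutoff (real (Suc n)) x * (ln (h x) / 2) = ln (h x) / 2"
        unfolding eventually_sequentially
      proof (intro exI[of _ N] allI impI)
        fix n assume "N \<le> n"
        then have "\<bar>x\<bar> \<le> real (Suc n)" using N by simp
        then show "cutoff (real (Suc n)) x * (ln (h x) / 2) = ln (h x) / 2" by (subst cutoff_1) auto
      qed
    qed
    show "AE x in \<nu>. norm (cutoff (real (Suc n)) x * (ln (h x) / 2)) \<le> \<bar>ln (h x)\<bar>" for n
    proof (rule AE_I2)
      fix x
      have "\<bar>cutoff (real (Suc n)) x\<bar> * \<bar>ln (h x) / 2\<bar> \<le> 1 * \<bar>ln (h x)\<bar>"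
        using cutoff_bounds[of "real (Suc n)" x] by (intro mult_mono) auto
      then show "norm (cutoff (real (Suc n)) x * (ln (h x) / 2)) \<le> \<bar>ln (h x)\<bar>" by (simp add: abs_mult)
    qed
    show "(\<lambda>x. cutoff (real (Suc n)) x * (ln (h x) / 2)) \<in> borel_measurable \<nu>" for n
      unfolding cutoff_def by measurable
  qed (use int in auto)
  have "(\<integral>x. ln (h x) / 2 \<partial>\<nu>) \<le> K * N + 0 * N + L * N\<^sup>2"
  proof (rule tendsto_le[OF _ _ lim])
    have "(\<lambda>n. 4 * (1 / real (Suc n))) \<longlonglongrightarrow> 4 * 0" by (intro tendsto_intros LIMSEQ_Suc[OF lim_1_over_n])
    then have "(\<lambda>n. 4 / real (Suc n)) \<longlonglongrightarrow> 0" by simp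
    then show "(\<lambda>n. K * N + 4 / real (Suc n) * N + L * N\<^sup>2) \<longlonglongrightarrow> K * N + 0 * N + L * N\<^sup>2" by (intro tendsto_intros)
    show "\<forall>\<^sub>F n in sequentially. (\<integral>x. cutoff (real (Suc n)) x * (ln (h x) / 2) \<partial>\<nu>)
       \<le> K * N + 4 / real (Suc n) * N + L * N\<^sup>2"
      by (intro always_eventually allI bound) simp
  qed simp
  also have "\<dots> \<le> K * (sqrt 2 * W2 mix \<mu>) + L * (2 * (W2 mix \<mu>)\<^sup>2)"
    using NW K_nonneg L_nonneg le\<xi> unfolding N2
    by (simp add: add_mono mult_left_mono)
  finally show ?thesis by (simp add: algebra_simps)
qed

end

section \<open>Convergence of almost stationary measures\<close>

lemma second_moment_tail:
  assumes "\<mu> \<in> P2" "0 < e"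
  obtains R where "0 < R" "(\<integral>x. x\<^sup>2 * indicator {x. R < \<bar>x\<bar>} x \<partial>\<mu>) < e"
proof -
  have [measurable_cong]: "sets \<mu> = sets borel" using P2D(3)[OF assms(1)] .
  have "(\<lambda>n. \<integral>x. x\<^sup>2 * indicator {x. real (Suc n) < \<bar>x\<bar>} x \<partial>\<mu>) \<longlonglongrightarrow> (\<integral>x. 0 \<partial>\<mu>)"
  proof (rule integral_dominated_convergence[where w = "\<lambda>x. x\<^sup>2"])
    show "AE x in \<mu>. (\<lambda>n. x\<^sup>2 * indicator {x. real (Suc n) < \<bar>x\<bar>} x) \<longlonglongrightarrow> 0"
    proof (intro AE_I2 tendsto_eventually)
      fix x :: real
      obtain N :: nat where N: "\<bar>x\<bar> < real N" using reals_Archimedean2 by blast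
      show "\<forall>\<^sub>F n in sequentially. x\<^sup>2 * indicator {x. real (Suc n) < \<bar>x\<bar>} x = 0"
        unfolding eventually_sequentially by (rule exI[of _ N]) (use N in auto)
    qed
  qed (use P2D(5)[OF assms(1)] in \<open>auto split: split_indicator\<close>)
  then have "\<forall>\<^sub>F n in sequentially. (\<integral>x. x\<^sup>2 * indicator {x. real (Suc n) < \<bar>x\<bar>} x \<partial>\<mu>) < e"
    using assms(2) by (intro order_tendstoD(2)) auto
  then obtain n where "(\<integral>x. x\<^sup>2 * indicator {x. real (Suc n) < \<bar>x\<bar>} x \<partial>\<mu>) < e"
    by (auto simp: eventually_sequentially)
  then show thesis by (intro that[of "real (Suc n)"]) auto
qed

lemma transfer_distr:
  fixes f :: "real \<Rightarrow> real"
  assumes "X \<in> borel_measurable M" "distr M borel X = N" "f \<in> borel_measurable borel"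
  shows "integrable M (\<lambda>u. f (X u)) \<longleftrightarrow> integrable N f" "(\<integral>u. f (X u) \<partial>M) = (\<integral>x. f x \<partial>N)"
  using integrable_distr_eq[OF assms(1,3)] integral_distr[OF assms(1,3)] assms(2) by simp_all

lemma tails_of_higher_moment:
  assumes \<nu>: "\<nu> \<in> P2" and R: "1 \<le> R" and \<epsilon>: "0 < \<epsilon>"
    and int: "integrable \<nu> (\<lambda>z. \<bar>z\<bar> powr (2 + \<epsilon>))" and B: "(\<integral>z. \<bar>z\<bar> powr (2 + \<epsilon>) \<partial>\<nu>) \<le> B"
  shows "(\<integral>x. x\<^sup>2 * indicator {x. R < \<bar>x\<bar>} x \<partial>\<nu>) \<le> B / R powr \<epsilon>"
    and "measure \<nu> {x. R < \<bar>x\<bar>} \<le> B / R powr \<epsilon>"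
proof -
  have [measurable_cong]: "sets \<nu> = sets borel" using P2D(3)[OF \<nu>] .
  interpret prob_space \<nu> using P2D(2)[OF \<nu>] .
  have Rp: "0 < R powr \<epsilon>" using R by simp
  have le: "x\<^sup>2 * indicator {x. R < \<bar>x\<bar>} x \<le> \<bar>x\<bar> powr (2 + \<epsilon>) / R powr \<epsilon>" for x :: real
  proof (cases "R < \<bar>x\<bar>")
    case True
    then have x: "0 < \<bar>x\<bar>" using R by linarith
    have "x\<^sup>2 * R powr \<epsilon> \<le> x\<^sup>2 * \<bar>x\<bar> powr \<epsilon>"
      using True R \<epsilon> by (intro mult_left_mono powr_mono2) auto
    also have "\<dots> = \<bar>x\<bar> powr (2 + \<epsilon>)"
    proof -
      have "x\<^sup>2 = \<bar>x\<bar> powr 2" using x by (simp add: powr_numeral)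
      then show ?thesis by (simp add: powr_add)
    qed
    finally show ?thesis using True Rp by (simp add: field_simps)
  qed simp
  have sq: "integrable \<nu> (\<lambda>x. x\<^sup>2 * indicator {x. R < \<bar>x\<bar>} x)"
    by (rule Bochner_Integration.integrable_bound[OF P2D(5)[OF \<nu>]]) (auto split: split_indicator)
  have "(\<integral>x. x\<^sup>2 * indicator {x. R < \<bar>x\<bar>} x \<partial>\<nu>) \<le> (\<integral>x. \<bar>x\<bar> powr (2 + \<epsilon>) / R powr \<epsilon> \<partial>\<nu>)"
    by (rule integral_mono[OF sq _ le]) (use int in simp)
  also have "\<dots> = (\<integral>x. \<bar>x\<bar> powr (2 + \<epsilon>) \<partial>\<nu>) / R powr \<epsilon>" by simp
  also have "\<dots> \<le> B / R powr \<epsilon>" using B Rp by (intro divide_right_mono) auto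
  finally show 1: "(\<integral>x. x\<^sup>2 * indicator {x. R < \<bar>x\<bar>} x \<partial>\<nu>) \<le> B / R powr \<epsilon>" .
  have "measure \<nu> {x. R < \<bar>x\<bar>} = (\<integral>x. indicator {x. R < \<bar>x\<bar>} x \<partial>\<nu>)" by simp
  also have "\<dots> \<le> (\<integral>x. x\<^sup>2 * indicator {x. R < \<bar>x\<bar>} x \<partial>\<nu>)"
  proof (rule integral_mono[OF _ sq])
    fix x :: real
    show "indicator {x. R < \<bar>x\<bar>} x \<le> x\<^sup>2 * indicator {x. R < \<bar>x\<bar>} x"
      using R power_mono[of 1 "\<bar>x\<bar>" 2] by (auto split: split_indicator)
  qed (auto simp: integrable_real_indicator less_top[symmetric])
  finally show "measure \<nu> {x. R < \<bar>x\<bar>} \<le> B / R powr \<epsilon>" using 1 by linarith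
qed

text \<open>Over a step of length \<open>\<delta> / c\<close> to either side of \<open>x\<close> the
  function \<open>F\<close> changes by at least \<open>\<delta>\<close>, so \<open>y\<close> cannot
  lie beyond. The condition \<open>\<delta> \<le> c\<close> keeps the step within the unit margin on
  which the density is bounded below by \<open>c\<close>.\<close>

lemma cdf_gap_inverse:
  assumes d: "\<And>x. (F has_real_derivative \<rho> x) (at x)" and pos: "\<And>x. 0 < \<rho> x"
    and c: "0 < c" "\<And>x. x \<in> {- R - 1..R + 1} \<Longrightarrow> c \<le> \<rho> x"
    and x: "\<bar>x\<bar> \<le> R" and \<delta>: "0 \<le> \<delta>" "\<delta> \<le> c" and close: "\<bar>F x - F y\<bar> \<le> \<delta>"
  shows "\<bar>x - y\<bar> \<le> \<delta> / c"
proof -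
  have mono: "F s < F t" if "s < t" for s t
    by (rule DERIV_pos_imp_increasing[OF that]) (use d pos in blast)
  have step: "\<delta> \<le> F t - F s" if st: "t - s = \<delta> / c" "s \<in> {- R - 1..R + 1}" "t \<in> {- R - 1..R + 1}" for s t
  proof (cases "\<delta> = 0")
    case False
    then have "s < t" using st \<delta> c(1) by (metis diff_gt_0_iff_gt divide_pos_pos order_le_less)
    then obtain z where z: "s < z" "z < t" "F t - F s = (t - s) * \<rho> z" using MVT2[of s t F \<rho>] d by blast
    have "\<delta> / c * c \<le> \<delta> / c * \<rho> z" using \<delta> c z st by (intro mult_left_mono c(2)) auto
    then show ?thesis using z st c(1) by simp
  qed (use st in simp)
  have dc: "0 \<le> \<delta> / c" "\<delta> / c \<le> 1" using \<delta> c(1) by auto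
  show ?thesis
  proof (rule ccontr)
    assume "\<not> \<bar>x - y\<bar> \<le> \<delta> / c"
    then consider "x + \<delta> / c < y" | "y < x - \<delta> / c" by linarith
    then show False
    proof cases
      case 1
      have "\<delta> \<le> F (x + \<delta> / c) - F x" using x dc by (intro step) auto
      then show False using mono[OF 1] close by linarith
    next
      case 2
      have "\<delta> \<le> F x - F (x - \<delta> / c)" using x dc by (intro step) auto
      then show False using mono[OF 2] close by linarith
    qed
  qed
qed

text \<open>At levels \<open>u\<close> with \<open>quantile (\<nu> n) u\<close> in
  \<open>{- R..R}\<close> the two quantiles are close, because the distribution functions are and
  \<open>\<mu>\<close> has positive density there. At the remaining levels the squared difference is
  controlled by tails, which the higher moment makes uniformly small.\<close>

lemma W2_tendsto_0_of_cdf: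
  fixes \<nu> :: "nat \<Rightarrow> real measure"
  assumes \<nu>: "\<And>n. \<nu> n \<in> P2" and \<mu>: "\<mu> \<in> P2" and cont: "\<And>n x. isCont (cdf (\<nu> n)) x"
    and d: "\<And>x. (cdf \<mu> has_real_derivative \<rho> x) (at x)" and \<rho>: "\<And>x. 0 < \<rho> x" "continuous_on UNIV \<rho>"
    and \<epsilon>: "0 < \<epsilon>" and int: "\<And>n. integrable (\<nu> n) (\<lambda>z. \<bar>z\<bar> powr (2 + \<epsilon>))"
    and B: "\<And>n. (\<integral>z. \<bar>z\<bar> powr (2 + \<epsilon>) \<partial>\<nu> n) \<le> B"
    and close: "\<And>\<eta>. 0 < \<eta> \<Longrightarrow> \<forall>\<^sub>F n in sequentially. \<forall>x. \<bar>cdf (\<nu> n) x - cdf \<mu> x\<bar> \<le> \<eta>"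
  shows "(\<lambda>n. W2 (\<nu> n) \<mu>) \<longlonglongrightarrow> 0"
proof -
  have main: "\<forall>\<^sub>F n in sequentially. (W2 (\<nu> n) \<mu>)\<^sup>2 < e" if e: "0 < e" for e
  proof -
    obtain M where M: "0 < M" "(\<integral>x. x\<^sup>2 * indicator {x. M < \<bar>x\<bar>} x \<partial>\<mu>) < e / 8"
      using second_moment_tail[OF \<mu>, of "e / 8"] e by auto
    \<comment> \<open>Chosen after \<open>M\<close>: when the first quantile exceeds
      \<open>R\<close> in modulus, the part of the second below \<open>M\<close> contributes
      \<open>M\<^sup>2\<close> times the probability of this event, so the tail bound has to beat
      \<open>1 + M\<^sup>2\<close>.\<close>
    define R where "R = max 1 ((max B 0 * 8 * (1 + M\<^sup>2) / e) powr (1 / \<epsilon>))"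
    have R: "1 \<le> R" unfolding R_def by simp
    have tail: "B / R powr \<epsilon> * (1 + M\<^sup>2) \<le> e / 8"
    proof -
      let ?X = "max B 0 * 8 * (1 + M\<^sup>2) / e"
      have X: "0 \<le> ?X" using e by simp
      have "y = (y powr (1 / \<epsilon>)) powr \<epsilon>" if "0 \<le> y" for y using that \<epsilon> by (simp add: powr_powr)
      from this[OF X] have "?X = (?X powr (1 / \<epsilon>)) powr \<epsilon>" .
      also have "\<dots> \<le> R powr \<epsilon>" using \<epsilon> unfolding R_def by (intro powr_mono2) auto
      finally have "max B 0 * 8 * (1 + M\<^sup>2) \<le> R powr \<epsilon> * e" using e by (simp add: field_simps)
      moreover have "B * (1 + M\<^sup>2) \<le> max B 0 * (1 + M\<^sup>2)" by (intro mult_right_mono) auto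
      ultimately have "B * (1 + M\<^sup>2) * 8 \<le> R powr \<epsilon> * e" by linarith
      then show ?thesis using R by (simp add: field_simps)
    qed
    have "compact (\<rho> ` {- R - 1..R + 1})" by (intro compact_continuous_image continuous_on_subset[OF \<rho>(2)]) auto
    moreover have "\<rho> ` {- R - 1..R + 1} \<noteq> {}" using R by auto
    ultimately obtain c' where "c' \<in> \<rho> ` {- R - 1..R + 1}" "\<And>y. y \<in> \<rho> ` {- R - 1..R + 1} \<Longrightarrow> c' \<le> y"
      using compact_attains_inf by metis
    then have c: "0 < c'" "\<And>x. x \<in> {- R - 1..R + 1} \<Longrightarrow> c' \<le> \<rho> x" using \<rho>(1) by auto
    \<comment> \<open>\<open>\<delta> / c'\<close> is at most \<open>sqrt (e / 8)\<close>; with both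
      tails the contributions add up to less than \<open>5 * e / 8\<close>.\<close>
    define \<delta> where "\<delta> = c' * min 1 (sqrt (e / 8))"
    have \<delta>: "0 < \<delta>" "\<delta> \<le> c'" "\<delta> / c' \<le> sqrt (e / 8)"
      unfolding \<delta>_def using c(1) e by (auto simp: mult_le_cancel_left1 min_def)
    show ?thesis
      using close[OF \<delta>(1)]
    proof eventually_elim
      case (elim n)
      interpret U: prob_space unit_interval by (rule prob_space_unit_interval)
      note q = integrable_quantile[OF \<nu>[of n]] integrable_quantile[OF \<mu>]
      note [measurable] = q(1,3)
      let ?X = "quantile (\<nu> n)" and ?Y = "quantile \<mu>"
      have dX: "distr unit_interval borel ?X = \<nu> n" "distr unit_interval borel ?Y = \<mu>"
        using distr_quantile P2D(1) \<nu> \<mu> by auto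
      let ?f = "\<lambda>x::real. 2 * (x\<^sup>2 * indicator {x. R < \<bar>x\<bar>} x) + 2 * M\<^sup>2 * indicator {x. R < \<bar>x\<bar>} x"
      let ?g = "\<lambda>y::real. 2 * (y\<^sup>2 * indicator {y. M < \<bar>y\<bar>} y)"
      have pt: "(?X u - ?Y u)\<^sup>2 \<le> e / 8 + ?f (?X u) + ?g (?Y u)" if u: "u \<in> space unit_interval" for u
      proof (cases "R < \<bar>?X u\<bar>")
        case False
        have "cdf (\<nu> n) (?X u) = u" "cdf \<mu> (?Y u) = u"
          using cdf_quantile[OF P2D(1)[OF \<nu>] cont] cdf_quantile[OF P2D(1)[OF \<mu>] DERIV_isCont[OF d]] u by auto
        then have "\<bar>cdf \<mu> (?X u) - cdf \<mu> (?Y u)\<bar> \<le> \<delta>" using elim by (metis abs_minus_commute)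
        then have "\<bar>?X u - ?Y u\<bar> \<le> \<delta> / c'"
          using False \<delta> by (intro cdf_gap_inverse[OF d \<rho>(1) c]) auto
        then have "\<bar>?X u - ?Y u\<bar> \<le> sqrt (e / 8)" using \<delta> by linarith
        then have "\<bar>?X u - ?Y u\<bar>\<^sup>2 \<le> (sqrt (e / 8))\<^sup>2" by (intro power_mono) auto
        then have "(?X u - ?Y u)\<^sup>2 \<le> e / 8" using e by simp
        moreover have "0 \<le> ?f (?X u) + ?g (?Y u)" by simp
        ultimately show ?thesis by linarith
      next
        case True
        have "(?X u - ?Y u)\<^sup>2 \<le> 2 * (?X u)\<^sup>2 + 2 * (?Y u)\<^sup>2"
          using zero_le_power2[of "?X u + ?Y u"] by (simp add: power2_sum power2_diff)
        also have "(?Y u)\<^sup>2 \<le> M\<^sup>2 + (?Y u)\<^sup>2 * indicator {y. M < \<bar>y\<bar>} (?Y u)"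
          using power_mono[of "\<bar>?Y u\<bar>" M 2] by (auto split: split_indicator)
        finally show ?thesis using True e by (simp add: algebra_simps)
      qed
      have [measurable_cong]: "sets (\<nu> n) = sets borel" "sets \<mu> = sets borel" using P2D(3) \<nu> \<mu> by auto
      interpret Nn: prob_space "\<nu> n" using P2D(2)[OF \<nu>] .
      have iX: "integrable (\<nu> n) (\<lambda>x. x\<^sup>2 * indicator {x. R < \<bar>x\<bar>} x)"
        by (rule Bochner_Integration.integrable_bound[OF P2D(5)[OF \<nu>[of n]]]) (auto split: split_indicator)
      have i1: "integrable (\<nu> n) (\<lambda>x. indicator {x. R < \<bar>x\<bar>} x :: real)"
        by (auto simp: integrable_real_indicator less_top[symmetric])
      have iY: "integrable \<mu> (\<lambda>x. x\<^sup>2 * indicator {x. M < \<bar>x\<bar>} x)"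
        by (rule Bochner_Integration.integrable_bound[OF P2D(5)[OF \<mu>]]) (auto split: split_indicator)
      have if': "integrable unit_interval (\<lambda>u. ?f (?X u))" "(\<integral>u. ?f (?X u) \<partial>unit_interval) = (\<integral>x. ?f x \<partial>\<nu> n)"
        using transfer_distr[OF q(1) dX(1), of ?f] iX i1 by simp_all
      have ig': "integrable unit_interval (\<lambda>u. ?g (?Y u))" "(\<integral>u. ?g (?Y u) \<partial>unit_interval) = (\<integral>x. ?g x \<partial>\<mu>)"
        using transfer_distr[OF q(3) dX(2), of ?g] iY by simp_all
      have "(W2 (\<nu> n) \<mu>)\<^sup>2 = (\<integral>u. (?X u - ?Y u)\<^sup>2 \<partial>unit_interval)"
        unfolding W2_eq_quantile[OF \<nu> \<mu>] by simp
      also have "\<dots> \<le> (\<integral>u. e / 8 + ?f (?X u) + ?g (?Y u) \<partial>unit_interval)"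
        by (rule integral_mono[OF integrable_add_L2(2)[OF q(1,3,2,4)] _ pt]) (use if' ig' in auto)
      also have "\<dots> = e / 8 + (\<integral>x. ?f x \<partial>\<nu> n) + (\<integral>x. ?g x \<partial>\<mu>)"
        using if' ig' U.prob_space by simp
      also have "(\<integral>x. ?f x \<partial>\<nu> n) = 2 * (\<integral>x. x\<^sup>2 * indicator {x. R < \<bar>x\<bar>} x \<partial>\<nu> n) + 2 * M\<^sup>2 * measure (\<nu> n) {x. R < \<bar>x\<bar>}"
        using iX i1 by simp
      also have "\<dots> \<le> 2 * (B / R powr \<epsilon>) + 2 * M\<^sup>2 * (B / R powr \<epsilon>)"
        using tails_of_higher_moment[OF \<nu> R \<epsilon> int B] by (intro add_mono mult_left_mono) auto
      also have "\<dots> = 2 * (B / R powr \<epsilon> * (1 + M\<^sup>2))" by (simp add: algebra_simps)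
      also have "(\<integral>x. ?g x \<partial>\<mu>) = 2 * (\<integral>x. x\<^sup>2 * indicator {x. M < \<bar>x\<bar>} x \<partial>\<mu>)" by simp
      finally have "(W2 (\<nu> n) \<mu>)\<^sup>2 \<le> e / 8 + 2 * (B / R powr \<epsilon> * (1 + M\<^sup>2)) + 2 * (\<integral>x. x\<^sup>2 * indicator {x. M < \<bar>x\<bar>} x \<partial>\<mu>)"
        by simp
      then show ?case using tail M e by linarith
    qed
  qed
  show ?thesis
  proof (rule tendstoI)
    fix e :: real assume e: "0 < e"
    have "\<forall>\<^sub>F n in sequentially. (W2 (\<nu> n) \<mu>)\<^sup>2 < e\<^sup>2" using e by (intro main) simp
    then show "\<forall>\<^sub>F n in sequentially. dist (W2 (\<nu> n) \<mu>) 0 < e"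
    proof eventually_elim
      case (elim n)
      then show ?case using W2_nonneg[OF \<nu>[of n] \<mu>] e power2_less_imp_less[of "W2 (\<nu> n) \<mu>" e] by simp
    qed
  qed
qed

section \<open>Comparison of an almost stationary measure with its Gibbs reference\<close>

context normalized_stationary
begin

text \<open>On \<open>{- R..R}\<close> the relative density differs from \<open>h 0\<close> by at
  most \<open>K * sqrt M\<close>. Both measures give this interval mass at least
  \<open>1 - \<theta>\<close>, hence at least \<open>1 / 2\<close>, so \<open>h 0\<close> differs
  from \<open>1\<close> by at most \<open>2 * (K * sqrt M) + 2 * \<theta>\<close>. One more
  oscillation and one more tail produce the factors \<open>3\<close>.\<close>

lemma cdf_close:
  assumes R: "0 \<le> R" and M: "0 \<le> M" "\<And>z. z \<in> {- R..R + 1} \<Longrightarrow> exp (2 * V z) \<le> M"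
    and tail: "measure \<nu> {x. R < \<bar>x\<bar>} \<le> \<theta>" "measure \<mu> {x. R < \<bar>x\<bar>} \<le> \<theta>" and \<theta>: "\<theta> \<le> 1 / 2"
  shows "\<bar>cdf \<nu> x - cdf \<mu> x\<bar> \<le> 3 * (K * sqrt M) + 3 * \<theta>"
proof -
  interpret s: real_distribution \<mu> by (rule real_distribution_\<mu>)
  define \<kappa> where "\<kappa> = K * sqrt M"
  have \<kappa>: "0 \<le> \<kappa>" unfolding \<kappa>_def using K_nonneg M by simp
  let ?B = "{- R..R}"
  have near: "\<bar>measure \<nu> A - h 0 * measure \<mu> A\<bar> \<le> \<kappa>" if A: "A \<in> sets borel" "A \<subseteq> ?B" for A
  proof -
    note [measurable] = A(1)
    have m: "(\<lambda>x. indicator A x :: real) \<in> borel_measurable borel" by measurable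
    have i\<nu>: "integrable \<nu> (\<lambda>x. indicator A x :: real)" "integrable \<mu> (\<lambda>x. indicator A x :: real)"
      using A(1) by (auto simp: integrable_real_indicator less_top[symmetric])
    note i = i\<nu>[unfolded integral_\<nu>_density(1)[OF m] integral_\<mu>_density[OF m]]
    have e\<mu>: "measure \<mu> A = (\<integral>x. exp (- V x) * indicator A x \<partial>lborel)"
      using density_real(2)[OF measurable_densities(2) m] A(1) by (simp add: \<mu>_def[symmetric])
    let ?d = "\<lambda>x. h x * exp (- V x) * indicator A x - h 0 * (exp (- V x) * indicator A x)"
    have id: "integrable lborel ?d" by (intro Bochner_Integration.integrable_diff integrable_mult_right i)
    have "measure \<nu> A - h 0 * measure \<mu> A = (\<integral>x. h x * exp (- V x) * indicator A x \<partial>lborel) - h 0 * (\<integral>x. exp (- V x) * indicator A x \<partial>lborel)"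
      unfolding e\<mu>[symmetric] integral_\<nu>_density(2)[OF m, symmetric] using A(1) by simp
    also have "\<dots> = (\<integral>x. ?d x \<partial>lborel)"
      by (subst Bochner_Integration.integral_diff[OF i(1) integrable_mult_right[OF i(2)]])
         (simp only: integral_mult_right_zero)
    finally have eq: "measure \<nu> A - h 0 * measure \<mu> A = (\<integral>x. ?d x \<partial>lborel)" .
    have "\<bar>measure \<nu> A - h 0 * measure \<mu> A\<bar> \<le> (\<integral>x. \<bar>?d x\<bar> \<partial>lborel)"
      unfolding eq by (rule integral_abs_bound)
    also have "\<dots> \<le> (\<integral>x. \<kappa> * (exp (- V x) * indicator A x) \<partial>lborel)"
    proof (rule integral_mono[OF integrable_abs[OF id] integrable_mult_right[OF i(2)]])
      fix x
      have "\<bar>h x - h 0\<bar> \<le> \<kappa>" if "x \<in> A"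
      proof -
        have "x \<in> {- R..R}" "0 \<in> {- R..R}" using subsetD[OF A(2) that] R by auto
        then show ?thesis unfolding \<kappa>_def by (rule h_oscillation[OF _ _ M])
      qed
      then have 1: "\<bar>h x - h 0\<bar> * (exp (- V x) * indicator A x) \<le> \<kappa> * (exp (- V x) * indicator A x)"
        by (cases "x \<in> A") (auto intro!: mult_right_mono)
      have 2: "?d x = (h x - h 0) * (exp (- V x) * indicator A x)"
        by (simp only: left_diff_distrib mult.assoc)
      show "\<bar>?d x\<bar> \<le> \<kappa> * (exp (- V x) * indicator A x)"
        unfolding 2 abs_mult using 1 by simp
    qed
    also have "\<dots> = \<kappa> * measure \<mu> A" unfolding e\<mu> by (rule integral_mult_right_zero)
    also have "\<dots> \<le> \<kappa> * 1" using \<kappa> s.prob_le_1 by (intro mult_left_mono) auto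
    finally show ?thesis by simp
  qed
  have compl: "- ?B = {x. R < \<bar>x\<bar>}" by auto
  have B\<nu>: "1 - \<theta> \<le> measure \<nu> ?B" "measure \<nu> ?B \<le> 1"
    using prob_compl[of ?B] tail compl by (auto simp: Compl_eq_Diff_UNIV)
  have B\<mu>: "1 - \<theta> \<le> measure \<mu> ?B" "measure \<mu> ?B \<le> 1"
    using s.prob_compl[of ?B] tail compl by (auto simp: Compl_eq_Diff_UNIV)
  have h0: "\<bar>h 0 - 1\<bar> \<le> 2 * \<kappa> + 2 * \<theta>"
  proof -
    have "\<bar>measure \<nu> ?B - h 0 * measure \<mu> ?B\<bar> \<le> \<kappa>" by (rule near) auto
    then have "\<bar>h 0 * measure \<mu> ?B - measure \<mu> ?B\<bar> \<le> \<kappa> + \<theta>" using B\<nu> B\<mu> by linarith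
    moreover have "\<bar>h 0 * measure \<mu> ?B - measure \<mu> ?B\<bar> = \<bar>h 0 - 1\<bar> * measure \<mu> ?B"
      by (simp add: left_diff_distrib[of "h 0" 1, simplified, symmetric] abs_mult)
    moreover have "\<bar>h 0 - 1\<bar> * (1 / 2) \<le> \<bar>h 0 - 1\<bar> * measure \<mu> ?B"
      using B\<mu> \<theta> by (intro mult_left_mono) auto
    ultimately have "\<bar>h 0 - 1\<bar> * (1 / 2) \<le> \<kappa> + \<theta>" by (metis order.trans)
    then show ?thesis by simp
  qed
  let ?A = "{..x} \<inter> ?B"
  have "\<bar>measure \<nu> ?A - h 0 * measure \<mu> ?A\<bar> \<le> \<kappa>" by (rule near) auto
  moreover have "\<bar>h 0 * measure \<mu> ?A - measure \<mu> ?A\<bar> \<le> 2 * \<kappa> + 2 * \<theta>"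
  proof -
    have "\<bar>h 0 * measure \<mu> ?A - measure \<mu> ?A\<bar> = \<bar>h 0 - 1\<bar> * measure \<mu> ?A"
      by (simp add: left_diff_distrib[of "h 0" 1, simplified, symmetric] abs_mult)
    also have "\<dots> \<le> \<bar>h 0 - 1\<bar> * 1" using s.prob_le_1 by (intro mult_left_mono) auto
    also have "\<dots> \<le> 2 * \<kappa> + 2 * \<theta>" using h0 by simp
    finally show ?thesis .
  qed
  moreover have "cdf M x - measure M ?A \<in> {0..\<theta>}" if "real_distribution M" "measure M {x. R < \<bar>x\<bar>} \<le> \<theta>" for M
  proof -
    interpret m: real_distribution M by fact
    have "measure M {..x} = measure M (?A \<union> ({..x} - ?B))" by (rule arg_cong[of _ _ "measure M"]) auto
    also have "\<dots> = measure M ?A + measure M ({..x} - ?B)" by (rule m.finite_measure_Union) auto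
    finally have "cdf M x = measure M ?A + measure M ({..x} - ?B)" unfolding cdf_def .
    moreover have "measure M ({..x} - ?B) \<le> measure M {x. R < \<bar>x\<bar>}" by (rule m.finite_measure_mono) auto
    ultimately show ?thesis using that by auto
  qed
  from this[OF rd tail(1)] this[OF real_distribution_\<mu> tail(2)]
  have "0 \<le> cdf \<nu> x - measure \<nu> ?A" "cdf \<nu> x - measure \<nu> ?A \<le> \<theta>"
    "0 \<le> cdf \<mu> x - measure \<mu> ?A" "cdf \<mu> x - measure \<mu> ?A \<le> \<theta>" by auto
  ultimately show ?thesis unfolding \<kappa>_def[symmetric] by linarith
qed

text \<open>Jensen's inequality in the form \<open>1 - inverse (h x) \<le> ln (h x)\<close>. The
  integral of \<open>inverse (h x)\<close> against \<open>\<nu>\<close> is at most \<open>1\<close>;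
  the set where \<open>h\<close> vanishes makes it smaller.\<close>

lemma relative_entropy_nonneg:
  assumes int: "integrable \<nu> (\<lambda>x. ln (h x))"
  shows "0 \<le> (\<integral>x. ln (h x) \<partial>\<nu>)"
proof -
  have m: "(\<lambda>x. 1 - inverse (h x)) \<in> borel_measurable borel" "(\<lambda>x. inverse (h x)) \<in> borel_measurable borel" by measurable
  have one: "integrable \<mu> (\<lambda>x. 1 :: real)"
    using P2D(2)[OF \<mu>_P2, folded \<mu>_def] by (simp add: prob_space.finite_measure finite_measure.integrable_const)
  then have one': "integrable lborel (\<lambda>x. exp (- V x))" using integral_\<mu>_density[of "\<lambda>_. 1"] by simp
  have e: "(\<integral>x. exp (- V x) \<partial>lborel) = 1"
    using normalized one' by (simp add: nn_integral_eq_integral)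
  have ii: "integrable lborel (\<lambda>x. h x * exp (- V x) * inverse (h x))"
    by (rule Bochner_Integration.integrable_bound[OF one']) (use h_nonneg in \<open>auto simp: divide_simps\<close>)
  then have inv: "integrable \<nu> (\<lambda>x. inverse (h x))" using integral_\<nu>_density(1)[OF m(2)] by simp
  have "(\<integral>x. inverse (h x) \<partial>\<nu>) \<le> 1"
    unfolding integral_\<nu>_density(2)[OF m(2)] e[symmetric]
    by (rule integral_mono[OF ii one']) (auto simp: divide_simps)
  then have "0 \<le> 1 - (\<integral>x. inverse (h x) \<partial>\<nu>)" by simp
  also have "\<dots> = (\<integral>x. 1 - inverse (h x) \<partial>\<nu>)" using inv prob_space by simp
  also have "\<dots> \<le> (\<integral>x. ln (h x) \<partial>\<nu>)"
  proof (rule integral_mono_AE)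
    have "AE x in lborel. 0 < ennreal (h x * exp (- V x)) \<longrightarrow> 0 < h x"
      using h_nonneg by (simp add: zero_less_mult_iff)
    then have "AE x in \<nu>. 0 < h x" by (subst density_h, subst AE_density) auto
    then show "AE x in \<nu>. 1 - inverse (h x) \<le> ln (h x)"
    proof eventually_elim
      case (elim x)
      then have "ln (inverse (h x)) \<le> inverse (h x) - 1" by (intro ln_le_minus_one) auto
      then show ?case using elim by (simp add: ln_inverse)
    qed
  qed (use inv int in auto)
  finally show ?thesis .
qed

end

section \<open>Tilted Gibbs measures\<close>

context confined_potential
begin

lemma potential_superquadratic: "\<exists>C. \<forall>z. A * z\<^sup>2 - C \<le> \<Psi> z"
proof -
  obtain C where C: "\<forall>z::real. A * z\<^sup>2 \<le> K * \<bar>z\<bar> powr (2 + \<epsilon>) + C" using square_le_powr[OF K_pos, of A] by blast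
  have "A * z\<^sup>2 - (C + K) \<le> \<Psi> z" for z
    using C[rule_format, of z] growth[of z] by (simp add: algebra_simps)
  then show ?thesis by blast
qed

text \<open>The growth coefficient \<open>1 / b\<close> gives
  \<open>b * \<Psi> z \<ge> z\<^sup>2 - b * C\<close>, and
  \<open>a * \<bar>z\<bar> \<le> a\<^sup>2 / 2 + z\<^sup>2 / 2\<close>, so a Gaussian dominates.
  Besides \<open>b = 1\<close> the value \<open>b = 1 / 2\<close> is used, to integrate the
  potential itself.\<close>

lemma integrable_exp_potential:
  assumes b: "0 < b"
  shows "integrable lborel (\<lambda>z. exp (a * \<bar>z\<bar> - b * \<Psi> z))"
proof -
  obtain C where C: "\<forall>z. (1 / b) * z\<^sup>2 - C \<le> \<Psi> z" using potential_superquadratic by blast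
  have "integrable lborel (\<lambda>z::real. exp (a\<^sup>2 / 2 + b * C + 1) * exp (- z\<^sup>2 / 2 - 1))"
    by (rule integrable_mult_right[OF integrable_gauss])
  then show ?thesis
  proof (rule Bochner_Integration.integrable_bound)
    show "AE z in lborel. norm (exp (a * \<bar>z\<bar> - b * \<Psi> z)) \<le> norm (exp (a\<^sup>2 / 2 + b * C + 1) * exp (- z\<^sup>2 / 2 - 1))"
    proof (rule AE_I2)
      fix z :: real
      have "b * ((1 / b) * z\<^sup>2 - C) \<le> b * \<Psi> z" using C b by (intro mult_left_mono) auto
      then have "z\<^sup>2 - b * C \<le> b * \<Psi> z" using b by (simp add: right_diff_distrib)
      moreover have "2 * (a * \<bar>z\<bar>) \<le> a\<^sup>2 + z\<^sup>2" using zero_le_power2[of "a - \<bar>z\<bar>"] by (simp add: power2_diff)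
      ultimately have "a * \<bar>z\<bar> - b * \<Psi> z \<le> (a\<^sup>2 / 2 + b * C + 1) + (- z\<^sup>2 / 2 - 1)" by simp
      then have "exp (a * \<bar>z\<bar> - b * \<Psi> z) \<le> exp ((a\<^sup>2 / 2 + b * C + 1) + (- z\<^sup>2 / 2 - 1))" by (simp only: exp_le_cancel_iff)
      then show "norm (exp (a * \<bar>z\<bar> - b * \<Psi> z)) \<le> norm (exp (a\<^sup>2 / 2 + b * C + 1) * exp (- z\<^sup>2 / 2 - 1))"
        by (simp only: real_norm_def abs_exp_cancel mult_exp_exp)
    qed
  qed measurable
qed

lemma power_le_exp: "\<bar>z\<bar> ^ k \<le> exp (real k * \<bar>z\<bar>)" for z :: real
proof -
  have "\<bar>z\<bar> \<le> exp \<bar>z\<bar>" using exp_ge_add_one_self[of "\<bar>z\<bar>"] by linarith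
  then have "\<bar>z\<bar> ^ k \<le> exp \<bar>z\<bar> ^ k" by (intro power_mono) auto
  then show ?thesis by (simp add: exp_of_nat_mult)
qed

lemma integrable_moment_exp: "integrable lborel (\<lambda>z. \<bar>z\<bar> ^ k * exp (a * \<bar>z\<bar> - \<Psi> z))"
proof (rule Bochner_Integration.integrable_bound)
  show "integrable lborel (\<lambda>z. exp ((real k + a) * \<bar>z\<bar> - 1 * \<Psi> z))" by (rule integrable_exp_potential) simp
  show "AE z in lborel. norm (\<bar>z\<bar> ^ k * exp (a * \<bar>z\<bar> - \<Psi> z)) \<le> norm (exp ((real k + a) * \<bar>z\<bar> - 1 * \<Psi> z))"
  proof (rule AE_I2)
    fix z
    have "\<bar>z\<bar> ^ k * exp (a * \<bar>z\<bar> - \<Psi> z) \<le> exp (real k * \<bar>z\<bar>) * exp (a * \<bar>z\<bar> - \<Psi> z)"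
      by (intro mult_right_mono power_le_exp) auto
    also have "\<dots> = exp ((real k + a) * \<bar>z\<bar> - 1 * \<Psi> z)" by (simp add: exp_add[symmetric] algebra_simps)
    finally show "norm (\<bar>z\<bar> ^ k * exp (a * \<bar>z\<bar> - \<Psi> z)) \<le> norm (exp ((real k + a) * \<bar>z\<bar> - 1 * \<Psi> z))"
      by (simp add: abs_mult)
  qed
qed measurable

lemma integrable_moment: "integrable lborel (\<lambda>z. z ^ k * exp (\<sigma> * z - \<Psi> z))"
proof (rule Bochner_Integration.integrable_bound[OF integrable_moment_exp[of k "\<bar>\<sigma>\<bar>"]])
  show "AE z in lborel. norm (z ^ k * exp (\<sigma> * z - \<Psi> z)) \<le> norm (\<bar>z\<bar> ^ k * exp (\<bar>\<sigma>\<bar> * \<bar>z\<bar> - \<Psi> z))"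
  proof (rule AE_I2)
    fix z
    have "\<sigma> * z \<le> \<bar>\<sigma>\<bar> * \<bar>z\<bar>" by (metis abs_ge_self abs_mult)
    then show "norm (z ^ k * exp (\<sigma> * z - \<Psi> z)) \<le> norm (\<bar>z\<bar> ^ k * exp (\<bar>\<sigma>\<bar> * \<bar>z\<bar> - \<Psi> z))"
      by (simp add: abs_mult power_abs mult_left_mono)
  qed
qed measurable

text \<open>Unnormalized: \<open>moment 0\<close> is the partition function, and differentiation in
  \<open>\<sigma>\<close> raises \<open>k\<close> by one.\<close>

definition "moment k \<sigma> = (\<integral>z. z ^ k * exp (\<sigma> * z - \<Psi> z) \<partial>lborel)"

lemma moment0_pos: "0 < moment 0 \<sigma>"
proof -
  have i: "integrable lborel (\<lambda>z. exp (\<sigma> * z - \<Psi> z))" using integrable_moment[of 0 \<sigma>] by simp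
  have "0 \<le> moment 0 \<sigma>" unfolding moment_def by (simp add: integral_nonneg_AE)
  moreover have "moment 0 \<sigma> \<noteq> 0"
  proof
    assume "moment 0 \<sigma> = 0"
    then have "AE z in lborel. exp (\<sigma> * z - \<Psi> z) = 0"
      using integral_nonneg_eq_0_iff_AE[OF i] unfolding moment_def by simp
    then show False by (simp add: AE_iff_null null_sets_def)
  qed
  ultimately show ?thesis by simp
qed

lemma phi_star_eq: "phi_star \<Psi> \<sigma> = ln (moment 0 \<sigma>)"
  unfolding phi_star_def moment_def by simp

text \<open>The constant \<open>phi_star \<Psi> \<sigma>\<close> turns
  \<open>exp (- V \<sigma> z)\<close> into a probability density, as
  \<open>normalized_stationary\<close> demands of its reference.\<close>

definition "V \<sigma> z = \<Psi> z - \<sigma> * z + phi_star \<Psi> \<sigma>"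

lemma exp_V: "exp (- V \<sigma> z) = exp (\<sigma> * z - \<Psi> z) / moment 0 \<sigma>"
  unfolding V_def phi_star_eq using moment0_pos[of \<sigma>] by (simp add: exp_diff)

lemma mu_tilted_eq: "mu_tilted \<Psi> \<sigma> = density lborel (\<lambda>z. ennreal (exp (- V \<sigma> z)))"
  unfolding mu_tilted_def V_def by (simp add: algebra_simps)

lemma V_deriv: "(V \<sigma> has_real_derivative \<Psi>' z - \<sigma>) (at z)"
  unfolding V_def[abs_def] by (auto intro!: derivative_eq_intros deriv1)

lemma measurable_V_tilt [measurable]: "V \<sigma> \<in> borel_measurable borel"
  unfolding V_def[abs_def] by measurable

lemma V_normalized: "(\<integral>\<^sup>+z. ennreal (exp (- V \<sigma> z)) \<partial>lborel) = 1"
proof -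
  have i: "integrable lborel (\<lambda>z. exp (\<sigma> * z - \<Psi> z))" using integrable_moment[of 0 \<sigma>] by simp
  have "(\<integral>\<^sup>+z. ennreal (exp (- V \<sigma> z)) \<partial>lborel) = ennreal (\<integral>z. exp (- V \<sigma> z) \<partial>lborel)"
    unfolding exp_V using i moment0_pos[of \<sigma>] by (intro nn_integral_eq_integral) (auto intro: less_imp_le)
  also have "(\<integral>z. exp (- V \<sigma> z) \<partial>lborel) = 1"
    unfolding exp_V using moment0_pos[of \<sigma>] by (simp add: moment_def)
  finally show ?thesis by simp
qed

lemma V_lower: "V \<sigma> x + (\<Psi>' x - \<sigma>) * (y - x) - L * (y - x)\<^sup>2 \<le> V \<sigma> y"
proof -
  have "\<Psi> x + \<Psi>' x * (y - x) - L * (y - x)\<^sup>2 \<le> \<Psi> y"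
    by (rule taylor_lower[OF deriv1 deriv2 L_nonneg semiconvex])
  then show ?thesis unfolding V_def by (simp add: algebra_simps)
qed

lemma tilted_integral:
  fixes f :: "real \<Rightarrow> real"
  assumes f: "f \<in> borel_measurable borel"
  shows "integrable (mu_tilted \<Psi> \<sigma>) f \<longleftrightarrow> integrable lborel (\<lambda>x. exp (- V \<sigma> x) * f x)"
    and "(\<integral>x. f x \<partial>mu_tilted \<Psi> \<sigma>) = (\<integral>x. exp (- V \<sigma> x) * f x \<partial>lborel)"
proof -
  have [measurable]: "(\<lambda>x. exp (- V \<sigma> x)) \<in> borel_measurable borel" by measurable
  show "integrable (mu_tilted \<Psi> \<sigma>) f \<longleftrightarrow> integrable lborel (\<lambda>x. exp (- V \<sigma> x) * f x)"
    unfolding mu_tilted_eq by (rule density_real(1)) (use f in auto)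
  show "(\<integral>x. f x \<partial>mu_tilted \<Psi> \<sigma>) = (\<integral>x. exp (- V \<sigma> x) * f x \<partial>lborel)"
    unfolding mu_tilted_eq by (rule density_real(2)) (use f in auto)
qed

lemma tilted_moment:
  "integrable (mu_tilted \<Psi> \<sigma>) (\<lambda>x. x ^ k)" "(\<integral>x. x ^ k \<partial>mu_tilted \<Psi> \<sigma>) = moment k \<sigma> / moment 0 \<sigma>"
proof -
  have m: "(\<lambda>x. x ^ k) \<in> borel_measurable (borel :: real measure)" by measurable
  have e: "exp (- V \<sigma> x) * x ^ k = (x ^ k * exp (\<sigma> * x - \<Psi> x)) / moment 0 \<sigma>" for x by (simp add: exp_V)
  show "integrable (mu_tilted \<Psi> \<sigma>) (\<lambda>x. x ^ k)"
    unfolding tilted_integral(1)[OF m] e using integrable_moment[of k \<sigma>] by simp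
  show "(\<integral>x. x ^ k \<partial>mu_tilted \<Psi> \<sigma>) = moment k \<sigma> / moment 0 \<sigma>"
    unfolding tilted_integral(2)[OF m] e moment_def by simp
qed

lemma mu_tilted_P2: "mu_tilted \<Psi> \<sigma> \<in> P2"
proof (rule P2I)
  show "prob_space (mu_tilted \<Psi> \<sigma>)"
    by (rule prob_spaceI) (use V_normalized in \<open>simp add: mu_tilted_eq emeasure_density\<close>)
  show "sets (mu_tilted \<Psi> \<sigma>) = sets borel" by (simp add: mu_tilted_eq)
qed (rule tilted_moment(1))

text \<open>The point is integrability of the potential: half of the exponential weight is spent on
  \<open>y / 2 \<le> exp (y / 2)\<close> for the nonnegative
  \<open>y = \<Psi> z + K\<close>.\<close>

lemma mu_tilted_energy_density: "energy_density (mu_tilted \<Psi> \<sigma>) (\<lambda>x. exp (- V \<sigma> x))"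
proof -
  have i: "integrable (mu_tilted \<Psi> \<sigma>) \<Psi>"
    unfolding tilted_integral(1)[OF measurable_potential(1)]
  proof (rule Bochner_Integration.integrable_bound)
    let ?g = "\<lambda>z. (2 * exp (K / 2) * exp (\<bar>\<sigma>\<bar> * \<bar>z\<bar> - (1 / 2) * \<Psi> z) + K * exp (\<bar>\<sigma>\<bar> * \<bar>z\<bar> - 1 * \<Psi> z)) / moment 0 \<sigma>"
    show "integrable lborel ?g"
      by (intro integrable_divide_zero Bochner_Integration.integrable_add integrable_mult_right integrable_exp_potential) auto
    show "AE z in lborel. norm (exp (- V \<sigma> z) * \<Psi> z) \<le> norm (?g z)"
    proof (rule AE_I2)
      fix z
      define y where "y = \<Psi> z + K"
      have y: "0 \<le> y" unfolding y_def using potential_lower[of z] by simp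
      have "y / 2 \<le> exp (y / 2)" using exp_ge_add_one_self[of "y / 2"] by linarith
      moreover have "\<Psi> z = y - K" unfolding y_def by simp
      ultimately have "\<bar>\<Psi> z\<bar> \<le> 2 * exp (y / 2) + K" using y K_pos exp_ge_zero[of "y / 2"] by linarith
      then have "exp (\<bar>\<sigma>\<bar> * \<bar>z\<bar> - \<Psi> z) * \<bar>\<Psi> z\<bar> \<le> exp (\<bar>\<sigma>\<bar> * \<bar>z\<bar> - \<Psi> z) * (2 * exp (y / 2) + K)"
        by (intro mult_left_mono) auto
      also have "\<dots> = 2 * exp (K / 2) * exp (\<bar>\<sigma>\<bar> * \<bar>z\<bar> - (1 / 2) * \<Psi> z) + K * exp (\<bar>\<sigma>\<bar> * \<bar>z\<bar> - 1 * \<Psi> z)"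
      proof -
        have "exp (\<bar>\<sigma>\<bar> * \<bar>z\<bar> - \<Psi> z) * exp (y / 2) = exp (K / 2) * exp (\<bar>\<sigma>\<bar> * \<bar>z\<bar> - (1 / 2) * \<Psi> z)"
          unfolding y_def exp_add[symmetric] by (rule arg_cong[of _ _ exp]) (simp add: field_simps)
        then show ?thesis by (simp add: algebra_simps)
      qed
      finally have 1: "exp (\<bar>\<sigma>\<bar> * \<bar>z\<bar> - \<Psi> z) * \<bar>\<Psi> z\<bar> \<le> \<dots>" .
      have "\<sigma> * z \<le> \<bar>\<sigma>\<bar> * \<bar>z\<bar>" by (metis abs_ge_self abs_mult)
      then have "exp (\<sigma> * z - \<Psi> z) * \<bar>\<Psi> z\<bar> \<le> exp (\<bar>\<sigma>\<bar> * \<bar>z\<bar> - \<Psi> z) * \<bar>\<Psi> z\<bar>"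
        by (intro mult_right_mono) auto
      with 1 have 2: "exp (\<sigma> * z - \<Psi> z) * \<bar>\<Psi> z\<bar>
          \<le> 2 * exp (K / 2) * exp (\<bar>\<sigma>\<bar> * \<bar>z\<bar> - (1 / 2) * \<Psi> z) + K * exp (\<bar>\<sigma>\<bar> * \<bar>z\<bar> - 1 * \<Psi> z)" by linarith
      have "norm (exp (- V \<sigma> z) * \<Psi> z) = (exp (\<sigma> * z - \<Psi> z) * \<bar>\<Psi> z\<bar>) / moment 0 \<sigma>"
        unfolding exp_V using moment0_pos[of \<sigma>] by (simp add: abs_mult)
      also have "\<dots> \<le> ?g z" using 2 moment0_pos[of \<sigma>] by (intro divide_right_mono) auto
      also have "\<dots> \<le> norm (?g z)" by (simp only: real_norm_def abs_ge_self)
      finally show "norm (exp (- V \<sigma> z) * \<Psi> z) \<le> norm (?g z)" .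
    qed
  qed measurable
  have x: "integrable (mu_tilted \<Psi> \<sigma>) (\<lambda>x. x)" using tilted_moment(1)[of \<sigma> 1] by simp
  interpret prob_space "mu_tilted \<Psi> \<sigma>" using P2D(2)[OF mu_tilted_P2] .
  have "integrable (mu_tilted \<Psi> \<sigma>) (\<lambda>z. - (\<Psi> z - \<sigma> * z + phi_star \<Psi> \<sigma>))" using i x by simp
  then have "integrable (mu_tilted \<Psi> \<sigma>) (\<lambda>z. ln (exp (- V \<sigma> z)))" unfolding V_def by simp
  then show ?thesis unfolding energy_density_def using mu_tilted_P2 mu_tilted_eq i by auto
qed

lemma free_energy_tilted:
  "FE (mu_tilted \<Psi> \<sigma>) = ereal (\<sigma> * (\<integral>x. x \<partial>mu_tilted \<Psi> \<sigma>) - phi_star \<Psi> \<sigma> - J / 2 * (\<integral>x. x \<partial>mu_tilted \<Psi> \<sigma>)\<^sup>2)"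
proof -
  note D = energy_densityD[OF mu_tilted_energy_density]
  interpret prob_space "mu_tilted \<Psi> \<sigma>" using P2D(2)[OF mu_tilted_P2] .
  have "(\<integral>z. ln (exp (- V \<sigma> z)) \<partial>mu_tilted \<Psi> \<sigma>) = (\<integral>z. - \<Psi> z + \<sigma> * z - phi_star \<Psi> \<sigma> \<partial>mu_tilted \<Psi> \<sigma>)"
    unfolding V_def by (intro Bochner_Integration.integral_cong) auto
  also have "\<dots> = - (\<integral>z. \<Psi> z \<partial>mu_tilted \<Psi> \<sigma>) + \<sigma> * (\<integral>z. z \<partial>mu_tilted \<Psi> \<sigma>) - phi_star \<Psi> \<sigma>"
    using D(6) P2D(6)[OF mu_tilted_P2] prob_space by simp
  finally show ?thesis unfolding free_energy_eq[OF mu_tilted_energy_density] by simp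
qed

text \<open>The first variation at \<open>\<nu>\<close> has the drift \<open>\<Psi>' x\<close> minus
  \<open>J\<close> times the mean. Replacing this constant by \<open>\<sigma>\<close> adds a
  constant force, whose work is at most its modulus times the \<open>L2\<close> norm of
  \<open>\<xi>\<close>. A whole sequence of measures can thus be compared with one fixed
  tilt.\<close>

lemma normalized_stationary_tilt:
  assumes e: "energy_density \<nu> \<rho>" and slope: "metric_slope FE \<nu> \<le> ereal \<kappa>" "0 \<le> \<kappa>"
  shows "normalized_stationary (V \<sigma>) (\<lambda>x. \<Psi>' x - \<sigma>) \<nu> (\<kappa> + \<bar>\<sigma> - J * (\<integral>x. x \<partial>\<nu>)\<bar>) L"
proof -
  note D = energy_densityD[OF e]
  interpret prob_space \<nu> using P2D(2)[OF D(1)] .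
  have [measurable_cong]: "sets \<nu> = sets borel" using P2D(3)[OF D(1)] .
  let ?m = "\<integral>x. x \<partial>\<nu>"
  have test: "(\<integral>x. \<xi>' x - (\<Psi>' x - \<sigma>) * \<xi> x \<partial>\<nu>) \<le> (\<kappa> + \<bar>\<sigma> - J * ?m\<bar>) * sqrt (\<integral>x. (\<xi> x)\<^sup>2 \<partial>\<nu>)"
    if tf: "test_function \<xi> \<xi>'" for \<xi> \<xi>'
  proof -
    obtain R B where RB: "continuous_on UNIV \<xi>" "continuous_on UNIV \<xi>'"
      "\<And>x. R < \<bar>x\<bar> \<Longrightarrow> \<xi> x = 0" "\<And>x. R < \<bar>x\<bar> \<Longrightarrow> \<xi>' x = 0" "\<And>x. \<bar>\<xi> x\<bar> \<le> B" "\<And>x. \<bar>\<xi>' x\<bar> \<le> B"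
      by (rule test_functionD[OF tf]) blast
    have [measurable]: "\<xi> \<in> borel_measurable borel" "\<xi>' \<in> borel_measurable borel"
      using RB by (auto intro: borel_measurable_continuous_onI)
    have i\<xi>: "integrable \<nu> \<xi>" by (rule integrable_const_bound[of _ B]) (use RB in auto)
    have i\<xi>2: "integrable \<nu> (\<lambda>x. (\<xi> x)\<^sup>2)"
    proof (rule integrable_const_bound[of _ "B\<^sup>2"])
      show "AE x in \<nu>. norm ((\<xi> x)\<^sup>2) \<le> B\<^sup>2"
        using power_mono[OF RB(5), of _ 2] by (auto simp: power2_abs)
    qed simp
    define g where "g x = \<xi>' x - (\<Psi>' x - J * ?m) * \<xi> x" for x
    have cg: "continuous_on UNIV g" unfolding g_def by (intro continuous_intros RB continuous_potential)
    then have [measurable]: "g \<in> borel_measurable borel" by (rule borel_measurable_continuous_onI)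
    have "bounded (g ` {- R..R})"
      by (intro compact_imp_bounded compact_continuous_image continuous_on_subset[OF cg]) auto
    then obtain G where G: "\<forall>x\<in>{- R..R}. \<bar>g x\<bar> \<le> G" unfolding bounded_iff by auto
    have "\<bar>g x\<bar> \<le> max G 0" for x
    proof (cases "R < \<bar>x\<bar>")
      case True then show ?thesis using RB by (simp add: g_def)
    next
      case False
      then have "x \<in> {- R..R}" by auto
      then show ?thesis using G by fastforce
    qed
    then have ig: "integrable \<nu> g" by (intro integrable_const_bound[of _ "max G 0"]) auto
    have "(\<integral>x. \<xi>' x - (\<Psi>' x - \<sigma>) * \<xi> x \<partial>\<nu>) = (\<integral>x. g x + (\<sigma> - J * ?m) * \<xi> x \<partial>\<nu>)"
      unfolding g_def by (intro Bochner_Integration.integral_cong) (auto simp: algebra_simps)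
    also have "\<dots> = first_variation \<nu> \<xi> \<xi>' + (\<sigma> - J * ?m) * (\<integral>x. \<xi> x \<partial>\<nu>)"
      using ig i\<xi> unfolding first_variation_def g_def[symmetric] by simp
    finally have 1: "(\<integral>x. \<xi>' x - (\<Psi>' x - \<sigma>) * \<xi> x \<partial>\<nu>) = first_variation \<nu> \<xi> \<xi>' + (\<sigma> - J * ?m) * (\<integral>x. \<xi> x \<partial>\<nu>)" .
    have 2: "first_variation \<nu> \<xi> \<xi>' \<le> \<kappa> * sqrt (\<integral>x. (\<xi> x)\<^sup>2 \<partial>\<nu>)"
      by (rule first_variation_le_slope[OF e tf slope])
    have "(\<sigma> - J * ?m) * (\<integral>x. \<xi> x \<partial>\<nu>) \<le> \<bar>\<sigma> - J * ?m\<bar> * \<bar>\<integral>x. \<xi> x \<partial>\<nu>\<bar>" by (metis abs_ge_self abs_mult)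
    also have "\<dots> \<le> \<bar>\<sigma> - J * ?m\<bar> * sqrt (\<integral>x. (\<xi> x)\<^sup>2 \<partial>\<nu>)"
      by (intro mult_left_mono expectation_le_L2(2) i\<xi>2) auto
    finally show ?thesis using 1 2 by (simp add: distrib_right)
  qed
  show ?thesis
  proof (rule normalized_stationary.intro, rule almost_stationary.intro)
    show "normalized_stationary_axioms (V \<sigma>) (\<lambda>x. \<Psi>' x - \<sigma>) \<nu> L"
      by (rule normalized_stationary_axioms.intro)
         (use V_normalized V_lower L_nonneg D(1) mu_tilted_P2 mu_tilted_eq in auto)
    show "(V \<sigma> has_real_derivative \<Psi>' x - \<sigma>) (at x)" for x by (rule V_deriv)
    show "continuous_on UNIV (\<lambda>x. \<Psi>' x - \<sigma>)" by (intro continuous_intros continuous_potential)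
    show "real_distribution \<nu>" using P2D(1)[OF D(1)] .
    show "absolutely_continuous lborel \<nu>" by (subst D(4)) (intro absolutely_continuousI_density, use D(2) in simp)
    show "0 \<le> \<kappa> + \<bar>\<sigma> - J * ?m\<bar>" using slope by simp
  qed (use test in auto)
qed

text \<open>Relative to \<open>exp (- V \<sigma>)\<close> the energy becomes a relative entropy plus
  a function of the mean alone. The given density and the one built from averages agree almost
  everywhere by uniqueness of densities.\<close>

lemma free_energy_relative:
  assumes e: "energy_density \<nu> \<rho>" and ns: "normalized_stationary (V \<sigma>) (\<lambda>x. \<Psi>' x - \<sigma>) \<nu> k L"
  shows "integrable \<nu> (\<lambda>x. ln (almost_stationary.h (V \<sigma>) \<nu> x))"
    and "real_of_ereal (FE \<nu>) = (\<integral>x. ln (almost_stationary.h (V \<sigma>) \<nu> x) \<partial>\<nu>) + \<sigma> * (\<integral>x. x \<partial>\<nu>)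
       - phi_star \<Psi> \<sigma> - J / 2 * (\<integral>x. x \<partial>\<nu>)\<^sup>2"
proof -
  note D = energy_densityD[OF e]
  interpret N: normalized_stationary "V \<sigma>" "\<lambda>x. \<Psi>' x - \<sigma>" \<nu> k L by (rule ns)
  have [measurable_cong]: "sets \<nu> = sets borel" using P2D(3)[OF D(1)] .
  note [measurable] = D(2)
  have "density lborel (\<lambda>x. ennreal (\<rho> x)) = density lborel (\<lambda>x. ennreal (N.h x * exp (- V \<sigma> x)))"
    using D(4) N.density_h by simp
  then have "AE x in lborel. ennreal (\<rho> x) = ennreal (N.h x * exp (- V \<sigma> x))"
    by (subst (asm) sigma_finite_measure.density_unique_iff[OF sigma_finite_lborel, symmetric, THEN sym])
       auto
  then have ae: "AE x in lborel. \<rho> x = N.h x * exp (- V \<sigma> x)"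
    by eventually_elim (use D(3) N.h_nonneg in \<open>subst (asm) ennreal_inj, auto\<close>)
  have "AE x in lborel. 0 < ennreal (\<rho> x) \<longrightarrow> ln (N.h x) = ln (\<rho> x) + V \<sigma> x"
    using ae
  proof eventually_elim
    case (elim x)
    show ?case
    proof
      assume "0 < ennreal (\<rho> x)"
      then have p: "0 < N.h x" using elim N.h_nonneg[of x] by (auto simp: zero_less_mult_iff)
      have "N.h x = \<rho> x * exp (V \<sigma> x)" unfolding elim by (simp add: exp_minus)
      moreover have "0 < \<rho> x" unfolding elim using p by simp
      ultimately show "ln (N.h x) = ln (\<rho> x) + V \<sigma> x" by (simp add: ln_mult)
    qed
  qed
  then have ae\<nu>: "AE x in \<nu>. ln (\<rho> x) + V \<sigma> x = ln (N.h x)"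
    by (subst D(4), subst AE_density) auto
  have i: "integrable \<nu> (\<lambda>x. ln (\<rho> x) + V \<sigma> x)"
    unfolding V_def using D(5,6) P2D(6)[OF D(1)] by simp
  show "integrable \<nu> (\<lambda>x. ln (N.h x))" by (rule integrable_cong_AE_imp[OF i]) (use ae\<nu> in auto)
  have "(\<integral>x. ln (N.h x) \<partial>\<nu>) = (\<integral>x. ln (\<rho> x) + V \<sigma> x \<partial>\<nu>)"
    by (rule integral_cong_AE) (use ae\<nu> in auto)
  also have "\<dots> = (\<integral>x. ln (\<rho> x) \<partial>\<nu>) + (\<integral>x. \<Psi> x \<partial>\<nu>) - \<sigma> * (\<integral>x. x \<partial>\<nu>) + phi_star \<Psi> \<sigma>"
    unfolding V_def using D(5,6) P2D(6)[OF D(1)] N.prob_space by simp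
  finally show "real_of_ereal (FE \<nu>) = (\<integral>x. ln (N.h x) \<partial>\<nu>) + \<sigma> * (\<integral>x. x \<partial>\<nu>)
       - phi_star \<Psi> \<sigma> - J / 2 * (\<integral>x. x \<partial>\<nu>)\<^sup>2"
    unfolding free_energy_eq[OF e] by simp
qed

text \<open>Of the means only convergence is assumed; that the limit \<open>m\<close> is the mean of
  the measure tilted by \<open>J * m\<close> comes out of the convergence in
  \<open>W2\<close>.\<close>

theorem almost_critical_tendsto:
  fixes \<nu> :: "nat \<Rightarrow> real measure"
  assumes e: "\<And>n. energy_density (\<nu> n) (\<rho> n)" and bnd: "\<And>n. real_of_ereal (FE (\<nu> n)) \<le> E"
    and slope: "\<And>n. metric_slope FE (\<nu> n) \<le> ereal (\<kappa> n)" "\<And>n. 0 \<le> \<kappa> n" and \<kappa>: "\<kappa> \<longlonglongrightarrow> 0"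
    and m: "(\<lambda>n. \<integral>x. x \<partial>\<nu> n) \<longlonglongrightarrow> m"
  shows "(\<lambda>n. W2 (\<nu> n) (mu_tilted \<Psi> (J * m))) \<longlonglongrightarrow> 0"
    and "(\<integral>x. x \<partial>mu_tilted \<Psi> (J * m)) = m"
    and "(\<lambda>n. FE (\<nu> n)) \<longlonglongrightarrow> FE (mu_tilted \<Psi> (J * m))"
proof -
  define \<sigma> where "\<sigma> = J * m"
  define \<mu> where "\<mu> = mu_tilted \<Psi> \<sigma>"
  \<comment> \<open>The defect relative to the fixed tilt, slope plus mismatch of the means; both
    parts vanish in the limit.\<close>
  define K' where "K' n = \<kappa> n + \<bar>\<sigma> - J * (\<integral>x. x \<partial>\<nu> n)\<bar>" for n
  have ns: "normalized_stationary (V \<sigma>) (\<lambda>x. \<Psi>' x - \<sigma>) (\<nu> n) (K' n) L" for n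
    unfolding K'_def by (rule normalized_stationary_tilt[OF e slope])
  have as: "almost_stationary (V \<sigma>) (\<lambda>x. \<Psi>' x - \<sigma>) (\<nu> n) (K' n)" for n
    using ns[of n] by (rule normalized_stationary.axioms(1))
  have K'0: "0 \<le> K' n" for n unfolding K'_def using slope(2)[of n] by simp
  have "(\<lambda>n. \<kappa> n + \<bar>\<sigma> - J * (\<integral>x. x \<partial>\<nu> n)\<bar>) \<longlonglongrightarrow> 0 + \<bar>\<sigma> - J * m\<bar>"
    by (intro tendsto_intros \<kappa> m)
  then have K': "K' \<longlonglongrightarrow> 0" unfolding K'_def[abs_def] \<sigma>_def by simp
  have N\<mu>: "normalized_stationary.\<mu> (V \<sigma>) = \<mu>"
    using normalized_stationary.\<mu>_def[OF ns[of 0]] unfolding \<mu>_def mu_tilted_eq .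
  note D = energy_densityD[OF e]
  have \<mu>P2: "\<mu> \<in> P2" unfolding \<mu>_def by (rule mu_tilted_P2)
  obtain c1 c2 where c: "0 < c1"
    "\<And>\<nu> \<rho>. energy_density \<nu> \<rho> \<Longrightarrow> integrable \<nu> (\<lambda>z. \<bar>z\<bar> powr (2 + \<epsilon>)) \<and>
       c1 * (\<integral>z. \<bar>z\<bar> powr (2 + \<epsilon>) \<partial>\<nu>) - c2 \<le> real_of_ereal (FE \<nu>)" using moment_bound by metis
  have im: "integrable (\<nu> n) (\<lambda>z. \<bar>z\<bar> powr (2 + \<epsilon>))" for n using c(2)[OF e] by simp
  have im\<mu>: "integrable \<mu> (\<lambda>z. \<bar>z\<bar> powr (2 + \<epsilon>))" unfolding \<mu>_def using c(2)[OF mu_tilted_energy_density] by simp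
  define B where "B = max ((E + c2) / c1) (\<integral>z. \<bar>z\<bar> powr (2 + \<epsilon>) \<partial>\<mu>)"
  have B: "(\<integral>z. \<bar>z\<bar> powr (2 + \<epsilon>) \<partial>\<nu> n) \<le> B" "(\<integral>z. \<bar>z\<bar> powr (2 + \<epsilon>) \<partial>\<mu>) \<le> B" for n
  proof -
    have "c1 * (\<integral>z. \<bar>z\<bar> powr (2 + \<epsilon>) \<partial>\<nu> n) \<le> E + c2" using c(2)[OF e[of n]] bnd[of n] by linarith
    then have "(\<integral>z. \<bar>z\<bar> powr (2 + \<epsilon>) \<partial>\<nu> n) \<le> (E + c2) / c1" using c(1) by (simp add: field_simps)
    then show "(\<integral>z. \<bar>z\<bar> powr (2 + \<epsilon>) \<partial>\<nu> n) \<le> B" "(\<integral>z. \<bar>z\<bar> powr (2 + \<epsilon>) \<partial>\<mu>) \<le> B" unfolding B_def by auto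
  qed
  have cdf_close: "\<forall>\<^sub>F n in sequentially. \<forall>x. \<bar>cdf (\<nu> n) x - cdf \<mu> x\<bar> \<le> \<eta>" if \<eta>: "0 < \<eta>" for \<eta>
  proof -
    \<comment> \<open>Tail and oscillation are both kept to \<open>\<eta> / 6\<close>, since
      \<open>cdf_close\<close> multiplies each by \<open>3\<close>; the bound \<open>1 / 2\<close>
      is its hypothesis on the tail.\<close>
    define \<theta> where "\<theta> = min (1 / 2) (\<eta> / 6)"
    have \<theta>: "0 < \<theta>" "\<theta> \<le> 1 / 2" "\<theta> \<le> \<eta> / 6" unfolding \<theta>_def using \<eta> by auto
    define R where "R = max 1 ((max B 0 / \<theta>) powr (1 / \<epsilon>))"
    have R: "1 \<le> R" unfolding R_def by simp
    have BR: "B / R powr \<epsilon> \<le> \<theta>"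
    proof -
      have pw: "y = (y powr (1 / \<epsilon>)) powr \<epsilon>" if "0 \<le> y" for y using that \<epsilon>_pos by (simp add: powr_powr)
      have X: "0 \<le> max B 0 / \<theta>" using \<theta> by simp
      have "max B 0 / \<theta> = ((max B 0 / \<theta>) powr (1 / \<epsilon>)) powr \<epsilon>" by (rule pw[OF X])
      also have "\<dots> \<le> R powr \<epsilon>" using \<epsilon>_pos unfolding R_def by (intro powr_mono2) auto
      finally have "max B 0 \<le> R powr \<epsilon> * \<theta>" using \<theta> by (simp add: field_simps)
      then have "B \<le> R powr \<epsilon> * \<theta>" by simp
      then show ?thesis using R by (simp add: field_simps)
    qed
    have t\<nu>: "measure (\<nu> n) {x. R < \<bar>x\<bar>} \<le> \<theta>" for n
      using tails_of_higher_moment(2)[OF D(1)[of n] R \<epsilon>_pos im B(1)] BR by linarith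
    have t\<mu>: "measure \<mu> {x. R < \<bar>x\<bar>} \<le> \<theta>"
      using tails_of_higher_moment(2)[OF \<mu>P2 R \<epsilon>_pos im\<mu> B(2)] BR by linarith
    obtain M where M: "0 \<le> M" "\<forall>z\<in>{- R..R + 1}. exp (2 * V \<sigma> z) \<le> M"
      using almost_stationary.exp_2V_bounded[OF as[of 0]] by blast
    have "(\<lambda>n. K' n * sqrt M) \<longlonglongrightarrow> 0 * sqrt M" by (intro tendsto_intros K')
    then have "\<forall>\<^sub>F n in sequentially. K' n * sqrt M < \<eta> / 6" using \<eta> by (intro order_tendstoD(2)) auto
    then show ?thesis
    proof eventually_elim
      case (elim n)
      show ?case
      proof
        fix x
        have "\<bar>cdf (\<nu> n) x - cdf \<mu> x\<bar> \<le> 3 * (K' n * sqrt M) + 3 * \<theta>"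
          using normalized_stationary.cdf_close[OF ns[of n], of R M \<theta> x] R M t\<nu> t\<mu> \<theta> unfolding N\<mu> by auto
        then show "\<bar>cdf (\<nu> n) x - cdf \<mu> x\<bar> \<le> \<eta>" using elim \<theta> by linarith
      qed
    qed
  qed
  have d\<mu>: "(cdf \<mu> has_real_derivative exp (- V \<sigma> x)) (at x)" for x
    using normalized_stationary.cdf_\<mu>_deriv[OF ns[of 0]] unfolding N\<mu> .
  have cV: "continuous_on UNIV (\<lambda>x. exp (- V \<sigma> x))"
    by (intro continuous_intros almost_stationary.contV[OF as[of 0]])
  have W: "(\<lambda>n. W2 (\<nu> n) \<mu>) \<longlonglongrightarrow> 0"
    by (rule W2_tendsto_0_of_cdf[OF D(1) \<mu>P2 almost_stationary.cdf_continuous[OF as] d\<mu> _ cV \<epsilon>_pos im B(1) cdf_close]) auto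
  then show "(\<lambda>n. W2 (\<nu> n) (mu_tilted \<Psi> (J * m))) \<longlonglongrightarrow> 0" unfolding \<mu>_def \<sigma>_def .
  \<comment> \<open>The means converge to \<open>m\<close> by assumption and to the mean of
    \<open>\<mu>\<close> by convergence in \<open>W2\<close>.\<close>
  have mean: "(\<integral>x. x \<partial>\<mu>) = m"
  proof -
    have "(\<lambda>n. (\<integral>x. x \<partial>\<nu> n) - (\<integral>x. x \<partial>\<mu>)) \<longlonglongrightarrow> 0"
      by (rule Lim_null_comparison[OF _ W]) (use mean_diff_le_W2[OF D(1) \<mu>P2] in simp)
    moreover have "(\<lambda>n. (\<integral>x. x \<partial>\<nu> n) - (\<integral>x. x \<partial>\<mu>)) \<longlonglongrightarrow> m - (\<integral>x. x \<partial>\<mu>)" by (intro tendsto_intros m)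
    ultimately have "m - (\<integral>x. x \<partial>\<mu>) = 0" by (rule LIMSEQ_unique[symmetric])
    then show ?thesis by simp
  qed
  then show "(\<integral>x. x \<partial>mu_tilted \<Psi> (J * m)) = m" unfolding \<mu>_def \<sigma>_def .
  define mx where "mx n = normalized_stationary.mix (V \<sigma>) (\<nu> n)" for n
  define H where "H n = (\<integral>x. ln (almost_stationary.h (V \<sigma>) (\<nu> n) x) \<partial>\<nu> n)" for n
  have mxP2: "mx n \<in> P2" for n unfolding mx_def by (rule normalized_stationary.mix_P2[OF ns])
  have cmx: "cdf (mx n) x = (cdf (\<nu> n) x + cdf \<mu> x) / 2" for n x
    unfolding mx_def using normalized_stationary.cdf_mix[OF ns[of n]] unfolding N\<mu> .
  \<comment> \<open>\<open>relative_entropy_le\<close> involves the distance of the mixture from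
    \<open>\<mu>\<close>. The same criterion applies to it, because its distribution function lies
    halfway between the other two.\<close>
  have Wm: "(\<lambda>n. W2 (mx n) \<mu>) \<longlonglongrightarrow> 0"
  proof (rule W2_tendsto_0_of_cdf[OF mxP2 \<mu>P2 _ d\<mu> _ cV \<epsilon>_pos])
    show "isCont (cdf (mx n)) x" for n x
      unfolding mx_def by (rule DERIV_isCont[OF normalized_stationary.cdf_mix_deriv[OF ns]])
    have mm: "(\<lambda>z. \<bar>z\<bar> powr (2 + \<epsilon>)) \<in> borel_measurable (borel :: real measure)" by measurable
    show i: "integrable (mx n) (\<lambda>z. \<bar>z\<bar> powr (2 + \<epsilon>))" for n
      unfolding mx_def
      by (rule normalized_stationary.integrable_mix[OF ns mm im]) (use im\<mu> N\<mu> in simp)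
    show "(\<integral>z. \<bar>z\<bar> powr (2 + \<epsilon>) \<partial>mx n) \<le> B" for n
    proof -
      interpret N: normalized_stationary "V \<sigma>" "\<lambda>x. \<Psi>' x - \<sigma>" "\<nu> n" "K' n" L by (rule ns)
      have a: "integrable lborel (\<lambda>x. N.h x * exp (- V \<sigma> x) * \<bar>x\<bar> powr (2 + \<epsilon>))"
        using im[of n] N.integral_\<nu>_density(1)[OF mm] by simp
      have b: "integrable lborel (\<lambda>x. exp (- V \<sigma> x) * \<bar>x\<bar> powr (2 + \<epsilon>))"
        using im\<mu> tilted_integral(1)[OF mm, of \<sigma>] unfolding \<mu>_def by simp
      have "(\<integral>z. \<bar>z\<bar> powr (2 + \<epsilon>) \<partial>mx n) = (\<integral>x. (1 / 2) * (N.h x * exp (- V \<sigma> x) * \<bar>x\<bar> powr (2 + \<epsilon>)) + (1 / 2) * (exp (- V \<sigma> x) * \<bar>x\<bar> powr (2 + \<epsilon>)) \<partial>lborel)"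
        unfolding mx_def N.integral_mix_density(2)[OF mm]
        by (intro Bochner_Integration.integral_cong) (auto simp: algebra_simps add_divide_distrib)
      also have "\<dots> = (1 / 2) * (\<integral>x. N.h x * exp (- V \<sigma> x) * \<bar>x\<bar> powr (2 + \<epsilon>) \<partial>lborel) + (1 / 2) * (\<integral>x. exp (- V \<sigma> x) * \<bar>x\<bar> powr (2 + \<epsilon>) \<partial>lborel)"
        by (subst Bochner_Integration.integral_add[OF integrable_mult_right[OF a] integrable_mult_right[OF b]])
           (simp only: integral_mult_right_zero)
      also have "\<dots> = (1 / 2) * (\<integral>z. \<bar>z\<bar> powr (2 + \<epsilon>) \<partial>\<nu> n) + (1 / 2) * (\<integral>z. \<bar>z\<bar> powr (2 + \<epsilon>) \<partial>\<mu>)"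
        unfolding N.integral_\<nu>_density(2)[OF mm] \<mu>_def tilted_integral(2)[OF mm] ..
      also have "\<dots> \<le> B" using B(1)[of n] B(2) by linarith
      finally show ?thesis .
    qed
    show "\<forall>\<^sub>F n in sequentially. \<forall>x. \<bar>cdf (mx n) x - cdf \<mu> x\<bar> \<le> \<eta>" if "0 < \<eta>" for \<eta>
      using cdf_close[OF that]
    proof eventually_elim
      case (elim n)
      have "\<bar>cdf (mx n) x - cdf \<mu> x\<bar> \<le> \<bar>cdf (\<nu> n) x - cdf \<mu> x\<bar>" for x
        unfolding cmx by (simp add: field_simps)
      then show ?case using elim by (meson order.trans)
    qed
  qed auto
  have H: "H \<longlonglongrightarrow> 0"
  proof (rule tendsto_sandwich)
    show "\<forall>\<^sub>F n in sequentially. 0 \<le> H n"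
      unfolding H_def
      by (intro always_eventually allI normalized_stationary.relative_entropy_nonneg[OF ns] free_energy_relative(1)[OF e ns])
    show "\<forall>\<^sub>F n in sequentially. H n \<le> 2 * (K' n * (sqrt 2 * W2 (mx n) \<mu>) + 2 * L * (W2 (mx n) \<mu>)\<^sup>2)"
      unfolding H_def mx_def N\<mu>[symmetric]
      by (intro always_eventually allI normalized_stationary.relative_entropy_le[OF ns] free_energy_relative(1)[OF e ns])
    have "(\<lambda>n. 2 * (K' n * (sqrt 2 * W2 (mx n) \<mu>) + 2 * L * (W2 (mx n) \<mu>)\<^sup>2)) \<longlonglongrightarrow> 2 * (0 * (sqrt 2 * 0) + 2 * L * 0\<^sup>2)"
      by (intro tendsto_intros K' Wm)
    then show "(\<lambda>n. 2 * (K' n * (sqrt 2 * W2 (mx n) \<mu>) + 2 * L * (W2 (mx n) \<mu>)\<^sup>2)) \<longlonglongrightarrow> 0" by simp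
  qed simp
  have FEn: "FE (\<nu> n) = ereal (H n + \<sigma> * (\<integral>x. x \<partial>\<nu> n) - phi_star \<Psi> \<sigma> - J / 2 * (\<integral>x. x \<partial>\<nu> n)\<^sup>2)" for n
    using free_energy_relative(2)[OF e ns, of n] free_energy_eq[OF e[of n]] unfolding H_def by simp
  have "(\<lambda>n. H n + \<sigma> * (\<integral>x. x \<partial>\<nu> n) - phi_star \<Psi> \<sigma> - J / 2 * (\<integral>x. x \<partial>\<nu> n)\<^sup>2)
      \<longlonglongrightarrow> 0 + \<sigma> * m - phi_star \<Psi> \<sigma> - J / 2 * m\<^sup>2"
    by (intro tendsto_intros H m)
  then have "(\<lambda>n. FE (\<nu> n)) \<longlonglongrightarrow> ereal (\<sigma> * m - phi_star \<Psi> \<sigma> - J / 2 * m\<^sup>2)"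
    unfolding FEn by simp
  also have "ereal (\<sigma> * m - phi_star \<Psi> \<sigma> - J / 2 * m\<^sup>2) = FE \<mu>"
    unfolding \<mu>_def free_energy_tilted using mean unfolding \<mu>_def by simp
  finally show "(\<lambda>n. FE (\<nu> n)) \<longlonglongrightarrow> FE (mu_tilted \<Psi> (J * m))" unfolding \<mu>_def \<sigma>_def .
qed

end

section \<open>Moments of the tilted measures\<close>

context confined_potential
begin

lemma exp_remainder: "\<bar>exp u - 1 - u\<bar> \<le> u\<^sup>2 * exp \<bar>u\<bar>" for u :: real
proof -
  obtain t where t: "\<bar>t\<bar> \<le> \<bar>u\<bar>" "exp u = (\<Sum>m<2. u ^ m / fact m) + exp t / fact 2 * u ^ 2"
    using Maclaurin_exp_le[of u 2] by blast
  have A: "exp u - 1 - u = exp t / 2 * u\<^sup>2" using t(2) by (simp add: numeral_2_eq_2)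
  have "exp t \<le> exp \<bar>u\<bar>" using t(1) by simp
  then have B: "exp t / 2 \<le> exp \<bar>u\<bar>" using exp_gt_zero[of t] by linarith
  have "exp t / 2 * u\<^sup>2 \<le> exp \<bar>u\<bar> * u\<^sup>2" by (rule mult_right_mono[OF B]) simp
  moreover have "0 \<le> exp t / 2 * u\<^sup>2" by simp
  ultimately show ?thesis unfolding A by (simp only: abs_of_nonneg mult.commute)
qed

text \<open>Differentiation under the integral with an explicit remainder:
  \<open>exp_remainder\<close> at \<open>t * z\<close> produces \<open>t\<^sup>2\<close> times an
  integrand of order \<open>k + 2\<close> with the tilt enlarged by one, which is still
  integrable.\<close>

lemma moment_deriv: "(moment k has_real_derivative moment (Suc k) \<sigma>) (at \<sigma>)"
proof -
  define D where "D = (\<integral>z. \<bar>z\<bar> ^ (k + 2) * exp ((\<bar>\<sigma>\<bar> + 1) * \<bar>z\<bar> - \<Psi> z) \<partial>lborel)"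
  have bound: "\<bar>(moment k (\<sigma> + t) - moment k \<sigma>) / t - moment (Suc k) \<sigma>\<bar> \<le> \<bar>t\<bar> * D" if t: "t \<noteq> 0" "\<bar>t\<bar> < 1" for t
  proof -
    let ?r = "\<lambda>z. z ^ k * exp ((\<sigma> + t) * z - \<Psi> z) - z ^ k * exp (\<sigma> * z - \<Psi> z) - t * (z ^ Suc k * exp (\<sigma> * z - \<Psi> z))"
    have ir: "integrable lborel ?r"
      by (intro Bochner_Integration.integrable_diff integrable_mult_right integrable_moment)
    have eq: "moment k (\<sigma> + t) - moment k \<sigma> - t * moment (Suc k) \<sigma> = (\<integral>z. ?r z \<partial>lborel)"
      unfolding moment_def
      by (subst Bochner_Integration.integral_diff[OF Bochner_Integration.integrable_diff[OF integrable_moment integrable_moment] integrable_mult_right[OF integrable_moment]],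
          subst Bochner_Integration.integral_diff[OF integrable_moment integrable_moment],
          subst integral_mult_right_zero, rule refl)
    have "\<bar>\<integral>z. ?r z \<partial>lborel\<bar> \<le> (\<integral>z. \<bar>?r z\<bar> \<partial>lborel)" by (rule integral_abs_bound)
    moreover have "(\<integral>z. \<bar>?r z\<bar> \<partial>lborel) \<le> (\<integral>z. t\<^sup>2 * (\<bar>z\<bar> ^ (k + 2) * exp ((\<bar>\<sigma>\<bar> + 1) * \<bar>z\<bar> - \<Psi> z)) \<partial>lborel)"
    proof (rule integral_mono[OF integrable_abs[OF ir] integrable_mult_right[OF integrable_moment_exp]])
      fix z
      have e: "?r z = z ^ k * exp (\<sigma> * z - \<Psi> z) * (exp (t * z) - 1 - t * z)"
      proof -
        have "exp ((\<sigma> + t) * z - \<Psi> z) = exp (\<sigma> * z - \<Psi> z) * exp (t * z)"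
          unfolding mult_exp_exp by (rule arg_cong[of _ _ exp]) (simp add: algebra_simps)
        then show ?thesis by (simp add: algebra_simps)
      qed
      have "\<bar>?r z\<bar> = \<bar>z\<bar> ^ k * exp (\<sigma> * z - \<Psi> z) * \<bar>exp (t * z) - 1 - t * z\<bar>"
        unfolding e by (simp add: abs_mult power_abs)
      also have "\<dots> \<le> \<bar>z\<bar> ^ k * exp (\<bar>\<sigma>\<bar> * \<bar>z\<bar> - \<Psi> z) * ((t * z)\<^sup>2 * exp \<bar>z\<bar>)"
      proof (intro mult_mono)
        have "\<sigma> * z \<le> \<bar>\<sigma>\<bar> * \<bar>z\<bar>" by (metis abs_ge_self abs_mult)
        then show "exp (\<sigma> * z - \<Psi> z) \<le> exp (\<bar>\<sigma>\<bar> * \<bar>z\<bar> - \<Psi> z)" by simp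
        have "\<bar>t * z\<bar> \<le> \<bar>z\<bar>" using t by (simp add: abs_mult mult_left_le_one_le)
        then have "(t * z)\<^sup>2 * exp \<bar>t * z\<bar> \<le> (t * z)\<^sup>2 * exp \<bar>z\<bar>" by (intro mult_left_mono) auto
        then show "\<bar>exp (t * z) - 1 - t * z\<bar> \<le> (t * z)\<^sup>2 * exp \<bar>z\<bar>" using exp_remainder[of "t * z"] by linarith
      qed auto
      also have "\<dots> = t\<^sup>2 * (\<bar>z\<bar> ^ (k + 2) * exp ((\<bar>\<sigma>\<bar> + 1) * \<bar>z\<bar> - \<Psi> z))"
      proof -
        have 1: "exp ((\<bar>\<sigma>\<bar> + 1) * \<bar>z\<bar> - \<Psi> z) = exp (\<bar>\<sigma>\<bar> * \<bar>z\<bar> - \<Psi> z) * exp \<bar>z\<bar>"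
          unfolding mult_exp_exp by (rule arg_cong[of _ _ exp]) (simp add: algebra_simps)
        have 2: "\<bar>z\<bar> ^ (k + 2) = \<bar>z\<bar> ^ k * z\<^sup>2" unfolding power_add power2_abs ..
        show ?thesis unfolding 1 2 power_mult_distrib by (simp only: ac_simps)
      qed
      finally show "\<bar>?r z\<bar> \<le> t\<^sup>2 * (\<bar>z\<bar> ^ (k + 2) * exp ((\<bar>\<sigma>\<bar> + 1) * \<bar>z\<bar> - \<Psi> z))" .
    qed
    moreover have "(\<integral>z. t\<^sup>2 * (\<bar>z\<bar> ^ (k + 2) * exp ((\<bar>\<sigma>\<bar> + 1) * \<bar>z\<bar> - \<Psi> z)) \<partial>lborel) = t\<^sup>2 * D"
      unfolding D_def by (rule integral_mult_right_zero)
    ultimately have "\<bar>moment k (\<sigma> + t) - moment k \<sigma> - t * moment (Suc k) \<sigma>\<bar> \<le> t\<^sup>2 * D" unfolding eq by linarith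
    then have "\<bar>moment k (\<sigma> + t) - moment k \<sigma> - t * moment (Suc k) \<sigma>\<bar> / \<bar>t\<bar> \<le> t\<^sup>2 * D / \<bar>t\<bar>" by (intro divide_right_mono) auto
    also have "t\<^sup>2 * D / \<bar>t\<bar> = \<bar>t\<bar> * D" using t by (simp add: power2_eq_square abs_if)
    finally have "\<bar>moment k (\<sigma> + t) - moment k \<sigma> - t * moment (Suc k) \<sigma>\<bar> / \<bar>t\<bar> \<le> \<bar>t\<bar> * D" .
    moreover have "(moment k (\<sigma> + t) - moment k \<sigma>) / t - moment (Suc k) \<sigma> = (moment k (\<sigma> + t) - moment k \<sigma> - t * moment (Suc k) \<sigma>) / t"
      using t by (simp add: field_simps)
    ultimately show ?thesis by simp
  qed
  have "((\<lambda>t. (moment k (\<sigma> + t) - moment k \<sigma>) / t - moment (Suc k) \<sigma>) \<longlongrightarrow> 0) (at 0)"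
  proof (rule Lim_null_comparison)
    show "\<forall>\<^sub>F t in at 0. norm ((moment k (\<sigma> + t) - moment k \<sigma>) / t - moment (Suc k) \<sigma>) \<le> \<bar>t\<bar> * D"
      unfolding eventually_at using bound by (intro exI[of _ 1]) auto
    show "((\<lambda>t. \<bar>t\<bar> * D) \<longlongrightarrow> 0) (at 0)" by (rule tendsto_eq_intros refl | simp)+
  qed
  then show ?thesis unfolding DERIV_def by (simp add: LIM_zero_iff)
qed

definition "M \<sigma> = moment 1 \<sigma> / moment 0 \<sigma>"

text \<open>The variance of the tilted measure, written with raw moments.\<close>

definition "M' \<sigma> = moment 2 \<sigma> / moment 0 \<sigma> - (M \<sigma>)\<^sup>2"

lemma mean_tilted: "(\<integral>x. x \<partial>mu_tilted \<Psi> \<sigma>) = M \<sigma>"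
  using tilted_moment(2)[where k = 1 and \<sigma> = \<sigma>] unfolding M_def by simp

lemma M_deriv: "(M has_real_derivative M' \<sigma>) (at \<sigma>)"
proof -
  have "((\<lambda>\<sigma>. moment 1 \<sigma> / moment 0 \<sigma>) has_real_derivative
     (moment (Suc 1) \<sigma> * moment 0 \<sigma> - moment 1 \<sigma> * moment (Suc 0) \<sigma>) / (moment 0 \<sigma> * moment 0 \<sigma>)) (at \<sigma>)"
    using moment0_pos[of \<sigma>] by (intro DERIV_divide moment_deriv) simp
  moreover have "(moment (Suc 1) \<sigma> * moment 0 \<sigma> - moment 1 \<sigma> * moment (Suc 0) \<sigma>) / (moment 0 \<sigma> * moment 0 \<sigma>) = M' \<sigma>"
    unfolding M'_def M_def using moment0_pos[of \<sigma>] by (simp add: field_simps power2_eq_square numeral_2_eq_2)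
  ultimately show ?thesis unfolding M_def[abs_def] by simp
qed

lemma phi_star_deriv: "(phi_star \<Psi> has_real_derivative M \<sigma>) (at \<sigma>)"
proof -
  have "((\<lambda>\<sigma>. ln (moment 0 \<sigma>)) has_real_derivative M \<sigma>) (at \<sigma>)"
    using DERIV_chain2[OF DERIV_ln moment_deriv[of 0 \<sigma>]] moment0_pos[of \<sigma>] unfolding M_def
    by (simp add: divide_inverse mult.commute)
  then show ?thesis using phi_star_eq by presburger
qed

lemma not_AE_lborel:
  fixes a :: real
  assumes "\<And>z. z \<noteq> a \<Longrightarrow> \<not> P z"
  shows "\<not> (AE z in lborel. P z)"
proof
  assume "AE z in lborel. P z"
  then have "AE z in lborel. \<not> (z \<in> {a + 1..a + 2})" by eventually_elim (use assms in force)
  from emeasure_eq_0_AE[OF this] have "emeasure lborel {z \<in> space lborel. z \<in> {a + 1..a + 2}} = 0" .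
  moreover have "{z \<in> space lborel. z \<in> {a + 1..a + 2}} = {a + 1..a + 2}" by auto
  ultimately show False by simp
qed

lemma M'_pos: "0 < M' \<sigma>"
proof -
  let ?f = "\<lambda>z. (z - M \<sigma>)\<^sup>2 * exp (\<sigma> * z - \<Psi> z)"
  have e: "?f z = z ^ 2 * exp (\<sigma> * z - \<Psi> z) - (2 * M \<sigma>) * (z ^ 1 * exp (\<sigma> * z - \<Psi> z)) + (M \<sigma>)\<^sup>2 * (z ^ 0 * exp (\<sigma> * z - \<Psi> z))" for z
    by (simp add: power2_eq_square algebra_simps)
  have i: "integrable lborel ?f"
    unfolding e by (intro Bochner_Integration.integrable_add Bochner_Integration.integrable_diff integrable_mult_right integrable_moment)
  have "(\<integral>z. ?f z \<partial>lborel) = moment 2 \<sigma> - (2 * M \<sigma>) * moment 1 \<sigma> + (M \<sigma>)\<^sup>2 * moment 0 \<sigma>"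
    unfolding e moment_def using integrable_moment[of 2 \<sigma>] integrable_moment[of 1 \<sigma>] integrable_moment[of 0 \<sigma>] by simp
  also have "\<dots> = moment 0 \<sigma> * M' \<sigma>"
    unfolding M'_def M_def using moment0_pos[of \<sigma>] by (simp add: field_simps power2_eq_square)
  finally have f: "(\<integral>z. ?f z \<partial>lborel) = moment 0 \<sigma> * M' \<sigma>" .
  have "(\<integral>z. ?f z \<partial>lborel) \<noteq> 0"
  proof
    assume "(\<integral>z. ?f z \<partial>lborel) = 0"
    then have "AE z in lborel. ?f z = 0" using integral_nonneg_eq_0_iff_AE[OF i] by simp
    then show False using not_AE_lborel[of "M \<sigma>" "\<lambda>z. ?f z = 0"] by simp
  qed
  moreover have "0 \<le> (\<integral>z. ?f z \<partial>lborel)" by simp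
  ultimately have "0 < moment 0 \<sigma> * M' \<sigma>" unfolding f by linarith
  then show ?thesis using moment0_pos[of \<sigma>] by (simp add: zero_less_mult_iff)
qed

lemma M_strict_mono: "x < y \<Longrightarrow> M x < M y"
  by (rule DERIV_pos_imp_increasing) (use M_deriv M'_pos in blast)+

lemma continuous_M: "continuous_on A M"
  using M_deriv by (auto intro!: continuous_at_imp_continuous_on DERIV_isCont)

lemma phi_star_above_tangent: "phi_star \<Psi> \<sigma> + M \<sigma> * (\<tau> - \<sigma>) \<le> phi_star \<Psi> \<tau>"
proof (cases \<sigma> \<tau> rule: linorder_cases)
  case less
  obtain z where z: "\<sigma> < z" "z < \<tau>" "phi_star \<Psi> \<tau> - phi_star \<Psi> \<sigma> = (\<tau> - \<sigma>) * M z"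
    using MVT2[OF less phi_star_deriv] by blast
  have "(\<tau> - \<sigma>) * M \<sigma> \<le> (\<tau> - \<sigma>) * M z" using M_strict_mono[OF z(1)] less by (intro mult_left_mono) auto
  then show ?thesis using z(3) by (simp add: algebra_simps)
next
  case greater
  obtain z where z: "\<tau> < z" "z < \<sigma>" "phi_star \<Psi> \<sigma> - phi_star \<Psi> \<tau> = (\<sigma> - \<tau>) * M z"
    using MVT2[OF greater phi_star_deriv] by blast
  have "(\<sigma> - \<tau>) * M z \<le> (\<sigma> - \<tau>) * M \<sigma>" using M_strict_mono[OF z(2)] greater by (intro mult_left_mono) auto
  then show ?thesis using z(3) by (simp add: algebra_simps)
qed simp

text \<open>If all means were below \<open>m\<close>, convexity would let \<open>phi_star\<close>
  grow on the positive axis with slope at most \<open>m\<close>, while the mass of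
  \<open>{m + 1..m + 2}\<close> alone forces growth with slope \<open>m + 1\<close>.\<close>

lemma M_unbounded: "\<exists>\<sigma>. m \<le> M \<sigma>"
proof (rule ccontr)
  assume "\<nexists>\<sigma>. m \<le> M \<sigma>"
  then have lt: "M \<sigma> < m" for \<sigma> by (simp add: not_le)
  let ?g = "\<lambda>z. indicator {m + 1..m + 2} z * exp (- \<Psi> z)"
  have i0: "integrable lborel (\<lambda>z. exp (- \<Psi> z))" using integrable_moment[of 0 0] by simp
  have ig: "integrable lborel ?g"
    by (rule Bochner_Integration.integrable_bound[OF i0]) (auto split: split_indicator)
  define c where "c = (\<integral>z. ?g z \<partial>lborel)"
  have "c \<noteq> 0"
  proof
    assume "c = 0"
    then have "AE z in lborel. ?g z = 0" unfolding c_def using integral_nonneg_eq_0_iff_AE[OF ig] by simp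
    then have "AE z in lborel. \<not> (z \<in> {m + 1..m + 2})" by eventually_elim (auto split: split_indicator_asm)
    from emeasure_eq_0_AE[OF this] have "emeasure lborel {z \<in> space lborel. z \<in> {m + 1..m + 2}} = 0" .
    moreover have "{z \<in> space lborel. z \<in> {m + 1..m + 2}} = {m + 1..m + 2}" by auto
    ultimately show False by simp
  qed
  moreover have "0 \<le> c" unfolding c_def by simp
  ultimately have c: "0 < c" by simp
  \<comment> \<open>Positive and beyond the point where the two linear bounds cross.\<close>
  define \<sigma> where "\<sigma> = max 0 (phi_star \<Psi> 0 - ln c) + 1"
  have \<sigma>: "0 < \<sigma>" "phi_star \<Psi> 0 - ln c < \<sigma>" unfolding \<sigma>_def by auto
  have "exp (\<sigma> * (m + 1)) * c = (\<integral>z. exp (\<sigma> * (m + 1)) * ?g z \<partial>lborel)" unfolding c_def by simp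
  also have "\<dots> \<le> (\<integral>z. z ^ 0 * exp (\<sigma> * z - \<Psi> z) \<partial>lborel)"
  proof (rule integral_mono[OF integrable_mult_right[OF ig] integrable_moment])
    fix z
    have "exp (\<sigma> * (m + 1)) * exp (- \<Psi> z) \<le> exp (\<sigma> * z - \<Psi> z)" if "m + 1 \<le> z"
      using mult_left_mono[OF that, of \<sigma>] \<sigma>(1) unfolding mult_exp_exp by simp
    then show "exp (\<sigma> * (m + 1)) * ?g z \<le> z ^ 0 * exp (\<sigma> * z - \<Psi> z)" by (auto split: split_indicator)
  qed
  also have "\<dots> = moment 0 \<sigma>" unfolding moment_def ..
  finally have "ln (exp (\<sigma> * (m + 1)) * c) \<le> ln (moment 0 \<sigma>)" using c by (intro ln_mono) auto
  then have "\<sigma> * (m + 1) + ln c \<le> phi_star \<Psi> \<sigma>" using c by (simp add: phi_star_eq ln_mult)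
  moreover have "phi_star \<Psi> \<sigma> + M \<sigma> * (0 - \<sigma>) \<le> phi_star \<Psi> 0" by (rule phi_star_above_tangent)
  moreover have "M \<sigma> * \<sigma> \<le> m * \<sigma>" using lt[of \<sigma>] \<sigma>(1) by (intro mult_right_mono) auto
  ultimately show False using \<sigma>(2) by (simp add: algebra_simps)
qed

end

section \<open>The three critical points\<close>

locale symmetric_potential = confined_potential +
  assumes symmetric: "\<And>z. \<Psi> (- z) = \<Psi> z"
    and deriv_convex: "convex_on {0..} \<Psi>'"
    and supercritical: "1 / J < (\<integral>z. z\<^sup>2 * exp (- \<Psi> z) \<partial>lborel) / (\<integral>z. exp (- \<Psi> z) \<partial>lborel)"
begin

lemma moment_uminus: "moment k (- \<sigma>) = (- 1) ^ k * moment k \<sigma>"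
proof -
  have "moment k (- \<sigma>) = (\<integral>z. (- z) ^ k * exp (- \<sigma> * (- z) - \<Psi> (- z)) \<partial>lborel)"
    unfolding moment_def
    using lborel_integral_real_affine[of "- 1" "\<lambda>z. z ^ k * exp (- \<sigma> * z - \<Psi> z)" 0] by simp
  also have "\<dots> = (\<integral>z. (- 1) ^ k * (z ^ k * exp (\<sigma> * z - \<Psi> z)) \<partial>lborel)"
    by (intro Bochner_Integration.integral_cong refl) (subst power_minus, simp add: symmetric)
  also have "\<dots> = (- 1) ^ k * moment k \<sigma>" unfolding moment_def by simp
  finally show ?thesis .
qed

lemma M_uminus: "M (- \<sigma>) = - M \<sigma>" and M_0: "M 0 = 0"
proof -
  show 1: "M (- \<sigma>) = - M \<sigma>" for \<sigma> unfolding M_def moment_uminus by simp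
  show "M 0 = 0" using 1[of 0] by simp
qed

lemma potential'_uminus: "\<Psi>' (- z) = - \<Psi>' z"
proof -
  have "((\<lambda>x. - x) has_real_derivative - 1) (at z)" by (auto intro!: derivative_eq_intros)
  from DERIV_chain2[OF deriv1 this] have "((\<lambda>x. \<Psi> (- x)) has_real_derivative - \<Psi>' (- z)) (at z)" by simp
  then have "(\<Psi> has_real_derivative - \<Psi>' (- z)) (at z)" unfolding symmetric .
  then show ?thesis using DERIV_unique[OF deriv1] by fastforce
qed

lemma potential'_0: "\<Psi>' 0 = 0" using potential'_uminus[of 0] by simp

text \<open>A convex function that vanishes at \<open>0\<close> has nondecreasing chord slopes from
  the origin.\<close>

lemma potential'_ratio_mono:
  assumes "0 < x" "x \<le> y"
  shows "\<Psi>' x \<le> x / y * \<Psi>' y"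
proof -
  have "\<Psi>' ((1 - x / y) *\<^sub>R 0 + (x / y) *\<^sub>R y) \<le> (1 - x / y) * \<Psi>' 0 + (x / y) * \<Psi>' y"
    using assms by (intro convex_onD[OF deriv_convex]) auto
  then show ?thesis using assms by (simp add: potential'_0)
qed

text \<open>By symmetry of the potential the integrands may be averaged over \<open>\<sigma>\<close>
  and \<open>- \<sigma>\<close>, which makes them even.\<close>

lemma moments_hyperbolic:
  "moment 0 \<sigma> = (\<integral>z. cosh (\<sigma> * z) * exp (- \<Psi> z) \<partial>lborel)"
  "moment 1 \<sigma> = (\<integral>z. z * sinh (\<sigma> * z) * exp (- \<Psi> z) \<partial>lborel)"
  "moment 2 \<sigma> = (\<integral>z. z\<^sup>2 * cosh (\<sigma> * z) * exp (- \<Psi> z) \<partial>lborel)"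
  and integrable_hyperbolic:
  "integrable lborel (\<lambda>z. cosh (\<sigma> * z) * exp (- \<Psi> z))"
  "integrable lborel (\<lambda>z. z * sinh (\<sigma> * z) * exp (- \<Psi> z))"
  "integrable lborel (\<lambda>z. z\<^sup>2 * cosh (\<sigma> * z) * exp (- \<Psi> z))"
proof -
  have split: "exp (s - \<Psi> z) = exp s * exp (- \<Psi> z)" for s z unfolding mult_exp_exp by simp
  have e0: "cosh (\<sigma> * z) * exp (- \<Psi> z) = (z ^ 0 * exp (\<sigma> * z - \<Psi> z)) / 2 + (z ^ 0 * exp (- \<sigma> * z - \<Psi> z)) / 2"
   and e1: "z * sinh (\<sigma> * z) * exp (- \<Psi> z) = (z ^ 1 * exp (\<sigma> * z - \<Psi> z)) / 2 - (z ^ 1 * exp (- \<sigma> * z - \<Psi> z)) / 2"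
   and e2: "z\<^sup>2 * cosh (\<sigma> * z) * exp (- \<Psi> z) = (z ^ 2 * exp (\<sigma> * z - \<Psi> z)) / 2 + (z ^ 2 * exp (- \<sigma> * z - \<Psi> z)) / 2" for z
    unfolding split cosh_field_def sinh_field_def by (simp_all add: algebra_simps add_divide_distrib diff_divide_distrib)
  have i: "integrable lborel (\<lambda>z. (z ^ k * exp (s * z - \<Psi> z)) / 2)" for k s
    using integrable_moment[of k s] by simp
  show "integrable lborel (\<lambda>z. cosh (\<sigma> * z) * exp (- \<Psi> z))"
    unfolding e0 by (intro Bochner_Integration.integrable_add i)
  show "integrable lborel (\<lambda>z. z * sinh (\<sigma> * z) * exp (- \<Psi> z))"
    unfolding e1 by (intro Bochner_Integration.integrable_diff i)
  show "integrable lborel (\<lambda>z. z\<^sup>2 * cosh (\<sigma> * z) * exp (- \<Psi> z))"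
    unfolding e2 by (intro Bochner_Integration.integrable_add i)
  have h: "(\<integral>z. (z ^ k * exp (s * z - \<Psi> z)) / 2 \<partial>lborel) = moment k s / 2" for k s
    unfolding moment_def by simp
  show "moment 0 \<sigma> = (\<integral>z. cosh (\<sigma> * z) * exp (- \<Psi> z) \<partial>lborel)"
    unfolding e0 Bochner_Integration.integral_add[OF i i] h moment_uminus by simp
  show "moment 1 \<sigma> = (\<integral>z. z * sinh (\<sigma> * z) * exp (- \<Psi> z) \<partial>lborel)"
    unfolding e1 Bochner_Integration.integral_diff[OF i i] h moment_uminus by simp
  show "moment 2 \<sigma> = (\<integral>z. z\<^sup>2 * cosh (\<sigma> * z) * exp (- \<Psi> z) \<partial>lborel)"
    unfolding e2 Bochner_Integration.integral_add[OF i i] h moment_uminus by simp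
qed

text \<open>The derivative has the sign of \<open>sinh u * cosh u - u\<close> at
  \<open>u = \<sigma> * z\<close>, which is positive because its own derivative is
  \<open>2 * (sinh u)\<^sup>2\<close>.\<close>

lemma coth_increasing:
  fixes \<sigma> :: real
  assumes \<sigma>: "0 < \<sigma>" and xy: "0 < x" "x < y"
  shows "x * cosh (\<sigma> * x) / sinh (\<sigma> * x) < y * cosh (\<sigma> * y) / sinh (\<sigma> * y)"
proof -
  have gpos: "u < sinh u * cosh u" if u: "0 < u" for u :: real
  proof -
    have d: "((\<lambda>u. sinh u * cosh u - u) has_real_derivative 2 * (sinh z)\<^sup>2) (at z)" for z :: real
      using cosh_square_eq[of z]
      by (auto intro!: derivative_eq_intros simp: power2_eq_square algebra_simps)
    obtain z where z: "0 < z" "z < u" "(sinh u * cosh u - u) - (sinh 0 * cosh 0 - 0) = (u - 0) * (2 * (sinh z)\<^sup>2)"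
      using MVT2[OF u, of "\<lambda>u. sinh u * cosh u - u" "\<lambda>z. 2 * (sinh z)\<^sup>2"] d by blast
    have "0 < (u - 0) * (2 * (sinh z)\<^sup>2)" using u z by simp
    then show ?thesis using z(3) by simp
  qed
  have d: "((\<lambda>z. z * cosh (\<sigma> * z) / sinh (\<sigma> * z)) has_real_derivative
      (sinh (\<sigma> * z) * cosh (\<sigma> * z) - \<sigma> * z) / (sinh (\<sigma> * z))\<^sup>2) (at z)" if z: "0 < z" for z
  proof -
    have s: "sinh (\<sigma> * z) \<noteq> 0" using \<sigma> z by simp
    have c: "(cosh (\<sigma> * z))\<^sup>2 = (sinh (\<sigma> * z))\<^sup>2 + 1" by (rule cosh_square_eq)
    have "((\<lambda>z. z * cosh (\<sigma> * z) / sinh (\<sigma> * z)) has_real_derivative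
      ((1 * cosh (\<sigma> * z) + (sinh (\<sigma> * z) * \<sigma>) * z) * sinh (\<sigma> * z) - (z * cosh (\<sigma> * z)) * (cosh (\<sigma> * z) * \<sigma>)) / (sinh (\<sigma> * z) * sinh (\<sigma> * z))) (at z)"
      using s by (auto intro!: derivative_eq_intros)
    moreover have "((1 * cosh (\<sigma> * z) + (sinh (\<sigma> * z) * \<sigma>) * z) * sinh (\<sigma> * z) - (z * cosh (\<sigma> * z)) * (cosh (\<sigma> * z) * \<sigma>))
      = sinh (\<sigma> * z) * cosh (\<sigma> * z) - \<sigma> * z"
    proof -
      have "(z * cosh (\<sigma> * z)) * (cosh (\<sigma> * z) * \<sigma>) = \<sigma> * z * (cosh (\<sigma> * z))\<^sup>2" by (simp add: power2_eq_square)
      also have "\<dots> = \<sigma> * z * (sinh (\<sigma> * z) * sinh (\<sigma> * z)) + \<sigma> * z" unfolding c by (simp add: power2_eq_square algebra_simps)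
      finally show ?thesis by (simp add: algebra_simps)
    qed
    ultimately show ?thesis by (simp add: power2_eq_square)
  qed
  show ?thesis
  proof (rule DERIV_pos_imp_increasing[OF xy(2)])
    fix z assume "x \<le> z" "z \<le> y"
    then have z: "0 < z" using xy by simp
    have "0 < (sinh (\<sigma> * z) * cosh (\<sigma> * z) - \<sigma> * z) / (sinh (\<sigma> * z))\<^sup>2"
      using gpos[of "\<sigma> * z"] \<sigma> z by (intro divide_pos_pos) auto
    then show "\<exists>D. ((\<lambda>z. z * cosh (\<sigma> * z) / sinh (\<sigma> * z)) has_real_derivative D) (at z) \<and> 0 < D"
      using d[OF z] by blast
  qed
qed

end

context symmetric_potential
begin

text \<open>
  The mean \<open>M \<sigma>\<close> of the tilted measure satisfies \<open>\<sigma> M' \<sigma> < M \<sigma>\<close>: integrating by parts, the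
  difference is the integral of \<open>\<Psi>' B\<close> against \<open>exp (- \<Psi>)\<close> for an odd function \<open>B\<close> which is
  orthogonal to \<open>z\<close> and changes sign once on the half line, and the convex \<open>\<Psi>'\<close> may be compared
  with the linear function that agrees with it at the sign change.
\<close>

lemma M_pos: "0 < \<sigma> \<Longrightarrow> 0 < M \<sigma>"
  using M_strict_mono[of 0 \<sigma>] M_0 by simp

lemma exp_potential_bounded: "\<exists>D\<ge>0. \<forall>z. exp (a * \<bar>z\<bar> - \<Psi> z) \<le> D"
proof -
  obtain C where C: "\<forall>z. 1 * z\<^sup>2 - C \<le> \<Psi> z" using potential_superquadratic by blast
  have "exp (a * \<bar>z\<bar> - \<Psi> z) \<le> exp (a\<^sup>2 + C)" for z
  proof -
    have "2 * (a * \<bar>z\<bar>) \<le> a\<^sup>2 + z\<^sup>2" using zero_le_power2[of "a - \<bar>z\<bar>"] by (simp add: power2_diff)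
    moreover have "z\<^sup>2 - C \<le> \<Psi> z" using C by simp
    moreover have "0 \<le> z\<^sup>2" "0 \<le> a\<^sup>2" by simp_all
    ultimately have "a * \<bar>z\<bar> - \<Psi> z \<le> a\<^sup>2 + C" by linarith
    then show ?thesis by simp
  qed
  then show ?thesis by (intro exI[of _ "exp (a\<^sup>2 + C)"]) auto
qed

text \<open>A linear \<open>\<Psi>'\<close> on the half line would make the potential quadratic
  there, against its superquadratic growth. This is the source of strictness in
  \<open>slope_less_chord\<close>.\<close>

lemma not_linear_on_half_line: "\<exists>z>0. \<Psi>' z \<noteq> l * z"
proof (rule ccontr)
  assume "\<nexists>z. 0 < z \<and> \<Psi>' z \<noteq> l * z"
  then have lin: "\<Psi>' z = l * z" if "0 < z" for z using that by blast
  have eq: "\<Psi> z = \<Psi> 0 + l / 2 * z\<^sup>2" if z: "0 < z" for z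
  proof -
    have "((\<lambda>x. \<Psi> x - l / 2 * x\<^sup>2) has_real_derivative \<Psi>' x - l * x) (at x)" for x
      by (auto intro!: derivative_eq_intros deriv1)
    then obtain x where "0 < x" "x < z" "(\<Psi> z - l / 2 * z\<^sup>2) - (\<Psi> 0 - l / 2 * 0\<^sup>2) = (z - 0) * (\<Psi>' x - l * x)"
      using MVT2[OF z, of "\<lambda>x. \<Psi> x - l / 2 * x\<^sup>2" "\<lambda>x. \<Psi>' x - l * x"] by blast
    then show ?thesis using lin[of x] by simp
  qed
  obtain C where C: "\<forall>z. (l / 2 + 1) * z\<^sup>2 - C \<le> \<Psi> z" using potential_superquadratic by blast
  define z where "z = \<bar>C + \<Psi> 0\<bar> + 1"
  have z: "1 \<le> z" "C + \<Psi> 0 < z" unfolding z_def by auto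
  have "0 < z" using z by simp
  from eq[OF this] C[rule_format, of z] have "(l / 2 + 1) * z\<^sup>2 - C \<le> \<Psi> 0 + l / 2 * z\<^sup>2" by linarith
  then have "z\<^sup>2 \<le> C + \<Psi> 0" by (simp add: distrib_right)
  moreover have "z * 1 \<le> z * z" using z by (intro mult_left_mono) auto
  ultimately show False using z by (simp add: power2_eq_square)
qed

section \<open>The odd comparison function at a fixed positive tilt\<close>

context
  fixes \<sigma> :: real assumes \<sigma>: "0 < \<sigma>"
begin

definition "E = moment 2 \<sigma> / moment 0 \<sigma>"

text \<open>The coefficients are moments taken crosswise: the integral of
  \<open>z * B z * exp (- \<Psi> z)\<close> is
  \<open>M \<sigma> * moment 2 \<sigma> - E * moment 1 \<sigma>\<close>, which vanishes, while that
  of \<open>B' z * exp (- \<Psi> z)\<close> is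
  \<open>moment 0 \<sigma> * (M \<sigma> - \<sigma> * M' \<sigma>)\<close>, the quantity whose sign
  is wanted.\<close>

definition "B z = M \<sigma> * z * cosh (\<sigma> * z) - E * sinh (\<sigma> * z)"

definition "B' z = M \<sigma> * cosh (\<sigma> * z) + M \<sigma> * \<sigma> * z * sinh (\<sigma> * z) - E * \<sigma> * cosh (\<sigma> * z)"

lemma B_deriv: "(B has_real_derivative B' z) (at z)"
  unfolding B_def[abs_def] B'_def by (auto intro!: derivative_eq_intros simp: algebra_simps)

lemma continuous_B: "continuous_on A B" "continuous_on A B'"
  unfolding B_def B'_def by (intro continuous_intros)+

lemma B_uminus: "B (- z) = - B z"
  unfolding B_def by simp

lemma B_eq: "0 < z \<Longrightarrow> B z = sinh (\<sigma> * z) * (M \<sigma> * (z * cosh (\<sigma> * z) / sinh (\<sigma> * z)) - E)"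
  unfolding B_def using \<sigma> by (simp add: field_simps)

lemma integral_z_B: "integrable lborel (\<lambda>z. z * B z * exp (- \<Psi> z))" "(\<integral>z. z * B z * exp (- \<Psi> z) \<partial>lborel) = 0"
proof -
  have e: "z * B z * exp (- \<Psi> z) = M \<sigma> * (z\<^sup>2 * cosh (\<sigma> * z) * exp (- \<Psi> z)) - E * (z * sinh (\<sigma> * z) * exp (- \<Psi> z))" for z
    unfolding B_def by (simp add: power2_eq_square algebra_simps)
  note i = integrable_hyperbolic[of \<sigma>]
  show "integrable lborel (\<lambda>z. z * B z * exp (- \<Psi> z))"
    unfolding e by (intro Bochner_Integration.integrable_diff integrable_mult_right i)
  have "(\<integral>z. z * B z * exp (- \<Psi> z) \<partial>lborel) = M \<sigma> * moment 2 \<sigma> - E * moment 1 \<sigma>"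
    unfolding e moments_hyperbolic
    by (subst Bochner_Integration.integral_diff[OF integrable_mult_right[OF i(3)] integrable_mult_right[OF i(2)]])
       (simp only: integral_mult_right_zero)
  also have "\<dots> = 0" unfolding M_def E_def by simp
  finally show "(\<integral>z. z * B z * exp (- \<Psi> z) \<partial>lborel) = 0" .
qed

lemma integral_B': "integrable lborel (\<lambda>z. B' z * exp (- \<Psi> z))"
  "(\<integral>z. B' z * exp (- \<Psi> z) \<partial>lborel) = moment 0 \<sigma> * (M \<sigma> - \<sigma> * M' \<sigma>)"
proof -
  have e: "B' z * exp (- \<Psi> z) = (M \<sigma> - E * \<sigma>) * (cosh (\<sigma> * z) * exp (- \<Psi> z)) + M \<sigma> * \<sigma> * (z * sinh (\<sigma> * z) * exp (- \<Psi> z))" for z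
    unfolding B'_def by (simp add: algebra_simps)
  note i = integrable_hyperbolic[of \<sigma>]
  show "integrable lborel (\<lambda>z. B' z * exp (- \<Psi> z))"
    unfolding e by (intro Bochner_Integration.integrable_add integrable_mult_right i)
  have "(\<integral>z. B' z * exp (- \<Psi> z) \<partial>lborel) = (M \<sigma> - E * \<sigma>) * moment 0 \<sigma> + M \<sigma> * \<sigma> * moment 1 \<sigma>"
    unfolding e moments_hyperbolic
    by (subst Bochner_Integration.integral_add[OF integrable_mult_right[OF i(1)] integrable_mult_right[OF i(2)]])
       (simp only: integral_mult_right_zero)
  also have "moment 1 \<sigma> = M \<sigma> * moment 0 \<sigma>" unfolding M_def using moment0_pos[of \<sigma>] by simp
  also have "(M \<sigma> - E * \<sigma>) * moment 0 \<sigma> + M \<sigma> * \<sigma> * (M \<sigma> * moment 0 \<sigma>) = moment 0 \<sigma> * (M \<sigma> - \<sigma> * M' \<sigma>)"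
    unfolding M'_def E_def[symmetric] by (simp add: power2_eq_square algebra_simps)
  finally show "(\<integral>z. B' z * exp (- \<Psi> z) \<partial>lborel) = moment 0 \<sigma> * (M \<sigma> - \<sigma> * M' \<sigma>)" .
qed

text \<open>On the half line \<open>B\<close> is \<open>sinh (\<sigma> * z)\<close> times a strictly
  increasing factor. That factor has a zero, since otherwise \<open>z * B z\<close> would have one
  strict sign away from \<open>0\<close>, against its vanishing weighted integral.\<close>

lemma B_sign_change:
  obtains r where "0 < r" "\<And>z. 0 < z \<Longrightarrow> z < r \<Longrightarrow> B z < 0" "\<And>z. r < z \<Longrightarrow> 0 < B z" "B r = 0"
proof -
  let ?k = "\<lambda>z. M \<sigma> * (z * cosh (\<sigma> * z) / sinh (\<sigma> * z)) - E"
  have k: "?k x < ?k y" if "0 < x" "x < y" for x y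
    using coth_increasing[OF \<sigma> that] M_pos[OF \<sigma>] by (simp add: mult_strict_left_mono del: times_divide_eq_right)
  have sh: "0 < sinh (\<sigma> * z)" if "0 < z" for z using that \<sigma> by simp
  \<comment> \<open>Used with \<open>s = 1\<close> and \<open>s = - 1\<close>, to exclude either
    constant sign of \<open>B\<close>.\<close>
  have contra: False if s: "\<And>z. 0 < z \<Longrightarrow> 0 < s * B z" for s
  proof -
    have pos: "0 < s * (z * B z * exp (- \<Psi> z))" if z: "z \<noteq> 0" for z
    proof -
      have "0 < s * (z * B z)"
      proof (cases "0 < z")
        case True
        then have "0 < z * (s * B z)" using s by simp
        then show ?thesis by (simp add: algebra_simps)
      next
        case False
        then have "0 < - z" using z by simp
        from mult_pos_pos[OF this s[OF this]] show ?thesis by (simp add: B_uminus algebra_simps)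
      qed
      then have "0 < s * (z * B z) * exp (- \<Psi> z)" by simp
      then show ?thesis by (simp add: algebra_simps)
    qed
    have i: "integrable lborel (\<lambda>z. s * (z * B z * exp (- \<Psi> z)))" by (rule integrable_mult_right[OF integral_z_B(1)])
    have nn: "0 \<le> s * (z * B z * exp (- \<Psi> z))" for z using pos[of z] by (cases "z = 0") (auto intro: less_imp_le)
    have "(\<integral>z. s * (z * B z * exp (- \<Psi> z)) \<partial>lborel) = 0" by (simp add: integral_z_B(2))
    then have "AE z in lborel. s * (z * B z * exp (- \<Psi> z)) = 0"
      using integral_nonneg_eq_0_iff_AE[OF i] nn by simp
    moreover have "\<not> (AE z in lborel. s * (z * B z * exp (- \<Psi> z)) = 0)"
      by (rule not_AE_lborel[of 0]) (use pos in fastforce)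
    ultimately show False by simp
  qed
  have "\<exists>r>0. ?k r = 0"
  proof -
    obtain x where x: "0 < x" "?k x \<le> 0"
    proof (rule ccontr)
      assume "\<not> thesis"
      then have "0 < ?k z" if "0 < z" for z using that \<open>\<And>x. 0 < x \<Longrightarrow> ?k x \<le> 0 \<Longrightarrow> thesis\<close> by fastforce
      then have "0 < 1 * B z" if "0 < z" for z using B_eq[OF that] sh[OF that] that by simp
      then show False by (rule contra)
    qed
    obtain y where y: "0 < y" "0 \<le> ?k y"
    proof (rule ccontr)
      assume "\<not> thesis"
      then have "?k z < 0" if "0 < z" for z using that \<open>\<And>x. 0 < x \<Longrightarrow> 0 \<le> ?k x \<Longrightarrow> thesis\<close> by fastforce
      then have "0 < (- 1) * B z" if "0 < z" for z
        using B_eq[OF that] mult_pos_neg[OF sh[OF that]] that by simp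
      then show False by (rule contra)
    qed
    have xy: "x \<le> y" using k[of y x] x y by force
    have "continuous_on {x..y} ?k"
      using x \<sigma> by (intro continuous_intros) auto
    then obtain r where "x \<le> r" "?k r = 0" using IVT'[of ?k x 0 y] x y xy by blast
    then show ?thesis using x by (intro exI[of _ r]) auto
  qed
  then obtain r where r: "0 < r" "?k r = 0" by blast
  show thesis
  proof (rule that[of r])
    show "0 < r" "B r = 0" using r B_eq[of r] by auto
    show "B z < 0" if "0 < z" "z < r" for z
      using k[OF that] r(2) B_eq[OF that(1)] mult_pos_neg[OF sh[OF that(1)]] by simp
    show "0 < B z" if "r < z" for z
      using k[OF r(1) that] r B_eq[of z] mult_pos_pos[OF sh[of z]] that by simp
  qed
qed

lemma slope_less_chord: "\<sigma> * M' \<sigma> < M \<sigma>"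
proof -
  obtain r where r: "0 < r" "\<And>z. 0 < z \<Longrightarrow> z < r \<Longrightarrow> B z < 0" "\<And>z. r < z \<Longrightarrow> 0 < B z" "B r = 0"
    using B_sign_change by blast
  \<comment> \<open>The slope for which \<open>\<Psi>' z - l * z\<close> changes sign at
    \<open>r\<close>, as \<open>B\<close> does. Subtracting \<open>l * z\<close> is free because
    \<open>B\<close> is orthogonal to \<open>z\<close>.\<close>
  define l where "l = \<Psi>' r / r"
  define f where "f z = (\<Psi>' z - l * z) * B z * exp (- \<Psi> z)" for z
  define g where "g z = B' z * exp (- \<Psi> z) - l * (z * B z * exp (- \<Psi> z))" for z
  \<comment> \<open>The boundary term of the integration by parts: \<open>P\<close> has derivative
    \<open>g z - f z\<close> and is odd, so the integrals of \<open>g\<close> and \<open>f\<close>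
    over \<open>{- n..n}\<close> differ by \<open>2 * P n\<close>.\<close>
  define P where "P z = B z * exp (- \<Psi> z)" for z
  have f_uminus: "f (- z) = f z" for z
    unfolding f_def by (simp add: potential'_uminus B_uminus symmetric algebra_simps)
  have prod: "0 \<le> (\<Psi>' z - l * z) * B z" if z: "0 < z" for z
  proof (cases z r rule: linorder_cases)
    case less
    have "\<Psi>' z \<le> l * z" using potential'_ratio_mono[OF z, of r] less unfolding l_def by (simp add: mult.commute)
    then show ?thesis using r(2)[OF z less] by (intro mult_nonpos_nonpos) auto
  next
    case greater
    have "\<Psi>' r \<le> r / z * \<Psi>' z" using potential'_ratio_mono[OF r(1), of z] greater by simp
    then have "l * z \<le> \<Psi>' z" unfolding l_def using r(1) z by (simp add: field_simps)
    then show ?thesis using r(3)[OF greater] by (intro mult_nonneg_nonneg) auto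
  qed (use r in simp)
  have f0: "0 \<le> f z" for z
  proof -
    have p: "0 \<le> f z" if "0 < z" for z unfolding f_def using prod[OF that] by simp
    show ?thesis
    proof (cases z "0::real" rule: linorder_cases)
      case less
      then show ?thesis using p[of "- z"] f_uminus[of z] by simp
    next
      case equal
      then show ?thesis by (simp add: f_def potential'_0)
    next
      case greater
      then show ?thesis by (rule p)
    qed
  qed
  have cf: "continuous_on A f" for A
    unfolding f_def by (intro continuous_intros continuous_potential continuous_B)
  \<comment> \<open>\<open>f\<close> cannot vanish on the whole half line, because \<open>B\<close>
    is nonzero there except at \<open>r\<close> and \<open>\<Psi>'\<close> is not linear.\<close>
  obtain z0 where z0: "0 < z0" "f z0 \<noteq> 0"
  proof (rule ccontr)
    assume "\<not> thesis"
    then have fz: "f z = 0" if "0 < z" for z using that \<open>\<And>z0. 0 < z0 \<Longrightarrow> f z0 \<noteq> 0 \<Longrightarrow> thesis\<close> by blast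
    have "\<Psi>' z = l * z" if z: "0 < z" for z
    proof (cases z r rule: linorder_cases)
      case less
      then show ?thesis using fz[OF z] r(2)[OF z less] unfolding f_def by auto
    next
      case greater
      then show ?thesis using fz[OF z] r(3)[OF greater] unfolding f_def by auto
    next
      case equal
      then show ?thesis unfolding l_def using r by simp
    qed
    then show False using not_linear_on_half_line[of l] by blast
  qed
  have cg: "continuous_on A g" for A
    unfolding g_def by (intro continuous_intros continuous_potential continuous_B)
  have ig: "integrable lborel g"
    unfolding g_def by (intro Bochner_Integration.integrable_diff integrable_mult_right integral_B' integral_z_B)
  have intg: "(\<integral>z. g z \<partial>lborel) = moment 0 \<sigma> * (M \<sigma> - \<sigma> * M' \<sigma>)"
    unfolding g_def
    by (subst Bochner_Integration.integral_diff[OF integral_B'(1) integrable_mult_right[OF integral_z_B(1)]])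
       (simp add: integral_B'(2) integral_z_B(2))
  have dP: "(P has_real_derivative (g z - f z)) (at z)" for z
  proof -
    have "(P has_real_derivative (B' z * exp (- \<Psi> z) + (exp (- \<Psi> z) * - \<Psi>' z) * B z)) (at z)"
      unfolding P_def[abs_def] by (auto intro!: derivative_eq_intros B_deriv deriv1)
    then show ?thesis unfolding f_def g_def by (simp add: algebra_simps)
  qed
  \<comment> \<open>\<open>f\<close> is nonnegative, so its integrals over growing intervals
    increase; comparison with \<open>g\<close> yields their limit without first showing that
    \<open>f\<close> is integrable.\<close>
  define I where "I n = integral {- real n..real n} f" for n
  have I_eq: "I n = (\<integral>z. indicator {- real n..real n} z *\<^sub>R g z \<partial>lborel) - 2 * P (real n)" for n
  proof -
    have "(\<integral>z. indicator {- real n..real n} z *\<^sub>R (g z - f z) \<partial>lborel) = P (real n) - P (- real n)"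
    proof (rule integral_FTC_atLeastAtMost)
      show "(P has_vector_derivative g x - f x) (at x within {- real n..real n})" for x
        using dP[of x] has_field_derivative_at_within has_real_derivative_iff_has_vector_derivative by blast
    qed (auto intro!: continuous_intros cf cg)
    moreover have "P (- real n) = - P (real n)" unfolding P_def by (simp add: B_uminus symmetric)
    moreover have "(\<integral>z. indicator {- real n..real n} z *\<^sub>R (g z - f z) \<partial>lborel)
       = (\<integral>z. indicator {- real n..real n} z *\<^sub>R g z \<partial>lborel) - (\<integral>z. indicator {- real n..real n} z *\<^sub>R f z \<partial>lborel)"
      unfolding scaleR_diff_right
      using borel_integrable_atLeastAtMost'[OF cf, of "- real n" "real n"] borel_integrable_atLeastAtMost'[OF cg, of "- real n" "real n"]
      unfolding set_integrable_def by (intro Bochner_Integration.integral_diff)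
    moreover have "(\<integral>z. indicator {- real n..real n} z *\<^sub>R f z \<partial>lborel) = I n"
      using set_borel_integral_eq_integral(2)[OF borel_integrable_atLeastAtMost'[OF cf, of "- real n" "real n"]]
      unfolding I_def set_lebesgue_integral_def .
    ultimately show ?thesis by simp
  qed
  have "(\<lambda>n. \<integral>z. indicator {- real n..real n} z *\<^sub>R g z \<partial>lborel) \<longlonglongrightarrow> (\<integral>z. g z \<partial>lborel)"
  proof (rule integral_dominated_convergence[where w = "\<lambda>z. \<bar>g z\<bar>"])
    show "AE z in lborel. (\<lambda>n. indicator {- real n..real n} z *\<^sub>R g z) \<longlonglongrightarrow> g z"
    proof (intro AE_I2 tendsto_eventually)
      fix z :: real
      obtain N :: nat where N: "\<bar>z\<bar> < real N" using reals_Archimedean2 by blast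
      show "\<forall>\<^sub>F n in sequentially. indicator {- real n..real n} z *\<^sub>R g z = g z"
        unfolding eventually_sequentially
      proof (intro exI[of _ N] allI impI)
        fix n assume "N \<le> n"
        then have "real N \<le> real n" by simp
        then have "z \<in> {- real n..real n}" using N unfolding atLeastAtMost_iff by linarith
        then show "indicator {- real n..real n} z *\<^sub>R g z = g z" by simp
      qed
    qed
    show "AE z in lborel. norm (indicator {- real n..real n} z *\<^sub>R g z) \<le> \<bar>g z\<bar>" for n
      by (auto split: split_indicator)
  qed (use ig in auto)
  moreover have "(\<lambda>n. P (real n)) \<longlonglongrightarrow> 0"
  proof -
    \<comment> \<open>The exponent \<open>\<sigma> + 2\<close> pays for
      \<open>exp (\<sigma> * n)\<close> from the hyperbolic functions, for \<open>exp n\<close>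
      bounding the linear factor, and for the decay \<open>exp (- n)\<close> that remains.\<close>
    obtain D where D: "0 \<le> D" "\<forall>z. exp ((\<sigma> + 2) * \<bar>z\<bar> - \<Psi> z) \<le> D" using exp_potential_bounded by blast
    have "norm (P (real n)) \<le> (M \<sigma> + \<bar>E\<bar>) * D * exp (- real n)" for n
    proof -
      have n: "real n \<le> exp (real n)" "1 \<le> exp (real n)" using exp_ge_add_one_self[of "real n"] by linarith+
      have ch: "0 \<le> cosh (\<sigma> * real n)" "cosh (\<sigma> * real n) \<le> exp (\<sigma> * real n)"
        "0 \<le> sinh (\<sigma> * real n)" "sinh (\<sigma> * real n) \<le> exp (\<sigma> * real n)"
      proof -
        have "exp (- (\<sigma> * real n)) \<le> exp (\<sigma> * real n)" using \<sigma> by simp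
        then show "cosh (\<sigma> * real n) \<le> exp (\<sigma> * real n)" "sinh (\<sigma> * real n) \<le> exp (\<sigma> * real n)"
          unfolding cosh_field_def sinh_field_def using exp_gt_zero[of "- (\<sigma> * real n)"] exp_gt_zero[of "\<sigma> * real n"] by (simp_all add: field_simps)
        show "0 \<le> cosh (\<sigma> * real n)" "0 \<le> sinh (\<sigma> * real n)" using \<sigma> by simp_all
      qed
      have "\<bar>B (real n)\<bar> \<le> \<bar>M \<sigma> * real n * cosh (\<sigma> * real n)\<bar> + \<bar>E * sinh (\<sigma> * real n)\<bar>"
        unfolding B_def by (rule abs_triangle_ineq4)
      also have "\<dots> = M \<sigma> * (real n * cosh (\<sigma> * real n)) + \<bar>E\<bar> * sinh (\<sigma> * real n)"
        using M_pos[OF \<sigma>] ch by (simp add: abs_mult)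
      also have "\<dots> \<le> M \<sigma> * (exp (real n) * exp (\<sigma> * real n)) + \<bar>E\<bar> * (exp (real n) * exp (\<sigma> * real n))"
      proof (intro add_mono mult_left_mono)
        show "real n * cosh (\<sigma> * real n) \<le> exp (real n) * exp (\<sigma> * real n)" using n ch by (intro mult_mono) auto
        have "1 * sinh (\<sigma> * real n) \<le> exp (real n) * exp (\<sigma> * real n)" using n ch by (intro mult_mono) auto
        then show "sinh (\<sigma> * real n) \<le> exp (real n) * exp (\<sigma> * real n)" by simp
      qed (use M_pos[OF \<sigma>] in auto)
      finally have b: "\<bar>B (real n)\<bar> \<le> (M \<sigma> + \<bar>E\<bar>) * (exp (real n) * exp (\<sigma> * real n))" by (simp add: algebra_simps)
      have "norm (P (real n)) \<le> (M \<sigma> + \<bar>E\<bar>) * (exp (real n) * exp (\<sigma> * real n)) * exp (- \<Psi> (real n))"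
        unfolding P_def using b by (simp add: abs_mult mult_right_mono)
      also have "\<dots> = (M \<sigma> + \<bar>E\<bar>) * (exp ((\<sigma> + 2) * \<bar>real n\<bar> - \<Psi> (real n)) * exp (- real n))"
      proof -
        have "exp (real n) * exp (\<sigma> * real n) * exp (- \<Psi> (real n)) = exp ((\<sigma> + 2) * \<bar>real n\<bar> - \<Psi> (real n)) * exp (- real n)"
          unfolding mult_exp_exp by (rule arg_cong[of _ _ exp]) (simp add: algebra_simps)
        then show ?thesis by (simp only: mult.assoc)
      qed
      also have "\<dots> \<le> (M \<sigma> + \<bar>E\<bar>) * (D * exp (- real n))"
        using M_pos[OF \<sigma>] by (intro mult_left_mono mult_right_mono D(2)[rule_format]) auto
      finally show ?thesis by (simp only: mult.assoc)
    qed
    moreover have "(\<lambda>n. (M \<sigma> + \<bar>E\<bar>) * D * exp (- real n)) \<longlonglongrightarrow> (M \<sigma> + \<bar>E\<bar>) * D * 0"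
      by (intro tendsto_intros filterlim_compose[OF exp_at_bot] filterlim_compose[OF filterlim_uminus_at_bot_at_top] filterlim_real_sequentially)
    ultimately show ?thesis
      using Lim_null_comparison[of "\<lambda>n. P (real n)" "\<lambda>n. (M \<sigma> + \<bar>E\<bar>) * D * exp (- real n)" sequentially] by simp
  qed
  ultimately have lim: "I \<longlonglongrightarrow> (\<integral>z. g z \<partial>lborel) - 2 * 0"
    unfolding I_eq[abs_def] by (intro tendsto_intros)
  obtain N :: nat where N: "z0 < real N" using reals_Archimedean2 by blast
  have Nz: "z0 \<in> {- real N..real N}" using N z0 by auto
  have "I N \<noteq> 0"
    unfolding I_def using integral_eq_0_iff[OF cf, of "- real N" "real N"] f0 z0 N Nz by auto
  moreover have "0 \<le> I N" unfolding I_def using f0 cf by (intro integral_nonneg integrable_continuous_real) auto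
  ultimately have IN: "0 < I N" by simp
  have "I N \<le> I n" if "N \<le> n" for n
    unfolding I_def using that f0 cf by (intro integral_subset_le integrable_continuous_real) auto
  then have "I N \<le> (\<integral>z. g z \<partial>lborel) - 2 * 0"
    by (intro tendsto_lowerbound[OF lim]) (auto simp: eventually_sequentially)
  then have "0 < moment 0 \<sigma> * (M \<sigma> - \<sigma> * M' \<sigma>)" using IN intg by simp
  then show ?thesis using moment0_pos[of \<sigma>] by (simp add: zero_less_mult_iff)
qed

end

lemma ratio_strict_antimono:
  assumes "0 < x" "x < y"
  shows "M y / y < M x / x"
proof (rule DERIV_neg_imp_decreasing[OF assms(2)])
  fix z assume "x \<le> z" "z \<le> y"
  then have z: "0 < z" using assms by simp
  have "((\<lambda>z. M z / z) has_real_derivative (M' z * z - M z * 1) / (z * z)) (at z)"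
    using z by (intro DERIV_divide M_deriv DERIV_ident) auto
  moreover have "(M' z * z - M z * 1) / (z * z) < 0"
    using slope_less_chord[OF z] z by (intro divide_neg_pos) (auto simp: mult.commute)
  ultimately show "\<exists>D. ((\<lambda>z. M z / z) has_real_derivative D) (at z) \<and> D < 0" by blast
qed

text \<open>\<open>supercritical\<close> says that the variance at zero tilt exceeds
  \<open>1 / J\<close>, so the graph of \<open>M\<close> leaves the origin above the line
  \<open>\<sigma> / J\<close>.\<close>

lemma M_large_at_0: "\<exists>\<sigma>>0. \<sigma> / J < M \<sigma>"
proof -
  have d: "((\<lambda>\<sigma>. M \<sigma> - \<sigma> / J) has_real_derivative M' 0 - 1 / J) (at 0)"
    by (intro DERIV_diff M_deriv DERIV_cdivide DERIV_ident)
  have "0 < M' 0 - 1 / J"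
    using supercritical unfolding M'_def M_0 moment_def by simp
  from has_real_derivative_pos_inc_right[OF d this] obtain e where
    e: "0 < e" "\<And>h. 0 < h \<Longrightarrow> h < e \<Longrightarrow> M 0 - 0 / J < M (0 + h) - (0 + h) / J" by auto
  have "M 0 - 0 / J < M (0 + e / 2) - (0 + e / 2) / J" using e(1) by (intro e(2)) auto
  then show ?thesis using e(1) by (intro exI[of _ "e / 2"]) (simp add: M_0)
qed

text \<open>If \<open>M\<close> stayed above the line \<open>\<sigma> / J\<close> beyond
  \<open>s\<close>, then \<open>phi_star\<close> would grow at least like
  \<open>\<sigma>\<^sup>2 / (2 * J)\<close>, while superquadratic confinement bounds it by
  \<open>\<sigma>\<^sup>2 / (4 * J)\<close> plus a constant.\<close>

lemma M_small_at_top: "\<exists>\<sigma>>s. M \<sigma> < \<sigma> / J"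
proof (rule ccontr)
  assume "\<not> (\<exists>\<sigma>>s. M \<sigma> < \<sigma> / J)"
  then have ge: "\<sigma> / J \<le> M \<sigma>" if "s < \<sigma>" for \<sigma> using that by force
  define a where "a = max s 0 + 1"
  have a: "s < a" "0 < a" unfolding a_def by auto
  have lower: "phi_star \<Psi> a - a\<^sup>2 / (2 * J) \<le> phi_star \<Psi> \<sigma> - \<sigma>\<^sup>2 / (2 * J)" if "a \<le> \<sigma>" for \<sigma>
  proof (rule DERIV_nonneg_imp_nondecreasing[OF that])
    fix x assume x: "a \<le> x" "x \<le> \<sigma>"
    have "((\<lambda>x. phi_star \<Psi> x - x\<^sup>2 / (2 * J)) has_real_derivative M x - x / J) (at x)"
      using J_pos by (auto intro!: derivative_eq_intros phi_star_deriv)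
    moreover have "0 \<le> M x - x / J" using ge[of x] x a by simp
    ultimately show "\<exists>D. ((\<lambda>x. phi_star \<Psi> x - x\<^sup>2 / (2 * J)) has_real_derivative D) (at x) \<and> 0 \<le> D" by blast
  qed
  \<comment> \<open>\<open>J * z\<^sup>2\<close> absorbs \<open>\<sigma> * z\<close> up to
    \<open>\<sigma>\<^sup>2 / (4 * J)\<close>; the remaining \<open>z\<^sup>2 / 2\<close> is kept as
    the exponent of a Gaussian.\<close>
  obtain C where C: "\<forall>z. (J + 1 / 2) * z\<^sup>2 - C \<le> \<Psi> z" using potential_superquadratic by blast
  define D where "D = (\<integral>z. exp (C + 1) * exp (- z\<^sup>2 / 2 - 1) \<partial>lborel)"
  have upper: "moment 0 \<sigma> \<le> exp (\<sigma>\<^sup>2 / (4 * J)) * D" for \<sigma>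
  proof -
    have "moment 0 \<sigma> \<le> (\<integral>z. exp (\<sigma>\<^sup>2 / (4 * J)) * (exp (C + 1) * exp (- z\<^sup>2 / 2 - 1)) \<partial>lborel)"
      unfolding moment_def
    proof (rule integral_mono[OF integrable_moment integrable_mult_right[OF integrable_mult_right[OF integrable_gauss]]])
      fix z
      have "\<sigma> * z \<le> \<sigma>\<^sup>2 / (4 * J) + J * z\<^sup>2"
      proof -
        have "0 \<le> (\<sigma> - 2 * J * z)\<^sup>2 / (4 * J)" using J_pos by simp
        also have "\<dots> = \<sigma>\<^sup>2 / (4 * J) + J * z\<^sup>2 - \<sigma> * z" using J_pos by (simp add: field_simps power2_eq_square)
        finally show ?thesis by simp
      qed
      moreover have "J * z\<^sup>2 + z\<^sup>2 / 2 - C \<le> \<Psi> z" using C[rule_format, of z] by (simp add: distrib_right)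
      ultimately have "\<sigma> * z - \<Psi> z \<le> \<sigma>\<^sup>2 / (4 * J) + ((C + 1) + (- z\<^sup>2 / 2 - 1))" by simp
      then show "z ^ 0 * exp (\<sigma> * z - \<Psi> z) \<le> exp (\<sigma>\<^sup>2 / (4 * J)) * (exp (C + 1) * exp (- z\<^sup>2 / 2 - 1))"
        unfolding mult_exp_exp by simp
    qed
    then show ?thesis unfolding D_def by simp
  qed
  have Dp: "0 < D"
  proof -
    have "0 < exp (0\<^sup>2 / (4 * J)) * D" using upper[of 0] moment0_pos[of 0] by linarith
    then show ?thesis by simp
  qed
  have up2: "phi_star \<Psi> \<sigma> \<le> \<sigma>\<^sup>2 / (4 * J) + ln D" for \<sigma>
  proof -
    have "ln (moment 0 \<sigma>) \<le> ln (exp (\<sigma>\<^sup>2 / (4 * J)) * D)" using upper moment0_pos by (intro ln_mono)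
    then show ?thesis using Dp by (simp add: phi_star_eq ln_mult)
  qed
  define c where "c = \<bar>ln D - phi_star \<Psi> a + a\<^sup>2 / (2 * J)\<bar>"
  \<comment> \<open>At this size the lower and the upper bound for \<open>phi_star\<close> are
    incompatible.\<close>
  define \<sigma> where "\<sigma> = a + 1 + 4 * J * (c + 1)"
  have \<sigma>: "a \<le> \<sigma>" "1 \<le> \<sigma>" "4 * J * (c + 1) \<le> \<sigma>" unfolding \<sigma>_def using a J_pos by (auto simp: c_def)
  have "\<sigma>\<^sup>2 / (2 * J) - \<sigma>\<^sup>2 / (4 * J) \<le> c" using lower[OF \<sigma>(1)] up2[of \<sigma>] unfolding c_def by linarith
  moreover have "\<sigma>\<^sup>2 / (2 * J) - \<sigma>\<^sup>2 / (4 * J) = \<sigma>\<^sup>2 / (4 * J)" using J_pos by (simp add: field_simps)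
  ultimately have "\<sigma>\<^sup>2 \<le> 4 * J * c" using J_pos by (simp add: field_simps)
  moreover have "\<sigma> * 1 \<le> \<sigma> * \<sigma>" using \<sigma> by (intro mult_left_mono) auto
  ultimately have "4 * J * (c + 1) \<le> 4 * J * c" using \<sigma>(3) by (simp add: power2_eq_square)
  then show False using J_pos by (simp add: distrib_left)
qed

text \<open>With \<open>\<sigma> = J * m\<close> the equation for \<open>m > 0\<close> reads
  \<open>M \<sigma> / \<sigma> = 1 / J\<close>. The ratio is strictly decreasing, exceeds
  \<open>1 / J\<close> somewhere and falls below it later; since \<open>M\<close> is odd, the
  negative solution is the mirror image.\<close>

lemma fixed_points: "\<exists>a>0. {m. M (J * m) = m} = {- a, 0, a}"
proof -
  obtain s where s: "0 < s" "s / J < M s" using M_large_at_0 by blast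
  obtain t where t: "s < t" "M t < t / J" using M_small_at_top by blast
  have "continuous_on {s..t} (\<lambda>\<sigma>. M \<sigma> - \<sigma> / J)" using J_pos by (intro continuous_intros continuous_M) auto
  then obtain r where r: "s \<le> r" "M r - r / J = 0"
    using IVT2'[of "\<lambda>\<sigma>. M \<sigma> - \<sigma> / J" t 0 s] s t by fastforce
  have rp: "0 < r" using r s by simp
  define a where "a = r / J"
  have a: "0 < a" "M (J * a) = a" "J * a = r" unfolding a_def using rp r J_pos by auto
  have uniq: "m = a" if m: "0 < m" "M (J * m) = m" for m
  proof (rule ccontr)
    assume "m \<noteq> a"
    have e: "M (J * m) / (J * m) = 1 / J" unfolding m(2) using m(1) J_pos by simp
    have e': "M (J * a) / (J * a) = 1 / J" unfolding a(2) using a(1) J_pos by simp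
    have p: "0 < J * m" "0 < J * a" by (rule mult_pos_pos[OF J_pos m(1)], rule mult_pos_pos[OF J_pos a(1)])
    show False
    proof (cases m a rule: linorder_cases)
      case less
      then have "J * m < J * a" using J_pos by simp
      from ratio_strict_antimono[OF p(1) this] show ?thesis unfolding e e' by simp
    next
      case greater
      then have "J * a < J * m" using J_pos by simp
      from ratio_strict_antimono[OF p(2) this] show ?thesis unfolding e e' by simp
    qed (use \<open>m \<noteq> a\<close> in simp)
  qed
  have "{m. M (J * m) = m} = {- a, 0, a}"
  proof (intro set_eqI iffI)
    fix m assume "m \<in> {m. M (J * m) = m}"
    then have m: "M (J * m) = m" by simp
    show "m \<in> {- a, 0, a}"
    proof (cases m "0::real" rule: linorder_cases)
      case less
      have "M (J * (- m)) = - m" using M_uminus[of "J * m"] m by simp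
      then have "- m = a" using less by (intro uniq) auto
      then show ?thesis by auto
    next
      case greater
      then show ?thesis using uniq m by simp
    qed simp
  next
    fix m assume "m \<in> {- a, 0, a}"
    then show "m \<in> {m. M (J * m) = m}" using a M_0 M_uminus[of "J * a"] by auto
  qed
  then show ?thesis using a by blast
qed

section \<open>Legendre duality and the critical points of the coarse-grained potential\<close>

definition "N m = (THE \<sigma>. M \<sigma> = m)"

text \<open>Injectivity is strict monotonicity. Surjectivity applies \<open>M_unbounded\<close>
  twice: oddness turns a large value of \<open>M\<close> into one below \<open>m\<close>, and the
  \<open>min\<close> orders the endpoints for the intermediate value theorem.\<close>

lemma N_M: "N (M \<sigma>) = \<sigma>" and M_N: "M (N m) = m"
proof -
  have inj: "x = y" if "M x = M y" for x y using M_strict_mono[of x y] M_strict_mono[of y x] that by (cases x y rule: linorder_cases) auto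
  show 1: "N (M \<sigma>) = \<sigma>" for \<sigma> unfolding N_def using inj by blast
  obtain x where x: "m \<le> M x" using M_unbounded by blast
  obtain y where y: "- m \<le> M y" using M_unbounded by blast
  have "M (min (- y) x) \<le> m"
  proof -
    have "M (min (- y) x) \<le> M (- y)"       by (cases "x < - y") (use M_strict_mono[of x "- y"] in \<open>simp_all add: min_def\<close>)
    then show ?thesis using M_uminus[of y] y by simp
  qed
  then obtain z where "M z = m" using IVT'[of M "min (- y) x" m x] x continuous_M by auto
  then show "M (N m) = m" using 1[of z] by simp
qed

lemma N_deriv: "(N has_real_derivative inverse (M' (N m))) (at m)"
proof -
  have "isCont N (M (N m))"
    by (rule isCont_inverse_function[of 1]) (use N_M M_deriv in \<open>auto intro: DERIV_isCont\<close>)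
  then show ?thesis
    using M_deriv[of "N m"] M'_pos[of "N m"] M_N
    by (intro DERIV_inverse_function[where f = M and a = "m - 1" and b = "m + 1"]) auto
qed

text \<open>The tangent inequality for \<open>phi_star\<close> at \<open>N m\<close> shows that the
  supremum is attained there.\<close>

lemma phi_eq: "phi \<Psi> m = N m * m - phi_star \<Psi> (N m)"
  unfolding phi_def
proof (rule cSup_eq_maximum)
  show "x \<le> N m * m - phi_star \<Psi> (N m)" if "x \<in> range (\<lambda>\<sigma>. \<sigma> * m - phi_star \<Psi> \<sigma>)" for x
  proof -
    obtain \<sigma> where x: "x = \<sigma> * m - phi_star \<Psi> \<sigma>" using \<open>x \<in> range _\<close> by blast
    show ?thesis unfolding x using phi_star_above_tangent[of "N m" \<sigma>] unfolding M_N by (simp add: algebra_simps)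
  qed
qed auto

lemma phi_deriv: "(phi \<Psi> has_real_derivative N m) (at m)"
proof -
  have "((\<lambda>m. N m * m - phi_star \<Psi> (N m)) has_real_derivative
     (inverse (M' (N m)) * m + 1 * N m) - M (N m) * inverse (M' (N m))) (at m)"
    by (intro DERIV_diff DERIV_mult N_deriv DERIV_ident DERIV_chain2[OF phi_star_deriv N_deriv])
  then show ?thesis unfolding M_N phi_eq[abs_def] by (simp add: algebra_simps)
qed

text \<open>\<open>H_bar \<Psi> J\<close> has derivative \<open>N m - J * m\<close>, and inverting
  \<open>N\<close> turns its zeros into the solutions of the self-consistency equation for the
  mean.\<close>

lemma critical_points: "{m. (H_bar \<Psi> J has_real_derivative 0) (at m)} = {m. M (J * m) = m}"
proof (intro set_eqI iffI)
  have d: "(H_bar \<Psi> J has_real_derivative N m - J * m) (at m)" for m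
    unfolding H_bar_def[abs_def] by (auto intro!: derivative_eq_intros phi_deriv)
  fix m
  show "m \<in> {m. M (J * m) = m}" if "m \<in> {m. (H_bar \<Psi> J has_real_derivative 0) (at m)}"
  proof -
    have "N m - J * m = 0" using that DERIV_unique[OF d] by simp
    then show ?thesis using M_N[of m] by simp
  qed
  show "m \<in> {m. (H_bar \<Psi> J has_real_derivative 0) (at m)}" if "m \<in> {m. M (J * m) = m}"
  proof -
    have "N m = J * m" using that N_M[of "J * m"] by simp
    then show ?thesis using d[of m] by simp
  qed
qed

lemma m_star: "0 < m_star \<Psi> J" "{m. M (J * m) = m} = {- m_star \<Psi> J, 0, m_star \<Psi> J}"
proof -
  obtain a where a: "0 < a" "{m. M (J * m) = m} = {- a, 0, a}" using fixed_points by blast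
  have "m_star \<Psi> J = a"
    unfolding m_star_def critical_points a(2)
  proof (rule the_equality)
    fix b assume b: "0 < b \<and> {- a, 0, a} = {- b, 0, b}"
    then have "b \<in> {- a, 0, a}" by auto
    then show "b = a" using b a by auto
  qed (use a in auto)
  then show "0 < m_star \<Psi> J" "{m. M (J * m) = m} = {- m_star \<Psi> J, 0, m_star \<Psi> J}" using a by auto
qed

lemma critical_measures:
  assumes "M (J * m) = m"
  shows "mu_tilted \<Psi> (J * m) \<in> {mu_minus \<Psi> J, mu_zero \<Psi>, mu_plus \<Psi> J}"
proof -
  have dphi: "deriv (phi \<Psi>) m = J * m" if "M (J * m) = m" for m
  proof -
    have "N m = J * m" using that N_M[of "J * m"] by simp
    then show ?thesis using DERIV_imp_deriv[OF phi_deriv[of m]] by simp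
  qed
  have "m \<in> {- m_star \<Psi> J, 0, m_star \<Psi> J}" using assms m_star(2) by blast
  then show ?thesis unfolding mu_minus_def mu_zero_def mu_plus_def using dphi[OF assms] by auto
qed

end

section \<open>Curves dissipating an energy\<close>

text \<open>The energy argument sees only distances between positive times and a real energy. The
  dissipation is stated with \<open>Lim\<close>, as the flow provides it; that the limit exists is
  settled by \<open>AE_speed_exists\<close>.\<close>

locale dissipative_curve =
  fixes \<omega> :: "real \<Rightarrow> real \<Rightarrow> real" and m E :: "real \<Rightarrow> real"
  assumes nonneg: "\<And>s t. 0 < s \<Longrightarrow> 0 < t \<Longrightarrow> 0 \<le> \<omega> s t"
    and refl: "\<And>t. 0 < t \<Longrightarrow> \<omega> t t = 0"
    and sym: "\<And>s t. 0 < s \<Longrightarrow> 0 < t \<Longrightarrow> \<omega> s t = \<omega> t s"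
    and triangle: "\<And>r s t. 0 < r \<Longrightarrow> 0 < s \<Longrightarrow> 0 < t \<Longrightarrow> \<omega> r t \<le> \<omega> r s + \<omega> s t"
    and m: "L2_loc_pos m"
    and bound: "\<And>s t. 0 < s \<Longrightarrow> s < t \<Longrightarrow> \<omega> s t \<le> (LINT r:{s..t}|lborel. m r)"
    and E_ac: "locally_abs_continuous_pos E"
    and dissipation: "AE t in lborel. 0 < t \<longrightarrow>
      (E has_real_derivative - (Lim (at t) (\<lambda>s. \<omega> s t / \<bar>s - t\<bar>))\<^sup>2) (at t)"
begin

lemma set_integrable_m2: "0 < s \<Longrightarrow> set_integrable lborel {s..t} (\<lambda>r. (m r)\<^sup>2)"
  using m unfolding L2_loc_pos_def by (auto dest!: spec[of _ "{s..t}"])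

lemma set_integrable_const_Icc: "set_integrable lborel {s..t} (\<lambda>r. k)" for s t k :: real
  unfolding set_integrable_def scaleR_conv_of_real by (simp add: integrable_real_indicator emeasure_lborel_Icc_eq)

lemma set_integrable_m: assumes "0 < s" shows "set_integrable lborel {s..t} m"
proof -
  have m0: "(\<lambda>r. indicator {0<..} r *\<^sub>R m r) \<in> borel_measurable lborel"
    using m unfolding L2_loc_pos_def set_borel_measurable_def by (rule conjunct1)
  have "(\<lambda>r. indicator {s..t} r *\<^sub>R (indicator {0<..} r *\<^sub>R m r)) \<in> borel_measurable lborel"
    by (rule borel_measurable_scaleR[OF _ m0]) simp
  also have "(\<lambda>r. indicator {s..t} r *\<^sub>R (indicator {0<..} r *\<^sub>R m r)) = (\<lambda>r. indicator {s..t} r *\<^sub>R m r)"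
    using assms by (auto split: split_indicator)
  finally have meas: "(\<lambda>r. indicator {s..t} r *\<^sub>R m r) \<in> borel_measurable lborel" .
  have "set_integrable lborel {s..t} (\<lambda>r. 1 + (m r)\<^sup>2)"
    by (intro set_integral_add set_integrable_m2[OF assms] set_integrable_const_Icc)
  then show ?thesis unfolding set_integrable_def
  proof (rule Bochner_Integration.integrable_bound[OF _ meas])
    have *: "\<bar>x\<bar> \<le> 1 + x\<^sup>2" for x :: real
      using zero_le_power2[of "\<bar>x\<bar> - 1/2"] unfolding power2_diff power2_abs by (simp add: power2_eq_square)
    show "AE x in lborel. norm (indicator {s..t} x *\<^sub>R m x) \<le> norm (indicator {s..t} x *\<^sub>R (1 + (m x)\<^sup>2))"
      using * by (intro AE_I2) (simp split: split_indicator)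
  qed
qed

text \<open>Young's inequality \<open>m r \<le> k * (m r)\<^sup>2 + 1 / (4 * k)\<close> under the
  integral; small \<open>k\<close> will give absolute continuity of the distance.\<close>

lemma increment_le:
  assumes st: "0 < s" "s \<le> t" and k: "0 < k"
  shows "\<omega> s t \<le> k * (LINT r:{s..t}|lborel. (m r)\<^sup>2) + (t - s) / (4 * k)"
proof (cases "s = t")
  case True
  then show ?thesis using refl st k by (simp add: set_lebesgue_integral_def)
next
  case False
  have "(LINT r:{s..t}|lborel. m r) \<le> (LINT r:{s..t}|lborel. k * (m r)\<^sup>2 + 1 / (4 * k))"
  proof (rule set_integral_mono)
    show "set_integrable lborel {s..t} (\<lambda>r. k * (m r)\<^sup>2 + 1 / (4 * k))"
      by (intro set_integral_add set_integrable_mult_right set_integrable_m2[OF st(1)] set_integrable_const_Icc)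
    fix r
    have "0 \<le> k * (m r - 1 / (2 * k))\<^sup>2" using k by simp
    also have "\<dots> = k * (m r)\<^sup>2 + 1 / (4 * k) - m r" using k by (simp add: power2_eq_square field_simps)
    finally show "m r \<le> k * (m r)\<^sup>2 + 1 / (4 * k)" by simp
  qed (rule set_integrable_m[OF st(1)])
  also have "\<dots> = k * (LINT r:{s..t}|lborel. (m r)\<^sup>2) + (LINT r:{s..t}|lborel. 1 / (4 * k))"
    by (subst set_integral_add(2)[OF set_integrable_mult_right[OF set_integrable_m2[OF st(1)]] set_integrable_const_Icc]) simp
  also have "(LINT r:{s..t}|lborel. 1 / (4 * k)) = (t - s) / (4 * k)"
    using st by (simp add: set_lebesgue_integral_def)
  finally show ?thesis using bound[of s t] st False by linarith
qed

lemma abs_continuous_distance: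
  assumes a: "0 < a"
  shows "abs_continuous_on_interval a b (\<omega> a)"
proof (rule abs_continuous_on_intervalI)
  fix e :: real assume e: "0 < e"
  define G where "G t = (LINT r:{a..t}|lborel. (m r)\<^sup>2)" for t
  have split: "G y - G x = (LINT r:{x..y}|lborel. (m r)\<^sup>2)" if "a \<le> x" "x \<le> y" for x y
  proof -
    have "integral {a..x} (\<lambda>r. (m r)\<^sup>2) + integral {x..y} (\<lambda>r. (m r)\<^sup>2) = integral {a..y} (\<lambda>r. (m r)\<^sup>2)"
      using that set_borel_integral_eq_integral(1)[OF set_integrable_m2[OF a]]
      by (intro Henstock_Kurzweil_Integration.integral_combine) auto
    then show ?thesis unfolding G_def
      using that a set_borel_integral_eq_integral(2)[OF set_integrable_m2] by simp
  qed
  have pos: "0 \<le> (LINT r:{x..y}|lborel. (m r)\<^sup>2)" for x y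
    unfolding set_lebesgue_integral_def by (intro integral_nonneg_AE AE_I2) (simp split: split_indicator)
  have mono: "G x \<le> G y" if "a \<le> x" "x \<le> y" for x y using split[OF that] pos[of x y] by simp
  have G0: "0 \<le> G t" for t unfolding G_def by (rule pos)
  \<comment> \<open>Makes the first terms of \<open>increment_le\<close> add up to at most
    \<open>e / 4\<close>; the second do so as well once the total length is below
    \<open>k * e\<close>.\<close>
  define k where "k = e / (4 * (G b + 1))"
  have k: "0 < k" "k * G b \<le> e / 4" using e G0[of b] unfolding k_def by (auto simp: field_simps)
  show "\<exists>d>0. \<forall>I :: (real \<times> real) set. finite I \<longrightarrow> (\<forall>x y. (x, y) \<in> I \<longrightarrow> a \<le> x \<and> x \<le> y \<and> y \<le> b) \<longrightarrow>
       pairwise (\<lambda>p q. disjnt {fst p<..<snd p} {fst q<..<snd q}) I \<longrightarrow>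
       (\<Sum>(x, y)\<in>I. y - x) < d \<longrightarrow> (\<Sum>(x, y)\<in>I. \<bar>\<omega> a y - \<omega> a x\<bar>) < e"
  proof (rule exI[of _ "k * e"], intro conjI allI impI)
    show "0 < k * e" using k e by simp
    fix I :: "(real \<times> real) set"
    assume I: "finite I" "\<forall>x y. (x, y) \<in> I \<longrightarrow> a \<le> x \<and> x \<le> y \<and> y \<le> b"
      "pairwise (\<lambda>p q. disjnt {fst p<..<snd p} {fst q<..<snd q}) I" "(\<Sum>(x, y)\<in>I. y - x) < k * e"
    have "(\<Sum>(x, y)\<in>I. \<bar>\<omega> a y - \<omega> a x\<bar>) \<le> (\<Sum>(x, y)\<in>I. k * (G y - G x) + (y - x) / (4 * k))"
    proof (rule sum_mono, clarify)
      fix x y assume "(x, y) \<in> I"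
      then have xy: "a \<le> x" "x \<le> y" using I by auto
      have "\<bar>\<omega> a y - \<omega> a x\<bar> \<le> \<omega> x y"
        using triangle[of a x y] triangle[of a y x] sym[of x y] xy a by linarith
      also have "\<dots> \<le> k * (G y - G x) + (y - x) / (4 * k)"
        unfolding split[OF xy] using xy a k by (intro increment_le) auto
      finally show "\<bar>\<omega> a y - \<omega> a x\<bar> \<le> k * (G y - G x) + (y - x) / (4 * k)" .
    qed
    also have "\<dots> = k * (\<Sum>(x, y)\<in>I. G y - G x) + (\<Sum>(x, y)\<in>I. y - x) / (4 * k)"
      by (simp add: split_beta sum.distrib sum_distrib_left sum_divide_distrib)
    also have "(\<Sum>(x, y)\<in>I. G y - G x) \<le> G b"
    proof (cases "a \<le> b")
      case True
      then have "(\<Sum>(x, y)\<in>I. G y - G x) \<le> G b - G a"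
        using I mono by (intro sum_increments_mono_le) (auto simp: mono_on_def)
      then show ?thesis using G0[of a] by linarith
    next
      case False
      then have "I = {}" using I(2) by force
      then show ?thesis using G0 by simp
    qed
    finally have "(\<Sum>(x, y)\<in>I. \<bar>\<omega> a y - \<omega> a x\<bar>) \<le> k * G b + (\<Sum>(x, y)\<in>I. y - x) / (4 * k)"
      using k by simp
    also have "(\<Sum>(x, y)\<in>I. y - x) / (4 * k) \<le> k * e / (4 * k)"
      using k I(4) by (intro divide_right_mono) auto
    finally show "(\<Sum>(x, y)\<in>I. \<bar>\<omega> a y - \<omega> a x\<bar>) < e" using k e by simp
  qed
qed

text \<open>In contrast to \<open>metric_derivative\<close> this asserts that the limit defining the
  speed exists.\<close>

definition energy_speed :: "real \<Rightarrow> real \<Rightarrow> bool" where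
  "energy_speed t w \<longleftrightarrow> ((\<lambda>s. \<omega> s t / \<bar>s - t\<bar>) \<longlongrightarrow> w) (at t) \<and> (E has_real_derivative - w\<^sup>2) (at t)"

text \<open>The dominating measure has density \<open>\<bar>m r\<bar>\<close> on
  \<open>{a..b}\<close>; the modulus is taken because \<open>m\<close> may be negative.\<close>

lemma AE_speed_exists:
  assumes "0 < a"
  shows "AE t in lborel. t \<in> {a<..<b} \<longrightarrow> (\<exists>w. ((\<lambda>s. \<omega> s t / \<bar>s - t\<bar>) \<longlongrightarrow> w) (at t))"
proof -
  define h where "h r = indicator {a..b} r * \<bar>m r\<bar>" for r
  have h: "integrable lborel h"
    using integrable_abs[OF set_integrable_m[OF assms, of b, unfolded set_integrable_def]]
    unfolding h_def by (simp add: abs_mult)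
  have h0: "0 \<le> h r" for r unfolding h_def by simp
  have [measurable]: "h \<in> borel_measurable borel" using h by auto
  define \<beta> where "\<beta> = density lborel (\<lambda>r. ennreal (h r))"
  have em: "emeasure \<beta> A = ennreal (LINT r:A|lborel. h r)" if [measurable]: "A \<in> sets borel" for A
  proof -
    have "integrable lborel (\<lambda>r. indicator A r * h r)"
      by (rule Bochner_Integration.integrable_bound[OF h]) (auto split: split_indicator)
    then have "(\<integral>\<^sup>+r. ennreal (indicator A r * h r) \<partial>lborel) = ennreal (LINT r:A|lborel. h r)"
      unfolding set_lebesgue_integral_def using h0 by (subst nn_integral_eq_integral) auto
    moreover have "emeasure \<beta> A = (\<integral>\<^sup>+r. ennreal (indicator A r * h r) \<partial>lborel)"
      unfolding \<beta>_def by (subst emeasure_density) (auto intro!: nn_integral_cong split: split_indicator)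
    ultimately show ?thesis by simp
  qed
  interpret ps: dominated_pseudometric \<omega> a b \<beta>
  proof (rule dominated_pseudometric.intro)
    show "finite_measure \<beta>" by (rule finite_measureI) (use em[of UNIV] in \<open>simp add: \<beta>_def\<close>)
    show "sets \<beta> = sets borel" by (simp add: \<beta>_def)
    show "absolutely_continuous lborel \<beta>" unfolding \<beta>_def by (rule absolutely_continuousI_density) simp
    fix s t assume st: "a < s" "s \<le> t" "t < b"
    have "0 \<le> (LINT r:{s..t}|lborel. h r)"
      unfolding set_lebesgue_integral_def by (intro integral_nonneg_AE AE_I2) (simp add: h0)
    then have meas: "measure \<beta> {s..t} = (LINT r:{s..t}|lborel. h r)"
      unfolding measure_def using em[of "{s..t}"] by simp
    show "\<omega> s t \<le> measure \<beta> {s..t}"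
    proof (cases "s = t")
      case True
      then show ?thesis using refl assms st by simp
    next
      case False
      have "(LINT r:{s..t}|lborel. m r) \<le> (LINT r:{s..t}|lborel. h r)"
      proof -
        have "(LINT r:{s..t}|lborel. h r) = (LINT r:{s..t}|lborel. \<bar>m r\<bar>)"
          unfolding set_lebesgue_integral_def h_def using st by (intro Bochner_Integration.integral_cong) (auto split: split_indicator)
        then show ?thesis
          using set_integrable_m[of s t] assms st by (auto intro!: set_integral_mono set_integrable_abs)
      qed
      then show ?thesis using bound[of s t] False assms st unfolding meas by linarith
    qed
  qed (use assms nonneg sym triangle in auto)
  show ?thesis by (rule ps.AE_metric_derivative_exists)
qed

lemma AE_energy_speed: "AE t in lborel. 0 < t \<longrightarrow> (\<exists>w. energy_speed t w)"
proof -
  have "AE t in lborel. \<forall>n::nat. t \<in> {1 / real (Suc n)<..<real (Suc n)} \<longrightarrow> (\<exists>w. ((\<lambda>s. \<omega> s t / \<bar>s - t\<bar>) \<longlongrightarrow> w) (at t))"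
    unfolding AE_all_countable by (intro allI AE_speed_exists) simp
  then show ?thesis using dissipation
  proof eventually_elim
    case (elim t)
    show ?case
    proof
      assume t: "0 < t"
      obtain n where n: "max t (1 / t) < real n" using reals_Archimedean2 by blast
      have "1 / t < real (Suc n)" "t < real (Suc n)" using n by auto
      then have "1 / real (Suc n) < t" using t by (simp add: field_simps)
      then obtain w where w: "((\<lambda>s. \<omega> s t / \<bar>s - t\<bar>) \<longlongrightarrow> w) (at t)"
        using elim(1) \<open>t < real (Suc n)\<close> unfolding greaterThanLessThan_iff by blast
      have "Lim (at t) (\<lambda>s. \<omega> s t / \<bar>s - t\<bar>) = w" using w by (intro tendsto_Lim) auto
      then show "\<exists>w. energy_speed t w" using elim(2) t w unfolding energy_speed_def by auto
    qed
  qed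
qed

text \<open>The form required by \<open>abs_continuous_antimonotone\<close>: the intervals contain
  \<open>t\<close> anywhere, not merely as an endpoint. The two sides of \<open>t\<close> are
  expanded separately and added.\<close>

lemma energy_speed_expansion:
  assumes t: "0 < t" and w: "energy_speed t w" and e: "0 < e"
  shows "\<exists>d>0. \<forall>u v. 0 < u \<longrightarrow> u \<le> t \<longrightarrow> t \<le> v \<longrightarrow> t - u < d \<longrightarrow> v - t < d \<longrightarrow>
     \<omega> u v \<le> (w + e) * (v - u) \<and> E v - E u \<le> (e - w\<^sup>2) * (v - u)"
proof -
  obtain d1 where d1: "0 < d1" "\<And>s. s \<noteq> t \<Longrightarrow> \<bar>s - t\<bar> < d1 \<Longrightarrow> \<bar>\<omega> s t / \<bar>s - t\<bar> - w\<bar> < e"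
    using LIM_D[OF conjunct1[OF w[unfolded energy_speed_def]] e] unfolding real_norm_def by metis
  obtain d2 where d2: "0 < d2" "\<And>s. s \<noteq> t \<Longrightarrow> \<bar>s - t\<bar> < d2 \<Longrightarrow> \<bar>(E s - E t) / (s - t) - - w\<^sup>2\<bar> < e"
    using LIM_D[OF conjunct2[OF w[unfolded energy_speed_def], unfolded has_field_derivative_iff] e] unfolding real_norm_def by metis
  have dist: "\<omega> s t \<le> (w + e) * \<bar>s - t\<bar>" if "\<bar>s - t\<bar> < d1" for s
  proof (cases "s = t")
    case False
    then have "\<omega> s t / \<bar>s - t\<bar> \<le> w + e" using d1(2)[of s] that by linarith
    then show ?thesis using False by (simp add: field_simps)
  qed (simp add: refl t)
  have up: "E v - E t \<le> (e - w\<^sup>2) * (v - t)" if "t \<le> v" "v - t < d2" for v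
  proof (cases "v = t")
    case False
    then have "(E v - E t) / (v - t) \<le> e - w\<^sup>2" using d2(2)[of v] that by auto
    then show ?thesis using False that by (simp add: field_simps)
  qed simp
  have down: "E t - E u \<le> (e - w\<^sup>2) * (t - u)" if "u \<le> t" "t - u < d2" for u
  proof (cases "u = t")
    case False
    have "(E t - E u) / (t - u) = (E u - E t) / (u - t)" using False by (simp add: field_simps)
    also have "\<dots> \<le> e - w\<^sup>2" using d2(2)[of u] that False by auto
    finally show ?thesis using False that by (simp add: field_simps)
  qed simp
  show ?thesis
  proof (rule exI[of _ "min d1 d2"], intro conjI allI impI)
    fix u v assume uv: "0 < u" "u \<le> t" "t \<le> v" "t - u < min d1 d2" "v - t < min d1 d2"
    have "\<omega> u v \<le> \<omega> u t + \<omega> v t" using triangle[of u t v] sym[of t v] uv t by simp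
    also have "\<dots> \<le> (w + e) * (t - u) + (w + e) * (v - t)" using dist[of u] dist[of v] uv by simp
    finally show "\<omega> u v \<le> (w + e) * (v - u)" by (simp add: algebra_simps)
    have "E v - E u \<le> (e - w\<^sup>2) * (v - t) + (e - w\<^sup>2) * (t - u)" using up[of v] down[of u] uv by simp
    then show "E v - E u \<le> (e - w\<^sup>2) * (v - u)" by (simp add: algebra_simps)
  qed (use d1 d2 in auto)
qed

lemma energy_speed_off_null_set:
  obtains Z where "Z \<in> null_sets lborel" "\<And>t. 0 < t \<Longrightarrow> t \<notin> Z \<Longrightarrow> \<exists>w. energy_speed t w"
proof -
  from AE_energy_speed obtain Z where "{t \<in> space lborel. \<not> (0 < t \<longrightarrow> (\<exists>w. energy_speed t w))} \<subseteq> Z" "Z \<in> sets lborel" "emeasure lborel Z = 0"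
    by (rule AE_E)
  then show thesis by (intro that[of Z]) auto
qed

lemma energy_antimono:
  assumes ab: "0 < a" "a \<le> b" shows "E b \<le> E a"
proof (cases "a = b")
  case False
  obtain Z where Z: "Z \<in> null_sets lborel" "\<And>t. 0 < t \<Longrightarrow> t \<notin> Z \<Longrightarrow> \<exists>w. energy_speed t w" using energy_speed_off_null_set by blast
  show ?thesis
  proof (rule abs_continuous_antimonotone[OF ab(2) _ Z(1)])
    show "abs_continuous_on_interval a b E" using E_ac ab False unfolding locally_abs_continuous_pos_def by simp
    fix x e :: real assume x: "x \<in> {a..b} - Z" "0 < e"
    then have x0: "0 < x" "x \<notin> Z" using ab by auto
    then obtain w where w: "energy_speed x w" using Z(2) by blast
    obtain d where d: "0 < d" "\<And>u v. 0 < u \<Longrightarrow> u \<le> x \<Longrightarrow> x \<le> v \<Longrightarrow> x - u < d \<Longrightarrow> v - x < d \<Longrightarrow>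
      \<omega> u v \<le> (w + e) * (v - u) \<and> E v - E u \<le> (e - w\<^sup>2) * (v - u)"
      using energy_speed_expansion[OF x0(1) w x(2)] by metis
    have "E v - E u \<le> e * (v - u)" if uv: "a \<le> u" "u \<le> x" "x \<le> v" "x - u < d" "v - x < d" for u v
    proof -
      have "(e - w\<^sup>2) * (v - u) \<le> e * (v - u)" using uv by (intro mult_right_mono) auto
      then show ?thesis using d(2)[of u v] uv ab by linarith
    qed
    then show "\<exists>d>0. \<forall>u v. a \<le> u \<longrightarrow> u \<le> x \<longrightarrow> x \<le> v \<longrightarrow> v \<le> b \<longrightarrow> x - u < d \<longrightarrow> v - x < d \<longrightarrow> E v - E u \<le> e * (v - u)"
      using d(1) by blast
  qed
qed simp

text \<open>The function \<open>\<omega> a t - l / 2 * t + E t / (2 * l)\<close> is nonincreasing,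
  because its slope is at most \<open>w - l / 2 - w\<^sup>2 / (2 * l) = - (w - l)\<^sup>2 / (2 *
  l)\<close>. Optimizing over \<open>l\<close> would give the square root bound; with
  \<open>l\<close> free the squared speed is never integrated.\<close>

lemma distance_le_energy_drop:
  assumes ab: "0 < a" "a \<le> b" and l: "0 < l"
  shows "\<omega> a b \<le> l / 2 * (b - a) + (E a - E b) / (2 * l)"
proof (cases "a = b")
  case False
  obtain Z where Z: "Z \<in> null_sets lborel" "\<And>t. 0 < t \<Longrightarrow> t \<notin> Z \<Longrightarrow> \<exists>w. energy_speed t w" using energy_speed_off_null_set by blast
  define f where "f t = \<omega> a t + ((- l / 2) * t + (1 / (2 * l)) * E t)" for t
  have "f b \<le> f a"
  proof (rule abs_continuous_antimonotone[OF ab(2) _ Z(1)])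
    show "abs_continuous_on_interval a b f" unfolding f_def
      using E_ac ab False unfolding locally_abs_continuous_pos_def
      by (intro abs_continuous_on_interval_add abs_continuous_on_interval_mult abs_continuous_distance abs_continuous_on_interval_ident) simp_all
    fix x e :: real assume x: "x \<in> {a..b} - Z" "0 < e"
    then have x0: "0 < x" "x \<notin> Z" using ab by auto
    then obtain w where w: "energy_speed x w" using Z(2) by blast
    \<comment> \<open>Splits the tolerance between the distance and the energy, which enters
      \<open>f\<close> with weight \<open>1 / (2 * l)\<close>.\<close>
    define e1 where "e1 = e / (1 + 1 / (2 * l))"
    have dn: "0 < 1 + 1 / (2 * l)" using l by (simp add: add_pos_pos)
    have e1: "0 < e1" using x(2) dn unfolding e1_def by simp
    have e1': "e1 + e1 / (2 * l) = e"
    proof -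
      have "e1 + e1 / (2 * l) = e1 * (1 + 1 / (2 * l))" by (simp add: distrib_left)
      then show ?thesis using dn unfolding e1_def by simp
    qed
    obtain d where d: "0 < d" "\<And>u v. 0 < u \<Longrightarrow> u \<le> x \<Longrightarrow> x \<le> v \<Longrightarrow> x - u < d \<Longrightarrow> v - x < d \<Longrightarrow>
      \<omega> u v \<le> (w + e1) * (v - u) \<and> E v - E u \<le> (e1 - w\<^sup>2) * (v - u)"
      using energy_speed_expansion[OF x0(1) w e1] by metis
    have "f v - f u \<le> e * (v - u)" if uv: "a \<le> u" "u \<le> x" "x \<le> v" "x - u < d" "v - x < d" for u v
    proof -
      have "\<omega> a v \<le> \<omega> a u + \<omega> u v" using triangle[of a u v] uv ab by linarith
      moreover have "f v - f u = \<omega> a v - \<omega> a u - l / 2 * (v - u) + (1 / (2 * l)) * (E v - E u)"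
        unfolding f_def by (simp add: algebra_simps diff_divide_distrib)
      ultimately have "f v - f u \<le> \<omega> u v - l / 2 * (v - u) + (1 / (2 * l)) * (E v - E u)" by linarith
      also have "\<dots> \<le> (w + e1) * (v - u) - l / 2 * (v - u) + (1 / (2 * l)) * ((e1 - w\<^sup>2) * (v - u))"
        using d(2)[of u v] uv ab l by (intro add_mono diff_mono mult_left_mono order_refl) auto
      also have "\<dots> = (w - l / 2 - w\<^sup>2 / (2 * l) + (e1 + e1 / (2 * l))) * (v - u)" by (simp add: algebra_simps diff_divide_distrib)
      also have "\<dots> \<le> e * (v - u)"
      proof (rule mult_right_mono)
        have "w\<^sup>2 / (2 * l) + l / 2 - w = (w - l)\<^sup>2 / (2 * l)" using l by (simp add: power2_eq_square field_simps)
        moreover have "0 \<le> (w - l)\<^sup>2 / (2 * l)" using l by simp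
        ultimately show "w - l / 2 - w\<^sup>2 / (2 * l) + (e1 + e1 / (2 * l)) \<le> e" unfolding e1' by linarith
      qed (use uv in simp)
      finally show ?thesis .
    qed
    then show "\<exists>d>0. \<forall>u v. a \<le> u \<longrightarrow> u \<le> x \<longrightarrow> x \<le> v \<longrightarrow> v \<le> b \<longrightarrow> x - u < d \<longrightarrow> v - x < d \<longrightarrow> f v - f u \<le> e * (v - u)"
      using d(1) by blast
  qed
  then show ?thesis unfolding f_def using refl[OF ab(1)] by (simp add: algebra_simps diff_divide_distrib)
qed (use refl ab in simp)

text \<open>If the squared speed exceeded the energy drop by \<open>d\<close> at almost all times of
  the unit interval, the energy would fall by more than it does. The null set \<open>N\<close> to be
  avoided will contain the times at which the slope identity fails.\<close>

lemma slow_time: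
  assumes a: "0 < a" and d: "0 < d" and N: "N \<in> null_sets lborel"
  obtains t w where "a \<le> t" "t \<le> a + 1" "t \<notin> N" "energy_speed t w" "w\<^sup>2 \<le> E a - E (a + 1) + d"
proof -
  obtain Z where Z: "Z \<in> null_sets lborel" "\<And>t. 0 < t \<Longrightarrow> t \<notin> Z \<Longrightarrow> \<exists>w. energy_speed t w" using energy_speed_off_null_set by blast
  define c where "c = E a - E (a + 1) + d"
  have "\<exists>t w. a \<le> t \<and> t \<le> a + 1 \<and> t \<notin> N \<and> energy_speed t w \<and> w\<^sup>2 \<le> c"
  proof (rule ccontr)
    assume neg: "\<not> ?thesis"
    have "E (a + 1) + c * (a + 1) \<le> E a + c * a"
    proof (rule abs_continuous_antimonotone[of a "a + 1" "\<lambda>t. E t + c * t", OF _ _ null_sets.Un[OF Z(1) N]])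
      show "abs_continuous_on_interval a (a + 1) (\<lambda>t. E t + c * t)"
        using E_ac a unfolding locally_abs_continuous_pos_def
        by (intro abs_continuous_on_interval_add abs_continuous_on_interval_mult abs_continuous_on_interval_ident) simp
      fix x e :: real assume x: "x \<in> {a..a + 1} - (Z \<union> N)" "0 < e"
      then have x0: "0 < x" "x \<notin> Z" using a by auto
      then obtain w where w: "energy_speed x w" using Z(2) by blast
      have wc: "c < w\<^sup>2" using neg w x by fastforce
      obtain d where d: "0 < d" "\<And>u v. 0 < u \<Longrightarrow> u \<le> x \<Longrightarrow> x \<le> v \<Longrightarrow> x - u < d \<Longrightarrow> v - x < d \<Longrightarrow>
        \<omega> u v \<le> (w + e) * (v - u) \<and> E v - E u \<le> (e - w\<^sup>2) * (v - u)"
        using energy_speed_expansion[OF x0(1) w x(2)] by metis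
      have "E v + c * v - (E u + c * u) \<le> e * (v - u)" if uv: "a \<le> u" "u \<le> x" "x \<le> v" "x - u < d" "v - x < d" for u v
      proof -
        have "(e - w\<^sup>2) * (v - u) \<le> (e - c) * (v - u)" using uv wc by (intro mult_right_mono) auto
        then have "E v - E u \<le> (e - c) * (v - u)" using d(2)[of u v] uv a by linarith
        then show ?thesis by (simp add: algebra_simps)
      qed
      then show "\<exists>d>0. \<forall>u v. a \<le> u \<longrightarrow> u \<le> x \<longrightarrow> x \<le> v \<longrightarrow> v \<le> a + 1 \<longrightarrow> x - u < d \<longrightarrow> v - x < d \<longrightarrow> E v + c * v - (E u + c * u) \<le> e * (v - u)"
        using d(1) by blast
    qed simp
    then show False using d unfolding c_def by (simp add: algebra_simps)
  qed
  then show thesis using that unfolding c_def by blast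
qed

section \<open>Long-time behaviour when the energy is bounded below\<close>

context
  fixes l assumes bdd: "\<And>t. 1 \<le> t \<Longrightarrow> l \<le> E t"
begin

lemma energy_tendsto: obtains e where "(E \<longlongrightarrow> e) at_top"
proof -
  have ne: "E ` {1..} \<noteq> {}" and below: "bdd_below (E ` {1..})" using bdd by (auto intro!: bdd_belowI2[of _ l])
  have "(E \<longlongrightarrow> Inf (E ` {1..})) at_top"
  proof (rule order_tendstoI)
    fix y assume "y < Inf (E ` {1..})"
    then show "\<forall>\<^sub>F x in at_top. y < E x"
      unfolding eventually_at_top_linorder
    proof (intro exI[of _ 1] allI impI)
      fix t :: real assume "1 \<le> t"
      then have "Inf (E ` {1..}) \<le> E t" by (intro cInf_lower[OF _ below]) simp
      then show "y < E t" using \<open>y < _\<close> by linarith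
    qed
  next
    fix y assume "Inf (E ` {1..}) < y"
    then obtain T where T: "1 \<le> T" "E T < y" using cInf_lessD[OF ne] by auto
    show "\<forall>\<^sub>F x in at_top. E x < y"
      unfolding eventually_at_top_linorder
    proof (intro exI[of _ T] allI impI)
      fix t :: real assume "T \<le> t"
      then show "E t < y" using energy_antimono[of T t] T by linarith
    qed
  qed
  then show thesis by (rule that)
qed

text \<open>Windows of length \<open>2\<close> are needed because the slow time of index
  \<open>n\<close> may lie anywhere in \<open>{n + 1..n + 2}\<close> and is compared with times
  between \<open>n\<close> and \<open>n + 1\<close>.\<close>

lemma distance_vanishes:
  assumes e: "0 < e"
  obtains T where "1 \<le> T" "\<And>s t. T \<le> s \<Longrightarrow> s \<le> t \<Longrightarrow> t \<le> s + 2 \<Longrightarrow> \<omega> s t \<le> e"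
proof -
  obtain f where f: "(E \<longlongrightarrow> f) at_top" using energy_tendsto .
  \<comment> \<open>With \<open>l = e / 2\<close> in \<open>distance_le_energy_drop\<close> the
    length term and the energy term are then at most \<open>e / 2\<close> each.\<close>
  define k where "k = e\<^sup>2 / 4"
  have k: "0 < k" unfolding k_def using e by simp
  have "\<forall>\<^sub>F t in at_top. \<bar>E t - f\<bar> < k"
    using tendstoD[OF f k] unfolding dist_real_def .
  then obtain T where T: "\<And>t. T \<le> t \<Longrightarrow> \<bar>E t - f\<bar> < k" unfolding eventually_at_top_linorder by blast
  show thesis
  proof (rule that[of "max T 1"])
    fix s t assume st: "max T 1 \<le> s" "s \<le> t" "t \<le> s + 2"
    have "E s - E t \<le> 2 * k" using T[of s] T[of t] st unfolding max_def by (auto split: if_splits)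
    moreover have "\<omega> s t \<le> (e / 2) / 2 * (t - s) + (E s - E t) / (2 * (e / 2))"
      using distance_le_energy_drop[of s t "e / 2"] st e by simp
    moreover have "(e / 2) / 2 * (t - s) \<le> (e / 2) / 2 * 2" using st e by (intro mult_left_mono) auto
    moreover have "(E s - E t) / (2 * (e / 2)) \<le> 2 * k / (2 * (e / 2))" using calculation(1) e by (intro divide_right_mono) auto
    moreover have "2 * k / (2 * (e / 2)) = e / 2" unfolding k_def using e by (simp add: power2_eq_square)
    ultimately show "\<omega> s t \<le> e" by simp
  qed simp
qed

lemma slow_times:
  assumes N: "N \<in> null_sets lborel"
  obtains t w where "\<And>n. real n + 1 \<le> t n" "\<And>n. t n \<le> real n + 2" "\<And>n. t n \<notin> N" "\<And>n. energy_speed (t n) (w n)" "w \<longlonglongrightarrow> 0"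
proof -
  have "\<exists>t w. real n + 1 \<le> t \<and> t \<le> real n + 2 \<and> t \<notin> N \<and> energy_speed t w \<and>
      w\<^sup>2 \<le> E (real n + 1) - E (real n + 2) + inverse (real (Suc n))" for n
    by (rule slow_time[of "real n + 1" "inverse (real (Suc n))" N]) (use N in \<open>auto simp: add.assoc\<close>)
  then obtain t w where tw: "\<And>n. real n + 1 \<le> t n" "\<And>n. t n \<le> real n + 2" "\<And>n. t n \<notin> N" "\<And>n. energy_speed (t n) (w n)"
      "\<And>n. (w n)\<^sup>2 \<le> E (real n + 1) - E (real n + 2) + inverse (real (Suc n))" by metis
  obtain e where e: "(E \<longlongrightarrow> e) at_top" using energy_tendsto .
  have top: "filterlim (\<lambda>n. real n + c) at_top sequentially" for c
    using filterlim_tendsto_add_at_top[OF tendsto_const[of c] filterlim_real_sequentially] by (simp add: add.commute)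
  have lim: "(\<lambda>n. E (real n + 1) - E (real n + 2) + inverse (real (Suc n))) \<longlonglongrightarrow> e - e + 0"
  proof -
    have E1: "(\<lambda>n. E (real n + c)) \<longlonglongrightarrow> e" for c by (rule filterlim_compose[OF e top])
    show ?thesis by (rule tendsto_add[OF tendsto_diff[OF E1 E1] LIMSEQ_inverse_real_of_nat])
  qed
  have "(\<lambda>n. (w n)\<^sup>2) \<longlonglongrightarrow> e - e + 0"
  proof (rule tendsto_sandwich[OF _ _ _ lim])
    show "(\<lambda>n. 0) \<longlonglongrightarrow> e - e + 0" by simp
    show "\<forall>\<^sub>F n in sequentially. (w n)\<^sup>2 \<le> E (real n + 1) - E (real n + 2) + inverse (real (Suc n))"
      by (rule always_eventually) (use tw(5) in blast)
  qed simp
  then have "w \<longlonglongrightarrow> 0" by simp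
  then show thesis using tw(1-4) that by blast
qed

end

end

text \<open>By compactness the sequence is eventually close to \<open>F\<close>. Distinct points of
  \<open>F\<close> are at least \<open>d\<close> apart and the steps are eventually below
  \<open>d / 3\<close>, so the sequence cannot change the point it is close to.\<close>

lemma slowly_varying_convergent:
  fixes x :: "nat \<Rightarrow> real"
  assumes bnd: "\<And>n. \<bar>x n\<bar> \<le> B" and incr: "(\<lambda>n. x (Suc n) - x n) \<longlonglongrightarrow> 0"
    and d: "0 < d" "\<And>p q. p \<in> F \<Longrightarrow> q \<in> F \<Longrightarrow> \<bar>p - q\<bar> < d \<Longrightarrow> p = q"
    and cluster: "\<And>r y. strict_mono r \<Longrightarrow> (x \<circ> r) \<longlonglongrightarrow> y \<Longrightarrow> y \<in> F"
  obtains p where "p \<in> F" "x \<longlonglongrightarrow> p"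
proof -
  have near: "\<exists>N. \<forall>n\<ge>N. \<exists>p\<in>F. \<bar>x n - p\<bar> < e" if e: "0 < e" for e
  proof (rule ccontr)
    define A where "A = {n. \<forall>p\<in>F. e \<le> \<bar>x n - p\<bar>}"
    assume "\<not> ?thesis"
    then have "infinite A" unfolding infinite_nat_iff_unbounded_le A_def by (auto simp: not_less)
    then obtain r :: "nat \<Rightarrow> nat" where r: "strict_mono r" "\<And>n. r n \<in> A" using infinite_enumerate by blast
    have "bounded (range (x \<circ> r))" unfolding bounded_iff using bnd by auto
    then obtain y r' where r': "strict_mono r'" "((x \<circ> r) \<circ> r') \<longlonglongrightarrow> y"
      using bounded_imp_convergent_subsequence by blast
    have y: "y \<in> F" using cluster[of "r \<circ> r'" y] r r' by (simp add: strict_mono_o o_assoc)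
    obtain n where "\<bar>x (r (r' n)) - y\<bar> < e" using LIMSEQ_D[OF r'(2) e] by auto
    then show False using r(2)[of "r' n"] y unfolding A_def by fastforce
  qed
  have d3: "0 < d / 3" using d by simp
  obtain N1 where N1: "\<And>n. N1 \<le> n \<Longrightarrow> \<exists>p\<in>F. \<bar>x n - p\<bar> < d / 3" using near[OF d3] by blast
  obtain N2 where N2: "\<And>n. N2 \<le> n \<Longrightarrow> \<bar>x (Suc n) - x n\<bar> < d / 3" using LIMSEQ_D[OF incr d3] by auto
  define N where "N = max N1 N2"
  obtain p where p: "p \<in> F" "\<bar>x N - p\<bar> < d / 3" using N1[of N] unfolding N_def by auto
  have close: "\<bar>x n - p\<bar> < d / 3" if "N \<le> n" for n
    using that
  proof (induction n rule: dec_induct)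
    case (step n)
    obtain q where q: "q \<in> F" "\<bar>x (Suc n) - q\<bar> < d / 3" using N1[of "Suc n"] step unfolding N_def by auto
    have "\<bar>x (Suc n) - x n\<bar> < d / 3" using N2[of n] step unfolding N_def by simp
    then have "\<bar>p - q\<bar> < d" using q(2) step.IH by linarith
    then show ?case using d(2)[OF p(1) q(1)] q(2) by simp
  qed (rule p(2))
  have "x \<longlonglongrightarrow> p"
  proof (rule LIMSEQ_I)
    fix e :: real assume e: "0 < e"
    have "0 < min e (d / 3)" using e d3 by simp
    then obtain M where M: "\<And>n. M \<le> n \<Longrightarrow> \<exists>q\<in>F. \<bar>x n - q\<bar> < min e (d / 3)" using near by blast
    have "\<bar>x n - p\<bar> < e" if n: "max M N \<le> n" for n
    proof -
      obtain q where q: "q \<in> F" "\<bar>x n - q\<bar> < min e (d / 3)" using M[of n] n by auto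
      have "\<bar>x n - q\<bar> < d / 3" using q(2) by simp
      moreover have "\<bar>x n - p\<bar> < d / 3" using close[of n] n by simp
      ultimately have "\<bar>p - q\<bar> < d" using d(1) by linarith
      then show ?thesis using d(2)[OF p(1) q(1)] q(2) by simp
    qed
    then show "\<exists>no. \<forall>n\<ge>no. norm (x n - p) < e" unfolding real_norm_def by blast
  qed
  then show thesis using p(1) that by blast
qed

section \<open>Convergence of the gradient flow\<close>

context confined_potential
begin

lemma gradient_flow_dissipative:
  assumes flow: "gradient_flow FE \<mu> S"
  obtains m where "dissipative_curve (\<lambda>s t. W2 (S s) (S t)) m (\<lambda>t. real_of_ereal (FE (S t)))"
proof -
  have ac: "ac_curve S" and E: "locally_abs_continuous_pos (\<lambda>t. real_of_ereal (FE (S t)))"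
    and diss: "AE t in lborel. 0 < t \<longrightarrow>
        (\<exists>D. ((\<lambda>s. real_of_ereal (FE (S s))) has_real_derivative D) (at t) \<and>
             ereal D = - (metric_slope FE (S t))\<^sup>2 \<and> D = - (metric_derivative S t)\<^sup>2)"
    using flow unfolding gradient_flow_def by blast+
  have S: "S t \<in> P2" if "0 < t" for t using ac that unfolding ac_curve_def by simp
  obtain m where m: "L2_loc_pos m" "\<And>s t. 0 < s \<Longrightarrow> s < t \<Longrightarrow> W2 (S s) (S t) \<le> (LINT r:{s..t}|lborel. m r)"
    using ac unfolding ac_curve_def by blast
  have "dissipative_curve (\<lambda>s t. W2 (S s) (S t)) m (\<lambda>t. real_of_ereal (FE (S t)))"
  proof
    show "AE t in lborel. 0 < t \<longrightarrow> ((\<lambda>t. real_of_ereal (FE (S t))) has_real_derivative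
        - (Lim (at t) (\<lambda>s. W2 (S s) (S t) / \<bar>s - t\<bar>))\<^sup>2) (at t)"
      using diss
    proof eventually_elim
      case (elim t)
      then show ?case unfolding metric_derivative_def by blast
    qed
    show "W2 (S t) (S t) = 0" if "0 < t" for t using W2_eq_quantile[OF S[OF that] S[OF that]] by simp
  qed (use S m E W2_nonneg W2_sym W2_triangle in auto)
  then show thesis by (rule that)
qed

lemma mean_bounded:
  obtains C where "\<And>\<nu> \<rho>. energy_density \<nu> \<rho> \<Longrightarrow> real_of_ereal (FE \<nu>) \<le> e \<Longrightarrow> \<bar>\<integral>x. x \<partial>\<nu>\<bar> \<le> C"
proof -
  obtain c1 c2 where c: "0 < c1"
    "\<And>\<nu> \<rho>. energy_density \<nu> \<rho> \<Longrightarrow> integrable \<nu> (\<lambda>z. \<bar>z\<bar> powr (2 + \<epsilon>)) \<and>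
       c1 * (\<integral>z. \<bar>z\<bar> powr (2 + \<epsilon>) \<partial>\<nu>) - c2 \<le> real_of_ereal (FE \<nu>)"
    using moment_bound by metis
  show thesis
  proof (rule that[of "1 + (e + c2) / c1"])
    fix \<nu> \<rho> assume ed: "energy_density \<nu> \<rho>" and le: "real_of_ereal (FE \<nu>) \<le> e"
    have \<nu>: "\<nu> \<in> P2" using energy_densityD(1)[OF ed] .
    interpret prob_space \<nu> using P2D(2)[OF \<nu>] .
    have i: "integrable \<nu> (\<lambda>z. \<bar>z\<bar> powr (2 + \<epsilon>))" using c(2)[OF ed] by blast
    have p: "\<bar>z\<bar> \<le> 1 + \<bar>z\<bar> powr (2 + \<epsilon>)" for z :: real
    proof (cases "\<bar>z\<bar> \<le> 1")
      case True
      then show ?thesis using powr_ge_zero[of "\<bar>z\<bar>" "2 + \<epsilon>"] by linarith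
    next
      case False
      then have "\<bar>z\<bar> powr 1 \<le> \<bar>z\<bar> powr (2 + \<epsilon>)" using \<epsilon>_pos by (intro powr_mono) auto
      then show ?thesis using False by simp
    qed
    have "\<bar>\<integral>x. x \<partial>\<nu>\<bar> \<le> (\<integral>x. \<bar>x\<bar> \<partial>\<nu>)" by (rule integral_abs_bound)
    also have "\<dots> \<le> (\<integral>z. 1 + \<bar>z\<bar> powr (2 + \<epsilon>) \<partial>\<nu>)"
      using P2D(6)[OF \<nu>] i p by (intro integral_mono) auto
    also have "\<dots> = 1 + (\<integral>z. \<bar>z\<bar> powr (2 + \<epsilon>) \<partial>\<nu>)" using i by (simp add: prob_space)
    also have "(\<integral>z. \<bar>z\<bar> powr (2 + \<epsilon>) \<partial>\<nu>) \<le> (e + c2) / c1"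
    proof -
      have "c1 * (\<integral>z. \<bar>z\<bar> powr (2 + \<epsilon>) \<partial>\<nu>) \<le> e + c2" using c(2)[OF ed] le by linarith
      then show ?thesis using c(1) by (simp add: field_simps)
    qed
    finally show "\<bar>\<integral>x. x \<partial>\<nu>\<bar> \<le> 1 + (e + c2) / c1" by simp
  qed
qed

lemma energy_bounded_below:
  obtains c where "\<And>\<nu> \<rho>. energy_density \<nu> \<rho> \<Longrightarrow> c \<le> real_of_ereal (FE \<nu>)"
proof -
  obtain c1 c2 where c: "0 < c1"
    "\<And>\<nu> \<rho>. energy_density \<nu> \<rho> \<Longrightarrow> integrable \<nu> (\<lambda>z. \<bar>z\<bar> powr (2 + \<epsilon>)) \<and>
       c1 * (\<integral>z. \<bar>z\<bar> powr (2 + \<epsilon>) \<partial>\<nu>) - c2 \<le> real_of_ereal (FE \<nu>)"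
    using moment_bound by metis
  show thesis
  proof (rule that[of "- c2"])
    fix \<nu> \<rho> assume ed: "energy_density \<nu> \<rho>"
    have "0 \<le> c1 * (\<integral>z. \<bar>z\<bar> powr (2 + \<epsilon>) \<partial>\<nu>)"
      using c(1) by (intro mult_nonneg_nonneg integral_nonneg_AE) auto
    then show "- c2 \<le> real_of_ereal (FE \<nu>)" using c(2)[OF ed] by linarith
  qed
qed

end

context symmetric_potential
begin

theorem gradient_flow_converges:
  assumes flow: "gradient_flow FE \<mu> S"
  obtains m where "M (J * m) = m"
    "((\<lambda>t. W2 (S t) (mu_tilted \<Psi> (J * m))) \<longlongrightarrow> 0) at_top"
    "((\<lambda>t. FE (S t)) \<longlongrightarrow> FE (mu_tilted \<Psi> (J * m))) at_top"
proof -
  define E where "E t = real_of_ereal (FE (S t))" for t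
  have fl: "ac_curve S" "\<forall>t>0. \<bar>FE (S t)\<bar> \<noteq> \<infinity>" "AE t in lborel. 0 < t \<longrightarrow>
        (\<exists>D. (E has_real_derivative D) (at t) \<and> ereal D = - (metric_slope FE (S t))\<^sup>2 \<and> D = - (metric_derivative S t)\<^sup>2)"
    using flow[unfolded gradient_flow_def] unfolding E_def by simp_all
  have fin: "\<bar>FE (S t)\<bar> \<noteq> \<infinity>" if "0 < t" for t by (rule fl(2)[THEN spec, THEN mp, OF that])
  have FE_eq: "FE (S t) = ereal (E t)" if "0 < t" for t using fin[OF that] unfolding E_def by (simp add: ereal_real)
  have S: "S t \<in> P2" if "0 < t" for t using fl(1) that unfolding ac_curve_def by simp
  have "\<exists>\<rho>. energy_density (S t) \<rho>" if "0 < t" for t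
  proof -
    have "FE (S t) \<noteq> \<infinity>" using FE_eq[OF \<open>0 < t\<close>] by simp
    from free_energy_finiteD[OF S[OF \<open>0 < t\<close>] this] show ?thesis by blast
  qed
  then obtain \<rho> where \<rho>: "\<And>t. 0 < t \<Longrightarrow> energy_density (S t) (\<rho> t)" by metis
  obtain k where "dissipative_curve (\<lambda>s t. W2 (S s) (S t)) k E"
    using gradient_flow_dissipative[OF flow] unfolding E_def by blast
  then interpret dc: dissipative_curve "\<lambda>s t. W2 (S s) (S t)" k E .
  obtain c where c: "\<And>\<nu> \<rho>. energy_density \<nu> \<rho> \<Longrightarrow> c \<le> real_of_ereal (FE \<nu>)" using energy_bounded_below by blast
  have below: "c \<le> E t" if "1 \<le> t" for t unfolding E_def using that by (intro c[OF \<rho>]) simp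
  have diss: "AE t in lborel. 0 < t \<longrightarrow>
        (\<exists>D. (E has_real_derivative D) (at t) \<and> ereal D = - (metric_slope FE (S t))\<^sup>2)"
    by (rule AE_mp[OF fl(3)], rule AE_I2) blast
  \<comment> \<open>Contains the times without the slope identity; the slow times are chosen
    outside.\<close>
  from diss obtain N where N0: "{t \<in> space lborel. \<not> (0 < t \<longrightarrow>
        (\<exists>D. (E has_real_derivative D) (at t) \<and> ereal D = - (metric_slope FE (S t))\<^sup>2))} \<subseteq> N"
      "emeasure lborel N = 0" "N \<in> sets lborel" by (rule AE_E)
  have N: "N \<in> null_sets lborel" using N0 by auto
  obtain t w where tw: "\<And>n. real n + 1 \<le> t n" "\<And>n. t n \<le> real n + 2" "\<And>n. t n \<notin> N" "\<And>n. dc.energy_speed (t n) (w n)" "w \<longlonglongrightarrow> 0"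
    using dc.slow_times[OF below N] by blast
  have t1: "1 \<le> t n" for n using tw(1)[of n] by simp
  then have t0: "0 < t n" for n using less_le_trans[OF zero_less_one t1] by blast
  \<comment> \<open>Slope and speed have the same square, namely minus the derivative of the energy;
    this is compared in the extended reals, so an infinite slope has to be excluded.\<close>
  have slope: "metric_slope FE (S (t n)) \<le> ereal \<bar>w n\<bar>" for n
  proof -
    obtain D where D: "(E has_real_derivative D) (at (t n))" "ereal D = - (metric_slope FE (S (t n)))\<^sup>2"
      using N0(1) tw(3)[of n] t0[of n] by auto
    have "D = - (w n)\<^sup>2" using DERIV_unique[OF D(1)] tw(4)[of n] unfolding dc.energy_speed_def by blast
    then have sq: "(metric_slope FE (S (t n)))\<^sup>2 = ereal ((w n)\<^sup>2)" using D(2)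
      by (metis ereal_uminus_uminus minus_minus uminus_ereal.simps(1))
    show ?thesis
    proof (cases "metric_slope FE (S (t n))")
      case (real r)
      then have "r\<^sup>2 = (w n)\<^sup>2" using sq by (simp add: power2_eq_square)
      then have "\<bar>r\<bar> = \<bar>w n\<bar>" by (simp add: power2_eq_iff abs_eq_iff)
      then show ?thesis using real by simp
    next
      case PInf
      then show ?thesis using sq by (simp add: power2_eq_square)
    qed simp
  qed
  define \<nu> where "\<nu> n = S (t n)" for n
  define x where "x n = (\<integral>z. z \<partial>\<nu> n)" for n
  have e: "energy_density (\<nu> n) (\<rho> (t n))" for n unfolding \<nu>_def by (rule \<rho>[OF t0])

  have bnd: "real_of_ereal (FE (\<nu> n)) \<le> E 1" for n
    using dc.energy_antimono[OF zero_less_one t1] unfolding \<nu>_def E_def .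
  obtain B where "\<And>\<nu> \<rho>. energy_density \<nu> \<rho> \<Longrightarrow> real_of_ereal (FE \<nu>) \<le> E 1 \<Longrightarrow> \<bar>\<integral>x. x \<partial>\<nu>\<bar> \<le> B" using mean_bounded by blast
  then have B: "\<bar>x n\<bar> \<le> B" for n using e bnd unfolding x_def by blast
  have sub: "(\<lambda>n. W2 (\<nu> (r n)) (mu_tilted \<Psi> (J * y))) \<longlonglongrightarrow> 0 \<and> M (J * y) = y
      \<and> (\<lambda>n. FE (\<nu> (r n))) \<longlonglongrightarrow> FE (mu_tilted \<Psi> (J * y))"
    if r: "strict_mono r" and y: "(\<lambda>n. x (r n)) \<longlonglongrightarrow> y" for r y
  proof -
    have wr: "(\<lambda>n. \<bar>w (r n)\<bar>) \<longlonglongrightarrow> 0"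
      using LIMSEQ_subseq_LIMSEQ[OF tendsto_rabs_zero[OF tw(5)] r] by (simp add: o_def)
    note * = almost_critical_tendsto[of "\<lambda>n. \<nu> (r n)" "\<lambda>n. \<rho> (t (r n))" "E 1" "\<lambda>n. \<bar>w (r n)\<bar>" y, OF e bnd _ abs_ge_zero wr y[unfolded x_def]]
    have s: "metric_slope FE (\<nu> (r n)) \<le> ereal \<bar>w (r n)\<bar>" for n unfolding \<nu>_def by (rule slope)
    show ?thesis using *[OF s] mean_tilted[of "J * y"] by simp
  qed
  obtain a where a: "0 < a" "{m. M (J * m) = m} = {- a, 0, a}" using fixed_points by blast
  have incr: "(\<lambda>n. x (Suc n) - x n) \<longlonglongrightarrow> 0"
  proof (rule LIMSEQ_I)
    fix q :: real assume q: "0 < q"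
    then have q2: "0 < q / 3" by simp
    obtain T where T: "1 \<le> T" "\<And>s t. T \<le> s \<Longrightarrow> s \<le> t \<Longrightarrow> t \<le> s + 2 \<Longrightarrow> W2 (S s) (S t) \<le> q / 3"
      using dc.distance_vanishes[OF below q2] by blast
    have "\<bar>x (Suc n) - x n\<bar> < q" if n: "nat \<lceil>T\<rceil> \<le> n" for n
    proof -
      have Tn: "T \<le> real n" using n by linarith
      \<comment> \<open>The time \<open>n + 2\<close> separates two consecutive slow times, and each
        of the two pieces fits into a window.\<close>
      have "W2 (S (t n)) (S (real n + 2)) \<le> q / 3" using tw(1,2)[of n] Tn by (intro T(2)) auto
      moreover have "W2 (S (real n + 2)) (S (t (Suc n))) \<le> q / 3" using tw(1,2)[of "Suc n"] Tn by (intro T(2)) auto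
      moreover have "W2 (S (t n)) (S (t (Suc n))) \<le> W2 (S (t n)) (S (real n + 2)) + W2 (S (real n + 2)) (S (t (Suc n)))"
        by (intro W2_triangle S t0) simp
      moreover have "\<bar>x n - x (Suc n)\<bar> \<le> W2 (S (t n)) (S (t (Suc n)))"
        unfolding x_def \<nu>_def by (intro mean_diff_le_W2 S t0)
      ultimately show ?thesis using q by linarith
    qed
    then show "\<exists>no. \<forall>n\<ge>no. norm (x (Suc n) - x n - 0) < q" by (intro exI[of _ "nat \<lceil>T\<rceil>"]) simp
  qed
  have sep: "p = q" if "p \<in> {- a, 0, a}" "q \<in> {- a, 0, a}" "\<bar>p - q\<bar> < a" for p q
    using that a(1) by auto
  have cluster: "y \<in> {- a, 0, a}" if "strict_mono r" "(x \<circ> r) \<longlonglongrightarrow> y" for r y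
    using sub[of r y] that a(2) by (auto simp: o_def)
  have "\<exists>m. x \<longlonglongrightarrow> m"
    by (rule slowly_varying_convergent[OF B incr a(1) sep cluster]) blast+
  then obtain m where m: "x \<longlonglongrightarrow> m" by blast
  have lim: "(\<lambda>n. W2 (\<nu> n) (mu_tilted \<Psi> (J * m))) \<longlonglongrightarrow> 0" "M (J * m) = m"
    "(\<lambda>n. FE (\<nu> n)) \<longlonglongrightarrow> FE (mu_tilted \<Psi> (J * m))"
    using sub[OF strict_mono_id, of m] m by (simp_all add: id_def)
  define \<mu>' where "\<mu>' = mu_tilted \<Psi> (J * m)"
  have \<mu>': "\<mu>' \<in> P2" unfolding \<mu>'_def by (rule mu_tilted_P2)
  have W: "((\<lambda>s. W2 (S s) \<mu>') \<longlongrightarrow> 0) at_top"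
  proof (rule tendstoI)
    fix q :: real assume q: "0 < q"
    then have q2: "0 < q / 3" by simp
    obtain T where T: "1 \<le> T" "\<And>s t. T \<le> s \<Longrightarrow> s \<le> t \<Longrightarrow> t \<le> s + 2 \<Longrightarrow> W2 (S s) (S t) \<le> q / 3"
      using dc.distance_vanishes[OF below q2] by blast
    obtain n0 where n0: "\<And>n. n0 \<le> n \<Longrightarrow> \<bar>W2 (\<nu> n) \<mu>'\<bar> < q / 3"
      using LIMSEQ_D[OF lim(1) q2] unfolding \<mu>'_def by auto
    have "dist (W2 (S s) \<mu>') 0 < q" if s: "max T (real n0 + 1) \<le> s" for s
    proof -
      \<comment> \<open>For this index \<open>t n\<close> lies after \<open>s\<close> and within two
        units of it.\<close>
      define n where "n = nat \<lfloor>s\<rfloor>"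
      have n: "real n \<le> s" "s < real n + 1" "n0 \<le> n" using s T(1) unfolding n_def by (auto simp: le_nat_iff le_floor_iff)
      have s0: "0 < s" using s T(1) by simp
      have "W2 (S s) (S (t n)) \<le> q / 3" using n tw(1,2)[of n] s by (intro T(2)) auto
      moreover have "W2 (S s) \<mu>' \<le> W2 (S s) (S (t n)) + W2 (S (t n)) \<mu>'" by (intro W2_triangle S t0 s0 \<mu>')
      moreover have "0 \<le> W2 (S s) \<mu>'" by (intro W2_nonneg S s0 \<mu>')
      ultimately show ?thesis using n0[OF n(3)] q unfolding \<nu>_def dist_real_def by linarith
    qed
    then show "\<forall>\<^sub>F s in at_top. dist (W2 (S s) \<mu>') 0 < q" unfolding eventually_at_top_linorder by blast
  qed
  \<comment> \<open>Monotonicity provides some limit of the energy; the slow times identify it as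
    the energy of \<open>\<mu>'\<close>.\<close>
  obtain e where e: "(E \<longlongrightarrow> e) at_top" using dc.energy_tendsto[OF below] .
  have FE_lim: "((\<lambda>s. FE (S s)) \<longlongrightarrow> ereal e) at_top"
  proof (rule Lim_transform_eventually)
    show "((\<lambda>s. ereal (E s)) \<longlongrightarrow> ereal e) at_top" using e by (rule tendsto_ereal)
    show "\<forall>\<^sub>F s in at_top. ereal (E s) = FE (S s)"
      using eventually_gt_at_top[of 0] by eventually_elim (simp add: FE_eq)
  qed
  have "real n \<le> t n" for n using tw(1)[of n] by simp
  then have "filterlim t at_top sequentially"
    by (intro filterlim_at_top_mono[OF filterlim_real_sequentially] always_eventually allI)
  from filterlim_compose[OF FE_lim this] have "(\<lambda>n. FE (\<nu> n)) \<longlonglongrightarrow> ereal e" unfolding \<nu>_def .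
  then have "FE \<mu>' = ereal e" using LIMSEQ_unique[OF lim(3)] unfolding \<mu>'_def by blast
  then show thesis using that[OF lim(2)] W FE_lim unfolding \<mu>'_def by simp
qed

end

lemma C2_D:
  assumes "C2 f"
  shows "(f has_real_derivative deriv f z) (at z)"
    "(deriv f has_real_derivative deriv (deriv f) z) (at z)" "continuous_on UNIV (deriv (deriv f))"
  using assms unfolding C2_def differentiable_on_def
  by (auto simp: DERIV_deriv_iff_real_differentiable)

theorem theorem1:
  fixes \<Psi> \<Psi>\<^sub>c \<Psi>\<^sub>b :: "real \<Rightarrow> real"
    and J c c' c'' \<epsilon> :: real
    and \<mu> :: "real measure"
    and S :: "real \<Rightarrow> real measure"
  assumes J_pos: "0 < J"
    and decomposition: "\<And>z. \<Psi> z = \<Psi>\<^sub>c z + \<Psi>\<^sub>b z"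
    and smooth: "C2 \<Psi>\<^sub>c" "C2 \<Psi>\<^sub>b"
    and constants_1: "0 < c" "0 < c'"
    and strictly_convex: "\<And>z. c \<le> deriv (deriv \<Psi>\<^sub>c) z"
    and bounded_part: "\<And>z. \<bar>\<Psi>\<^sub>b z\<bar> + \<bar>deriv \<Psi>\<^sub>b z\<bar> + \<bar>deriv (deriv \<Psi>\<^sub>b) z\<bar> \<le> c'"
    and constants_2: "0 < \<epsilon>" "0 < c''"
    and growth: "\<And>z. c'' * (\<bar>z\<bar> powr (2 + \<epsilon>) - 1) \<le> \<Psi> z"
    and symmetric: "\<And>z. \<Psi> z = \<Psi> (- z)"
    and supercritical: "1 / J <
      (\<integral>z. z\<^sup>2 * exp (- \<Psi> z) \<partial>lborel) / (\<integral>z. exp (- \<Psi> z) \<partial>lborel)"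
    and deriv_convex: "convex_on {0..} (deriv \<Psi>)"
    and initial: "\<mu> \<in> P2"
    and flow: "gradient_flow (free_energy \<Psi> J) \<mu> S"
  shows "\<exists>\<mu>' \<in> {mu_minus \<Psi> J, mu_zero \<Psi>, mu_plus \<Psi> J}.
    ((\<lambda>t. W2 (S t) \<mu>') \<longlongrightarrow> 0) at_top \<and>
    ((\<lambda>t. free_energy \<Psi> J (S t)) \<longlongrightarrow> free_energy \<Psi> J \<mu>') at_top"
proof -
  have \<Psi>_eq: "\<Psi> = (\<lambda>z. \<Psi>\<^sub>c z + \<Psi>\<^sub>b z)" using decomposition by blast
  have d1: "(\<Psi> has_real_derivative deriv \<Psi>\<^sub>c z + deriv \<Psi>\<^sub>b z) (at z)" for z
    unfolding \<Psi>_eq by (intro DERIV_add C2_D smooth)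
  then have deriv_eq: "deriv \<Psi> = (\<lambda>z. deriv \<Psi>\<^sub>c z + deriv \<Psi>\<^sub>b z)" using DERIV_imp_deriv by blast
  have d2: "(deriv \<Psi> has_real_derivative deriv (deriv \<Psi>\<^sub>c) z + deriv (deriv \<Psi>\<^sub>b) z) (at z)" for z
    unfolding deriv_eq by (intro DERIV_add C2_D smooth)
  \<comment> \<open>Semiconvexity holds with \<open>L = c'\<close>, since the convex part has
    positive second derivative and that of the bounded part is at least \<open>- c'\<close>. The
    growth constant is \<open>K = c''\<close>.\<close>
  interpret symmetric_potential \<Psi> "deriv \<Psi>" "\<lambda>z. deriv (deriv \<Psi>\<^sub>c) z + deriv (deriv \<Psi>\<^sub>b) z" J c' c'' \<epsilon>
  proof
    show "(\<Psi> has_real_derivative deriv \<Psi> z) (at z)" for z using d1[of z] by (simp add: deriv_eq)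
    show "- c' \<le> deriv (deriv \<Psi>\<^sub>c) z + deriv (deriv \<Psi>\<^sub>b) z" for z
      using strictly_convex[of z] bounded_part[of z] constants_1 by linarith
    show "continuous_on UNIV (\<lambda>z. deriv (deriv \<Psi>\<^sub>c) z + deriv (deriv \<Psi>\<^sub>b) z)"
      by (intro continuous_on_add C2_D smooth)
    show "\<Psi> (- z) = \<Psi> z" for z using symmetric[of z] by simp
  qed (use assms d2 in simp_all)
  obtain m where m: "M (J * m) = m"
    "((\<lambda>t. W2 (S t) (mu_tilted \<Psi> (J * m))) \<longlongrightarrow> 0) at_top"
    "((\<lambda>t. FE (S t)) \<longlongrightarrow> FE (mu_tilted \<Psi> (J * m))) at_top"
    using gradient_flow_converges[OF flow] by blast
  show ?thesis using critical_measures[OF m(1)] m(2,3) by blast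
qed

end
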